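(* Let $\xi\sim\nu$ be a random vector, let $f(\cdot;\xi):\mathbb{R}^d\to\mathbb{R}$ be stochastic loss functions and $f(x)=\mathbb{E}f(x;\xi)$. For $\eta>0$ consider the stochastic gradient descent chain $x_{n+1}=x_n-\eta\nabla f(x_n;\xi_n)$ with $\xi_n\sim\nu$ i.i.d., $\xi_n$ independent of $x_n$, and set $u^n(x)=\mathbb{E}_x\varphi(x_n)$. Consider also the It\^o SDE in $\mathbb{R}^d$ $$dX=b(X)\,dt+\sqrt{\eta\Sigma(X)}\,dW,$$ and set $u(x,t)=\mathbb{E}_x\varphi(X(t))$. Let $T>0$. (a) Assume $\sup_\xi\|f(\cdot;\xi)\|_{C^5}<\infty$. If $b(x)=-\nabla f(x)$ and $\Sigma\in C_b^2(\mathbb{R}^d)$ is positive semi-definite, then for all $\varphi\in C_b^4(\mathbb{R}^d)$ there exist $\eta_0>0$ and $C(T,\|\varphi\|_{C^4},\eta_0)>0$ such that $$\sup_{n:\,n\eta\le T}\|u^n-u(\cdot,n\eta)\|_\infty\le C(T,\|\varphi\|_{C^4},\eta_0)\,\eta,\qquad\forall\,\eta\le\eta_0.$$ (b) If instead $\sup_\xi\|f(\cdot;\xi)\|_{C^7}<\infty$ and $b(x)=-\nabla f(x)-\frac14\eta\nabla|\nabla f(x)|^2$, $\Sigma(x)=\operatorname{var}(\nabla f(x;\xi))$, then for all $\varphi\in C_b^6(\mathbb{R}^d)$ there exist $\eta_0>0$ and $C(T,\|\varphi\|_{C^6},\eta_0)>0$ such that $$\sup_{n:\,n\eta\le T}\|u^n-u(\cdot,n\eta)\|_\infty\le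 C(T,\|\varphi\|_{C^6},\eta_0)\,\eta^2,\qquad\forall\,\eta\le\eta_0.$$
   Context: $\|g\|_{C^m}:=\sum_{|\alpha|\le m}|D^\alpha g|_\infty$ (sup norms over $\mathbb{R}^d$), and $C_b^m(\mathbb{R}^d)$ is the set of $g\in C^m(\mathbb{R}^d)$ with $\|g\|_{C^m}<\infty$; for the matrix field $\Sigma$ this is meant entrywise. $\mathbb{E}_x$ denotes expectation for the process started at $x$. $\sqrt{\cdot}$ is the positive semi-definite square root of a symmetric positive semi-definite matrix, $W$ is a standard Brownian motion in $\mathbb{R}^d$, and $\operatorname{var}(\nabla f(x;\xi))$ is the $d\times d$ covariance matrix of the random vector $\nabla f(x;\xi)$. $\sup_\xi$ is over all values of $\xi$. The constants do not depend on $n$ or $\eta$; they may depend on the fixed data $d$, $f$, $\Sigma$. *)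

theory Defs
  imports "HOL-Probability.Probability"
begin

section \<open>$C^m$ functions and norms\<close>

definition partial_deriv :: "'d::finite \<Rightarrow> (real^'d \<Rightarrow> real) \<Rightarrow> real^'d \<Rightarrow> real" where
  "partial_deriv i g x = frechet_derivative g (at x) (axis i 1)"

definition grad :: "(real^'d::finite \<Rightarrow> real) \<Rightarrow> real^'d \<Rightarrow> real^'d" where
  "grad g x = (\<chi> i. partial_deriv i g x)"

primrec partial_derivs :: "'d::finite list \<Rightarrow> (real^'d \<Rightarrow> real) \<Rightarrow> real^'d \<Rightarrow> real" where
  "partial_derivs [] g = g"
| "partial_derivs (i # is) g = partial_deriv i (partial_derivs is g)"

text \<open>The index type carries no order, so an enumeration of the multi-index \<open>\<alpha>\<close> is chosen.
  For functions in \<open>C\<^sup>m\<close> and \<open>|\<alpha>| \<le> m\<close> the choice is irrelevant by Schwarz's theorem.\<close>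
definition multi_deriv :: "('d::finite \<Rightarrow> nat) \<Rightarrow> (real^'d \<Rightarrow> real) \<Rightarrow> real^'d \<Rightarrow> real" where
  "multi_deriv \<alpha> = partial_derivs (SOME is. \<forall>i. count_list is i = \<alpha> i)"

primrec C_diff :: "nat \<Rightarrow> (real^'d::finite \<Rightarrow> real) \<Rightarrow> bool" where
  "C_diff 0 g \<longleftrightarrow> continuous_on UNIV g"
| "C_diff (Suc m) g \<longleftrightarrow> g differentiable_on UNIV \<and> (\<forall>i. C_diff m (partial_deriv i g))"

definition sup_norm :: "(real^'d::finite \<Rightarrow> real) \<Rightarrow> ennreal" where
  "sup_norm g = (SUP x. ennreal \<bar>g x\<bar>)"

definition C_norm :: "nat \<Rightarrow> (real^'d::finite \<Rightarrow> real) \<Rightarrow> ennreal" where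
  "C_norm m g = (\<Sum>\<alpha> | (\<Sum>i\<in>UNIV. \<alpha> i) \<le> m. sup_norm (multi_deriv \<alpha> g))"

definition C_b :: "nat \<Rightarrow> (real^'d::finite \<Rightarrow> real) set" where
  "C_b m = {g. C_diff m g \<and> C_norm m g < \<infinity>}"


section \<open>Matrices\<close>

definition pos_semidef :: "real^'d^'d::finite \<Rightarrow> bool" where
  "pos_semidef A \<longleftrightarrow> transpose A = A \<and> (\<forall>v. 0 \<le> v \<bullet> (A *v v))"

text \<open>Meaningful for positive semi-definite \<open>A\<close>, where the root exists and is unique.\<close>
definition psd_sqrt :: "real^'d^'d::finite \<Rightarrow> real^'d^'d" where
  "psd_sqrt A = (THE B. pos_semidef B \<and> B ** B = A)"

definition covariance_matrix :: "'e measure \<Rightarrow> ('e \<Rightarrow> real^'d::finite) \<Rightarrow> real^'d^'d" where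
  "covariance_matrix \<nu> Y =
     (\<chi> i j. \<integral>\<xi>. (Y \<xi> $ i - (\<integral>\<zeta>. Y \<zeta> $ i \<partial>\<nu>)) * (Y \<xi> $ j - (\<integral>\<zeta>. Y \<zeta> $ j \<partial>\<nu>)) \<partial>\<nu>)"


section \<open>Stochastic gradient descent\<close>

primrec sgd_chain ::
  "('e \<Rightarrow> real^'d::finite \<Rightarrow> real) \<Rightarrow> real \<Rightarrow> real^'d \<Rightarrow> (nat \<Rightarrow> 'e) \<Rightarrow> nat \<Rightarrow> real^'d" where
  "sgd_chain f \<eta> x \<xi> 0 = x"
| "sgd_chain f \<eta> x \<xi> (Suc n) = sgd_chain f \<eta> x \<xi> n - \<eta> *\<^sub>R grad (f (\<xi> n)) (sgd_chain f \<eta> x \<xi> n)"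

text \<open>The i.i.d. sequence \<open>\<xi>\<^sub>0, \<xi>\<^sub>1, \<dots>\<close> is realised as the coordinates of the infinite product
  measure. As \<open>x\<^sub>n\<close> is a function of \<open>\<xi>\<^sub>0, \<dots>, \<xi>\<^sub>n\<^sub>-\<^sub>1\<close>, it is independent of \<open>\<xi>\<^sub>n\<close>.\<close>
definition sgd_mean ::
  "'e measure \<Rightarrow> ('e \<Rightarrow> real^'d::finite \<Rightarrow> real) \<Rightarrow> real \<Rightarrow> (real^'d \<Rightarrow> real) \<Rightarrow> nat \<Rightarrow> real^'d \<Rightarrow> real"
  where
  "sgd_mean \<nu> f \<eta> \<phi> n x = (\<integral>\<xi>. \<phi> (sgd_chain f \<eta> x \<xi> n) \<partial>(\<Pi>\<^sub>M k\<in>(UNIV :: nat set). \<nu>))"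


section \<open>Brownian motion, the Ito integral and SDEs\<close>

text \<open>Standard \<open>d\<close>-dimensional Brownian motion relative to the filtration \<open>F\<close>. Only times
  \<open>t \<ge> 0\<close> matter for \<open>W\<close>.\<close>
definition brownian_motion ::
  "'w measure \<Rightarrow> (real \<Rightarrow> 'w measure) \<Rightarrow> (real \<Rightarrow> 'w \<Rightarrow> real^'d::finite) \<Rightarrow> bool" where
  "brownian_motion M F W \<longleftrightarrow>
     prob_space M \<and> filtration (space M) F \<and> (\<forall>t. subalgebra M (F t)) \<and>
     (\<forall>t\<ge>0. W t \<in> borel_measurable (F t)) \<and>
     (\<forall>\<omega>\<in>space M. continuous_on {0..} (\<lambda>t. W t \<omega>)) \<and>
     (AE \<omega> in M. W 0 \<omega> = 0) \<and>
     (\<forall>s t. 0 \<le> s \<and> s < t \<longrightarrow>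
        prob_space.indep_set M (sets (F s))
          {(\<lambda>\<omega>. W t \<omega> - W s \<omega>) -` A \<inter> space M | A. A \<in> sets borel} \<and>
        distributed M lborel (\<lambda>\<omega>. W t \<omega> - W s \<omega>)
          (\<lambda>y. ennreal (\<Prod>i\<in>UNIV. normal_density 0 (sqrt (t - s)) (y $ i))))"

text \<open>Elementary integrands \<open>\<Sum>\<^sub>k\<^sub><\<^sub>N h\<^sub>k 1\<^bsub>(p\<^sub>k, p\<^sub>k\<^sub>+\<^sub>1]\<^esub>\<close> with bounded \<open>F(p\<^sub>k)\<close>-measurable
  matrix-valued \<open>h\<^sub>k\<close>, and their integrals over \<open>[0,t]\<close>.\<close>
definition elementary ::
  "'w measure \<Rightarrow> (real \<Rightarrow> 'w measure) \<Rightarrow> nat \<Rightarrow> (nat \<Rightarrow> real) \<Rightarrow> (nat \<Rightarrow> 'w \<Rightarrow> real^'d^'d::finite) \<Rightarrow> bool"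
  where
  "elementary M F N p h \<longleftrightarrow>
     0 \<le> p 0 \<and> (\<forall>k<N. p k < p (Suc k) \<and> h k \<in> borel_measurable (F (p k)) \<and>
       (\<exists>B. \<forall>\<omega>\<in>space M. norm (h k \<omega>) \<le> B))"

definition elementary_process ::
  "nat \<Rightarrow> (nat \<Rightarrow> real) \<Rightarrow> (nat \<Rightarrow> 'w \<Rightarrow> real^'d^'d::finite) \<Rightarrow> real \<Rightarrow> 'w \<Rightarrow> real^'d^'d" where
  "elementary_process N p h s \<omega> = (\<Sum>k<N. indicator {p k<..p (Suc k)} s *\<^sub>R h k \<omega>)"

definition elementary_integral ::
  "nat \<Rightarrow> (nat \<Rightarrow> real) \<Rightarrow> (nat \<Rightarrow> 'w \<Rightarrow> real^'d^'d::finite) \<Rightarrow> (real \<Rightarrow> 'w \<Rightarrow> real^'d) \<Rightarrow>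
     real \<Rightarrow> 'w \<Rightarrow> real^'d" where
  "elementary_integral N p h W t \<omega> =
     (\<Sum>k<N. h k \<omega> *v (W (min t (p (Suc k))) \<omega> - W (min t (p k)) \<omega>))"

text \<open>\<open>I\<close> is (a version of) \<open>\<integral>\<^sub>0\<^sup>t H dW\<close> for a measurable, adapted integrand with
  \<open>E \<integral>\<^sub>0\<^sup>t |H|\<^sup>2 ds < \<infinity>\<close>, as the \<open>L\<^sup>2\<close>-limit of integrals of elementary integrands. The norm
  on matrices is the Frobenius norm.\<close>
definition has_ito_integral ::
  "'w measure \<Rightarrow> (real \<Rightarrow> 'w measure) \<Rightarrow> (real \<Rightarrow> 'w \<Rightarrow> real^'d) \<Rightarrow> (real \<Rightarrow> 'w \<Rightarrow> real^'d^'d::finite) \<Rightarrow>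
     real \<Rightarrow> ('w \<Rightarrow> real^'d) \<Rightarrow> bool" where
  "has_ito_integral M F W H t I \<longleftrightarrow>
     (\<lambda>(s, \<omega>). H s \<omega>) \<in> borel_measurable (restrict_space borel {0..t} \<Otimes>\<^sub>M M) \<and>
     (\<forall>s\<in>{0..t}. H s \<in> borel_measurable (F s)) \<and>
     (\<integral>\<^sup>+\<omega>. (\<integral>\<^sup>+s\<in>{0..t}. ennreal ((norm (H s \<omega>))\<^sup>2) \<partial>lborel) \<partial>M) < \<infinity> \<and>
     I \<in> borel_measurable M \<and>
     (\<exists>N p h. (\<forall>m. elementary M F (N m) (p m) (h m)) \<and>
        (\<lambda>m. \<integral>\<^sup>+\<omega>. (\<integral>\<^sup>+s\<in>{0..t}.
            ennreal ((norm (elementary_process (N m) (p m) (h m) s \<omega> - H s \<omega>))\<^sup>2) \<partial>lborel) \<partial>M)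
          \<longlonglongrightarrow> 0 \<and>
        (\<lambda>m. \<integral>\<^sup>+\<omega>. ennreal ((norm (elementary_integral (N m) (p m) (h m) W t \<omega> - I \<omega>))\<^sup>2) \<partial>M)
          \<longlonglongrightarrow> 0)"

text \<open>\<open>X\<close> solves \<open>dX = b(X) dt + \<sigma>(X) dW\<close>, \<open>X(0) = x\<close>, on the filtered probability space \<open>(M, F)\<close>
  with \<open>F\<close>-Brownian motion \<open>W\<close>. Since only square-integrable integrands are considered,
  \<open>\<sigma>(X)\<close> is required to be square integrable; this is no restriction for bounded \<open>\<sigma>\<close>.\<close>
definition sde_solution ::
  "'w measure \<Rightarrow> (real \<Rightarrow> 'w measure) \<Rightarrow> (real \<Rightarrow> 'w \<Rightarrow> real^'d::finite) \<Rightarrow>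
     (real^'d \<Rightarrow> real^'d) \<Rightarrow> (real^'d \<Rightarrow> real^'d^'d) \<Rightarrow> real^'d \<Rightarrow> (real \<Rightarrow> 'w \<Rightarrow> real^'d) \<Rightarrow> bool" where
  "sde_solution M F W b \<sigma> x X \<longleftrightarrow>
     brownian_motion M F W \<and>
     (\<forall>t\<ge>0. X t \<in> borel_measurable (F t)) \<and>
     (\<forall>\<omega>\<in>space M. continuous_on {0..} (\<lambda>t. X t \<omega>)) \<and>
     (AE \<omega> in M. X 0 \<omega> = x) \<and>
     (\<forall>t\<ge>0. \<exists>I. has_ito_integral M F W (\<lambda>s \<omega>. \<sigma> (X s \<omega>)) t I \<and>
        (AE \<omega> in M. (\<lambda>s. b (X s \<omega>)) absolutely_integrable_on {0..t} \<and>
           X t \<omega> = x + integral {0..t} (\<lambda>s. b (X s \<omega>)) + I \<omega>))"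

text \<open>\<open>E\<^sub>x \<phi>(X(t))\<close>, given for each starting point \<open>x\<close> a solution \<open>X x\<close> on a space \<open>M x\<close>.\<close>
definition sde_mean ::
  "(real^'d::finite \<Rightarrow> 'w measure) \<Rightarrow> (real^'d \<Rightarrow> real \<Rightarrow> 'w \<Rightarrow> real^'d) \<Rightarrow> (real^'d \<Rightarrow> real) \<Rightarrow>
     real^'d \<Rightarrow> real \<Rightarrow> real" where
  "sde_mean M X \<phi> x t = (\<integral>\<omega>. \<phi> (X x t \<omega>) \<partial>M x)"

end

(* Let S be the one-step operator of the chain, S g(x) = E g(x - eta grad f(x; xi)), so that
   u^n = S^n phi. A gradient step multiplies C^{m,1} norms by at most 1 + O(eta), hence all S^k phi
   with k eta <= T are bounded in C^{m,1} by a multiple of the norm of phi. Along the solution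
   started in x,
     u(x, n eta) - u^n(x) = sum_k E[(S^{n-k-1} phi)(X((k+1) eta)) - (S^{n-k} phi)(X(k eta))],
   so neither the Markov property nor the regularity of the Kolmogorov equation is needed: it is
   enough to compare, for one smooth g, E g(X(s + eta)) with E (S g)(X(s)). The former is expanded by
   Dynkin's formula d/dt E g(X(t)) = E (L g)(X(t)), the latter by Taylor's formula; with the modified
   drift of part (b) the terms of order eta^2 agree as well.

   Dynkin's formula is obtained by freezing the coefficients: over a time step of length d, the
   Ito integral differs from sigma(X(s)) (W(s + d) - W(s)) by an L^2 error of order d^{3/4}, because
   the square root of a matrix is Hoelder continuous of exponent 1/2, and the difference is
   orthogonal to all F(s)-measurable random variables. *)
theory Submission
  imports Defs
begin

section \<open>$C^{m,1}$ functions\<close>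

text \<open>The solution is an arbitrary one on an arbitrary filtered space, and the root of
  \<open>\<eta> *\<^sub>R \<Sigma> y\<close> need not be Lipschitz where \<Sigma> degenerates.
  Dependence on the starting point is therefore out of reach, and all smoothness is asked of the
  iterates of the chain. Exponents: an increment of X over time d has L^2 size d^{1/2}, so the
  squared change of \<sigma> has mean O(d^{1/2}), and the isometry yields a squared freezing error
  O(d^{3/2}). The worst product is that of the Gaussian increment, d^{1/2}, with the freezing error,
  d^{3/4}; the result d^{5/4} is o(d), which suffices for a derivative. Its constant is lost in the
  limit, so the final constants come from sup bounds of the generator and from Taylor remainders
  alone. Derivatives: Dynkin's formula is available on C^{2,1}, and each use of the drift operator
  before it costs one more derivative. Order one therefore works with C^{3,1} functions and order
  two with C^{4,1} functions. All bounds are uniform in \<eta> \<le> 1, whence the threshold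
  1.\<close>

lemma has_derivative_partial:
  fixes g :: "real^'d::finite \<Rightarrow> real"
  assumes "g differentiable (at x)"
  shows "(g has_derivative (\<lambda>h. \<Sum>i\<in>UNIV. partial_deriv i g x * h $ i)) (at x)"
proof -
  let ?D = "frechet_derivative g (at x)"
  have D: "(g has_derivative ?D) (at x)"
    using assms by (simp add: frechet_derivative_works)
  then interpret linear ?D by (rule has_derivative_linear)
  have "?D h = (\<Sum>i\<in>UNIV. partial_deriv i g x * h $ i)" for h
  proof -
    have "?D h = ?D (\<Sum>i\<in>UNIV. (h $ i) *\<^sub>R axis i 1)"
      by (simp add: basis_expansion scalar_mult_eq_scaleR[symmetric])
    also have "\<dots> = (\<Sum>i\<in>UNIV. partial_deriv i g x * h $ i)"
      by (simp add: sum scale partial_deriv_def mult.commute)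
    finally show ?thesis .
  qed
  then have "?D = (\<lambda>h. \<Sum>i\<in>UNIV. partial_deriv i g x * h $ i)" by (rule ext)
  with D show ?thesis by simp
qed

lemma partial_derivI:
  fixes g :: "real^'d::finite \<Rightarrow> real"
  assumes "(g has_derivative D) (at x)"
  shows "partial_deriv i g x = D (axis i 1)"
  unfolding partial_deriv_def using frechet_derivative_at[OF assms] by simp

text \<open>Reads partial derivatives off a derivative in coordinate form; the sum, product and
  chain rules below are obtained through it.\<close>

lemma has_derivative_partialI:
  fixes g :: "real^'d::finite \<Rightarrow> real"
  assumes "(g has_derivative (\<lambda>h. \<Sum>i\<in>UNIV. c i * h $ i)) (at x)"
  shows "partial_deriv i g x = c i"
  using partial_derivI[OF assms, of i] by (simp add: axis_def if_distrib[of "(*) _"] cong: if_cong)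

lemma has_real_derivative_line:
  fixes g :: "real^'d::finite \<Rightarrow> real"
  assumes "g differentiable (at (x + t *\<^sub>R v))"
  shows "((\<lambda>t. g (x + t *\<^sub>R v)) has_real_derivative (\<Sum>i\<in>UNIV. partial_deriv i g (x + t *\<^sub>R v) * v $ i)) (at t)"
proof -
  have "((\<lambda>t. x + t *\<^sub>R v) has_derivative (\<lambda>h. h *\<^sub>R v)) (at t)"
    by (auto intro!: derivative_eq_intros)
  from has_derivative_compose[OF this has_derivative_partial[OF assms]]
  show ?thesis
    unfolding has_field_derivative_def
    by (rule has_derivative_eq_rhs) (simp add: sum_distrib_left mult_ac fun_eq_iff)
qed

lemma MVT_line:
  fixes g :: "real^'d::finite \<Rightarrow> real"
  assumes "g differentiable_on UNIV"
  obtains t where "0 < t" "t < 1"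
    "g (x + v) - g x = (\<Sum>i\<in>UNIV. partial_deriv i g (x + t *\<^sub>R v) * v $ i)"
proof -
  have "g differentiable (at y)" for y
    using assms by (simp add: differentiable_on_def)
  from MVT2[of 0 1 "\<lambda>t. g (x + t *\<^sub>R v)", OF _ has_real_derivative_line[OF this]]
  show thesis using that by auto
qed

text \<open>The step sizes 1/(n+1) exhibit the partial derivative as the limit of a sequence; this
  is what makes it measurable in a parameter.\<close>

lemma partial_deriv_LIMSEQ:
  fixes g :: "real^'d::finite \<Rightarrow> real"
  assumes "g differentiable (at x)"
  shows "(\<lambda>n. real (Suc n) * (g (x + inverse (real (Suc n)) *\<^sub>R axis i 1) - g x)) \<longlonglongrightarrow> partial_deriv i g x"
proof -
  have "((\<lambda>t. g (x + t *\<^sub>R axis i 1)) has_real_derivative partial_deriv i g x) (at 0)"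
    using has_real_derivative_line[of g x 0 "axis i 1"] assms
    by (simp add: axis_def if_distrib[of "(*) _"] cong: if_cong)
  then have "((\<lambda>h. (g (x + h *\<^sub>R axis i 1) - g x) / h) \<longlongrightarrow> partial_deriv i g x) (at 0)"
    by (simp add: DERIV_def)
  moreover have "filterlim (\<lambda>n. inverse (real (Suc n))) (at 0) sequentially"
    using LIMSEQ_inverse_real_of_nat by (simp add: filterlim_at)
  ultimately have "(\<lambda>n. (g (x + inverse (real (Suc n)) *\<^sub>R axis i 1) - g x) / inverse (real (Suc n))) \<longlonglongrightarrow> partial_deriv i g x"
    by (rule filterlim_compose)
  then show ?thesis by (simp add: divide_inverse mult.commute)
qed

lemma measurable_partial_deriv:
  fixes G :: "'e \<Rightarrow> real^'d::finite \<Rightarrow> real"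
  assumes "\<And>y. (\<lambda>\<xi>. G \<xi> y) \<in> borel_measurable N"
    and "\<And>\<xi>. \<xi> \<in> space N \<Longrightarrow> G \<xi> differentiable_on UNIV"
  shows "(\<lambda>\<xi>. partial_deriv i (G \<xi>) y) \<in> borel_measurable N"
proof (rule borel_measurable_LIMSEQ_real)
  fix \<xi> assume "\<xi> \<in> space N"
  then have "G \<xi> differentiable (at y)"
    using assms(2) by (simp add: differentiable_on_def)
  from partial_deriv_LIMSEQ[OF this]
  show "(\<lambda>n. real (Suc n) * (G \<xi> (y + inverse (real (Suc n)) *\<^sub>R axis i 1) - G \<xi> y)) \<longlonglongrightarrow> partial_deriv i (G \<xi>) y" .
qed (use assms(1) in measurable)

lemma partial_deriv_add:
  fixes g h :: "real^'d::finite \<Rightarrow> real"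
  assumes "g differentiable_on UNIV" "h differentiable_on UNIV"
  shows "partial_deriv i (\<lambda>x. g x + h x) = (\<lambda>x. partial_deriv i g x + partial_deriv i h x)"
proof
  fix x
  have "g differentiable (at x)" "h differentiable (at x)"
    using assms by (auto simp: differentiable_on_def)
  from has_derivative_add[OF has_derivative_partial[OF this(1)] has_derivative_partial[OF this(2)]]
  show "partial_deriv i (\<lambda>x. g x + h x) x = partial_deriv i g x + partial_deriv i h x"
    by (intro has_derivative_partialI[where c = "\<lambda>i. partial_deriv i g x + partial_deriv i h x"])
       (simp add: sum.distrib distrib_right)
qed

lemma partial_deriv_cmult:
  fixes g :: "real^'d::finite \<Rightarrow> real"
  assumes "g differentiable_on UNIV"
  shows "partial_deriv i (\<lambda>x. c * g x) = (\<lambda>x. c * partial_deriv i g x)"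
proof
  fix x
  have "g differentiable (at x)"
    using assms by (auto simp: differentiable_on_def)
  from has_derivative_mult_right[OF has_derivative_partial[OF this], of c]
  show "partial_deriv i (\<lambda>x. c * g x) x = c * partial_deriv i g x"
    by (intro has_derivative_partialI[where c = "\<lambda>i. c * partial_deriv i g x"])
       (simp add: sum_distrib_left mult_ac)
qed

lemma partial_deriv_mult:
  fixes g h :: "real^'d::finite \<Rightarrow> real"
  assumes "g differentiable_on UNIV" "h differentiable_on UNIV"
  shows "partial_deriv i (\<lambda>x. g x * h x) = (\<lambda>x. partial_deriv i g x * h x + g x * partial_deriv i h x)"
proof
  fix x
  have "g differentiable (at x)" "h differentiable (at x)"
    using assms by (auto simp: differentiable_on_def)
  from has_derivative_mult[OF has_derivative_partial[OF this(1)] has_derivative_partial[OF this(2)]]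
  show "partial_deriv i (\<lambda>x. g x * h x) x = partial_deriv i g x * h x + g x * partial_deriv i h x"
    by (intro has_derivative_partialI[where c = "\<lambda>i. partial_deriv i g x * h x + g x * partial_deriv i h x"])
       (simp add: sum.distrib sum_distrib_left sum_distrib_right distrib_right distrib_left add.commute mult_ac)
qed

text \<open>The class \<open>C\<^sup>m\<^sup>,\<^sup>1\<close>: unlike \<open>C\<^sup>m\<close> it is given by uniform inequalities only, so that it is
  stable under averaging over \<open>\<xi>\<close> without a limit argument. The dimension in the Lipschitz constant
  makes the class decreasing in \<open>m\<close> for fixed \<open>K\<close>.\<close>
primrec Clip :: "nat \<Rightarrow> real \<Rightarrow> (real^'d::finite \<Rightarrow> real) \<Rightarrow> bool" where
  "Clip 0 K g \<longleftrightarrow> (\<forall>x. \<bar>g x\<bar> \<le> K) \<and> (\<forall>x y. \<bar>g x - g y\<bar> \<le> K * CARD('d) * norm (x - y))"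
| "Clip (Suc m) K g \<longleftrightarrow> (\<forall>x. \<bar>g x\<bar> \<le> K) \<and> g differentiable_on UNIV \<and> (\<forall>i. Clip m K (partial_deriv i g))"

lemma Clip_bound: "Clip m K g \<Longrightarrow> \<bar>g x\<bar> \<le> K"
  by (cases m) auto

lemma Clip_nonneg: "Clip m K g \<Longrightarrow> 0 \<le> K"
  using Clip_bound abs_ge_zero order_trans by blast

text \<open>The mean value theorem on the segment gives one summand per coordinate, each at most
  \<open>K\<close> times the norm. This crude count is the origin of the dimension factor in
  \<open>Clip\<close>.\<close>

lemma bounded_partials_imp_lipschitz:
  fixes g :: "real^'d::finite \<Rightarrow> real"
  assumes "g differentiable_on UNIV" "\<And>i x. \<bar>partial_deriv i g x\<bar> \<le> K"
  shows "\<bar>g x - g y\<bar> \<le> K * CARD('d) * norm (x - y)"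
proof -
  obtain t where t: "g (y + (x - y)) - g y = (\<Sum>i\<in>UNIV. partial_deriv i g (y + t *\<^sub>R (x - y)) * (x - y) $ i)"
    using MVT_line[OF assms(1)] by metis
  have "\<bar>g x - g y\<bar> \<le> (\<Sum>i\<in>UNIV. \<bar>partial_deriv i g (y + t *\<^sub>R (x - y)) * (x - y) $ i\<bar>)"
    using t by (simp del: vector_minus_component)
  also have "\<dots> \<le> (\<Sum>i\<in>(UNIV::'d set). K * norm (x - y))"
    unfolding abs_mult using assms(2)[of _ x]
    by (intro sum_mono mult_mono assms component_le_norm_cart) (auto intro: order_trans[OF abs_ge_zero])
  finally show ?thesis by (simp add: mult_ac)
qed

lemma Clip_lipschitz:
  fixes g :: "real^'d::finite \<Rightarrow> real"
  assumes "Clip m K g"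
  shows "\<bar>g x - g y\<bar> \<le> K * CARD('d) * norm (x - y)"
proof (cases m)
  case 0 then show ?thesis using assms by simp
next
  case (Suc k)
  then show ?thesis using assms by (intro bounded_partials_imp_lipschitz) (auto dest: Clip_bound)
qed

lemma Clip_SucD: "Clip (Suc m) K g \<Longrightarrow> Clip m K g"
proof (induction m arbitrary: g)
  case 0
  then show ?case using Clip_lipschitz[OF 0] by simp
qed simp

lemma Clip_mono: "Clip m K g \<Longrightarrow> k \<le> m \<Longrightarrow> Clip k K g"
  by (induction m) (auto simp: le_Suc_eq dest: Clip_SucD simp del: Clip.simps)

lemma Clip_mono_const:
  fixes g :: "real^'d::finite \<Rightarrow> real"
  shows "Clip m K g \<Longrightarrow> K \<le> L \<Longrightarrow> Clip m L g"
proof (induction m arbitrary: g)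
  case 0
  have "\<bar>g x - g y\<bar> \<le> L * CARD('d) * norm (x - y)" for x y
    by (rule order_trans[OF Clip_lipschitz[OF 0(1)]]) (use 0(2) in \<open>intro mult_right_mono, auto\<close>)
  moreover have "\<bar>g x\<bar> \<le> L" for x
    using Clip_bound[OF 0(1), of x] 0(2) by simp
  ultimately show ?case by simp
next
  case (Suc m)
  have "\<bar>g x\<bar> \<le> L" for x
    using Clip_bound[OF Suc(2), of x] Suc(3) by simp
  with Suc show ?case by simp
qed

lemma Clip_differentiable: "Clip (Suc m) K g \<Longrightarrow> g differentiable_on UNIV"
  by simp

lemma Clip_partial: "Clip (Suc m) K g \<Longrightarrow> Clip m K (partial_deriv i g)"
  by simp

lemma Clip_continuous:
  fixes g :: "real^'d::finite \<Rightarrow> real"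
  assumes "Clip m K g" shows "continuous_on A g"
proof -
  have "(K * CARD('d))-lipschitz_on A g"
    using Clip_lipschitz[OF assms] Clip_nonneg[OF assms]
    by (intro lipschitz_onI) (auto simp: dist_real_def dist_norm)
  then show ?thesis by (rule lipschitz_on_continuous_on)
qed

lemma Clip_measurable [measurable_dest]: "Clip m K g \<Longrightarrow> g \<in> borel_measurable borel"
  by (intro borel_measurable_continuous_onI Clip_continuous)

lemma Clip_zero: "0 \<le> K \<Longrightarrow> Clip m K (\<lambda>x::real^'d::finite. 0)"
proof (induction m)
  case (Suc m)
  have "partial_deriv i (\<lambda>x::real^'d. 0) = (\<lambda>x. 0)" for i
    by (auto intro!: has_derivative_partialI[where c = "\<lambda>_. 0"])
  with Suc show ?case by simp
qed simp

lemma Clip_add: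
  fixes g h :: "real^'d::finite \<Rightarrow> real"
  shows "Clip m K g \<Longrightarrow> Clip m L h \<Longrightarrow> Clip m (K + L) (\<lambda>x. g x + h x)"
proof (induction m arbitrary: g h)
  case 0
  have "\<bar>g x + h x\<bar> \<le> K + L" for x
    using Clip_bound[OF 0(1), of x] Clip_bound[OF 0(2), of x] by linarith
  moreover have "\<bar>g x + h x - (g y + h y)\<bar> \<le> (K + L) * CARD('d) * norm (x - y)" for x y
    using Clip_lipschitz[OF 0(1), of x y] Clip_lipschitz[OF 0(2), of x y]
    by (simp add: distrib_right)
  ultimately show ?case by simp
next
  case (Suc m)
  have "\<bar>g x + h x\<bar> \<le> K + L" for x
    using Clip_bound[OF Suc(2), of x] Clip_bound[OF Suc(3), of x] by linarith
  with Suc show ?case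
    by (auto simp: partial_deriv_add intro!: differentiable_on_add)
qed

lemma Clip_cmult:
  fixes g :: "real^'d::finite \<Rightarrow> real"
  shows "Clip m K g \<Longrightarrow> Clip m (\<bar>c\<bar> * K) (\<lambda>x. c * g x)"
proof (induction m arbitrary: g)
  case 0
  have "\<bar>c * g x - c * g y\<bar> \<le> \<bar>c\<bar> * K * CARD('d) * norm (x - y)" for x y
    using mult_left_mono[OF Clip_lipschitz[OF 0, of x y], of "\<bar>c\<bar>"]
    by (simp add: right_diff_distrib[symmetric] abs_mult mult_ac)
  then show ?case using 0 by (auto simp: abs_mult intro!: mult_left_mono)
next
  case (Suc m)
  then show ?case
    by (auto simp: partial_deriv_cmult abs_mult intro!: mult_left_mono differentiable_on_mult)
qed

lemma Clip_minus: "Clip m K g \<Longrightarrow> Clip m K (\<lambda>x. - g x)"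
  using Clip_cmult[of m K g "-1"] by simp

lemma Clip_diff: "Clip m K g \<Longrightarrow> Clip m L h \<Longrightarrow> Clip m (K + L) (\<lambda>x. g x - h x)"
  using Clip_add[OF _ Clip_minus] by force

lemma Clip_sum:
  assumes "\<And>i. i \<in> I \<Longrightarrow> Clip m (K i) (g i)"
  shows "Clip m (\<Sum>i\<in>I. K i) (\<lambda>x. \<Sum>i\<in>I. g i x)"
  using assms by (induction I rule: infinite_finite_induct) (auto intro: Clip_zero Clip_add)

text \<open>The Leibniz rule has two terms, so every derivative doubles the constant; one further
  doubling comes from the Lipschitz estimate of a product at the bottom level.\<close>

lemma Clip_mult:
  fixes g h :: "real^'d::finite \<Rightarrow> real"
  shows "Clip m K g \<Longrightarrow> Clip m L h \<Longrightarrow> Clip m (2 ^ Suc m * K * L) (\<lambda>x. g x * h x)"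
proof (induction m arbitrary: g h)
  case 0
  note K = Clip_nonneg[OF 0(1)] and L = Clip_nonneg[OF 0(2)]
  have b: "\<bar>g x * h x\<bar> \<le> K * L" for x
    unfolding abs_mult using Clip_bound[OF 0(1), of x] Clip_bound[OF 0(2), of x] K L
    by (intro mult_mono) auto
  have "\<bar>g x * h x - g y * h y\<bar> \<le> 2 * K * L * CARD('d) * norm (x - y)" for x y
  proof -
    have "\<bar>g x * h x - g y * h y\<bar> = \<bar>g x * (h x - h y) + (g x - g y) * h y\<bar>"
      by (simp add: algebra_simps)
    also have "\<dots> \<le> \<bar>g x\<bar> * \<bar>h x - h y\<bar> + \<bar>g x - g y\<bar> * \<bar>h y\<bar>"
      by (metis abs_mult abs_triangle_ineq)
    also have "\<dots> \<le> K * (L * CARD('d) * norm (x - y)) + (K * CARD('d) * norm (x - y)) * L"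
      using K L by (intro add_mono mult_mono Clip_bound[OF 0(1)] Clip_bound[OF 0(2)]
          Clip_lipschitz[OF 0(1)] Clip_lipschitz[OF 0(2)]) auto
    finally show ?thesis by (simp add: mult_ac)
  qed
  with b K L show ?case by (auto intro: order_trans[OF b])
next
  case (Suc m)
  note K = Clip_nonneg[OF Suc(2)] and L = Clip_nonneg[OF Suc(3)]
  have KL: "0 \<le> K * L" using K L by simp
  have "\<bar>g x * h x\<bar> \<le> K * L" for x
    unfolding abs_mult using Clip_bound[OF Suc(2), of x] Clip_bound[OF Suc(3), of x] K L
    by (intro mult_mono) auto
  then have b: "\<bar>g x * h x\<bar> \<le> 2 ^ Suc (Suc m) * K * L" for x
    using mult_right_mono[OF one_le_power[of "2::real" "Suc (Suc m)"] KL]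
    by (metis (no_types, lifting) dual_order.trans mult.assoc mult_1 one_le_numeral)
  have "Clip m (2 ^ Suc m * K * L + 2 ^ Suc m * K * L)
     (\<lambda>x. partial_deriv i g x * h x + g x * partial_deriv i h x)" for i
    using Suc by (intro Clip_add Suc.IH Clip_partial Clip_SucD[of m K g] Clip_SucD[of m L h])
  then have "Clip m (2 ^ Suc (Suc m) * K * L)
     (\<lambda>x. partial_deriv i g x * h x + g x * partial_deriv i h x)" for i
    by (simp add: mult_ac)
  with b Suc show ?case
    by (auto simp: partial_deriv_mult intro!: differentiable_on_mult)
qed

section \<open>Taylor's formula with Lipschitz remainders\<close>

text \<open>One factor \<open>CARD('d)\<close> is the Lipschitz constant of the first derivatives,
  the other counts the coordinates of v. A Lipschitz gradient is enough for a quadratic remainder;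
  no second derivative has to exist.\<close>

lemma taylor_first_order:
  fixes g :: "real^'d::finite \<Rightarrow> real"
  assumes g: "Clip (Suc 0) K g"
  shows "\<bar>g (x + v) - g x - (\<Sum>i\<in>UNIV. partial_deriv i g x * v $ i)\<bar> \<le> K * CARD('d)^2 * norm v ^ 2"
proof -
  obtain t where t: "0 < t" "t < 1"
    "g (x + v) - g x = (\<Sum>i\<in>UNIV. partial_deriv i g (x + t *\<^sub>R v) * v $ i)"
    using MVT_line[OF Clip_differentiable[OF g]] .
  have K: "0 \<le> K" using Clip_nonneg[OF g] .
  have "\<bar>(partial_deriv i g (x + t *\<^sub>R v) - partial_deriv i g x) * v $ i\<bar> \<le> (K * CARD('d) * norm v) * norm v" for i
    unfolding abs_mult
  proof (rule mult_mono)
    have "\<bar>partial_deriv i g (x + t *\<^sub>R v) - partial_deriv i g x\<bar> \<le> K * CARD('d) * norm (x + t *\<^sub>R v - x)"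
      by (rule Clip_lipschitz[OF Clip_partial[OF g]])
    also have "\<dots> \<le> K * CARD('d) * norm v"
      using t K by (intro mult_left_mono) (auto simp: mult_left_le_one_le)
    finally show "\<bar>partial_deriv i g (x + t *\<^sub>R v) - partial_deriv i g x\<bar> \<le> K * CARD('d) * norm v" .
  qed (use K in \<open>auto simp: component_le_norm_cart\<close>)
  then have "(\<Sum>i\<in>UNIV. \<bar>(partial_deriv i g (x + t *\<^sub>R v) - partial_deriv i g x) * v $ i\<bar>)
      \<le> (\<Sum>i\<in>(UNIV::'d set). (K * CARD('d) * norm v) * norm v)"
    by (intro sum_mono)
  then have "\<bar>\<Sum>i\<in>UNIV. (partial_deriv i g (x + t *\<^sub>R v) - partial_deriv i g x) * v $ i\<bar>
      \<le> K * CARD('d)^2 * norm v ^ 2"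
    by (intro order_trans[OF sum_abs]) (simp add: power2_eq_square mult_ac)
  then show ?thesis
    by (simp add: t(3) left_diff_distrib sum_subtractf)
qed

lemma taylor_second_order:
  fixes g :: "real^'d::finite \<Rightarrow> real"
  assumes g: "Clip (Suc (Suc 0)) K g"
  shows "\<bar>g (x + v) - g x - (\<Sum>i\<in>UNIV. partial_deriv i g x * v $ i)
      - (\<Sum>i\<in>UNIV. \<Sum>j\<in>UNIV. partial_deriv j (partial_deriv i g) x * v $ i * v $ j) / 2\<bar>
      \<le> K * CARD('d)^3 * norm v ^ 3"
proof -
  have K: "0 \<le> K" using Clip_nonneg[OF g] .
  define a b where "a = (\<Sum>i\<in>UNIV. partial_deriv i g x * v $ i)"
    and "b = (\<Sum>i\<in>UNIV. \<Sum>j\<in>UNIV. partial_deriv j (partial_deriv i g) x * v $ i * v $ j)"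
  \<comment> \<open>Along the segment, w is g minus its quadratic Taylor polynomial up to a
    constant. Its derivative is a combination of the first-order remainders of the partial
    derivatives, so that \<open>taylor_first_order\<close> bounds it by the square of the norm of
    v.\<close>
  define w where "w t = g (x + t *\<^sub>R v) - t * a - t^2 / 2 * b" for t :: real
  have gd: "g differentiable (at y)" for y
    using Clip_differentiable[OF g] by (simp add: differentiable_on_def)
  have dw: "(w has_real_derivative (\<Sum>i\<in>UNIV. partial_deriv i g (x + t *\<^sub>R v) * v $ i) - a - t * b) (at t)" for t
    unfolding w_def by (rule derivative_eq_intros has_real_derivative_line gd refl | simp)+
  obtain t where t: "0 < t" "t < 1" and
    wt: "w 1 - w 0 = (\<Sum>i\<in>UNIV. partial_deriv i g (x + t *\<^sub>R v) * v $ i) - a - t * b"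
    using MVT2[of 0 1 w, OF _ dw] by auto
  have eq: "w 1 - w 0 = (\<Sum>i\<in>UNIV. (partial_deriv i g (x + t *\<^sub>R v) - partial_deriv i g x
     - (\<Sum>j\<in>UNIV. partial_deriv j (partial_deriv i g) x * (t *\<^sub>R v) $ j)) * v $ i)"
    unfolding wt a_def b_def
    by (simp add: sum_subtractf left_diff_distrib right_diff_distrib sum_distrib_left sum_distrib_right mult_ac)
  have "\<bar>w 1 - w 0\<bar> \<le> (\<Sum>i\<in>UNIV. \<bar>(partial_deriv i g (x + t *\<^sub>R v) - partial_deriv i g x
     - (\<Sum>j\<in>UNIV. partial_deriv j (partial_deriv i g) x * (t *\<^sub>R v) $ j)) * v $ i\<bar>)"
    unfolding eq by (rule sum_abs)
  also have "\<dots> \<le> (\<Sum>i\<in>(UNIV::'d set). (K * CARD('d)^2 * norm v ^ 2) * norm v)"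
    unfolding abs_mult
  proof (intro sum_mono mult_mono)
    fix i
    have "\<bar>partial_deriv i g (x + t *\<^sub>R v) - partial_deriv i g x
     - (\<Sum>j\<in>UNIV. partial_deriv j (partial_deriv i g) x * (t *\<^sub>R v) $ j)\<bar> \<le> K * CARD('d)^2 * norm (t *\<^sub>R v) ^ 2"
      by (rule taylor_first_order[OF Clip_partial[OF g]])
    also have "\<dots> \<le> K * CARD('d)^2 * norm v ^ 2"
      using t K by (intro mult_left_mono power_mono) (auto simp: mult_left_le_one_le)
    finally show "\<bar>partial_deriv i g (x + t *\<^sub>R v) - partial_deriv i g x
     - (\<Sum>j\<in>UNIV. partial_deriv j (partial_deriv i g) x * (t *\<^sub>R v) $ j)\<bar> \<le> K * CARD('d)^2 * norm v ^ 2" .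
  qed (use K in \<open>auto simp: component_le_norm_cart\<close>)
  finally have "\<bar>w 1 - w 0\<bar> \<le> K * CARD('d)^3 * norm v ^ 3"
    by (simp add: power2_eq_square power3_eq_cube mult_ac)
  then show ?thesis
    by (simp add: w_def a_def b_def)
qed

text \<open>A quadratic remainder bound with a fixed constant survives averaging over a parameter;
  this criterion turns the averaged bound back into differentiability.\<close>

lemma has_derivative_quadratic_remainder:
  fixes g :: "'a::real_normed_vector \<Rightarrow> real"
  assumes "bounded_linear D" "\<And>h. \<bar>g (x + h) - g x - D h\<bar> \<le> C * norm h ^ 2"
  shows "(g has_derivative D) (at x)"
  unfolding has_derivative_at
proof (intro conjI assms(1))
  have "((\<lambda>h::'a. C * norm h) \<longlongrightarrow> C * norm (0::'a)) (at 0)"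
    by (rule tendsto_mult_left[OF tendsto_norm[OF tendsto_ident_at]])
  then have lim: "((\<lambda>h::'a. C * norm h) \<longlongrightarrow> 0) (at 0)" by simp
  show "(\<lambda>h. norm (g (x + h) - g x - D h) / norm h) \<midarrow>0\<rightarrow> 0"
  proof (rule Lim_null_comparison[OF _ lim], rule always_eventually, rule allI)
    fix h :: 'a
    show "norm (norm (g (x + h) - g x - D h) / norm h) \<le> C * norm h"
    proof (cases "h = 0")
      case False
      with assms(2)[of h] show ?thesis
        by (simp add: divide_simps power2_eq_square mult_ac)
    qed simp
  qed
qed

section \<open>Averages over the random parameter\<close>

context prob_space
begin

lemma integrable_Clip:
  assumes "\<And>\<xi>. \<xi> \<in> space M \<Longrightarrow> Clip m K (G \<xi>)" "\<And>y. (\<lambda>\<xi>. G \<xi> y) \<in> borel_measurable M"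
  shows "integrable M (\<lambda>\<xi>. G \<xi> y)"
  using assms(1) by (intro integrable_const_bound[of _ K] assms(2)) (auto dest: Clip_bound)

lemma abs_expectation_le:
  fixes f :: "_ \<Rightarrow> real"
  assumes "integrable M f" "\<And>x. x \<in> space M \<Longrightarrow> \<bar>f x\<bar> \<le> K"
  shows "\<bar>expectation f\<bar> \<le> K"
proof -
  have "\<bar>expectation f\<bar> \<le> expectation (\<lambda>x. \<bar>f x\<bar>)"
    by (rule integral_abs_bound)
  also have "\<dots> \<le> expectation (\<lambda>x. K)"
    using assms by (intro integral_mono) auto
  finally show ?thesis by (simp add: prob_space)
qed

text \<open>The Taylor remainder is bounded by one multiple of the squared norm of h for all \<xi>
  at once, so integrating the Taylor formula already proves differentiability; dominated convergence
  is replaced by this uniform inequality.\<close>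

lemma
  fixes G :: "'a \<Rightarrow> real^'d::finite \<Rightarrow> real"
  assumes G: "\<And>\<xi>. \<xi> \<in> space M \<Longrightarrow> Clip (Suc 0) K (G \<xi>)"
    and meas: "\<And>y. (\<lambda>\<xi>. G \<xi> y) \<in> borel_measurable M"
  shows differentiable_expectation: "(\<lambda>y. expectation (\<lambda>\<xi>. G \<xi> y)) differentiable_on UNIV" (is ?th1)
    and partial_deriv_expectation:
      "partial_deriv i (\<lambda>y. expectation (\<lambda>\<xi>. G \<xi> y)) = (\<lambda>y. expectation (\<lambda>\<xi>. partial_deriv i (G \<xi>) y))" (is ?th2)
proof -
  have meas': "(\<lambda>\<xi>. partial_deriv i (G \<xi>) y) \<in> borel_measurable M" for i y
    using meas Clip_differentiable[OF G] by (rule measurable_partial_deriv)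
  have int: "integrable M (\<lambda>\<xi>. G \<xi> y)" for y
    using G meas by (rule integrable_Clip)
  have int': "integrable M (\<lambda>\<xi>. partial_deriv i (G \<xi>) y)" for i y
    using Clip_partial[OF G] meas' by (rule integrable_Clip)
  have D: "((\<lambda>y. expectation (\<lambda>\<xi>. G \<xi> y)) has_derivative
      (\<lambda>h. \<Sum>i\<in>UNIV. expectation (\<lambda>\<xi>. partial_deriv i (G \<xi>) y) * h $ i)) (at y)" for y
  proof (rule has_derivative_quadratic_remainder[where C = "K * CARD('d)^2"])
    show "bounded_linear (\<lambda>h::real^'d. \<Sum>i\<in>UNIV. expectation (\<lambda>\<xi>. partial_deriv i (G \<xi>) y) * h $ i)"
      by (intro bounded_linear_intros bounded_linear_sum bounded_linear_mult_right bounded_linear_vec_nth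
          bounded_linear_const_mult)
    fix h :: "real^'d"
    have "expectation (\<lambda>\<xi>. G \<xi> (y + h)) - expectation (\<lambda>\<xi>. G \<xi> y)
        - (\<Sum>i\<in>UNIV. expectation (\<lambda>\<xi>. partial_deriv i (G \<xi>) y) * h $ i)
      = expectation (\<lambda>\<xi>. G \<xi> (y + h) - G \<xi> y - (\<Sum>i\<in>UNIV. partial_deriv i (G \<xi>) y * h $ i))"
      using int int' by simp
    also have "\<bar>\<dots>\<bar> \<le> K * CARD('d)^2 * norm h ^ 2"
      using int int' by (intro abs_expectation_le taylor_first_order G) auto
    finally show "\<bar>expectation (\<lambda>\<xi>. G \<xi> (y + h)) - expectation (\<lambda>\<xi>. G \<xi> y)
        - (\<Sum>i\<in>UNIV. expectation (\<lambda>\<xi>. partial_deriv i (G \<xi>) y) * h $ i)\<bar> \<le> K * CARD('d)^2 * norm h ^ 2" .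
  qed
  show ?th1 using D by (auto simp: differentiable_on_def differentiable_def)
  show ?th2 using has_derivative_partialI[OF D] by (intro ext)
qed

text \<open>Every clause of \<open>Clip\<close> is a bound with the same constant for all \<xi> and
  passes to the mean without loss, once derivative and mean have been exchanged.\<close>

lemma Clip_expectation:
  fixes G :: "'a \<Rightarrow> real^'d::finite \<Rightarrow> real"
  assumes "\<And>\<xi>. \<xi> \<in> space M \<Longrightarrow> Clip m K (G \<xi>)"
    and "\<And>y. (\<lambda>\<xi>. G \<xi> y) \<in> borel_measurable M"
  shows "Clip m K (\<lambda>y. expectation (\<lambda>\<xi>. G \<xi> y))"
  using assms
proof (induction m arbitrary: G)
  case 0
  note int = integrable_Clip[OF 0]
  have "\<bar>expectation (\<lambda>\<xi>. G \<xi> y)\<bar> \<le> K" for y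
    using Clip_bound[OF 0(1)] by (intro abs_expectation_le int)
  moreover have "\<bar>expectation (\<lambda>\<xi>. G \<xi> x) - expectation (\<lambda>\<xi>. G \<xi> y)\<bar> \<le> K * CARD('d) * norm (x - y)" for x y
    using Clip_lipschitz[OF 0(1)] int
    by (simp add: Bochner_Integration.integral_diff[symmetric] del: Bochner_Integration.integral_diff)
       (intro abs_expectation_le Bochner_Integration.integrable_diff int, auto)
  ultimately show ?case by simp
next
  case (Suc m)
  have G1: "Clip (Suc 0) K (G \<xi>)" if "\<xi> \<in> space M" for \<xi>
    using Clip_mono[OF Suc(2)[OF that], of "Suc 0"] by simp
  have "\<bar>expectation (\<lambda>\<xi>. G \<xi> y)\<bar> \<le> K" for y
    using Clip_bound[OF Suc(2)] by (intro abs_expectation_le integrable_Clip[OF Suc(2,3)])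
  moreover have "Clip m K (\<lambda>y. expectation (\<lambda>\<xi>. partial_deriv i (G \<xi>) y))" for i
    using Suc(2,3) Clip_differentiable[OF Suc(2)]
    by (intro Suc.IH measurable_partial_deriv Clip_partial)
  ultimately show ?case
    using differentiable_expectation[OF G1 Suc(3)] by (simp add: partial_deriv_expectation[OF G1 Suc(3)])
qed

end

section \<open>A gradient step acting on C^{m,1} functions\<close>

lemma grad_nth: "grad f x $ i = partial_deriv i f x"
  by (simp add: grad_def)

lemma grad_axis_sum: "grad f x = (\<Sum>j\<in>UNIV. partial_deriv j f x *\<^sub>R axis j 1)"
  using basis_expansion[of "grad f x"] by (simp add: grad_nth scalar_mult_eq_scaleR)

lemma norm_grad_diff_le:
  fixes f :: "real^'d::finite \<Rightarrow> real"
  assumes "\<And>j. Clip m L (partial_deriv j f)"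
  shows "norm (grad f x - grad f y) \<le> L * CARD('d)^2 * norm (x - y)"
proof -
  have "norm (grad f x - grad f y) \<le> (\<Sum>j\<in>UNIV. \<bar>(grad f x - grad f y) $ j\<bar>)"
    by (rule norm_le_l1_cart)
  also have "\<dots> \<le> (\<Sum>j\<in>(UNIV::'d set). L * CARD('d) * norm (x - y))"
    using Clip_lipschitz[OF assms] by (intro sum_mono) (auto simp: grad_nth)
  finally show ?thesis by (simp add: power2_eq_square mult_ac)
qed

lemma norm_grad_le:
  fixes f :: "real^'d::finite \<Rightarrow> real"
  assumes "\<And>j. Clip m L (partial_deriv j f)"
  shows "norm (grad f x) \<le> L * CARD('d)"
proof -
  have "norm (grad f x) \<le> (\<Sum>j\<in>UNIV. \<bar>grad f x $ j\<bar>)"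
    by (rule norm_le_l1_cart)
  also have "\<dots> \<le> (\<Sum>j\<in>(UNIV::'d set). L)"
    using Clip_bound[OF assms] by (intro sum_mono) (auto simp: grad_nth)
  finally show ?thesis by (simp add: mult_ac)
qed

text \<open>Chain rule: the map x - \<eta> grad f(x) has the Jacobian I - \<eta> Hess f. The double
  sum is rearranged to display the coefficient of \<open>h $ i\<close>.\<close>

lemma has_derivative_grad_step:
  fixes f g :: "real^'d::finite \<Rightarrow> real"
  assumes g: "g differentiable_on UNIV" and f: "\<And>j. partial_deriv j f differentiable_on UNIV"
  shows "((\<lambda>x. g (x - \<eta> *\<^sub>R grad f x)) has_derivative
    (\<lambda>h. \<Sum>i\<in>UNIV. (partial_deriv i g (x - \<eta> *\<^sub>R grad f x)
      + (- \<eta>) * (\<Sum>j\<in>UNIV. partial_deriv j g (x - \<eta> *\<^sub>R grad f x) * partial_deriv i (partial_deriv j f) x)) * h $ i)) (at x)"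
proof -
  have fd: "partial_deriv j f differentiable (at x)" and gd: "g differentiable (at y)" for j x y
    using f g by (auto simp: differentiable_on_def)
  let ?q = "\<lambda>h. (\<Sum>j\<in>UNIV. (\<Sum>i\<in>UNIV. partial_deriv i (partial_deriv j f) x * h $ i) *\<^sub>R axis j (1::real))"
  have "((\<lambda>x. x - \<eta> *\<^sub>R grad f x) has_derivative (\<lambda>h. h - \<eta> *\<^sub>R ?q h)) (at x)"
    unfolding grad_axis_sum[abs_def]
    by (intro has_derivative_diff has_derivative_ident has_derivative_scaleR_right has_derivative_sum
        has_derivative_scaleR_left has_derivative_partial fd)
  from has_derivative_compose[OF this has_derivative_partial[OF gd]]
  have 1: "((\<lambda>x. g (x - \<eta> *\<^sub>R grad f x)) has_derivative
    (\<lambda>h. \<Sum>j\<in>UNIV. partial_deriv j g (x - \<eta> *\<^sub>R grad f x) * (h - \<eta> *\<^sub>R ?q h) $ j)) (at x)" .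
  have q: "?q h $ j = (\<Sum>i\<in>UNIV. partial_deriv i (partial_deriv j f) x * h $ i)" for h j
    by (simp add: axis_def if_distrib[of "(*) _"] sum.If_cases cong: if_cong)
  show ?thesis
  proof (rule has_derivative_eq_rhs[OF 1], rule ext)
    fix h :: "real^'d"
    let ?g = "\<lambda>j. partial_deriv j g (x - \<eta> *\<^sub>R grad f x)"
    have "(\<Sum>j\<in>UNIV. ?g j * (\<Sum>i\<in>UNIV. partial_deriv i (partial_deriv j f) x * h $ i))
      = (\<Sum>i\<in>UNIV. (\<Sum>j\<in>UNIV. ?g j * partial_deriv i (partial_deriv j f) x) * h $ i)"
      unfolding sum_distrib_left sum_distrib_right by (subst sum.swap) (simp add: mult_ac)
    then have "(\<Sum>j\<in>UNIV. ?g j * (\<eta> * (\<Sum>i\<in>UNIV. partial_deriv i (partial_deriv j f) x * h $ i)))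
      = (\<Sum>i\<in>UNIV. \<eta> * (\<Sum>j\<in>UNIV. ?g j * partial_deriv i (partial_deriv j f) x) * h $ i)"
      by (simp add: mult.left_commute[of _ \<eta>] sum_distrib_left[of \<eta>, symmetric] mult.assoc del: sum_distrib_left sum_distrib_right)
    then show "(\<Sum>j\<in>UNIV. ?g j * (h - \<eta> *\<^sub>R ?q h) $ j) = (\<Sum>i\<in>UNIV. (?g i + (- \<eta>) * (\<Sum>j\<in>UNIV. ?g j * partial_deriv i (partial_deriv j f) x)) * h $ i)"
      by (simp only: vector_minus_component vector_scaleR_component q right_diff_distrib distrib_right sum_subtractf sum.distrib real_scaleR_def)
         (simp add: sum_negf)
  qed
qed

text \<open>A partial derivative of the composition is the composed partial derivative of g plus
  \<eta> times products with Hessian entries of f. The first is covered by induction, the rest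
  contributes O(\<eta>). The factor must be 1 + O(\<eta>), since it is raised to a power of order
  1/\<eta> later; \<open>c\<close> is chosen before f, g and \<eta>.\<close>

lemma Clip_grad_step:
  shows "\<exists>c\<ge>0. \<forall>(f :: real^'d::finite \<Rightarrow> real) g \<eta> K.
    (\<forall>j. Clip m L (partial_deriv j f)) \<and> 0 \<le> \<eta> \<and> \<eta> \<le> 1 \<and> Clip m K g \<longrightarrow>
    Clip m ((1 + c * \<eta>) * K) (\<lambda>x. g (x - \<eta> *\<^sub>R grad f x))"
\<comment> \<open>A negative \<open>L\<close> bounds no function, and the claim is vacuous.\<close>
proof (cases "L \<ge> 0")
  case False
  then have "\<not> Clip m L g" for g :: "real^'d \<Rightarrow> real"
    using Clip_nonneg by blast
  then show ?thesis by blast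
next
  case L: True
  show ?thesis
  proof (induction m)
    case 0
    have "Clip 0 ((1 + (L * CARD('d)^2) * \<eta>) * K) (\<lambda>x. g (x - \<eta> *\<^sub>R grad f x))"
      if f: "\<forall>j. Clip 0 L (partial_deriv j f)" and "0 \<le> \<eta>" "\<eta> \<le> 1" and g: "Clip 0 K g"
      for f g :: "real^'d \<Rightarrow> real" and \<eta> K
    proof -
      have K: "0 \<le> K" using Clip_nonneg[OF g] .
      have "\<bar>g (x - \<eta> *\<^sub>R grad f x) - g (y - \<eta> *\<^sub>R grad f y)\<bar>
          \<le> (1 + (L * CARD('d)^2) * \<eta>) * K * CARD('d) * norm (x - y)" for x y
      proof -
        have "norm ((x - \<eta> *\<^sub>R grad f x) - (y - \<eta> *\<^sub>R grad f y)) = norm ((x - y) - \<eta> *\<^sub>R (grad f x - grad f y))"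
          by (simp add: algebra_simps)
        also have "\<dots> \<le> norm (x - y) + norm (\<eta> *\<^sub>R (grad f x - grad f y))"
          by (rule norm_triangle_ineq4)
        also have "\<dots> \<le> norm (x - y) + \<eta> * (L * CARD('d)^2 * norm (x - y))"
          using norm_grad_diff_le[of 0 L f x y] f that by (auto intro!: mult_left_mono)
        finally have "norm ((x - \<eta> *\<^sub>R grad f x) - (y - \<eta> *\<^sub>R grad f y)) \<le> (1 + (L * CARD('d)^2) * \<eta>) * norm (x - y)"
          by (simp add: algebra_simps)
        then have "K * CARD('d) * norm ((x - \<eta> *\<^sub>R grad f x) - (y - \<eta> *\<^sub>R grad f y))
            \<le> K * CARD('d) * ((1 + (L * CARD('d)^2) * \<eta>) * norm (x - y))"
          using K by (intro mult_left_mono) auto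
        with Clip_lipschitz[OF g, of "x - \<eta> *\<^sub>R grad f x" "y - \<eta> *\<^sub>R grad f y"] show ?thesis
          by (simp add: mult_ac)
      qed
      moreover have "\<bar>g x\<bar> \<le> (1 + (L * CARD('d)^2) * \<eta>) * K" for x
        using Clip_bound[OF g, of x] L K that(2) by (simp add: distrib_right add_increasing2)
      ultimately show ?thesis by simp
    qed
    then show ?case using L by (intro exI[of _ "L * CARD('d)^2"]) auto
  next
    case (Suc m)
    then obtain c where c: "0 \<le> c" and IH: "\<And>(f :: real^'d \<Rightarrow> real) g \<eta> K.
      (\<forall>j. Clip m L (partial_deriv j f)) \<Longrightarrow> 0 \<le> \<eta> \<Longrightarrow> \<eta> \<le> 1 \<Longrightarrow> Clip m K g \<Longrightarrow>
      Clip m ((1 + c * \<eta>) * K) (\<lambda>x. g (x - \<eta> *\<^sub>R grad f x))"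
      by blast
    \<comment> \<open>Each of the \<open>CARD('d)\<close> products carries \<eta>, the constant
      2^(m+1) of \<open>Clip_mult\<close>, the bound \<open>L\<close> of a Hessian entry, and (1 + c
      \<eta>) K, which is at most (1 + c) K because \<eta> \<le> 1.\<close>
    define c' where "c' = c + CARD('d) * (2 ^ Suc m * (1 + c) * L)"
    have c': "0 \<le> c'" using c L by (simp add: c'_def)
    have "Clip (Suc m) ((1 + c' * \<eta>) * K) (\<lambda>x. g (x - \<eta> *\<^sub>R grad f x))"
      if f: "\<forall>j. Clip (Suc m) L (partial_deriv j f)" and \<eta>: "0 \<le> \<eta>" "\<eta> \<le> 1" and g: "Clip (Suc m) K g"
      for f g :: "real^'d \<Rightarrow> real" and \<eta> K
    proof -
      have K: "0 \<le> K" using Clip_nonneg[OF g] .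
      have fm: "\<forall>j. Clip m L (partial_deriv j f)"
        using f Clip_SucD by blast
      note D = has_derivative_grad_step[OF Clip_differentiable[OF g] Clip_differentiable[OF f[rule_format]], of \<eta>]
      have pd: "partial_deriv i (\<lambda>x. g (x - \<eta> *\<^sub>R grad f x)) =
        (\<lambda>x. partial_deriv i g (x - \<eta> *\<^sub>R grad f x)
      + (- \<eta>) * (\<Sum>j\<in>UNIV. partial_deriv j g (x - \<eta> *\<^sub>R grad f x) * partial_deriv i (partial_deriv j f) x))" for i
        using has_derivative_partialI[OF D] by (intro ext)
      have IH': "Clip m ((1 + c * \<eta>) * K) (\<lambda>x. partial_deriv i g (x - \<eta> *\<^sub>R grad f x))" for i
        by (intro IH fm \<eta> Clip_partial g)
      have "Clip m ((1 + c * \<eta>) * K + \<bar>-\<eta>\<bar> * (\<Sum>j\<in>(UNIV::'d set). 2 ^ Suc m * ((1 + c * \<eta>) * K) * L))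
        (\<lambda>x. partial_deriv i g (x - \<eta> *\<^sub>R grad f x)
      + (- \<eta>) * (\<Sum>j\<in>UNIV. partial_deriv j g (x - \<eta> *\<^sub>R grad f x) * partial_deriv i (partial_deriv j f) x))" for i
        by (intro Clip_add Clip_cmult Clip_sum Clip_mult IH' Clip_partial f[rule_format])
      moreover have "(1 + c * \<eta>) * K + \<bar>-\<eta>\<bar> * (\<Sum>j\<in>(UNIV::'d set). 2 ^ Suc m * ((1 + c * \<eta>) * K) * L) \<le> (1 + c' * \<eta>) * K"
      proof -
        have "(1 + c * \<eta>) * (2 ^ Suc m * CARD('d) * L * \<eta> * K) \<le> (1 + c) * (2 ^ Suc m * CARD('d) * L * \<eta> * K)"
          using \<eta> c L K by (intro mult_right_mono) (auto simp: mult_left_le)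
        then show ?thesis using \<eta> by (simp add: c'_def algebra_simps)
      qed
      moreover have "\<bar>g (x - \<eta> *\<^sub>R grad f x)\<bar> \<le> (1 + c' * \<eta>) * K" for x
      proof -
        have "\<bar>g (x - \<eta> *\<^sub>R grad f x)\<bar> \<le> K" by (rule Clip_bound[OF g])
        also have "K \<le> (1 + c' * \<eta>) * K"
          using c' K \<eta> by (simp add: distrib_right)
        finally show ?thesis .
      qed
      moreover have "(\<lambda>x. g (x - \<eta> *\<^sub>R grad f x)) differentiable_on UNIV"
        using D by (auto simp: differentiable_on_def differentiable_def)
      ultimately show ?thesis
        by (auto simp: pd intro: Clip_mono_const)
    qed
    with c' show ?case by blast
  qed
qed

text \<open>For g of finite range the composition is measurable piece by piece; a general g is a
  limit of simple functions, and continuity in the second argument carries the limit through f.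
  Needed for random gradients at random points and for paths evaluated at a variable time.\<close>

lemma borel_measurable_Caratheodory:
  fixes f :: "'a \<Rightarrow> 'b::{metric_space,second_countable_topology} \<Rightarrow> 'c::{metric_space}"
  assumes g: "g \<in> borel_measurable M"
    and meas: "\<And>x. (\<lambda>\<omega>. f \<omega> x) \<in> borel_measurable M"
    and cont: "\<And>\<omega>. \<omega> \<in> space M \<Longrightarrow> continuous_on UNIV (f \<omega>)"
  shows "(\<lambda>\<omega>. f \<omega> (g \<omega>)) \<in> borel_measurable M"
proof -
  obtain s where s: "\<And>i. simple_function M (s i)" "\<And>\<omega>. \<omega> \<in> space M \<Longrightarrow> (\<lambda>i. s i \<omega>) \<longlonglongrightarrow> g \<omega>"
    using borel_measurable_implies_sequence_metric[OF g] by blast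
  show ?thesis
  proof (rule borel_measurable_LIMSEQ_metric)
    fix i
    have fin: "finite (s i ` space M)" using s(1) by (rule simple_functionD)
    show "(\<lambda>\<omega>. f \<omega> (s i \<omega>)) \<in> borel_measurable M"
    proof (rule measurable_compose_countable'[where f = "\<lambda>x \<omega>. f \<omega> x" and I = "s i ` space M"])
      show "s i \<in> M \<rightarrow>\<^sub>M count_space (s i ` space M)"
        using s(1)[of i] by (auto simp: simple_function_def measurable_count_space_eq2)
    qed (use meas fin in \<open>auto intro: countable_finite\<close>)
  next
    fix \<omega> assume \<omega>: "\<omega> \<in> space M"
    then have "isCont (f \<omega>) (g \<omega>)"
      using cont by (simp add: continuous_on_eq_continuous_at)
    then show "(\<lambda>i. f \<omega> (s i \<omega>)) \<longlonglongrightarrow> f \<omega> (g \<omega>)"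
      using s(2)[OF \<omega>] by (rule isCont_tendsto_compose)
  qed
qed

section \<open>Symmetry of second derivatives and the multi-index norm\<close>

text \<open>Two applications of the mean value theorem, first in direction i, then in direction j.
  The left-hand side is symmetric in i and j, which is the source of Schwarz's theorem.\<close>

lemma second_difference:
  fixes g :: "real^'d::finite \<Rightarrow> real"
  assumes g: "g differentiable_on UNIV" and g': "partial_deriv i g differentiable_on UNIV" and h: "0 < h"
  shows "\<exists>p. norm (p - x) \<le> 2 * h \<and>
    g (x + h *\<^sub>R axis i 1 + h *\<^sub>R axis j 1) - g (x + h *\<^sub>R axis i 1) - g (x + h *\<^sub>R axis j 1) + g x
      = h^2 * partial_deriv j (partial_deriv i g) p"
proof -
  define a b :: "real^'d" where "a = axis i 1" and "b = axis j 1"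
  have ab: "norm a = 1" "norm b = 1" by (simp_all add: a_def b_def norm_axis_1)
  have gd: "g differentiable (at y)" "partial_deriv i g differentiable (at y)" for y
    using g g' by (auto simp: differentiable_on_def)
  have pd: "(\<Sum>l\<in>UNIV. partial_deriv l G y * axis k 1 $ l) = partial_deriv k G y" for G :: "real^'d \<Rightarrow> real" and k y
    by (simp add: axis_def if_distrib[of "(*) _"] cong: if_cong)
  \<comment> \<open>The increment of u over [0, h] is the mixed second difference.\<close>
  define u where "u s = g ((x + h *\<^sub>R b) + s *\<^sub>R a) - g (x + s *\<^sub>R a)" for s
  have du: "(u has_real_derivative partial_deriv i g ((x + h *\<^sub>R b) + s *\<^sub>R a) - partial_deriv i g (x + s *\<^sub>R a)) (at s)" for s
    unfolding u_def using has_real_derivative_line[where g = g and x = "x + h *\<^sub>R b" and t = s and v = a, OF gd(1)]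
      has_real_derivative_line[where g = g and x = x and t = s and v = a, OF gd(1)]
    by (intro DERIV_diff) (simp_all add: a_def pd)
  obtain s where s: "0 < s" "s < h" and us: "u h - u 0 = h * (partial_deriv i g ((x + h *\<^sub>R b) + s *\<^sub>R a) - partial_deriv i g (x + s *\<^sub>R a))"
    using MVT2[OF h du] by auto
  have "((\<lambda>t. partial_deriv i g ((x + s *\<^sub>R a) + t *\<^sub>R b)) has_real_derivative
      partial_deriv j (partial_deriv i g) ((x + s *\<^sub>R a) + t *\<^sub>R b)) (at t)" for t
    using has_real_derivative_line[where x = "x + s *\<^sub>R a" and t = t and v = b, OF gd(2)] by (simp add: b_def pd)
  from MVT2[OF h this] obtain t where t: "0 < t" "t < h" and
    ut: "partial_deriv i g ((x + s *\<^sub>R a) + h *\<^sub>R b) - partial_deriv i g (x + s *\<^sub>R a)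
      = h * partial_deriv j (partial_deriv i g) ((x + s *\<^sub>R a) + t *\<^sub>R b)"
    by auto
  let ?p = "(x + s *\<^sub>R a) + t *\<^sub>R b"
  have "norm (?p - x) \<le> norm (s *\<^sub>R a) + norm (t *\<^sub>R b)"
    using norm_triangle_ineq[of "s *\<^sub>R a" "t *\<^sub>R b"] by (simp add: add.assoc)
  also have "\<dots> \<le> 2 * h" using s t ab by simp
  finally have "norm (?p - x) \<le> 2 * h" .
  moreover have "u h - u 0 = h^2 * partial_deriv j (partial_deriv i g) ?p"
    using us ut by (simp add: power2_eq_square add_ac)
  ultimately show ?thesis
    by (intro exI[of _ ?p]) (simp add: u_def a_def b_def add_ac)
qed

text \<open>The symmetric second difference equates the two mixed derivatives at points p and q
  within 2h of x; continuity brings both points to x as h tends to 0.\<close>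

lemma partial_deriv_commute:
  fixes g :: "real^'d::finite \<Rightarrow> real"
  assumes g: "g differentiable_on UNIV" "\<And>i. partial_deriv i g differentiable_on UNIV"
    and cont: "\<And>i j. continuous_on UNIV (partial_deriv i (partial_deriv j g))"
  shows "partial_deriv i (partial_deriv j g) = partial_deriv j (partial_deriv i g)"
proof
  fix x :: "real^'d"
  define h where "h n = inverse (real (Suc n))" for n
  have h: "0 < h n" for n by (simp add: h_def)
  have "\<exists>p q. norm (p - x) \<le> 2 * h n \<and> norm (q - x) \<le> 2 * h n \<and>
    partial_deriv i (partial_deriv j g) p = partial_deriv j (partial_deriv i g) q" for n
  proof -
    obtain p where p: "norm (p - x) \<le> 2 * h n" "g (x + h n *\<^sub>R axis j 1 + h n *\<^sub>R axis i 1) - g (x + h n *\<^sub>R axis j 1) - g (x + h n *\<^sub>R axis i 1) + g x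
      = (h n)^2 * partial_deriv i (partial_deriv j g) p"
      using second_difference[OF g(1) g(2) h] by blast
    obtain q where q: "norm (q - x) \<le> 2 * h n" "g (x + h n *\<^sub>R axis i 1 + h n *\<^sub>R axis j 1) - g (x + h n *\<^sub>R axis i 1) - g (x + h n *\<^sub>R axis j 1) + g x
      = (h n)^2 * partial_deriv j (partial_deriv i g) q"
      using second_difference[OF g(1) g(2) h] by blast
    have "(h n)^2 * partial_deriv i (partial_deriv j g) p = (h n)^2 * partial_deriv j (partial_deriv i g) q"
      using p(2) q(2) by (simp add: algebra_simps)
    then show ?thesis using p(1) q(1) h[of n] by auto
  qed
  then obtain p q where p: "\<And>n. norm (p n - x) \<le> 2 * h n" and q: "\<And>n. norm (q n - x) \<le> 2 * h n"
    and pq: "\<And>n. partial_deriv i (partial_deriv j g) (p n) = partial_deriv j (partial_deriv i g) (q n)"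
    by metis
  have "(\<lambda>n. 2 * h n) \<longlonglongrightarrow> 2 * 0"
    unfolding h_def by (intro tendsto_intros LIMSEQ_inverse_real_of_nat)
  then have lim: "(\<lambda>n. 2 * h n) \<longlonglongrightarrow> 0" by simp
  have "p \<longlonglongrightarrow> x" "q \<longlonglongrightarrow> x"
    using p q by (auto intro!: LIM_zero_cancel[OF Lim_null_comparison[OF _ lim]])
  moreover have "isCont (partial_deriv i (partial_deriv j g)) x" "isCont (partial_deriv j (partial_deriv i g)) x"
    using cont by (auto simp: continuous_on_eq_continuous_at)
  ultimately have "(\<lambda>n. partial_deriv i (partial_deriv j g) (p n)) \<longlonglongrightarrow> partial_deriv i (partial_deriv j g) x"
    "(\<lambda>n. partial_deriv j (partial_deriv i g) (q n)) \<longlonglongrightarrow> partial_deriv j (partial_deriv i g) x"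
    by (auto intro: isCont_tendsto_compose)
  then show "partial_deriv i (partial_deriv j g) x = partial_deriv j (partial_deriv i g) x"
    unfolding pq by (rule LIMSEQ_unique)
qed

lemma C_diff_SucD: "C_diff (Suc m) g \<Longrightarrow> C_diff m g"
  by (induction m arbitrary: g) (auto intro: differentiable_imp_continuous_on)

lemma C_diff_partial_derivs: "C_diff (length is + k) g \<Longrightarrow> C_diff k (partial_derivs is g)"
proof (induction "is" arbitrary: k)
  case (Cons i "is")
  from Cons.IH[of "Suc k"] Cons.prems show ?case by simp
qed simp

text \<open>The derivative in direction i passes those in \<open>us\<close> one at a time; the order
  of smoothness assumed leaves two derivatives for each exchange.\<close>

lemma partial_derivs_move_front:
  assumes "C_diff (Suc (length us + length vs)) g"
  shows "partial_derivs (us @ i # vs) g = partial_derivs (i # us @ vs) g"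
  using assms
proof (induction us)
  case (Cons u us)
  have IH: "partial_derivs (us @ i # vs) g = partial_deriv i (partial_derivs (us @ vs) g)"
    using Cons.IH C_diff_SucD[OF Cons.prems[simplified list.size add_Suc]] by simp
  have "C_diff (Suc (Suc 0)) (partial_derivs (us @ vs) g)"
    using Cons.prems by (intro C_diff_partial_derivs) simp
  then have "partial_deriv u (partial_deriv i (partial_derivs (us @ vs) g))
      = partial_deriv i (partial_deriv u (partial_derivs (us @ vs) g))"
    by (intro partial_deriv_commute) auto
  then show ?case by (simp add: IH)
qed simp

lemma partial_derivs_cong_mset:
  "mset is = mset js \<Longrightarrow> C_diff (length is) g \<Longrightarrow> partial_derivs is g = partial_derivs js g"
proof (induction "is" arbitrary: js)
  case (Cons i "is")
  have "i \<in> set js"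
    using Cons.prems(1) by (metis list.set_intros(1) mset_eq_setD)
  then obtain us vs where js: "js = us @ i # vs"
    by (meson split_list)
  have len: "length is = length us + length vs"
    using mset_eq_length[OF Cons.prems(1)] js by simp
  have "partial_derivs is g = partial_derivs (us @ vs) g"
    using Cons.prems js C_diff_SucD[of "length is" g] by (intro Cons.IH) auto
  then show ?case
    using partial_derivs_move_front[of us vs g i] Cons.prems(2) len js by simp
qed simp

text \<open>The enumeration picked by \<open>SOME\<close> is unknown, but it has the same multiset
  of entries as the given list, and only the multiset matters.\<close>

lemma multi_deriv_count_list:
  fixes "is" :: "'d::finite list"
  assumes "C_diff (length is) g"
  shows "multi_deriv (count_list is) g = partial_derivs is g"
proof -
  define js where "js = (SOME js. \<forall>i. count_list js i = count_list is i)"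
  have "\<forall>i. count_list js i = count_list is i"
    unfolding js_def by (rule someI[where x = "is"]) simp
  then have "mset is = mset js"
    by (intro multiset_eqI) (simp add: count_mset)
  then show ?thesis
    using partial_derivs_cong_mset[OF _ assms] by (simp add: multi_deriv_def js_def)
qed

lemma finite_multi_indices: "finite {\<alpha> :: 'd::finite \<Rightarrow> nat. (\<Sum>i\<in>UNIV. \<alpha> i) \<le> m}"
proof (rule finite_subset)
  show "{\<alpha> :: 'd \<Rightarrow> nat. (\<Sum>i\<in>UNIV. \<alpha> i) \<le> m} \<subseteq> UNIV \<rightarrow>\<^sub>E {..m}"
  proof
    fix \<alpha> :: "'d \<Rightarrow> nat" assume "\<alpha> \<in> {\<alpha>. (\<Sum>i\<in>UNIV. \<alpha> i) \<le> m}"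
    moreover have "\<alpha> i \<le> (\<Sum>i\<in>UNIV. \<alpha> i)" for i by (rule member_le_sum) auto
    ultimately show "\<alpha> \<in> UNIV \<rightarrow>\<^sub>E {..m}" by (auto intro: order_trans)
  qed
  show "finite (UNIV \<rightarrow>\<^sub>E {..m} :: ('d \<Rightarrow> nat) set)" by (intro finite_PiE) auto
qed

text \<open>Up to the order of differentiation, every iterated derivative of order at most
  \<open>m\<close> is a summand of \<open>C_norm\<close>, and all summands are nonnegative.\<close>

lemma abs_partial_derivs_le_C_norm:
  fixes g :: "real^'d::finite \<Rightarrow> real"
  assumes g: "C_diff m g" and N: "C_norm m g \<le> ennreal K" and K: "0 \<le> K" and len: "length is \<le> m"
  shows "\<bar>partial_derivs is g x\<bar> \<le> K"
proof -
  have cd: "C_diff (length is) g"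
    using len g by (induction rule: inc_induct) (auto simp del: C_diff.simps dest: C_diff_SucD)
  have "ennreal \<bar>partial_derivs is g x\<bar> \<le> sup_norm (multi_deriv (count_list is) g)"
    unfolding multi_deriv_count_list[OF cd] sup_norm_def by (intro SUP_upper) simp
  also have "\<dots> \<le> C_norm m g"
    unfolding C_norm_def
  proof (rule member_le_sum)
    have "(\<Sum>i\<in>UNIV. count_list is i) = length is"
      using sum_count_set[of "is" UNIV] by simp
    with len show "count_list is \<in> {\<alpha>. (\<Sum>i\<in>UNIV. \<alpha> i) \<le> m}" by simp
  qed (auto simp: finite_multi_indices)
  finally have "ennreal \<bar>partial_derivs is g x\<bar> \<le> ennreal K" using N by (rule order_trans)
  then show ?thesis using K by simp
qed

lemma partial_derivs_snoc: "partial_derivs (is @ [i]) g = partial_derivs is (partial_deriv i g)"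
  by (induction "is") auto

text \<open>C^{m+1} with bounded derivatives embeds into C^{m,1}: the derivatives of order m+1 serve
  as Lipschitz constants for those of order m.\<close>

lemma Clip_if_partial_derivs_bounded:
  fixes g :: "real^'d::finite \<Rightarrow> real"
  assumes "C_diff (Suc m) g" "\<And>is x. length is \<le> Suc m \<Longrightarrow> \<bar>partial_derivs is g x\<bar> \<le> K"
  shows "Clip m K g"
  using assms
proof (induction m arbitrary: g)
  case 0
  have "\<bar>partial_deriv i g x\<bar> \<le> K" for i x using 0(2)[of "[i]"] by simp
  with 0(1) have "\<bar>g x - g y\<bar> \<le> K * CARD('d) * norm (x - y)" for x y
    by (intro bounded_partials_imp_lipschitz) auto
  then show ?case using 0(2)[of "[]"] by simp
next
  case (Suc m)
  \<comment> \<open>\<open>partial_derivs\<close> applies the last entry of its list first, so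
    differentiating g beforehand appends an index.\<close>
  have "Clip m K (partial_deriv i g)" for i
    using Suc(2) Suc(3)[of "_ @ [i]"] by (intro Suc.IH) (auto simp: partial_derivs_snoc)
  then show ?case using Suc(2) Suc(3)[of "[]"] by simp
qed

lemma Clip_if_C_norm_le:
  assumes "C_diff (Suc m) g" "C_norm (Suc m) g \<le> ennreal K" "0 \<le> K"
  shows "Clip m K g"
  using assms by (intro Clip_if_partial_derivs_bounded abs_partial_derivs_le_C_norm)

lemma Clip_if_C_b:
  assumes "g \<in> C_b (Suc m)"
  shows "Clip m (enn2real (C_norm (Suc m) g)) g"
  using assms by (intro Clip_if_C_norm_le) (auto simp: C_b_def)

lemma Clip_partial_commute:
  fixes g :: "real^'d::finite \<Rightarrow> real"
  assumes "Clip (Suc (Suc m)) K g"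
  shows "partial_deriv i (partial_deriv j g) = partial_deriv j (partial_deriv i g)"
  using assms by (intro partial_deriv_commute) (auto intro: Clip_continuous)

section \<open>Square roots of positive semi-definite matrices\<close>

lemma symmetric_matrix_inner:
  fixes A :: "real^'d^'d::finite"
  assumes "transpose A = A" shows "(A *v x) \<bullet> y = x \<bullet> (A *v y)"
  by (metis assms dot_lmul_matrix transpose_matrix_vector)

text \<open>Rayleigh's principle. Let w be the part of \<open>A *v v\<close> orthogonal to v. If w
  were nonzero, moving v towards w would raise the quadratic form to first order, while the change
  of the norm is of second order only.\<close>

lemma max_quadratic_form_eigenvector:
  fixes A :: "real^'d^'d::finite"
  assumes sym: "transpose A = A" and S: "subspace S" "\<And>x. x \<in> S \<Longrightarrow> A *v x \<in> S"
    and v: "v \<in> S" "norm v = 1" and max: "\<And>x. x \<in> S \<Longrightarrow> norm x = 1 \<Longrightarrow> x \<bullet> (A *v x) \<le> v \<bullet> (A *v v)"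
  shows "A *v v = (v \<bullet> (A *v v)) *\<^sub>R v"
proof -
  define l where "l = v \<bullet> (A *v v)"
  define w where "w = A *v v - l *\<^sub>R v"
  \<comment> \<open>By homogeneity, maximality on the unit sphere of S becomes an inequality on all
    of S.\<close>
  have q: "x \<bullet> (A *v x) \<le> l * (x \<bullet> x)" if "x \<in> S" for x
  proof (cases "x = 0")
    case False
    have "(x /\<^sub>R norm x) \<bullet> (A *v (x /\<^sub>R norm x)) \<le> l"
      unfolding l_def using False that S(1) by (intro max) (auto intro: subspace_scale)
    then show ?thesis using False
      by (simp add: matrix_vector_mult_scaleR field_simps power2_norm_eq_inner[symmetric] power2_eq_square)
  qed simp
  have wS: "w \<in> S" unfolding w_def using S v by (intro subspace_diff subspace_scale) auto
  have vv: "v \<bullet> v = 1" using v(2) by (simp add: power2_norm_eq_inner[symmetric])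
  have vw: "v \<bullet> w = 0" by (simp add: w_def inner_diff_right vv l_def)
  have wv: "w \<bullet> v = 0" using vw by (simp add: inner_commute)
  have wAv: "w \<bullet> (A *v v) = w \<bullet> w"
    using wv by (simp add: w_def inner_diff_right)
  have vAw: "v \<bullet> (A *v w) = w \<bullet> w"
    using symmetric_matrix_inner[OF sym, of v w] wAv by (simp add: inner_commute)
  have key: "2 * t * (w \<bullet> w) \<le> t^2 * (l * (w \<bullet> w) - w \<bullet> (A *v w))" for t
  proof -
    have "v + t *\<^sub>R w \<in> S" using v wS S(1) by (intro subspace_add subspace_scale)
    from q[OF this] show ?thesis
      by (simp add: matrix_vector_right_distrib matrix_vector_mult_scaleR inner_add_left inner_add_right
          vv vw wv wAv vAw l_def[symmetric] power2_eq_square algebra_simps)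
  qed
  have "w \<bullet> w \<le> 0"
  proof (rule ccontr)
    assume "\<not> w \<bullet> w \<le> 0"
    define c where "c = \<bar>l * (w \<bullet> w) - w \<bullet> (A *v w)\<bar> + 1"
    have c: "0 < c" by (simp add: c_def)
    \<comment> \<open>For this t the upper bound t^2 c equals t times the squared norm of w, which
      is half of the left-hand side of \<open>key\<close>.\<close>
    define t where "t = (w \<bullet> w) / c"
    have t: "0 < t" using c \<open>\<not> w \<bullet> w \<le> 0\<close> unfolding t_def by (intro divide_pos_pos) auto
    have "2 * t * (w \<bullet> w) \<le> t^2 * c"
      by (rule order_trans[OF key]) (auto simp: c_def intro!: mult_left_mono)
    also have "t^2 * c = t * (w \<bullet> w)" using c by (simp add: t_def power2_eq_square)
    finally show False using t \<open>\<not> w \<bullet> w \<le> 0\<close> by simp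
  qed
  then have "w = 0" by (metis inner_ge_zero inner_eq_zero_iff order_antisym)
  then show ?thesis by (simp add: w_def l_def)
qed

lemma exists_max_quadratic_form:
  fixes A :: "real^'d^'d::finite"
  assumes "subspace S" "S \<noteq> {0}"
  obtains v where "v \<in> S" "norm v = 1" "\<And>x. x \<in> S \<Longrightarrow> norm x = 1 \<Longrightarrow> x \<bullet> (A *v x) \<le> v \<bullet> (A *v v)"
proof -
  obtain x where x: "x \<in> S" "x \<noteq> 0" using assms subspace_0 by blast
  have "x /\<^sub>R norm x \<in> S \<inter> sphere 0 1" using x assms by (auto intro: subspace_scale)
  then have "S \<inter> sphere 0 1 \<noteq> {}" by blast
  moreover have "compact (S \<inter> sphere 0 1)"
    using closed_subspace[OF assms(1)] by (simp add: closed_Int_compact)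
  moreover have "continuous_on (S \<inter> sphere 0 1) (\<lambda>x. x \<bullet> (A *v x))"
    by (intro continuous_intros)
  ultimately obtain v where "v \<in> S \<inter> sphere 0 1" "\<forall>x\<in>S \<inter> sphere 0 1. x \<bullet> (A *v x) \<le> v \<bullet> (A *v v)"
    using continuous_attains_sup[of "S \<inter> sphere 0 1" "\<lambda>x. x \<bullet> (A *v x)"] by metis
  then show thesis by (intro that[of v]) auto
qed

text \<open>Induction on the dimension: a maximiser v of the quadratic form on S is an eigenvector,
  and by symmetry of A its orthogonal complement in S is again invariant.\<close>

lemma symmetric_matrix_eigenbasis:
  fixes A :: "real^'d^'d::finite"
  assumes sym: "transpose A = A"
  shows "subspace S \<Longrightarrow> (\<And>x. x \<in> S \<Longrightarrow> A *v x \<in> S) \<Longrightarrow>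
    \<exists>B. finite B \<and> pairwise orthogonal B \<and> span B = S \<and> (\<forall>b\<in>B. norm b = 1 \<and> A *v b = (b \<bullet> (A *v b)) *\<^sub>R b)"
proof (induction "dim S" arbitrary: S rule: less_induct)
  case less
  show ?case
  proof (cases "S = {0}")
    case True then show ?thesis by (intro exI[of _ "{}"]) auto
  next
    case False
    obtain v where v: "v \<in> S" "norm v = 1" "\<And>x. x \<in> S \<Longrightarrow> norm x = 1 \<Longrightarrow> x \<bullet> (A *v x) \<le> v \<bullet> (A *v v)"
      using exists_max_quadratic_form[OF less.prems(1) False] by blast
    have ev: "A *v v = (v \<bullet> (A *v v)) *\<^sub>R v"
      by (rule max_quadratic_form_eigenvector[OF sym less.prems v])
    have vv: "v \<bullet> v = 1" using v(2) by (simp add: power2_norm_eq_inner[symmetric])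
    define S' where "S' = S \<inter> {x. v \<bullet> x = 0}"
    have sub: "subspace S'" unfolding S'_def
      by (intro subspace_inter less.prems subspace_hyperplane)
    have inv: "A *v x \<in> S'" if "x \<in> S'" for x
    proof -
      have "v \<bullet> (A *v x) = (A *v v) \<bullet> x" using symmetric_matrix_inner[OF sym] by metis
      also have "\<dots> = 0" using that ev by (metis (mono_tags) IntD2 S'_def inner_scaleR_left mem_Collect_eq mult_zero_right)
      finally show ?thesis using that less.prems by (auto simp: S'_def)
    qed
    have "v \<notin> S'" using vv by (simp add: S'_def)
    moreover have "S' \<subseteq> S" by (simp add: S'_def)
    ultimately have "S' \<subset> S" using v(1) by blast
    then have "dim S' < dim S"
      using sub less.prems(1) by (metis dim_psubset span_eq_iff)
    from less.hyps[OF this sub inv] obtain B where B: "finite B" "pairwise orthogonal B" "span B = S'"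
      "\<forall>b\<in>B. norm b = 1 \<and> A *v b = (b \<bullet> (A *v b)) *\<^sub>R b" by blast
    have BS: "b \<in> S'" if "b \<in> B" for b using that B(3) span_superset by blast
    have "span (insert v B) = S"
    proof
      show "span (insert v B) \<subseteq> S"
        using v(1) BS less.prems(1) by (intro span_minimal) (auto simp: S'_def)
      show "S \<subseteq> span (insert v B)"
      proof
        fix x assume x: "x \<in> S"
        have "x - (v \<bullet> x) *\<^sub>R v \<in> S'"
          using x v(1) less.prems(1) vv by (auto simp: S'_def inner_diff_right intro!: subspace_diff subspace_scale)
        then show "x \<in> span (insert v B)"
          unfolding span_insert B(3) by blast
      qed
    qed
    moreover have "pairwise orthogonal (insert v B)"
      using B(2) BS by (auto simp: pairwise_insert orthogonal_def S'_def inner_commute)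
    ultimately show ?thesis using B v(2) ev by (intro exI[of _ "insert v B"]) auto
  qed
qed

lemma orthonormal_expansion:
  fixes B :: "(real^'d::finite) set"
  assumes "finite B" "pairwise orthogonal B" "span B = UNIV" "\<And>b. b \<in> B \<Longrightarrow> norm b = 1"
  shows "x = (\<Sum>b\<in>B. (b \<bullet> x) *\<^sub>R b)"
proof -
  have "x \<in> span B" using assms(3) by simp
  then obtain r where r: "x = (\<Sum>b\<in>B. r b *\<^sub>R b)"
    unfolding span_finite[OF assms(1)] by auto
  have "b \<bullet> x = r b" if "b \<in> B" for b
  proof -
    have "b \<bullet> x = (\<Sum>c\<in>B. if c = b then r b else 0)"
      unfolding r inner_sum_right
    proof (intro sum.cong refl)
      fix c assume "c \<in> B"
      then show "b \<bullet> (r c *\<^sub>R c) = (if c = b then r b else 0)"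
        using assms(2,4) that
        by (auto simp: pairwise_def orthogonal_def power2_norm_eq_inner[symmetric])
    qed
    then show ?thesis using that assms(1) by simp
  qed
  then show ?thesis using r by simp
qed

lemma pos_semidef_sqrt_exists:
  fixes A :: "real^'d^'d::finite"
  assumes "pos_semidef A"
  shows "\<exists>R. pos_semidef R \<and> R ** R = A"
proof -
  have sym: "transpose A = A" and pos: "\<And>v. 0 \<le> v \<bullet> (A *v v)"
    using assms by (auto simp: pos_semidef_def)
  obtain B where B: "finite B" "pairwise orthogonal B" "span B = UNIV"
    "\<And>b. b \<in> B \<Longrightarrow> norm b = 1" "\<And>b. b \<in> B \<Longrightarrow> A *v b = (b \<bullet> (A *v b)) *\<^sub>R b"
    using symmetric_matrix_eigenbasis[OF sym subspace_UNIV] by auto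
  define r where "r b = sqrt (b \<bullet> (A *v b))" for b
  have r: "0 \<le> r b" "r b * r b = b \<bullet> (A *v b)" for b using pos by (auto simp: r_def)
  \<comment> \<open>The sum of sqrt(\<lambda>_b) b b^T over an orthonormal eigenbasis, \<lambda>_b
    being the eigenvalue of b.\<close>
  define T where "T x = (\<Sum>b\<in>B. (r b * (b \<bullet> x)) *\<^sub>R b)" for x
  have lin: "linear T"
    unfolding T_def by (intro linearI)
      (simp_all add: inner_add_right distrib_left scaleR_left_distrib sum.distrib scaleR_sum_right mult_ac)
  define R where "R = matrix T"
  have R: "R *v x = T x" for x unfolding R_def using lin by (simp add: matrix_works)
  have inner: "x \<bullet> T y = (\<Sum>b\<in>B. r b * (b \<bullet> x) * (b \<bullet> y))" for x y
    by (simp add: T_def inner_sum_right mult_ac inner_commute)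
  have "transpose R = R"
  proof -
    have "(transpose R *v x) \<bullet> y = (R *v x) \<bullet> y" for x y
      using inner[of x y] inner[of y x]
      by (simp add: transpose_matrix_vector dot_lmul_matrix)
         (simp add: R inner_commute mult_ac)
    then have "transpose R *v x = R *v x" for x by (metis vector_eq_rdot)
    then show ?thesis by (simp add: matrix_eq)
  qed
  moreover have "0 \<le> v \<bullet> (R *v v)" for v
    unfolding R inner using r(1) by (intro sum_nonneg) (simp add: mult.assoc)
  moreover have "R ** R = A"
  proof -
    have "(R ** R) *v x = A *v x" for x
    proof -
      have bT: "b \<bullet> T x = r b * (b \<bullet> x)" if "b \<in> B" for b
      proof -
        have "b \<bullet> T x = (\<Sum>c\<in>B. if c = b then r b * (b \<bullet> x) else 0)"
          unfolding inner
        proof (intro sum.cong refl)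
          fix c assume "c \<in> B"
          then show "r c * (c \<bullet> b) * (c \<bullet> x) = (if c = b then r b * (b \<bullet> x) else 0)"
            using B(2,4) that by (auto simp: pairwise_def orthogonal_def power2_norm_eq_inner[symmetric])
        qed
        then show ?thesis using that B(1) by simp
      qed
      have "(R ** R) *v x = T (T x)" by (simp add: matrix_vector_mul_assoc[symmetric] R)
      also have "\<dots> = (\<Sum>b\<in>B. (b \<bullet> x) *\<^sub>R (A *v b))"
        unfolding T_def[of "T x"]
      proof (intro sum.cong refl)
        fix b assume b: "b \<in> B"
        have "r b * (b \<bullet> T x) = (b \<bullet> x) * (b \<bullet> (A *v b))"
          using bT[OF b] r(2)[of b] by (metis mult.assoc mult.commute)
        then have "(r b * (b \<bullet> T x)) *\<^sub>R b = (b \<bullet> x) *\<^sub>R ((b \<bullet> (A *v b)) *\<^sub>R b)" by simp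
        then show "(r b * (b \<bullet> T x)) *\<^sub>R b = (b \<bullet> x) *\<^sub>R (A *v b)" using B(5)[OF b] by simp
      qed
      also have "\<dots> = A *v (\<Sum>b\<in>B. (b \<bullet> x) *\<^sub>R b)"
        by (simp add: linear_sum[OF matrix_vector_mul_linear] matrix_vector_mult_scaleR)
      finally show ?thesis using orthonormal_expansion[OF B(1-4), of x] by simp
    qed
    then show ?thesis by (simp add: matrix_eq)
  qed
  ultimately show ?thesis by (auto simp: pos_semidef_def)
qed

section \<open>Hoelder continuity of the matrix root\<close>

text \<open>The norm of a matrix as a nested vector is the Frobenius norm, which dominates the
  operator norm by Cauchy-Schwarz in each row.\<close>

lemma norm_matrix_vector_mult_le:
  fixes A :: "real^'n::finite^'m::finite"
  shows "norm (A *v x) \<le> norm A * norm x"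
proof -
  have "(norm (A *v x))^2 = (\<Sum>i\<in>UNIV. (A $ i \<bullet> x)^2)"
    by (simp add: norm_vec_def L2_set_def sum_nonneg matrix_vector_mul_component)
  also have "\<dots> \<le> (\<Sum>i\<in>UNIV. (norm (A $ i))^2 * (norm x)^2)"
    by (intro sum_mono) (metis Cauchy_Schwarz_ineq power2_norm_eq_inner)
  also have "\<dots> = (norm A * norm x)^2"
    by (simp add: sum_distrib_right[symmetric] power_mult_distrib norm_vec_def L2_set_def sum_nonneg)
  finally show ?thesis by (rule power2_le_imp_le) simp
qed

lemma norm_matrix_le_sum_abs:
  fixes A :: "real^'n::finite^'m::finite"
  shows "norm A \<le> (\<Sum>i\<in>UNIV. \<Sum>j\<in>UNIV. \<bar>A $ i $ j\<bar>)"
proof -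
  have "norm A \<le> (\<Sum>i\<in>UNIV. norm (A $ i))"
    by (simp add: norm_vec_def L2_set_le_sum)
  also have "\<dots> \<le> (\<Sum>i\<in>UNIV. \<Sum>j\<in>UNIV. \<bar>A $ i $ j\<bar>)"
    by (intro sum_mono norm_le_l1_cart)
  finally show ?thesis .
qed

text \<open>If \<open>\<lambda> > 0\<close> is the largest eigenvalue of \<open>P - Q\<close>, with unit eigenvector \<open>v\<close>, then
  \<open>v \<bullet> (P\<^sup>2 - Q\<^sup>2) v = \<lambda> (v \<bullet> P v + v \<bullet> Q v) \<ge> \<lambda>\<^sup>2\<close>.\<close>
lemma psd_diff_quadratic_form_le:
  fixes P Q :: "real^'d^'d::finite"
  assumes P: "pos_semidef P" and Q: "pos_semidef Q"
  shows "x \<bullet> ((P - Q) *v x) \<le> sqrt (norm (P ** P - Q ** Q)) * (x \<bullet> x)"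
proof -
  let ?D = "P - Q"
  have sym: "transpose P = P" "transpose Q = Q" and pos: "\<And>v. 0 \<le> v \<bullet> (P *v v)" "\<And>v. 0 \<le> v \<bullet> (Q *v v)"
    using P Q by (auto simp: pos_semidef_def)
  have symD: "transpose ?D = ?D" using sym by (simp add: transpose_def vec_eq_iff)
  have "axis (undefined :: 'd) 1 \<noteq> (0 :: real^'d)" by (simp add: axis_eq_0_iff)
  then have "(UNIV :: (real^'d) set) \<noteq> {0}" by blast
  from exists_max_quadratic_form[OF subspace_UNIV this, of ?D]
  obtain v :: "real^'d" where v: "norm v = 1" "\<And>x. norm x = 1 \<Longrightarrow> x \<bullet> (?D *v x) \<le> v \<bullet> (?D *v v)"
    by (metis UNIV_I)
  define l where "l = v \<bullet> (?D *v v)"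
  have ev: "?D *v v = l *\<^sub>R v"
    unfolding l_def by (rule max_quadratic_form_eigenvector[OF symD subspace_UNIV]) (use v in auto)
  have "l \<le> sqrt (norm (P ** P - Q ** Q))"
  proof (cases "l \<le> 0")
    case False
    have "l^2 \<le> l * (v \<bullet> (P *v v) + v \<bullet> (Q *v v))"
      unfolding power2_eq_square using False pos[of v]
      by (intro mult_left_mono) (auto simp: l_def matrix_vector_mult_diff_rdistrib inner_diff_right)
    also have "\<dots> = (?D *v v) \<bullet> (P *v v + Q *v v)"
      by (simp add: ev inner_add_right distrib_left)
    also have "\<dots> = (P *v v) \<bullet> (P *v v) - (Q *v v) \<bullet> (Q *v v)"
      by (simp add: matrix_vector_mult_diff_rdistrib inner_diff_left inner_diff_right inner_add_right inner_commute)
    also have "\<dots> = v \<bullet> ((P ** P - Q ** Q) *v v)"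
      by (simp add: symmetric_matrix_inner[OF sym(1)] symmetric_matrix_inner[OF sym(2)]
          matrix_vector_mult_diff_rdistrib inner_diff_right matrix_vector_mul_assoc)
    also have "\<dots> \<le> norm v * norm ((P ** P - Q ** Q) *v v)" by (rule norm_cauchy_schwarz)
    also have "\<dots> \<le> norm (P ** P - Q ** Q)"
      using norm_matrix_vector_mult_le[of "P ** P - Q ** Q" v] v(1) by simp
    finally show ?thesis by (rule real_le_rsqrt)
  qed (auto intro: order_trans)
  moreover have "x \<bullet> (?D *v x) \<le> l * (x \<bullet> x)"
  proof (cases "x = 0")
    case False
    have "(x /\<^sub>R norm x) \<bullet> (?D *v (x /\<^sub>R norm x)) \<le> l"
      unfolding l_def using False by (intro v(2)) auto
    then show ?thesis using False
      by (simp add: matrix_vector_mult_scaleR field_simps power2_norm_eq_inner[symmetric] power2_eq_square)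
  qed simp
  ultimately show ?thesis
    by (meson inner_ge_zero mult_right_mono order_trans)
qed

text \<open>The one-sided estimate for P - Q and for Q - P bounds the absolute quadratic form of the
  symmetric difference. Polarisation with a \<plusminus> b for unit coordinate vectors a, b then
  bounds each entry, as the squared norms of a + b and a - b add up to 4.\<close>

lemma norm_psd_diff_le:
  fixes P Q :: "real^'d^'d::finite"
  assumes P: "pos_semidef P" and Q: "pos_semidef Q"
  shows "norm (P - Q) \<le> 2 * CARD('d)^2 * sqrt (norm (P ** P - Q ** Q))"
proof -
  let ?D = "P - Q"
  define s where "s = sqrt (norm (P ** P - Q ** Q))"
  have symD: "transpose ?D = ?D" using P Q by (simp add: transpose_def vec_eq_iff pos_semidef_def)
  have q: "\<bar>x \<bullet> (?D *v x)\<bar> \<le> s * (x \<bullet> x)" for x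
    using psd_diff_quadratic_form_le[OF P Q, of x] psd_diff_quadratic_form_le[OF Q P, of x]
    by (simp add: s_def norm_minus_commute matrix_vector_mult_diff_rdistrib inner_diff_right abs_le_iff)
  have aux: "\<bar>(X - Y) / 4\<bar> \<le> (a + b) / 4" if "\<bar>X\<bar> \<le> a" "\<bar>Y\<bar> \<le> b" for X Y a b :: real
    using that by (auto simp: abs_le_iff field_simps)
  have "\<bar>?D $ i $ j\<bar> \<le> 2 * s" for i j
  proof -
    define a b :: "real^'d" where "a = axis i 1" and "b = axis j 1"
    have ab: "a \<bullet> a = 1" "b \<bullet> b = 1" by (simp_all add: a_def b_def inner_axis_axis)
    have "?D $ i $ j = a \<bullet> (?D *v b)"
      by (simp add: a_def b_def matrix_vector_mul_component inner_axis' inner_axis)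
    also have "\<dots> = ((a + b) \<bullet> (?D *v (a + b)) - (a - b) \<bullet> (?D *v (a - b))) / 4"
      using symmetric_matrix_inner[OF symD, of a b]
      by (simp add: matrix_vector_right_distrib matrix_vector_mult_diff_distrib inner_add_left inner_add_right
          inner_diff_left inner_diff_right inner_commute)
    finally have "\<bar>?D $ i $ j\<bar> \<le> (s * ((a + b) \<bullet> (a + b)) + s * ((a - b) \<bullet> (a - b))) / 4"
      by (simp only:) (rule aux[OF q q])
    also have "\<dots> = s"
      by (simp add: ab inner_add_left inner_add_right inner_diff_left inner_diff_right inner_commute algebra_simps)
    finally show ?thesis by (simp add: s_def)
  qed
  then have "(\<Sum>i\<in>UNIV. \<Sum>j\<in>UNIV. \<bar>?D $ i $ j\<bar>) \<le> (\<Sum>i\<in>(UNIV::'d set). \<Sum>j\<in>(UNIV::'d set). 2 * s)"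
    by (intro sum_mono)
  with norm_matrix_le_sum_abs[of ?D] show ?thesis
    by (simp add: s_def power2_eq_square mult_ac)
qed

text \<open>Existence comes from the spectral theorem; uniqueness is the Hoelder estimate for two
  roots with equal squares.\<close>

lemma psd_sqrt:
  fixes A :: "real^'d^'d::finite"
  assumes "pos_semidef A"
  shows pos_semidef_psd_sqrt: "pos_semidef (psd_sqrt A)"
    and psd_sqrt_square: "psd_sqrt A ** psd_sqrt A = A"
proof -
  have "\<exists>!R. pos_semidef R \<and> R ** R = A"
  proof (rule ex_ex1I)
    show "\<exists>R. pos_semidef R \<and> R ** R = A" using assms by (rule pos_semidef_sqrt_exists)
    fix P Q assume "pos_semidef P \<and> P ** P = A" "pos_semidef Q \<and> Q ** Q = A"
    then show "P = Q" using norm_psd_diff_le[of P Q] by simp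
  qed
  from theI'[OF this] show "pos_semidef (psd_sqrt A)" "psd_sqrt A ** psd_sqrt A = A"
    by (auto simp: psd_sqrt_def)
qed

lemma norm_psd_sqrt_diff_le:
  fixes A B :: "real^'d^'d::finite"
  assumes "pos_semidef A" "pos_semidef B"
  shows "norm (psd_sqrt A - psd_sqrt B) \<le> 2 * CARD('d)^2 * sqrt (norm (A - B))"
  using norm_psd_diff_le[OF assms[THEN pos_semidef_psd_sqrt]] assms by (simp add: psd_sqrt_square)

text \<open>By symmetry of the root its square is also R R^T. This product is what the covariance of
  a frozen Ito increment contains, so the generator depends on A and inherits none of the roughness
  of the root.\<close>

lemma psd_sqrt_row_sum:
  fixes A :: "real^'d^'d::finite"
  assumes "pos_semidef A"
  shows "(\<Sum>k\<in>UNIV. psd_sqrt A $ i $ k * psd_sqrt A $ j $ k) = A $ i $ j"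
proof -
  let ?R = "psd_sqrt A"
  have "transpose ?R = ?R" using pos_semidef_psd_sqrt[OF assms] by (simp add: pos_semidef_def)
  then have "?R $ j $ k = ?R $ k $ j" for k by (simp add: transpose_def vec_eq_iff)
  then have "(\<Sum>k\<in>UNIV. ?R $ i $ k * ?R $ j $ k) = (?R ** ?R) $ i $ j"
    by (simp add: matrix_matrix_mult_def)
  then show ?thesis using psd_sqrt_square[OF assms] by simp
qed

text \<open>The squared Frobenius norm of the root is the trace of A, so bounds for the entries of A
  control the root.\<close>

lemma norm_psd_sqrt:
  fixes A :: "real^'d^'d::finite"
  assumes "pos_semidef A"
  shows "(norm (psd_sqrt A))^2 = (\<Sum>i\<in>UNIV. A $ i $ i)"
  using psd_sqrt_row_sum[OF assms] by (simp add: power2_norm_eq_inner inner_vec_def)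

lemma pos_semidef_scaleR:
  fixes A :: "real^'d^'d::finite"
  assumes "pos_semidef A" "0 \<le> c"
  shows "pos_semidef (c *\<^sub>R A)"
proof -
  have "transpose (c *\<^sub>R A) = c *\<^sub>R transpose A" by (simp add: transpose_def vec_eq_iff)
  moreover have "(c *\<^sub>R A) *v v = c *\<^sub>R (A *v v)" for v
    by (rule scaleR_matrix_vector_assoc[symmetric])
  ultimately show ?thesis using assms by (simp add: pos_semidef_def)
qed

text \<open>The quadratic form at v is the second moment of the centred variable v \<bullet> Y;
  boundedness of Y provides integrability.\<close>

lemma pos_semidef_covariance_matrix:
  fixes Y :: "'e \<Rightarrow> real^'d::finite"
  assumes "prob_space \<nu>" and meas: "\<And>i. (\<lambda>\<xi>. Y \<xi> $ i) \<in> borel_measurable \<nu>"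
    and bnd: "\<And>i \<xi>. \<xi> \<in> space \<nu> \<Longrightarrow> \<bar>Y \<xi> $ i\<bar> \<le> B"
  shows "pos_semidef (covariance_matrix \<nu> Y)"
proof -
  interpret prob_space \<nu> by fact
  define Z where "Z \<xi> i = Y \<xi> $ i - (\<integral>\<zeta>. Y \<zeta> $ i \<partial>\<nu>)" for \<xi> i
  have [measurable]: "(\<lambda>\<xi>. Z \<xi> i) \<in> borel_measurable \<nu>" for i
    unfolding Z_def using meas by measurable
  have Zb: "\<bar>Z \<xi> i\<bar> \<le> 2 * B" if "\<xi> \<in> space \<nu>" for \<xi> i
  proof -
    have "integrable \<nu> (\<lambda>\<zeta>. Y \<zeta> $ i)"
      using bnd by (intro integrable_const_bound[of _ B] meas) auto
    then have "\<bar>\<integral>\<zeta>. Y \<zeta> $ i \<partial>\<nu>\<bar> \<le> B" using bnd by (rule abs_expectation_le)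
    then show ?thesis using bnd[OF that, of i] by (simp add: Z_def abs_le_iff)
  qed
  have int: "integrable \<nu> (\<lambda>\<xi>. Z \<xi> i * Z \<xi> j)" for i j
  proof (rule integrable_const_bound[of _ "(2 * B) * (2 * B)"])
    show "AE \<xi> in \<nu>. norm (Z \<xi> i * Z \<xi> j) \<le> (2 * B) * (2 * B)"
    proof (rule AE_I2)
      fix \<xi> assume "\<xi> \<in> space \<nu>"
      from Zb[OF this, of i] Zb[OF this, of j] show "norm (Z \<xi> i * Z \<xi> j) \<le> (2 * B) * (2 * B)"
        unfolding real_norm_def abs_mult by (intro mult_mono) auto
    qed
  qed measurable
  have cov: "covariance_matrix \<nu> Y $ i $ j = (\<integral>\<xi>. Z \<xi> i * Z \<xi> j \<partial>\<nu>)" for i j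
    by (simp add: covariance_matrix_def Z_def)
  have "v \<bullet> (covariance_matrix \<nu> Y *v v) = (\<integral>\<xi>. (\<Sum>i\<in>UNIV. v $ i * Z \<xi> i)^2 \<partial>\<nu>)" for v
  proof -
    have "(\<Sum>i\<in>UNIV. v $ i * Z \<xi> i)^2 = (\<Sum>i\<in>UNIV. \<Sum>j\<in>UNIV. (v $ i * v $ j) * (Z \<xi> i * Z \<xi> j))" for \<xi>
      by (simp add: power2_eq_square sum_product mult_ac)
    then have "(\<integral>\<xi>. (\<Sum>i\<in>UNIV. v $ i * Z \<xi> i)^2 \<partial>\<nu>) = (\<Sum>i\<in>UNIV. \<Sum>j\<in>UNIV. (v $ i * v $ j) * (\<integral>\<xi>. Z \<xi> i * Z \<xi> j \<partial>\<nu>))"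
      using int by (simp add: Bochner_Integration.integral_sum)
    then show ?thesis
      by (simp add: inner_vec_def matrix_vector_mult_def cov sum_distrib_left mult_ac)
  qed
  moreover have "transpose (covariance_matrix \<nu> Y) = covariance_matrix \<nu> Y"
    by (simp add: transpose_def vec_eq_iff covariance_matrix_def mult.commute)
  ultimately show ?thesis by (simp add: pos_semidef_def)
qed

section \<open>Brownian increments and the Ito isometry\<close>

lemma borel_measurable_vec_nth:
  fixes f :: "'a \<Rightarrow> ('b::real_normed_vector)^'n::finite"
  shows "f \<in> borel_measurable M \<Longrightarrow> (\<lambda>x. f x $ i) \<in> borel_measurable M"
  by (rule borel_measurable_continuous_on[where f = "\<lambda>v. v $ i"]) (auto intro: continuous_on_component continuous_on_id)

lemma borel_measurable_vecI:
  fixes f :: "'a \<Rightarrow> real^'n::finite"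
  assumes "\<And>i. (\<lambda>x. f x $ i) \<in> borel_measurable M"
  shows "f \<in> borel_measurable M"
proof -
  have "(\<lambda>x. \<Sum>i\<in>UNIV. (f x $ i) *\<^sub>R (axis i 1 :: real^'n)) \<in> borel_measurable M"
    using assms by measurable
  then show ?thesis by (simp add: basis_expansion scalar_mult_eq_scaleR[symmetric])
qed

lemma borel_measurable_matrix_vector_mult:
  fixes A :: "'a \<Rightarrow> real^'n::finite^'m::finite"
  assumes "A \<in> borel_measurable M" "x \<in> borel_measurable M"
  shows "(\<lambda>\<omega>. A \<omega> *v x \<omega>) \<in> borel_measurable M"
proof (rule borel_measurable_vecI)
  fix i
  show "(\<lambda>\<omega>. (A \<omega> *v x \<omega>) $ i) \<in> borel_measurable M"
    unfolding matrix_vector_mult_def vec_lambda_beta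
    by (intro borel_measurable_sum borel_measurable_times borel_measurable_vec_nth assms)
qed

text \<open>Lebesgue measure is the image of a product measure indexed by \<open>Basis\<close>,
  whereas coordinates are indexed by the type \<open>'d\<close>. The factors are therefore carried
  over to axis vectors by \<open>Q\<close> before the product formula applies.\<close>

lemma lborel_prod_integral:
  fixes q :: "'d::finite \<Rightarrow> real \<Rightarrow> real"
  assumes q: "\<And>i. integrable lborel (q i)"
  shows "integrable lborel (\<lambda>y::real^'d. \<Prod>i\<in>UNIV. q i (y $ i))"
    and "(\<integral>y. (\<Prod>i\<in>UNIV. q i ((y::real^'d) $ i)) \<partial>lborel) = (\<Prod>i\<in>UNIV. \<integral>y. q i y \<partial>lborel)"
proof -
  interpret product_sigma_finite "\<lambda>_::real^'d. lborel :: real measure" ..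
  define Q where "Q b = q (axis_index b)" for b :: "real^'d"
  have Bas: "Basis = range (\<lambda>i. axis i 1 :: real^'d)"
    by (auto simp: Basis_vec_def)
  have reindex: "(\<Prod>b\<in>Basis. g b) = (\<Prod>i\<in>UNIV. g (axis i 1))" for g :: "real^'d \<Rightarrow> real"
    unfolding Bas by (subst prod.reindex) (auto simp: inj_on_def axis_eq_axis)
  have nth: "(\<Sum>b\<in>Basis. f b *\<^sub>R b) $ i = f (axis i 1)" for f :: "real^'d \<Rightarrow> real" and i
  proof -
    have "(\<Sum>b\<in>Basis. f b *\<^sub>R b) $ i = (\<Sum>b\<in>Basis. f b *\<^sub>R b) \<bullet> axis i 1" by (simp add: inner_axis)
    also have "\<dots> = f (axis i 1)" by (rule inner_sum_left_Basis) (simp add: axis_in_Basis_iff)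
    finally show ?thesis .
  qed
  have eq: "(\<Prod>i\<in>UNIV. q i ((\<Sum>b\<in>Basis. f b *\<^sub>R b :: real^'d) $ i)) = (\<Prod>b\<in>Basis. Q b (f b))" for f
    unfolding reindex nth Q_def by simp
  have Qi: "integrable lborel (Q b)" for b using q by (simp add: Q_def)
  have qm: "(\<lambda>y::real^'d. \<Prod>i\<in>UNIV. q i (y $ i)) \<in> borel_measurable borel"
    using borel_measurable_integrable[OF q]
    by (intro borel_measurable_prod measurable_compose[OF borel_measurable_vec_nth]) auto
  have mp: "(\<lambda>f. \<Sum>b\<in>Basis. f b *\<^sub>R b :: real^'d) \<in> measurable (\<Pi>\<^sub>M b\<in>Basis. lborel) borel"
    by measurable
  show "integrable lborel (\<lambda>y::real^'d. \<Prod>i\<in>UNIV. q i (y $ i))"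
    unfolding lborel_eq[where 'a = "real^'d"] integrable_distr_eq[OF mp qm] eq
    by (intro product_integrable_prod Qi) auto
  show "(\<integral>y. (\<Prod>i\<in>UNIV. q i ((y::real^'d) $ i)) \<partial>lborel) = (\<Prod>i\<in>UNIV. \<integral>y. q i y \<partial>lborel)"
    unfolding lborel_eq[where 'a = "real^'d"] integral_distr[OF mp qm] eq
    by (subst product_integral_prod) (simp_all add: Qi reindex, simp add: Q_def)
qed

section \<open>Moments and independence of Brownian increments\<close>

locale brownian =
  fixes M :: "'w measure" and F :: "real \<Rightarrow> 'w measure" and W :: "real \<Rightarrow> 'w \<Rightarrow> real^'d::finite"
  assumes bm: "brownian_motion M F W"

sublocale brownian \<subseteq> prob_space M
  using bm by (simp add: brownian_motion_def)

context brownian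
begin

lemma space_F: "space (F t) = space M"
  using bm by (auto simp: brownian_motion_def filtration_def)

lemma measurable_F_mono: "s \<le> t \<Longrightarrow> f \<in> borel_measurable (F s) \<Longrightarrow> f \<in> borel_measurable (F t)"
  using bm by (intro measurable_from_subalg[of "F t" "F s"]) (auto simp: brownian_motion_def filtration_def subalgebra_def)

lemma measurable_F_imp_M: "f \<in> borel_measurable (F s) \<Longrightarrow> f \<in> borel_measurable M"
  using bm by (intro measurable_from_subalg[of M "F s"]) (auto simp: brownian_motion_def)

lemma W_measurable_F: "0 \<le> s \<Longrightarrow> s \<le> t \<Longrightarrow> W s \<in> borel_measurable (F t)"
  using bm by (intro measurable_F_mono[of s t]) (auto simp: brownian_motion_def)

lemma W_measurable: "0 \<le> s \<Longrightarrow> W s \<in> borel_measurable M"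
  using W_measurable_F[of s s] measurable_F_imp_M by blast

lemma increment_nth_measurable_F:
  assumes "0 \<le> s" "s \<le> t" "t \<le> u"
  shows "(\<lambda>\<omega>. (W t \<omega> - W s \<omega>) $ j) \<in> borel_measurable (F u)"
  by (intro borel_measurable_vec_nth borel_measurable_diff W_measurable_F) (use assms in auto)

lemma
  assumes st: "0 \<le> s" "s < t"
  shows integrable_increment_powers: "integrable M (\<lambda>\<omega>. \<Prod>i\<in>UNIV. ((W t \<omega> - W s \<omega>) $ i) ^ n i)"
    and expectation_increment_powers: "expectation (\<lambda>\<omega>. \<Prod>i\<in>UNIV. ((W t \<omega> - W s \<omega>) $ i) ^ n i)
      = (\<Prod>i\<in>UNIV. \<integral>y. normal_density 0 (sqrt (t - s)) y * y ^ n i \<partial>lborel)"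
proof -
  let ?f = "\<lambda>y::real^'d. \<Prod>i\<in>UNIV. normal_density 0 (sqrt (t - s)) (y $ i)"
  let ?g = "\<lambda>y::real^'d. \<Prod>i\<in>UNIV. (y $ i) ^ n i"
  have D: "distributed M lborel (\<lambda>\<omega>. W t \<omega> - W s \<omega>) (\<lambda>y. ennreal (?f y))"
    using bm st by (simp add: brownian_motion_def)
  have g: "?g \<in> borel_measurable lborel"
    unfolding measurable_lborel1 by (intro borel_measurable_prod borel_measurable_power borel_measurable_vec_nth) simp
  have f0: "0 \<le> ?f y" for y by (intro prod_nonneg) auto
  have q: "integrable lborel (\<lambda>y. normal_density 0 (sqrt (t - s)) y * y ^ n i)" for i
    using integrable_normal_moment[of "sqrt (t - s)" 0 "n i"] st by simp
  have "integrable lborel (\<lambda>y. ?f y * ?g y)"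
    using lborel_prod_integral(1)[OF q] by (simp add: prod.distrib)
  then show "integrable M (\<lambda>\<omega>. \<Prod>i\<in>UNIV. ((W t \<omega> - W s \<omega>) $ i) ^ n i)"
    using distributed_integrable[OF D g f0] by simp
  have "expectation (\<lambda>\<omega>. ?g (W t \<omega> - W s \<omega>)) = (\<integral>y. ?f y * ?g y \<partial>lborel)"
    using distributed_integral[OF D g f0] by simp
  also have "\<dots> = (\<Prod>i\<in>UNIV. \<integral>y. normal_density 0 (sqrt (t - s)) y * y ^ n i \<partial>lborel)"
    using lborel_prod_integral(2)[OF q] by (simp add: prod.distrib)
  finally show "expectation (\<lambda>\<omega>. ?g (W t \<omega> - W s \<omega>)) = (\<Prod>i\<in>UNIV. \<integral>y. normal_density 0 (sqrt (t - s)) y * y ^ n i \<partial>lborel)" .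
qed

lemma
  assumes st: "0 \<le> s" "s \<le> t"
  shows integrable_increment: "integrable M (\<lambda>\<omega>. (W t \<omega> - W s \<omega>) $ j)" (is ?i1)
    and expectation_increment: "expectation (\<lambda>\<omega>. (W t \<omega> - W s \<omega>) $ j) = 0" (is ?e1)
    and integrable_increment_product: "integrable M (\<lambda>\<omega>. (W t \<omega> - W s \<omega>) $ j * (W t \<omega> - W s \<omega>) $ k)" (is ?i2)
    and expectation_increment_product:
      "expectation (\<lambda>\<omega>. (W t \<omega> - W s \<omega>) $ j * (W t \<omega> - W s \<omega>) $ k) = (if j = k then t - s else 0)" (is ?e2)
    and integrable_increment_fourth: "integrable M (\<lambda>\<omega>. ((W t \<omega> - W s \<omega>) $ j) ^ 4)" (is ?i4)
    and expectation_increment_fourth: "expectation (\<lambda>\<omega>. ((W t \<omega> - W s \<omega>) $ j) ^ 4) = 3 * (t - s)^2" (is ?e4)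
proof -
  have "?i1 \<and> ?e1 \<and> ?i2 \<and> ?e2 \<and> ?i4 \<and> ?e4"
  \<comment> \<open>A density is prescribed for s < t only; for s = t the increment vanishes, and so
    do all the moments in question.\<close>
  proof (cases "s = t")
    case False
    with st have lt: "s < t" and pos: "0 < sqrt (t - s)" by auto
    define m where "m n = (\<integral>y. normal_density 0 (sqrt (t - s)) y * y ^ n \<partial>lborel)" for n :: nat
    have m: "m 0 = 1" "m 1 = 0" "m 2 = t - s" "m 4 = 3 * (t - s)^2"
      using integral_normal_moment_odd[OF pos, of 0 0] integral_normal_moment_even[OF pos, of 0 1]
        integral_normal_moment_even[OF pos, of 0 2] integral_normal_density[OF pos, of 0] st
      by (simp_all add: m_def fact_numeral power2_eq_square)
    \<comment> \<open>Powers and products of coordinates are written as full products with exponent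
      0 elsewhere, so that they fall under the product formula for moments.\<close>
    have pw: "(\<Prod>i\<in>UNIV. (y $ i) ^ (if i = j then n else 0)) = (y $ j) ^ n" for y :: "real^'d" and j n
      by (simp add: if_distrib[of "(^) _"] cong: if_cong)
    have mm: "(\<Prod>i\<in>UNIV. m (if i = j then n else 0)) = m n" for j :: 'd and n
      using m(1) by (simp add: if_distrib[of m] cong: if_cong)
    have pw2: "(\<Prod>i\<in>UNIV. (y $ i) ^ ((if i = j then 1 else 0) + (if i = k then 1 else 0))) = y $ j * y $ k" for y :: "real^'d"
      using pw[of y j 1] pw[of y k 1] by (simp only: power_add prod.distrib power_one_right)
    have mm2: "(\<Prod>i\<in>UNIV. m ((if i = j then 1 else 0) + (if i = k then 1 else 0))) = (if j = k then t - s else 0)"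
    proof (cases "j = k")
      case True
      then have "(if i = j then 1 else 0) + (if i = k then 1 else 0) = (if i = j then 2 else (0::nat))" for i by simp
      then show ?thesis using mm[of j 2] m True by simp
    next
      case False
      then show ?thesis using m(2) by (auto intro!: prod_zero bexI[of _ j])
    qed
    note I = integrable_increment_powers[OF st(1) lt] and E = expectation_increment_powers[OF st(1) lt, folded m_def]
    show ?thesis
      using I[of "\<lambda>i. if i = j then 1 else 0"] E[of "\<lambda>i. if i = j then 1 else 0"]
        I[of "\<lambda>i. if i = j then 4 else 0"] E[of "\<lambda>i. if i = j then 4 else 0"]
        I[of "\<lambda>i. (if i = j then 1 else 0) + (if i = k then 1 else 0)"]
        E[of "\<lambda>i. (if i = j then 1 else 0) + (if i = k then 1 else 0)"]
      unfolding pw mm pw2 mm2 m power_one_right by blast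
  qed simp
  then show ?i1 ?e1 ?i2 ?e2 ?i4 ?e4 by blast+
qed

text \<open>The \<sigma>-algebras generated by Z and by a function of the increment lie inside the
  two families whose independence is part of \<open>brownian_motion\<close>. Hence means
  factor.\<close>

lemma
  fixes Z :: "'w \<Rightarrow> real" and q :: "real^'d \<Rightarrow> real"
  assumes st: "0 \<le> s" "s \<le> t" and Z: "Z \<in> borel_measurable (F s)" "integrable M Z"
    and q: "q \<in> borel_measurable borel" "integrable M (\<lambda>\<omega>. q (W t \<omega> - W s \<omega>))"
  shows integrable_mult_increment: "integrable M (\<lambda>\<omega>. Z \<omega> * q (W t \<omega> - W s \<omega>))" (is ?i)
    and expectation_mult_increment: "expectation (\<lambda>\<omega>. Z \<omega> * q (W t \<omega> - W s \<omega>)) = expectation Z * expectation (\<lambda>\<omega>. q (W t \<omega> - W s \<omega>))" (is ?e)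
proof -
  have "?i \<and> ?e"
  proof (cases "s = t")
    case True then show ?thesis using Z by (simp add: prob_space)
  next
    case False
    with st have lt: "s < t" by simp
    let ?D = "\<lambda>\<omega>. W t \<omega> - W s \<omega>" and ?V = "\<lambda>X::'w \<Rightarrow> real. {X -` A \<inter> space M | A. A \<in> sets borel}"
    have ind: "indep_set (sets (F s)) {?D -` A \<inter> space M | A. A \<in> sets borel}"
      using bm st lt by (simp add: brownian_motion_def)
    have qm: "(\<lambda>\<omega>. q (?D \<omega>)) \<in> borel_measurable M"
      using q(2) by (rule borel_measurable_integrable)
    \<comment> \<open>The preimages of Borel sets already form a \<sigma>-algebra, so the closure
      \<open>sigma_sets\<close> in the characterisation of \<open>indep_var\<close> changes
      nothing.\<close>
    have sv: "sigma_sets (space M) (?V X) = ?V X" for X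
      using sets_vimage_algebra[of "space M" X borel] sets_vimage_algebra2[of X "space M" borel] by simp
    have VZ: "?V Z \<subseteq> sets (F s)"
      using measurable_sets[OF Z(1)] by (auto simp: space_F)
    have Vq: "?V (\<lambda>\<omega>. q (?D \<omega>)) \<subseteq> {?D -` A \<inter> space M | A. A \<in> sets borel}"
    proof safe
      fix A :: "real set" assume "A \<in> sets borel"
      then have "q -` A \<in> sets borel" using q(1) measurable_sets_borel by blast
      then show "\<exists>B. (\<lambda>\<omega>. q (?D \<omega>)) -` A \<inter> space M = ?D -` B \<inter> space M \<and> B \<in> sets borel"
        by (intro exI[of _ "q -` A"]) auto
    qed
    have "indep_set (?V Z) (?V (\<lambda>\<omega>. q (?D \<omega>)))"
      unfolding indep_set_def
    proof (rule indep_sets_mono_sets[OF ind[unfolded indep_set_def]])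
      fix i show "case_bool (?V Z) (?V (\<lambda>\<omega>. q (?D \<omega>))) i
          \<subseteq> case_bool (sets (F s)) {?D -` A \<inter> space M | A. A \<in> sets borel} i"
        using VZ Vq by (cases i) simp_all
    qed
    then have "indep_var borel Z borel (\<lambda>\<omega>. q (?D \<omega>))"
      unfolding indep_var_eq sv using Z(2) q(2) by (simp add: borel_measurable_integrable)
    from indep_var_lebesgue_integral[OF this Z(2) q(2)] indep_var_integrable[OF this Z(2) q(2)]
    show ?thesis by simp
  qed
  then show ?i ?e by blast+
qed

lemma has_bochner_integral_later_increment:
  assumes "0 \<le> s" "s \<le> t" "Z \<in> borel_measurable (F s)" "integrable M Z"
  shows "has_bochner_integral M (\<lambda>\<omega>. Z \<omega> * (W t \<omega> - W s \<omega>) $ k) 0"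
proof -
  have q: "(\<lambda>y::real^'d. y $ k) \<in> borel_measurable borel"
    by (intro borel_measurable_vec_nth) simp
  show ?thesis
    using integrable_mult_increment[OF assms q integrable_increment[OF assms(1,2)]]
      expectation_mult_increment[OF assms q integrable_increment[OF assms(1,2)]]
      expectation_increment[OF assms(1,2), of k]
    by (simp add: has_bochner_integral_iff)
qed

lemma integrable_bounded_mult:
  fixes u X :: "'w \<Rightarrow> real"
  assumes "u \<in> borel_measurable M" "\<And>\<omega>. \<omega> \<in> space M \<Longrightarrow> \<bar>u \<omega>\<bar> \<le> B" "integrable M X"
  shows "integrable M (\<lambda>\<omega>. u \<omega> * X \<omega>)"
proof (rule Bochner_Integration.integrable_bound)
  show "integrable M (\<lambda>\<omega>. B * \<bar>X \<omega>\<bar>)" using assms by auto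
  show "(\<lambda>\<omega>. u \<omega> * X \<omega>) \<in> borel_measurable M"
    using assms by (auto intro: borel_measurable_integrable)
  show "AE \<omega> in M. norm (u \<omega> * X \<omega>) \<le> norm (B * \<bar>X \<omega>\<bar>)"
  proof (rule AE_I2)
    fix \<omega> assume "\<omega> \<in> space M"
    then have "\<bar>u \<omega>\<bar> * \<bar>X \<omega>\<bar> \<le> \<bar>B\<bar> * \<bar>X \<omega>\<bar>"
      by (intro mult_right_mono order_trans[OF assms(2) abs_ge_self]) auto
    then show "norm (u \<omega> * X \<omega>) \<le> norm (B * \<bar>X \<omega>\<bar>)" by (simp add: abs_mult)
  qed
qed

text \<open>Both intervals are cut at c and at e = min b d. Products of increments over disjoint
  pieces have mean zero; the common piece (c, e] gives the length of the overlap when j = k.\<close>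

lemma has_bochner_integral_increment_pair_ordered:
  assumes ab: "0 \<le> a" "a \<le> b" and cd: "c \<le> d" and ac: "a \<le> c"
    and z: "z \<in> borel_measurable (F c)" "\<And>\<omega>. \<omega> \<in> space M \<Longrightarrow> \<bar>z \<omega>\<bar> \<le> B"
  shows "has_bochner_integral M (\<lambda>\<omega>. z \<omega> * ((W b \<omega> - W a \<omega>) $ j * (W d \<omega> - W c \<omega>) $ k))
    ((if j = k then max 0 (min b d - max a c) else 0) * expectation z)"
proof -
  have c0: "0 \<le> c" using ab ac by simp
  have zM: "z \<in> borel_measurable M" using z(1) by (rule measurable_F_imp_M)
  have zint: "integrable M z" using z(2) by (intro integrable_const_bound[of _ B] zM) auto
  have zs: "z \<in> borel_measurable (F e)" if "c \<le> e" for e using measurable_F_mono[OF that z(1)] .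
  \<comment> \<open>Together with z the earlier increment is known at the time when the later one
    starts; the later one has mean zero and is independent of it.\<close>
  have early: "has_bochner_integral M (\<lambda>\<omega>. z \<omega> * ((W e \<omega> - W p \<omega>) $ j * (W d' \<omega> - W e' \<omega>) $ k)) 0"
    if "0 \<le> p" "p \<le> e" "e \<le> e'" "e' \<le> d'" "c \<le> e'" for p e e' d' j k
  proof -
    have "has_bochner_integral M (\<lambda>\<omega>. (z \<omega> * (W e \<omega> - W p \<omega>) $ j) * (W d' \<omega> - W e' \<omega>) $ k) 0"
      using that
      by (intro has_bochner_integral_later_increment borel_measurable_times zs increment_nth_measurable_F
          integrable_bounded_mult[OF zM z(2)] integrable_increment) auto
    then show ?thesis by (simp add: mult.assoc)
  qed
  show ?thesis
  proof (cases "b \<le> c")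
    case True
    then have "max 0 (min b d - max a c) = 0" by auto
    then show ?thesis using early[of a b c d j k] True ab cd by (simp only: if_cancel mult_zero_left)
  next
    case False
    define e where "e = min b d"
    have e: "c \<le> e" "e \<le> b" "e \<le> d" using False cd by (auto simp: e_def)
    have 1: "has_bochner_integral M (\<lambda>\<omega>. z \<omega> * ((W c \<omega> - W a \<omega>) $ j * (W d \<omega> - W c \<omega>) $ k)) 0"
      using ab ac cd by (intro early) auto
    have q: "(\<lambda>y::real^'d. y $ j * y $ k) \<in> borel_measurable borel"
      by (intro borel_measurable_times borel_measurable_vec_nth) simp_all
    have 2: "has_bochner_integral M (\<lambda>\<omega>. z \<omega> * ((W e \<omega> - W c \<omega>) $ j * (W e \<omega> - W c \<omega>) $ k))
        (expectation z * (if j = k then e - c else 0))"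
      using integrable_mult_increment[OF c0 e(1) z(1) zint q integrable_increment_product[OF c0 e(1)]]
        expectation_mult_increment[OF c0 e(1) z(1) zint q integrable_increment_product[OF c0 e(1)]]
        expectation_increment_product[OF c0 e(1), of j k]
      by (simp add: has_bochner_integral_iff)
    have 3: "has_bochner_integral M (\<lambda>\<omega>. z \<omega> * ((W e \<omega> - W c \<omega>) $ j * (W d \<omega> - W e \<omega>) $ k)) 0"
      using c0 e by (intro early) auto
    \<comment> \<open>If b \<le> d, then e = b and the increment is zero. Otherwise e = d, and the
      remaining piece of the first interval comes after the second interval, so that the two factors
      change roles.\<close>
    have 4: "has_bochner_integral M (\<lambda>\<omega>. z \<omega> * ((W b \<omega> - W e \<omega>) $ j * (W d \<omega> - W c \<omega>) $ k)) 0"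
    proof (cases "b \<le> d")
      case True then show ?thesis by (simp add: e_def has_bochner_integral_zero)
    next
      case False
      then have "has_bochner_integral M (\<lambda>\<omega>. z \<omega> * ((W d \<omega> - W c \<omega>) $ k * (W b \<omega> - W e \<omega>) $ j)) 0"
        using c0 cd e by (intro early) (auto simp: e_def)
      then show ?thesis by (simp add: mult_ac)
    qed
    have "(if j = k then max 0 (min b d - max a c) else 0) = (if j = k then e - c else 0)"
      using e ac by (auto simp: e_def)
    then show ?thesis
      using has_bochner_integral_add[OF has_bochner_integral_add[OF has_bochner_integral_add[OF 1 2] 3] 4]
      by (simp add: algebra_simps)
  qed
qed

lemma has_bochner_integral_increment_pair:
  assumes ab: "0 \<le> a" "a \<le> b" and cd: "0 \<le> c" "c \<le> d"
    and u: "u \<in> borel_measurable (F a)" "\<And>\<omega>. \<omega> \<in> space M \<Longrightarrow> \<bar>u \<omega>\<bar> \<le> B"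
    and v: "v \<in> borel_measurable (F c)" "\<And>\<omega>. \<omega> \<in> space M \<Longrightarrow> \<bar>v \<omega>\<bar> \<le> B'"
  shows "has_bochner_integral M (\<lambda>\<omega>. (u \<omega> * v \<omega>) * ((W b \<omega> - W a \<omega>) $ j * (W d \<omega> - W c \<omega>) $ k))
    ((if j = k then max 0 (min b d - max a c) else 0) * expectation (\<lambda>\<omega>. u \<omega> * v \<omega>))"
proof -
  have uv: "\<bar>u \<omega> * v \<omega>\<bar> \<le> B * B'" if "\<omega> \<in> space M" for \<omega>
    unfolding abs_mult using u(2)[OF that] v(2)[OF that] by (intro mult_mono) auto
  show ?thesis
  proof (cases "a \<le> c")
    case True
    then show ?thesis
      using measurable_F_mono[OF True u(1)] v(1) ab cd uv
      by (intro has_bochner_integral_increment_pair_ordered) auto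
  next
    case False
    then have "c \<le> a" by simp
    from has_bochner_integral_increment_pair_ordered[OF cd(1,2) ab(2) this, of "\<lambda>\<omega>. u \<omega> * v \<omega>" "B * B'" k j]
      measurable_F_mono[OF this v(1)] u(1) uv
    show ?thesis
      by (auto simp: mult_ac min.commute max.commute eq_commute[of j k])
  qed
qed

section \<open>The Ito isometry for lists of steps\<close>

text \<open>A triple \<open>(a, b, h)\<close> represents the integrand \<open>h 1\<^bsub>(a,b]\<^esub>\<close>. Unlike the elementary
  integrands of the definition, the intervals in a list of steps may overlap, so that sums and
  differences are formed by appending lists.\<close>
definition adapted_step :: "real \<times> real \<times> ('w \<Rightarrow> real^'d^'d) \<Rightarrow> bool" where
  "adapted_step = (\<lambda>(a, b, h). 0 \<le> a \<and> a \<le> b \<and> h \<in> borel_measurable (F a) \<and> (\<exists>B. \<forall>\<omega>\<in>space M. norm (h \<omega>) \<le> B))"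

definition step_integral :: "real \<times> real \<times> ('w \<Rightarrow> real^'d^'d) \<Rightarrow> 'w \<Rightarrow> real^'d" where
  "step_integral = (\<lambda>(a, b, h) \<omega>. h \<omega> *v (W b \<omega> - W a \<omega>))"

definition step_process :: "real \<times> real \<times> ('w \<Rightarrow> real^'d^'d) \<Rightarrow> real \<Rightarrow> 'w \<Rightarrow> real^'d^'d" where
  "step_process = (\<lambda>(a, b, h) r \<omega>. indicator {a<..b} r *\<^sub>R h \<omega>)"

definition steps_integral where "steps_integral l \<omega> = (\<Sum>x\<leftarrow>l. step_integral x \<omega>)"

definition steps_process where "steps_process l r \<omega> = (\<Sum>x\<leftarrow>l. step_process x r \<omega>)"

lemma steps_integral_measurable:
  assumes "\<forall>x\<in>set l. adapted_step x"
  shows "steps_integral l \<in> borel_measurable M"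
  using assms
proof (induction l)
  case (Cons x l)
  obtain a b h where x: "x = (a, b, h)" by (cases x)
  have "0 \<le> a" "0 \<le> b" "h \<in> borel_measurable M"
    using Cons.prems x measurable_F_imp_M by (auto simp: adapted_step_def)
  then have "step_integral x \<in> borel_measurable M"
    unfolding x step_integral_def by (auto intro!: borel_measurable_matrix_vector_mult borel_measurable_diff W_measurable)
  then show ?case using Cons by (simp add: steps_integral_def[abs_def])
qed (simp add: steps_integral_def[abs_def])

lemma integrable_bounded_product:
  fixes u v :: "'w \<Rightarrow> real"
  assumes "u \<in> borel_measurable M" "v \<in> borel_measurable M"
    and "\<And>\<omega>. \<omega> \<in> space M \<Longrightarrow> \<bar>u \<omega>\<bar> \<le> B" "\<And>\<omega>. \<omega> \<in> space M \<Longrightarrow> \<bar>v \<omega>\<bar> \<le> B'"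
  shows "integrable M (\<lambda>\<omega>. u \<omega> * v \<omega>)"
  using assms by (intro integrable_bounded_mult[of u B v] integrable_const_bound[of v B']) auto

lemma abs_matrix_entry_le: "\<bar>A $ i $ j\<bar> \<le> norm (A :: real^'n::finite^'m::finite)"
  by (metis Finite_Cartesian_Product.norm_nth_le order_trans component_le_norm_cart)

text \<open>Only equal components of the two Brownian increments are correlated, so the triple sum
  collapses to the Frobenius inner product of the integrands times the length of the
  overlap.\<close>

lemma has_bochner_integral_step_inner:
  assumes x: "adapted_step (a, b, h)" and y: "adapted_step (c, d, h')"
  shows "integrable M (\<lambda>\<omega>. h \<omega> \<bullet> h' \<omega>)"
    and "has_bochner_integral M (\<lambda>\<omega>. step_integral (a, b, h) \<omega> \<bullet> step_integral (c, d, h') \<omega>)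
    (max 0 (min b d - max a c) * expectation (\<lambda>\<omega>. h \<omega> \<bullet> h' \<omega>))"
proof -
  let ?o = "max 0 (min b d - max a c)"
  obtain B B' where B: "\<And>\<omega>. \<omega> \<in> space M \<Longrightarrow> norm (h \<omega>) \<le> B" and B': "\<And>\<omega>. \<omega> \<in> space M \<Longrightarrow> norm (h' \<omega>) \<le> B'"
    using x y by (auto simp: adapted_step_def)
  have hB: "\<bar>h \<omega> $ i $ j\<bar> \<le> B" "\<bar>h' \<omega> $ i $ j\<bar> \<le> B'" if "\<omega> \<in> space M" for \<omega> i j
    using order_trans[OF abs_matrix_entry_le B[OF that]] order_trans[OF abs_matrix_entry_le B'[OF that]] by auto
  have m: "(\<lambda>\<omega>. h \<omega> $ i $ j) \<in> borel_measurable (F a)" "(\<lambda>\<omega>. h' \<omega> $ i $ j) \<in> borel_measurable (F c)" for i j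
    using x y by (auto simp: adapted_step_def intro!: borel_measurable_vec_nth)
  have int: "integrable M (\<lambda>\<omega>. h \<omega> $ i $ j * h' \<omega> $ i $ k)" for i j k
    using m[THEN measurable_F_imp_M] hB by (intro integrable_bounded_product)
  have inner: "h \<omega> \<bullet> h' \<omega> = (\<Sum>i\<in>UNIV. \<Sum>j\<in>UNIV. h \<omega> $ i $ j * h' \<omega> $ i $ j)" for \<omega>
    by (simp add: inner_vec_def)
  show "integrable M (\<lambda>\<omega>. h \<omega> \<bullet> h' \<omega>)"
    unfolding inner using int by simp
  have "step_integral (a, b, h) \<omega> \<bullet> step_integral (c, d, h') \<omega> = (\<Sum>i\<in>UNIV. \<Sum>j\<in>UNIV. \<Sum>k\<in>UNIV.
      (h \<omega> $ i $ j * h' \<omega> $ i $ k) * ((W b \<omega> - W a \<omega>) $ j * (W d \<omega> - W c \<omega>) $ k))" for \<omega>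
    by (simp add: step_integral_def inner_vec_def matrix_vector_mult_def sum_product mult_ac del: vector_minus_component)
  moreover have "has_bochner_integral M (\<lambda>\<omega>. \<Sum>i\<in>UNIV. \<Sum>j\<in>UNIV. \<Sum>k\<in>UNIV.
      (h \<omega> $ i $ j * h' \<omega> $ i $ k) * ((W b \<omega> - W a \<omega>) $ j * (W d \<omega> - W c \<omega>) $ k))
      (\<Sum>i\<in>UNIV. \<Sum>j\<in>UNIV. \<Sum>k\<in>UNIV. (if j = k then ?o else 0) * expectation (\<lambda>\<omega>. h \<omega> $ i $ j * h' \<omega> $ i $ k))"
    using x y m hB unfolding adapted_step_def
    by (intro has_bochner_integral_sum has_bochner_integral_increment_pair) auto
  moreover have "(\<Sum>i\<in>UNIV. \<Sum>j\<in>UNIV. \<Sum>k\<in>UNIV. (if j = k then ?o else 0) * expectation (\<lambda>\<omega>. h \<omega> $ i $ j * h' \<omega> $ i $ k))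
      = ?o * expectation (\<lambda>\<omega>. h \<omega> \<bullet> h' \<omega>)"
  proof -
    have "(if j = k then ?o else 0) * e = (if j = k then ?o * e else 0)" for j k :: 'd and e :: real by simp
    then show ?thesis
      unfolding inner using int by (simp add: Bochner_Integration.integral_sum sum_distrib_left)
  qed
  ultimately show "has_bochner_integral M (\<lambda>\<omega>. step_integral (a, b, h) \<omega> \<bullet> step_integral (c, d, h') \<omega>)
    (?o * expectation (\<lambda>\<omega>. h \<omega> \<bullet> h' \<omega>))" by simp
qed

text \<open>The counterpart in time of \<open>has_bochner_integral_step_inner\<close>: the same
  overlap length appears as the measure of the intersection of the two intervals.\<close>

lemma has_bochner_integral_process_inner:
  "has_bochner_integral lborel (\<lambda>r. step_process (a, b, h) r \<omega> \<bullet> step_process (c, d, h') r \<omega>)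
     (max 0 (min b d - max a c) * (h \<omega> \<bullet> h' \<omega>))"
proof -
  have 1: "step_process (a, b, h) r \<omega> \<bullet> step_process (c, d, h') r \<omega> = indicator {max a c<..min b d} r *\<^sub>R (h \<omega> \<bullet> h' \<omega>)" for r
    by (auto simp: step_process_def indicator_def)
  have "has_bochner_integral lborel (indicator {max a c<..min b d}) (measure lborel {max a c<..min b d})"
    using emeasure_bounded_finite[of "{max a c<..min b d}"]
    by (intro has_bochner_integral_real_indicator) (auto simp: bounded_Ioc)
  then have "has_bochner_integral lborel (\<lambda>r. indicator {max a c<..min b d} r *\<^sub>R (h \<omega> \<bullet> h' \<omega>))
      (measure lborel {max a c<..min b d} *\<^sub>R (h \<omega> \<bullet> h' \<omega>))"
    by (rule has_bochner_integral_scaleR_left)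
  moreover have "measure lborel {max a c<..min b d} = max 0 (min b d - max a c)"
  proof -
    have "measure lborel {x<..y} = max 0 (y - x)" for x y :: real
      by (cases "x \<le> y") (simp_all add: measure_def)
    then show ?thesis .
  qed
  ultimately show ?thesis unfolding 1 by simp
qed

text \<open>Both sides expand into the same double sum of overlap lengths times means of inner
  products. Since each pair is treated separately, overlapping intervals are allowed.\<close>

lemma ito_isometry_steps:
  assumes l: "\<forall>x\<in>set l. adapted_step x"
  shows "(\<integral>\<^sup>+\<omega>. ennreal ((norm (steps_integral l \<omega>))\<^sup>2) \<partial>M)
    = (\<integral>\<^sup>+\<omega>. (\<integral>\<^sup>+r. ennreal ((norm (steps_process l r \<omega>))\<^sup>2) \<partial>lborel) \<partial>M)"
proof -
  let ?I = "{..<length l}"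
  define A B H where "A i = fst (l ! i)" and "B i = fst (snd (l ! i))" and "H i = snd (snd (l ! i))" for i
  have li: "l ! i = (A i, B i, H i)" for i by (simp add: A_def B_def H_def)
  have ad: "adapted_step (A i, B i, H i)" if "i \<in> ?I" for i using l that li[of i] by simp (metis nth_mem)
  define ov where "ov i j = max 0 (min (B i) (B j) - max (A i) (A j))" for i j
  define Q where "Q \<omega> = (\<Sum>i\<in>?I. \<Sum>j\<in>?I. ov i j * (H i \<omega> \<bullet> H j \<omega>))" for \<omega>
  have si: "steps_integral l \<omega> = (\<Sum>i\<in>?I. step_integral (A i, B i, H i) \<omega>)" for \<omega>
    by (simp add: steps_integral_def sum_list_sum_nth li atLeast0LessThan)
  have sp: "steps_process l r \<omega> = (\<Sum>i\<in>?I. step_process (A i, B i, H i) r \<omega>)" for r \<omega>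
    by (simp add: steps_process_def sum_list_sum_nth li atLeast0LessThan)
  have "has_bochner_integral M (\<lambda>\<omega>. \<Sum>i\<in>?I. \<Sum>j\<in>?I. step_integral (A i, B i, H i) \<omega> \<bullet> step_integral (A j, B j, H j) \<omega>)
      (\<Sum>i\<in>?I. \<Sum>j\<in>?I. ov i j * expectation (\<lambda>\<omega>. H i \<omega> \<bullet> H j \<omega>))"
    unfolding ov_def using has_bochner_integral_step_inner(2)[OF ad ad] by (intro has_bochner_integral_sum) auto
  then have 1: "has_bochner_integral M (\<lambda>\<omega>. (norm (steps_integral l \<omega>))\<^sup>2) (\<Sum>i\<in>?I. \<Sum>j\<in>?I. ov i j * expectation (\<lambda>\<omega>. H i \<omega> \<bullet> H j \<omega>))"
    by (simp add: si power2_norm_eq_inner inner_sum_left inner_sum_right inner_commute)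
  have "has_bochner_integral lborel (\<lambda>r. \<Sum>i\<in>?I. \<Sum>j\<in>?I. step_process (A i, B i, H i) r \<omega> \<bullet> step_process (A j, B j, H j) r \<omega>) (Q \<omega>)" for \<omega>
    unfolding Q_def ov_def by (intro has_bochner_integral_sum has_bochner_integral_process_inner)
  then have 2: "has_bochner_integral lborel (\<lambda>r. (norm (steps_process l r \<omega>))\<^sup>2) (Q \<omega>)" for \<omega>
    by (simp add: sp power2_norm_eq_inner inner_sum_left inner_sum_right inner_commute)
  have 3: "has_bochner_integral M Q (\<Sum>i\<in>?I. \<Sum>j\<in>?I. ov i j * expectation (\<lambda>\<omega>. H i \<omega> \<bullet> H j \<omega>))"
    unfolding Q_def
    using has_bochner_integral_step_inner(1)[OF ad ad]
    by (intro has_bochner_integral_sum has_bochner_integral_mult_right has_bochner_integral_integrable) auto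
  have nn: "(\<integral>\<^sup>+x. ennreal (f x) \<partial>N) = ennreal c" if "has_bochner_integral N f c" "\<And>x. 0 \<le> f x" for f c and N :: "'z measure"
    using that by (simp add: has_bochner_integral_iff nn_integral_eq_integral)
  have Q0: "0 \<le> Q \<omega>" for \<omega>
    unfolding has_bochner_integral_integral_eq[OF 2, symmetric] by (rule Bochner_Integration.integral_nonneg) simp
  show ?thesis
    unfolding nn[OF 1 zero_le_power2] nn[OF 2 zero_le_power2] nn[OF 3 Q0] ..
qed

text \<open>Every step starts at or after s, so Z times the coefficient of the step is known when
  its increment begins, and the increment has mean zero.\<close>

lemma expectation_inner_steps_integral:
  assumes l: "\<forall>x\<in>set l. adapted_step x \<and> s \<le> fst x" and s: "0 \<le> s"
    and Z: "Z \<in> borel_measurable (F s)" "\<And>\<omega>. \<omega> \<in> space M \<Longrightarrow> norm (Z \<omega> :: real^'d) \<le> K"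
  shows "has_bochner_integral M (\<lambda>\<omega>. Z \<omega> \<bullet> steps_integral l \<omega>) 0"
  using l
proof (induction l)
  case Nil then show ?case by (simp add: steps_integral_def has_bochner_integral_zero)
next
  case (Cons x l)
  obtain a b h where x: "x = (a, b, h)" by (cases x)
  have ab: "0 \<le> a" "a \<le> b" "s \<le> a" "h \<in> borel_measurable (F a)" using Cons.prems x by (auto simp: adapted_step_def)
  obtain B where B: "\<And>\<omega>. \<omega> \<in> space M \<Longrightarrow> norm (h \<omega>) \<le> B"
    using Cons.prems x by (auto simp: adapted_step_def)
  have m: "(\<lambda>\<omega>. Z \<omega> $ i) \<in> borel_measurable (F a)" "(\<lambda>\<omega>. h \<omega> $ i $ j) \<in> borel_measurable (F a)" for i j
    using measurable_F_mono[OF ab(3) Z(1)] ab(4) by (auto intro!: borel_measurable_vec_nth)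
  have "has_bochner_integral M (\<lambda>\<omega>. (Z \<omega> $ i * h \<omega> $ i $ j) * (W b \<omega> - W a \<omega>) $ j) 0" for i j
  proof (rule has_bochner_integral_later_increment[OF ab(1,2)])
    show "integrable M (\<lambda>\<omega>. Z \<omega> $ i * h \<omega> $ i $ j)"
      using m[THEN measurable_F_imp_M] order_trans[OF component_le_norm_cart Z(2)] order_trans[OF abs_matrix_entry_le B]
      by (intro integrable_bounded_product) auto
  qed (use m in auto)
  then have "has_bochner_integral M (\<lambda>\<omega>. \<Sum>i\<in>UNIV. \<Sum>j\<in>UNIV. (Z \<omega> $ i * h \<omega> $ i $ j) * (W b \<omega> - W a \<omega>) $ j)
      (\<Sum>i\<in>(UNIV::'d set). \<Sum>j\<in>(UNIV::'d set). 0)"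
    by (intro has_bochner_integral_sum)
  moreover have "(\<Sum>i\<in>UNIV. \<Sum>j\<in>UNIV. (Z \<omega> $ i * h \<omega> $ i $ j) * (W b \<omega> - W a \<omega>) $ j) = Z \<omega> \<bullet> step_integral x \<omega>" for \<omega>
    by (simp add: x step_integral_def inner_vec_def matrix_vector_mult_def sum_distrib_left mult_ac del: vector_minus_component)
  ultimately have "has_bochner_integral M (\<lambda>\<omega>. Z \<omega> \<bullet> step_integral x \<omega>) 0" by simp
  from has_bochner_integral_add[OF this Cons.IH] Cons.prems show ?case
    by (simp add: steps_integral_def inner_add_right)
qed

end

section \<open>From elementary integrands to Ito integrals\<close>

lemma ennreal_twice_add: "0 \<le> a \<Longrightarrow> 0 \<le> b \<Longrightarrow> ennreal (2 * a + 2 * b) = 2 * ennreal a + 2 * ennreal b"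
  by (simp add: ennreal_mult)

text \<open>Replaces the triangle inequality in L^2. The factor 2 is harmless here, and the
  inequality makes sense for infinite integrals.\<close>

lemma nn_integral_norm_add_sq_le:
  fixes f g :: "'a \<Rightarrow> 'b::{real_normed_vector,second_countable_topology}"
  assumes "f \<in> borel_measurable N" "g \<in> borel_measurable N"
  shows "(\<integral>\<^sup>+x. ennreal ((norm (f x + g x))\<^sup>2) \<partial>N)
    \<le> 2 * (\<integral>\<^sup>+x. ennreal ((norm (f x))\<^sup>2) \<partial>N) + 2 * (\<integral>\<^sup>+x. ennreal ((norm (g x))\<^sup>2) \<partial>N)"
proof -
  have "(norm (f x + g x))\<^sup>2 \<le> 2 * (norm (f x))\<^sup>2 + 2 * (norm (g x))\<^sup>2" for x
  proof -
    have "(norm (f x + g x))\<^sup>2 \<le> (norm (f x) + norm (g x))\<^sup>2"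
      by (intro power_mono norm_triangle_ineq) auto
    also have "\<dots> \<le> 2 * (norm (f x))\<^sup>2 + 2 * (norm (g x))\<^sup>2"
      using sum_squares_bound[of "norm (f x)" "norm (g x)"] by (simp add: power2_sum)
    finally show ?thesis .
  qed
  then have "(\<integral>\<^sup>+x. ennreal ((norm (f x + g x))\<^sup>2) \<partial>N)
      \<le> (\<integral>\<^sup>+x. 2 * ennreal ((norm (f x))\<^sup>2) + 2 * ennreal ((norm (g x))\<^sup>2) \<partial>N)"
    by (intro nn_integral_mono) (simp only: ennreal_twice_add[OF zero_le_power2 zero_le_power2, symmetric] ennreal_leI)
  also have "\<dots> = 2 * (\<integral>\<^sup>+x. ennreal ((norm (f x))\<^sup>2) \<partial>N) + 2 * (\<integral>\<^sup>+x. ennreal ((norm (g x))\<^sup>2) \<partial>N)"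
    using assms by (simp add: nn_integral_add nn_integral_cmult)
  finally show ?thesis .
qed

lemma nn_integral_norm_diff_sq_le:
  fixes f g h :: "'a \<Rightarrow> 'b::{real_normed_vector,second_countable_topology}"
  assumes "f \<in> borel_measurable N" "g \<in> borel_measurable N" "h \<in> borel_measurable N"
  shows "(\<integral>\<^sup>+x. ennreal ((norm (f x - h x))\<^sup>2) \<partial>N)
    \<le> 2 * (\<integral>\<^sup>+x. ennreal ((norm (f x - g x))\<^sup>2) \<partial>N) + 2 * (\<integral>\<^sup>+x. ennreal ((norm (g x - h x))\<^sup>2) \<partial>N)"
  using nn_integral_norm_add_sq_le[of "\<lambda>x. f x - g x" N "\<lambda>x. g x - h x"] assms by simp

context brownian
begin

text \<open>The part of an elementary integrand living on (s, t], as a list of steps. The filter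
  removes the intervals whose truncation would have its end before its beginning, which
  \<open>adapted_step\<close> forbids.\<close>

definition elementary_steps ::
  "nat \<Rightarrow> (nat \<Rightarrow> real) \<Rightarrow> (nat \<Rightarrow> 'w \<Rightarrow> real^'d^'d) \<Rightarrow> real \<Rightarrow> real \<Rightarrow> (real \<times> real \<times> ('w \<Rightarrow> real^'d^'d)) list" where
  "elementary_steps N p h s t =
    map (\<lambda>k. (max s (p k), min t (p (Suc k)), h k)) (filter (\<lambda>k. p k \<le> t \<and> s \<le> p (Suc k)) [0..<N])"

lemma sum_list_elementary_steps:
  fixes G :: "_ \<Rightarrow> 'z::comm_monoid_add"
  shows "(\<Sum>x\<leftarrow>elementary_steps N p h s t. G x) =
    (\<Sum>k<N. if p k \<le> t \<and> s \<le> p (Suc k) then G (max s (p k), min t (p (Suc k)), h k) else 0)"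
  by (simp add: elementary_steps_def sum_list_map_filter' o_def interv_sum_list_conv_sum_set_nat atLeast0LessThan)

lemma elementary_nonneg:
  assumes "elementary M F N p h"
  shows "k \<le> N \<Longrightarrow> 0 \<le> p k"
proof (induction k)
  case (Suc k)
  then have "p k < p (Suc k)" using assms by (simp add: elementary_def)
  with Suc show ?case by simp
qed (use assms in \<open>simp add: elementary_def\<close>)

lemma adapted_elementary_steps:
  assumes el: "elementary M F N p h" and st: "0 \<le> s" "s \<le> t" and x: "x \<in> set (elementary_steps N p h s t)"
  shows "adapted_step x" "s \<le> fst x"
proof -
  obtain k where k: "k < N" "p k \<le> t" "s \<le> p (Suc k)" and x: "x = (max s (p k), min t (p (Suc k)), h k)"
    using x by (auto simp: elementary_steps_def)
  have el': "p k < p (Suc k)" "h k \<in> borel_measurable (F (p k))" "\<exists>B. \<forall>\<omega>\<in>space M. norm (h k \<omega>) \<le> B"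
    using el k(1) by (auto simp: elementary_def)
  have "h k \<in> borel_measurable (F (max s (p k)))" using el'(2) by (rule measurable_F_mono[rotated]) simp
  then show "adapted_step x" using k el' st by (auto simp: adapted_step_def x)
  show "s \<le> fst x" by (simp add: x)
qed

lemma steps_integral_elementary:
  assumes el: "elementary M F N p h" and st: "s \<le> t"
  shows "steps_integral (elementary_steps N p h s t) \<omega>
    = elementary_integral N p h W t \<omega> - elementary_integral N p h W s \<omega>"
  unfolding steps_integral_def sum_list_elementary_steps elementary_integral_def sum_subtractf[symmetric]
proof (rule sum.cong)
  fix k assume "k \<in> {..<N}"
  then have p: "p k < p (Suc k)" using el by (simp add: elementary_def)
  show "(if p k \<le> t \<and> s \<le> p (Suc k) then step_integral (max s (p k), min t (p (Suc k)), h k) \<omega> else 0)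
     = h k \<omega> *v (W (min t (p (Suc k))) \<omega> - W (min t (p k)) \<omega>) - h k \<omega> *v (W (min s (p (Suc k))) \<omega> - W (min s (p k)) \<omega>)"
    using p st by (cases "s \<le> p k"; cases "p k \<le> t"; cases "s \<le> p (Suc k)")
      (simp_all add: step_integral_def matrix_vector_mult_diff_distrib min_def max_def)
qed simp

lemma steps_process_elementary:
  assumes "s < r" "r \<le> t"
  shows "steps_process (elementary_steps N p h s t) r \<omega> = elementary_process N p h r \<omega>"
  unfolding steps_process_def sum_list_elementary_steps elementary_process_def
  using assms by (intro sum.cong) (auto simp: step_process_def indicator_def)

lemma steps_process_elementary_outside:
  assumes "r \<notin> {s<..t}"
  shows "steps_process (elementary_steps N p h s t) r \<omega> = 0"
  unfolding steps_process_def sum_list_elementary_steps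
  using assms by (intro sum.neutral) (auto simp: step_process_def indicator_def)

lemma steps_process_jointly_measurable:
  assumes "\<forall>x\<in>set l. adapted_step x"
  shows "(\<lambda>(r, \<omega>). steps_process l r \<omega>) \<in> borel_measurable (lborel \<Otimes>\<^sub>M M)"
  using assms
proof (induction l)
  case (Cons x l)
  obtain a b h where x: "x = (a, b, h)" by (cases x)
  have [measurable]: "h \<in> borel_measurable M"
    using Cons.prems x measurable_F_imp_M by (auto simp: adapted_step_def)
  have "(\<lambda>(r, \<omega>). step_process x r \<omega>) \<in> borel_measurable (lborel \<Otimes>\<^sub>M M)"
    unfolding x step_process_def prod.case by measurable
  then show ?case using Cons by (simp add: steps_process_def split_beta')
qed (simp add: steps_process_def split_beta')

text \<open>By Tonelli the isometry becomes an identity of L^2 norms over one product space, where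
  approximants and integrands are compared.\<close>

lemma ito_isometry_product:
  assumes "\<forall>x\<in>set l. adapted_step x"
  shows "(\<integral>\<^sup>+\<omega>. ennreal ((norm (steps_integral l \<omega>))\<^sup>2) \<partial>M)
    = (\<integral>\<^sup>+z. ennreal ((norm (steps_process l (fst z) (snd z)))\<^sup>2) \<partial>(lborel \<Otimes>\<^sub>M M))"
proof -
  interpret L: pair_sigma_finite "lborel :: real measure" M ..
  have "(\<lambda>z. steps_process l (fst z) (snd z)) \<in> borel_measurable (lborel \<Otimes>\<^sub>M M)"
    using steps_process_jointly_measurable[OF assms] by (simp add: split_beta')
  then show ?thesis
    unfolding ito_isometry_steps[OF assms] by (subst L.nn_integral_snd[symmetric]) auto
qed

text \<open>Appending negated steps represents a difference of integrands by a single list, to which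
  the isometry applies at once.\<close>

definition negate_step :: "real \<times> real \<times> ('w \<Rightarrow> real^'d^'d) \<Rightarrow> real \<times> real \<times> ('w \<Rightarrow> real^'d^'d)" where
  "negate_step = (\<lambda>(a, b, h). (a, b, \<lambda>\<omega>. - h \<omega>))"

lemma adapted_negate_step: "adapted_step x \<Longrightarrow> adapted_step (negate_step x)"
  by (cases x) (auto simp: adapted_step_def negate_step_def)

lemma matrix_vector_mult_minus: "(- A) *v x = - (A *v (x::real^'n::finite))" for A :: "real^'n^'m::finite"
  by (simp add: matrix_vector_mult_def vec_eq_iff sum_negf)

lemma steps_integral_append_negate:
  "steps_integral (l @ map negate_step l') \<omega> = steps_integral l \<omega> - steps_integral l' \<omega>"
proof -
  have "(\<Sum>x\<leftarrow>map negate_step l'. step_integral x \<omega>) = - (\<Sum>x\<leftarrow>l'. step_integral x \<omega>)"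
    by (induction l') (auto simp: negate_step_def step_integral_def matrix_vector_mult_minus split: prod.splits)
  then show ?thesis by (simp add: steps_integral_def)
qed

lemma steps_process_append_negate:
  "steps_process (l @ map negate_step l') r \<omega> = steps_process l r \<omega> - steps_process l' r \<omega>"
proof -
  have "(\<Sum>x\<leftarrow>map negate_step l'. step_process x r \<omega>) = - (\<Sum>x\<leftarrow>l'. step_process x r \<omega>)"
    by (induction l') (auto simp: negate_step_def step_process_def split: prod.splits)
  then show ?thesis by (simp add: steps_process_def)
qed

lemma ito_isometry_diff:
  assumes "\<forall>x\<in>set l. adapted_step x" "\<forall>x\<in>set l'. adapted_step x"
  shows "(\<integral>\<^sup>+\<omega>. ennreal ((norm (steps_integral l \<omega> - steps_integral l' \<omega>))\<^sup>2) \<partial>M)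
    = (\<integral>\<^sup>+z. ennreal ((norm (steps_process l (fst z) (snd z) - steps_process l' (fst z) (snd z)))\<^sup>2) \<partial>(lborel \<Otimes>\<^sub>M M))"
proof -
  have "\<forall>x\<in>set (l @ map negate_step l'). adapted_step x"
    using assms adapted_negate_step by auto
  from ito_isometry_product[OF this] show ?thesis
    by (simp only: steps_integral_append_negate steps_process_append_negate)
qed

text \<open>The integrand on (s, t], extended by zero, so that it lives on the same product space as
  \<open>steps_process\<close>.\<close>

definition cut :: "real \<Rightarrow> real \<Rightarrow> (real \<Rightarrow> 'w \<Rightarrow> real^'d^'d) \<Rightarrow> real \<times> 'w \<Rightarrow> real^'d^'d" where
  "cut s t H z = indicator {s<..t} (fst z) *\<^sub>R H (fst z) (snd z)"

lemma cut_jointly_measurable: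
  assumes H: "(\<lambda>(s, \<omega>). H s \<omega>) \<in> borel_measurable (restrict_space borel {0..T} \<Otimes>\<^sub>M M)"
    and st: "0 \<le> s" "t \<le> T" "0 \<le> T"
  shows "cut s t H \<in> borel_measurable (lborel \<Otimes>\<^sub>M M)"
proof -
  \<comment> \<open>Joint measurability of H is known on [0, T] only. Clamping time to [0, T] gives
    a function measurable for all times, and the indicator hides the change.\<close>
  have "(\<lambda>r. max 0 (min T r)) \<in> measurable borel (restrict_space borel {0..T})"
    using st by (intro measurable_restrict_space2) auto
  then have "(\<lambda>z. (max 0 (min T (fst z)), snd z)) \<in> measurable (lborel \<Otimes>\<^sub>M M) (restrict_space borel {0..T} \<Otimes>\<^sub>M M)"
    by (intro measurable_Pair measurable_compose[OF measurable_fst]) auto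
  from measurable_compose[OF this H]
  have [measurable]: "(\<lambda>z. H (max 0 (min T (fst z))) (snd z)) \<in> borel_measurable (lborel \<Otimes>\<^sub>M M)" by simp
  have "cut s t H = (\<lambda>z. indicator {s<..t} (fst z) *\<^sub>R H (max 0 (min T (fst z))) (snd z))"
    using st by (auto simp: cut_def indicator_def fun_eq_iff)
  also have "\<dots> \<in> borel_measurable (lborel \<Otimes>\<^sub>M M)" by measurable
  finally show ?thesis .
qed

text \<open>Restriction to (s, t] does not increase the L^2 distance to H, because both functions
  vanish outside that interval.\<close>

lemma nn_integral_cut_elementary_le:
  assumes el: "elementary M F N p h" and st: "0 \<le> s" "s \<le> t" "t \<le> T"
    and H: "(\<lambda>(s, \<omega>). H s \<omega>) \<in> borel_measurable (restrict_space borel {0..T} \<Otimes>\<^sub>M M)"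
  shows "(\<integral>\<^sup>+z. ennreal ((norm (steps_process (elementary_steps N p h s t) (fst z) (snd z) - cut s t H z))\<^sup>2) \<partial>(lborel \<Otimes>\<^sub>M M))
    \<le> (\<integral>\<^sup>+\<omega>. (\<integral>\<^sup>+r\<in>{0..T}. ennreal ((norm (elementary_process N p h r \<omega> - H r \<omega>))\<^sup>2) \<partial>lborel) \<partial>M)"
proof -
  interpret L: pair_sigma_finite "lborel :: real measure" M ..
  have "\<forall>x\<in>set (elementary_steps N p h s t). adapted_step x"
    using adapted_elementary_steps(1)[OF el st(1,2)] by blast
  from steps_process_jointly_measurable[OF this] cut_jointly_measurable[OF H st(1,3)] st
  have "(\<lambda>z. steps_process (elementary_steps N p h s t) (fst z) (snd z) - cut s t H z) \<in> borel_measurable (lborel \<Otimes>\<^sub>M M)"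
    by (intro borel_measurable_diff) (simp_all add: split_beta')
  then have "(\<integral>\<^sup>+z. ennreal ((norm (steps_process (elementary_steps N p h s t) (fst z) (snd z) - cut s t H z))\<^sup>2) \<partial>(lborel \<Otimes>\<^sub>M M))
     = (\<integral>\<^sup>+\<omega>. (\<integral>\<^sup>+r. ennreal ((norm (steps_process (elementary_steps N p h s t) r \<omega> - cut s t H (r, \<omega>)))\<^sup>2) \<partial>lborel) \<partial>M)"
    by (subst L.nn_integral_snd[symmetric]) auto
  also have "\<dots> \<le> (\<integral>\<^sup>+\<omega>. (\<integral>\<^sup>+r\<in>{0..T}. ennreal ((norm (elementary_process N p h r \<omega> - H r \<omega>))\<^sup>2) \<partial>lborel) \<partial>M)"
    using st by (intro nn_integral_mono)
      (auto simp: cut_def indicator_def steps_process_elementary steps_process_elementary_outside)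
  finally show ?thesis .
qed

text \<open>The integrals up to t and up to s come with unrelated approximating sequences, and
  nothing in \<open>has_ito_integral\<close> links them. The sequence for t also approximates the
  integrand on (0, s]; by the isometry its integral up to s is close to that of the other sequence,
  hence to \<open>Is\<close>. The increment is then approximated by steps that start at or after
  s.\<close>

lemma ito_increment_approx:
  assumes It: "has_ito_integral M F W H t It" and Is: "has_ito_integral M F W H s Is"
    and st: "0 \<le> s" "s \<le> t" and e: "0 < e"
  obtains l where "\<forall>x\<in>set l. adapted_step x \<and> s \<le> fst x"
    "(\<integral>\<^sup>+\<omega>. ennreal ((norm (It \<omega> - Is \<omega> - steps_integral l \<omega>))\<^sup>2) \<partial>M) \<le> ennreal e"
    "(\<integral>\<^sup>+z. ennreal ((norm (steps_process l (fst z) (snd z) - cut s t H z))\<^sup>2) \<partial>(lborel \<Otimes>\<^sub>M M)) \<le> ennreal e"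
proof -
  let ?P = "lborel \<Otimes>\<^sub>M M"
  have t0: "0 \<le> t" using st by simp
  have Hm: "(\<lambda>(s, \<omega>). H s \<omega>) \<in> borel_measurable (restrict_space borel {0..t} \<Otimes>\<^sub>M M)"
    and Hm': "(\<lambda>(s, \<omega>). H s \<omega>) \<in> borel_measurable (restrict_space borel {0..s} \<Otimes>\<^sub>M M)"
    and Im: "It \<in> borel_measurable M" "Is \<in> borel_measurable M"
    using It Is by (auto simp: has_ito_integral_def)
  define D where "D t N p h = (\<integral>\<^sup>+\<omega>. (\<integral>\<^sup>+s\<in>{0..t}. ennreal ((norm (elementary_process N p h s \<omega> - H s \<omega>))\<^sup>2) \<partial>lborel) \<partial>M)" for t N p h
  define R where "R t I N p h = (\<integral>\<^sup>+\<omega>. ennreal ((norm (elementary_integral N p h W t \<omega> - I \<omega>))\<^sup>2) \<partial>M)" for t I N p h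
  \<comment> \<open>The estimates below nest as 2c + 2(2c + 2(2c + 2c)) = 22c.\<close>
  define c where "c = ennreal (e / 22)"
  have c: "0 < c" using e by (simp add: c_def)
  have ex: "\<exists>N p h. elementary M F N p h \<and> D t N p h \<le> c \<and> R t I N p h \<le> c" if I: "has_ito_integral M F W H t I" for t I
  proof -
    obtain N p h where el: "\<And>m. elementary M F (N m) (p m) (h m)" and lim: "(\<lambda>m. D t (N m) (p m) (h m)) \<longlonglongrightarrow> 0"
      "(\<lambda>m. R t I (N m) (p m) (h m)) \<longlonglongrightarrow> 0"
      using I unfolding has_ito_integral_def D_def R_def by blast
    have "\<forall>\<^sub>F m in sequentially. D t (N m) (p m) (h m) < c \<and> R t I (N m) (p m) (h m) < c"
      using order_tendstoD(2)[OF lim(1) c] order_tendstoD(2)[OF lim(2) c] by (rule eventually_conj)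
    from eventually_happens'[OF sequentially_bot this]
    obtain m where "D t (N m) (p m) (h m) < c \<and> R t I (N m) (p m) (h m) < c" ..
    then show ?thesis using el[of m] less_imp_le by blast
  qed
  obtain N p h where el: "elementary M F N p h" and DR: "D t N p h \<le> c" "R t It N p h \<le> c" using ex[OF It] by blast
  obtain N' p' h' where el': "elementary M F N' p' h'" and DR': "D s N' p' h' \<le> c" "R s Is N' p' h' \<le> c" using ex[OF Is] by blast
  let ?E = "\<lambda>r \<omega>. elementary_integral N p h W r \<omega>" and ?E' = "\<lambda>r \<omega>. elementary_integral N' p' h' W r \<omega>"
  let ?lt = "elementary_steps N p h s t" and ?lz = "elementary_steps N p h 0 s" and ?lw = "elementary_steps N' p' h' 0 s"
  have ad: "\<forall>x\<in>set ?lt. adapted_step x \<and> s \<le> fst x" "\<forall>x\<in>set ?lz. adapted_step x" "\<forall>x\<in>set ?lw. adapted_step x"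
    using adapted_elementary_steps[OF el st] adapted_elementary_steps[OF el order_refl st(1)]
      adapted_elementary_steps[OF el' order_refl st(1)] by blast+
  have p0: "0 \<le> p k" if "k \<le> N" for k using elementary_nonneg[OF el that] .
  have p0': "0 \<le> p' k" if "k \<le> N'" for k using elementary_nonneg[OF el' that] .
  have E0: "?E 0 \<omega> = 0" "?E' 0 \<omega> = 0" for \<omega>
    unfolding elementary_integral_def using p0 p0' by (auto intro!: sum.neutral simp: min_def)
  have Em: "?E r \<in> borel_measurable M" "?E' r \<in> borel_measurable M" if "0 \<le> r" for r
  proof -
    have "steps_integral (elementary_steps N p h 0 r) = ?E r" "steps_integral (elementary_steps N' p' h' 0 r) = ?E' r"
      using steps_integral_elementary[OF el that] steps_integral_elementary[OF el' that] E0 by auto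
    moreover have "\<forall>x\<in>set (elementary_steps N p h 0 r). adapted_step x" "\<forall>x\<in>set (elementary_steps N' p' h' 0 r). adapted_step x"
      using adapted_elementary_steps[OF el order_refl that] adapted_elementary_steps[OF el' order_refl that] by blast+
    ultimately show "?E r \<in> borel_measurable M" "?E' r \<in> borel_measurable M"
      using steps_integral_measurable[of "elementary_steps N p h 0 r"] steps_integral_measurable[of "elementary_steps N' p' h' 0 r"]
      by simp_all
  qed
  have Pm: "(\<lambda>z. steps_process ?lz (fst z) (snd z)) \<in> borel_measurable ?P" "(\<lambda>z. steps_process ?lw (fst z) (snd z)) \<in> borel_measurable ?P"
    using steps_process_jointly_measurable[OF ad(2)] steps_process_jointly_measurable[OF ad(3)] by (simp_all add: split_beta')
  have sw: "(\<integral>\<^sup>+x. ennreal ((norm (f x - g x))\<^sup>2) \<partial>N) = (\<integral>\<^sup>+x. ennreal ((norm (g x - f x))\<^sup>2) \<partial>N)"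
    for f g :: "'z \<Rightarrow> 'y::real_normed_vector" and N
    by (simp add: norm_minus_commute)
  have D0: "(\<integral>\<^sup>+z. ennreal ((norm (steps_process ?lz (fst z) (snd z) - cut 0 s H z))\<^sup>2) \<partial>?P) \<le> c"
    using order_trans[OF nn_integral_cut_elementary_le[OF el _ st(1) st(2) Hm] DR(1)[unfolded D_def]] by simp
  have D0': "(\<integral>\<^sup>+z. ennreal ((norm (steps_process ?lw (fst z) (snd z) - cut 0 s H z))\<^sup>2) \<partial>?P) \<le> c"
    using order_trans[OF nn_integral_cut_elementary_le[OF el' _ st(1) order_refl Hm'] DR'(1)[unfolded D_def]] by simp
  \<comment> \<open>The two approximants of the integral up to s are compared through their common
    limit integrand \<open>cut 0 s H\<close>.\<close>
  have "(\<integral>\<^sup>+\<omega>. ennreal ((norm (?E' s \<omega> - ?E s \<omega>))\<^sup>2) \<partial>M)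
      = (\<integral>\<^sup>+z. ennreal ((norm (steps_process ?lw (fst z) (snd z) - steps_process ?lz (fst z) (snd z)))\<^sup>2) \<partial>?P)"
    using ito_isometry_diff[OF ad(3,2)] steps_integral_elementary[OF el st(1)] steps_integral_elementary[OF el' st(1)] E0 by simp
  also have "\<dots> \<le> 2 * (\<integral>\<^sup>+z. ennreal ((norm (steps_process ?lw (fst z) (snd z) - cut 0 s H z))\<^sup>2) \<partial>?P)
      + 2 * (\<integral>\<^sup>+z. ennreal ((norm (cut 0 s H z - steps_process ?lz (fst z) (snd z)))\<^sup>2) \<partial>?P)"
    by (intro nn_integral_norm_diff_sq_le Pm cut_jointly_measurable[OF Hm order_refl st(2) t0])
  also have "\<dots> \<le> 2 * c + 2 * c"
    using D0 D0' by (intro add_mono mult_left_mono) (simp_all add: norm_minus_commute)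
  finally have EE: "(\<integral>\<^sup>+\<omega>. ennreal ((norm (?E' s \<omega> - ?E s \<omega>))\<^sup>2) \<partial>M) \<le> 2 * c + 2 * c" .
  have "(\<integral>\<^sup>+\<omega>. ennreal ((norm (Is \<omega> - ?E s \<omega>))\<^sup>2) \<partial>M)
      \<le> 2 * (\<integral>\<^sup>+\<omega>. ennreal ((norm (Is \<omega> - ?E' s \<omega>))\<^sup>2) \<partial>M) + 2 * (\<integral>\<^sup>+\<omega>. ennreal ((norm (?E' s \<omega> - ?E s \<omega>))\<^sup>2) \<partial>M)"
    by (intro nn_integral_norm_diff_sq_le Im Em st)
  also have "\<dots> \<le> 2 * c + 2 * (2 * c + 2 * c)"
    using DR'(2) EE unfolding R_def by (intro add_mono mult_left_mono) (simp_all add: norm_minus_commute)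
  finally have IE: "(\<integral>\<^sup>+\<omega>. ennreal ((norm (?E s \<omega> - Is \<omega>))\<^sup>2) \<partial>M) \<le> 2 * c + 2 * (2 * c + 2 * c)"
    by (simp add: norm_minus_commute)
  have "(\<integral>\<^sup>+\<omega>. ennreal ((norm (It \<omega> - Is \<omega> - steps_integral ?lt \<omega>))\<^sup>2) \<partial>M)
     = (\<integral>\<^sup>+\<omega>. ennreal ((norm ((It \<omega> - ?E t \<omega>) + (?E s \<omega> - Is \<omega>)))\<^sup>2) \<partial>M)"
    unfolding steps_integral_elementary[OF el st(2)] by (simp add: algebra_simps)
  also have "\<dots> \<le> 2 * (\<integral>\<^sup>+\<omega>. ennreal ((norm (It \<omega> - ?E t \<omega>))\<^sup>2) \<partial>M) + 2 * (\<integral>\<^sup>+\<omega>. ennreal ((norm (?E s \<omega> - Is \<omega>))\<^sup>2) \<partial>M)"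
    by (intro nn_integral_norm_add_sq_le borel_measurable_diff Im Em st t0)
  also have "\<dots> \<le> 2 * c + 2 * (2 * c + 2 * (2 * c + 2 * c))"
    using DR(2) IE unfolding R_def by (intro add_mono mult_left_mono) (simp_all add: norm_minus_commute)
  also have "\<dots> = ennreal e"
  proof -
    define x where "x = e / 22"
    have x: "0 \<le> x" using e by (simp add: x_def)
    have "ennreal e = ennreal (2 * x + 2 * (2 * x + 2 * (2 * x + 2 * x)))" by (simp add: x_def)
    also have "\<dots> = 2 * ennreal x + 2 * ennreal (2 * x + 2 * (2 * x + 2 * x))" using x by (intro ennreal_twice_add) auto
    also have "ennreal (2 * x + 2 * (2 * x + 2 * x)) = 2 * ennreal x + 2 * ennreal (2 * x + 2 * x)" using x by (intro ennreal_twice_add) auto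
    also have "ennreal (2 * x + 2 * x) = 2 * ennreal x + 2 * ennreal x" using x by (intro ennreal_twice_add) auto
    finally show ?thesis by (simp only: c_def x_def)
  qed
  finally have 1: "(\<integral>\<^sup>+\<omega>. ennreal ((norm (It \<omega> - Is \<omega> - steps_integral ?lt \<omega>))\<^sup>2) \<partial>M) \<le> ennreal e" .
  have "(\<integral>\<^sup>+z. ennreal ((norm (steps_process ?lt (fst z) (snd z) - cut s t H z))\<^sup>2) \<partial>?P) \<le> c"
    using order_trans[OF nn_integral_cut_elementary_le[OF el st order_refl Hm] DR(1)[unfolded D_def]] .
  also have "c \<le> ennreal e" using e by (auto simp: c_def intro!: ennreal_leI)
  finally show thesis using that[OF ad(1) 1] by blast
qed

lemma ito_increment_frozen_error:
  assumes It: "has_ito_integral M F W H t It" and Is: "has_ito_integral M F W H s Is"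
    and st: "0 \<le> s" "s \<le> t" and h0: "h0 \<in> borel_measurable (F s)" "\<And>\<omega>. \<omega> \<in> space M \<Longrightarrow> norm (h0 \<omega>) \<le> B"
  shows "(\<integral>\<^sup>+\<omega>. ennreal ((norm (It \<omega> - Is \<omega> - h0 \<omega> *v (W t \<omega> - W s \<omega>)))\<^sup>2) \<partial>M)
    \<le> 4 * (\<integral>\<^sup>+z. ennreal ((norm (cut s t (\<lambda>r \<omega>. H r \<omega> - h0 \<omega>) z))\<^sup>2) \<partial>(lborel \<Otimes>\<^sub>M M))"
    (is "?L \<le> 4 * ?R")
proof (rule ennreal_le_epsilon)
  fix e :: real assume e: "0 < e"
  let ?P = "lborel \<Otimes>\<^sub>M M" and ?g = "\<lambda>\<omega>. h0 \<omega> *v (W t \<omega> - W s \<omega>)"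
  have t0: "0 \<le> t" using st by simp
  have Hm: "(\<lambda>(s, \<omega>). H s \<omega>) \<in> borel_measurable (restrict_space borel {0..t} \<Otimes>\<^sub>M M)"
    and Im: "It \<in> borel_measurable M" "Is \<in> borel_measurable M"
    using It Is by (auto simp: has_ito_integral_def)
  \<comment> \<open>The errors of the approximation add up to 2(e/6) + 4(e/6) = e.\<close>
  have e6: "0 < e / 6" using e by simp
  obtain l where l: "\<forall>x\<in>set l. adapted_step x \<and> s \<le> fst x"
    "(\<integral>\<^sup>+\<omega>. ennreal ((norm (It \<omega> - Is \<omega> - steps_integral l \<omega>))\<^sup>2) \<partial>M) \<le> ennreal (e / 6)"
    "(\<integral>\<^sup>+z. ennreal ((norm (steps_process l (fst z) (snd z) - cut s t H z))\<^sup>2) \<partial>?P) \<le> ennreal (e / 6)"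
    using ito_increment_approx[OF It Is st e6] .
  let ?l0 = "[(s, t, h0)]"
  have ad0: "\<forall>x\<in>set ?l0. adapted_step x" using h0 st by (auto simp: adapted_step_def)
  have g: "steps_integral ?l0 = ?g" by (auto simp: steps_integral_def step_integral_def)
  have gm: "?g \<in> borel_measurable M" using steps_integral_measurable[OF ad0] g by simp
  have ad: "\<forall>x\<in>set l. adapted_step x" using l(1) by blast
  have p0: "steps_process ?l0 (fst z) (snd z) = cut s t (\<lambda>r \<omega>. h0 \<omega>) z" for z
    by (simp add: steps_process_def step_process_def cut_def)
  have pm: "(\<lambda>z. steps_process l (fst z) (snd z)) \<in> borel_measurable ?P" "cut s t (\<lambda>r \<omega>. h0 \<omega>) \<in> borel_measurable ?P"
    using steps_process_jointly_measurable[OF ad] steps_process_jointly_measurable[OF ad0] p0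
    by (simp_all add: split_beta')
  have cm: "cut s t H \<in> borel_measurable ?P"
    by (rule cut_jointly_measurable[OF Hm st(1) order_refl t0])
  have cd: "cut s t H z - cut s t (\<lambda>r \<omega>. h0 \<omega>) z = cut s t (\<lambda>r \<omega>. H r \<omega> - h0 \<omega>) z" for z
    by (simp add: cut_def scaleR_diff_right)
  have "(\<integral>\<^sup>+\<omega>. ennreal ((norm (steps_integral l \<omega> - ?g \<omega>))\<^sup>2) \<partial>M)
      = (\<integral>\<^sup>+z. ennreal ((norm (steps_process l (fst z) (snd z) - cut s t (\<lambda>r \<omega>. h0 \<omega>) z))\<^sup>2) \<partial>?P)"
    using ito_isometry_diff[OF ad ad0] by (simp add: g p0)
  also have "\<dots> \<le> 2 * (\<integral>\<^sup>+z. ennreal ((norm (steps_process l (fst z) (snd z) - cut s t H z))\<^sup>2) \<partial>?P)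
      + 2 * (\<integral>\<^sup>+z. ennreal ((norm (cut s t H z - cut s t (\<lambda>r \<omega>. h0 \<omega>) z))\<^sup>2) \<partial>?P)"
    by (rule nn_integral_norm_diff_sq_le[OF pm(1) cm pm(2)])
  also have "\<dots> \<le> 2 * ennreal (e / 6) + 2 * ?R"
    using l(3) by (intro add_mono mult_left_mono) (simp_all add: cd)
  finally have 1: "(\<integral>\<^sup>+\<omega>. ennreal ((norm (steps_integral l \<omega> - ?g \<omega>))\<^sup>2) \<partial>M) \<le> 2 * ennreal (e / 6) + 2 * ?R" .
  have "?L \<le> 2 * (\<integral>\<^sup>+\<omega>. ennreal ((norm (It \<omega> - Is \<omega> - steps_integral l \<omega>))\<^sup>2) \<partial>M)
      + 2 * (\<integral>\<^sup>+\<omega>. ennreal ((norm (steps_integral l \<omega> - ?g \<omega>))\<^sup>2) \<partial>M)"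
    by (rule nn_integral_norm_diff_sq_le[OF borel_measurable_diff[OF Im] steps_integral_measurable[OF ad] gm])
  also have "\<dots> \<le> 2 * ennreal (e / 6) + 2 * (2 * ennreal (e / 6) + 2 * ?R)"
    using l(2) 1 by (intro add_mono mult_left_mono) auto
  also have "\<dots> = 4 * ?R + (2 * ennreal (e / 6) + 2 * (2 * ennreal (e / 6)))"
    by (simp add: distrib_left add_ac mult.assoc[symmetric])
  also have "2 * ennreal (e / 6) + 2 * (2 * ennreal (e / 6)) = ennreal e"
  proof -
    have "2 * ennreal (e / 6) + 2 * (2 * ennreal (e / 6)) = ennreal (2 * (e / 6) + 2 * (2 * (e / 6)))"
      using e ennreal_twice_add[of "e / 6" "2 * (e / 6)"] ennreal_mult[of 2 "e / 6"] by simp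
    also have "2 * (e / 6) + 2 * (2 * (e / 6)) = e" by simp
    finally show ?thesis .
  qed
  finally show "?L \<le> 4 * ?R + ennreal e" .
qed

text \<open>The martingale property, tested against bounded variables known at time s: it holds
  exactly for step integrals starting at or after s and passes to the L^2 limit.\<close>

lemma has_bochner_integral_inner_ito_increment:
  assumes It: "has_ito_integral M F W H t It" and Is: "has_ito_integral M F W H s Is"
    and st: "0 \<le> s" "s \<le> t"
    and fin: "integrable M (\<lambda>\<omega>. (norm (It \<omega> - Is \<omega>))\<^sup>2)"
    and Z: "Z \<in> borel_measurable (F s)" "\<And>\<omega>. \<omega> \<in> space M \<Longrightarrow> norm (Z \<omega> :: real^'d) \<le> K"
  shows "has_bochner_integral M (\<lambda>\<omega>. Z \<omega> \<bullet> (It \<omega> - Is \<omega>)) 0"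
proof -
  let ?J = "\<lambda>\<omega>. It \<omega> - Is \<omega>"
  have Im: "It \<in> borel_measurable M" "Is \<in> borel_measurable M"
    using It Is by (auto simp: has_ito_integral_def)
  have Zm: "Z \<in> borel_measurable M" using Z(1) by (rule measurable_F_imp_M)
  obtain \<omega>0 where "\<omega>0 \<in> space M" using not_empty by blast
  then have K: "0 \<le> K" using order_trans[OF norm_ge_zero Z(2)] by blast
  \<comment> \<open>Takes the place of Cauchy-Schwarz in L^2: with a second moment of at most d^2,
    both terms have mean at most K d.\<close>
  have young: "\<bar>Z \<omega> \<bullet> y\<bar> \<le> K * (d + (norm y)\<^sup>2 / d)" if "\<omega> \<in> space M" "0 < d" for \<omega> y d
  proof -
    have "norm y \<le> d + (norm y)\<^sup>2 / d"
    proof (cases "norm y \<le> d")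
      case False
      then have "norm y * d \<le> norm y * norm y" by (intro mult_left_mono) auto
      then have "norm y \<le> (norm y)\<^sup>2 / d" using that by (simp add: pos_le_divide_eq power2_eq_square)
      then show ?thesis using that by simp
    qed (use that in \<open>simp add: add_increasing2\<close>)
    then have "norm (Z \<omega>) * norm y \<le> K * (d + (norm y)\<^sup>2 / d)"
      using Z(2)[OF that(1)] K by (intro mult_mono) auto
    with Cauchy_Schwarz_ineq2[of "Z \<omega>" y] show ?thesis by linarith
  qed
  have int: "integrable M (\<lambda>\<omega>. Z \<omega> \<bullet> ?J \<omega>)"
  proof (rule Bochner_Integration.integrable_bound)
    show "integrable M (\<lambda>\<omega>. K * (1 + (norm (?J \<omega>))\<^sup>2 / 1))" using fin by simp
    show "AE \<omega> in M. norm (Z \<omega> \<bullet> ?J \<omega>) \<le> norm (K * (1 + (norm (?J \<omega>))\<^sup>2 / 1))"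
      using young[of _ 1] by (intro AE_I2) (force intro: order_trans[OF _ abs_ge_self])
  qed (use Zm Im in measurable)
  have "\<bar>expectation (\<lambda>\<omega>. Z \<omega> \<bullet> ?J \<omega>)\<bar> \<le> 2 * K * d" if d: "0 < d" for d
  proof -
    have d2: "0 < d\<^sup>2" using d by simp
    obtain l where l: "\<forall>x\<in>set l. adapted_step x \<and> s \<le> fst x"
      "(\<integral>\<^sup>+\<omega>. ennreal ((norm (?J \<omega> - steps_integral l \<omega>))\<^sup>2) \<partial>M) \<le> ennreal (d\<^sup>2)"
      "(\<integral>\<^sup>+z. ennreal ((norm (steps_process l (fst z) (snd z) - cut s t H z))\<^sup>2) \<partial>(lborel \<Otimes>\<^sub>M M)) \<le> ennreal (d\<^sup>2)"
      using ito_increment_approx[OF It Is st d2] .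
    let ?R = "\<lambda>\<omega>. ?J \<omega> - steps_integral l \<omega>"
    have Rm: "?R \<in> borel_measurable M"
      using Im steps_integral_measurable[of l] l(1) by (intro borel_measurable_diff) auto
    have Rint: "integrable M (\<lambda>\<omega>. (norm (?R \<omega>))\<^sup>2)"
      using l(2) Rm by (intro integrableI_bounded) (auto simp: less_top[symmetric] top_unique)
    have "expectation (\<lambda>\<omega>. (norm (?R \<omega>))\<^sup>2) \<le> d\<^sup>2"
      using l(2) Rint by (simp add: nn_integral_eq_integral)
    have hb: "has_bochner_integral M (\<lambda>\<omega>. Z \<omega> \<bullet> steps_integral l \<omega>) 0"
      by (rule expectation_inner_steps_integral[OF l(1) st(1) Z])
    then have "expectation (\<lambda>\<omega>. Z \<omega> \<bullet> ?J \<omega>) = expectation (\<lambda>\<omega>. Z \<omega> \<bullet> ?R \<omega>)"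
      using int by (simp add: inner_diff_right has_bochner_integral_iff)
    also have "\<bar>\<dots>\<bar> \<le> expectation (\<lambda>\<omega>. \<bar>Z \<omega> \<bullet> ?R \<omega>\<bar>)" by (rule integral_abs_bound)
    also have "\<dots> \<le> expectation (\<lambda>\<omega>. K * (d + (norm (?R \<omega>))\<^sup>2 / d))"
    proof (rule integral_mono)
      show "integrable M (\<lambda>\<omega>. \<bar>Z \<omega> \<bullet> ?R \<omega>\<bar>)"
        using int hb by (intro integrable_abs) (simp only: inner_diff_right has_bochner_integral_iff Bochner_Integration.integrable_diff)
    qed (use Rint young d in auto)
    also have "\<dots> = K * (d + expectation (\<lambda>\<omega>. (norm (?R \<omega>))\<^sup>2) / d)"
      using Rint by (simp add: prob_space)
    also have "\<dots> \<le> K * (d + d\<^sup>2 / d)"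
      using \<open>expectation (\<lambda>\<omega>. (norm (?R \<omega>))\<^sup>2) \<le> d\<^sup>2\<close> K d by (intro mult_left_mono add_left_mono divide_right_mono) auto
    also have "\<dots> = 2 * K * d" using d by (simp add: power2_eq_square)
    finally show ?thesis .
  qed
  note bound = this
  have "\<bar>expectation (\<lambda>\<omega>. Z \<omega> \<bullet> ?J \<omega>)\<bar> \<le> 0"
  proof (rule field_le_epsilon)
    fix e :: real assume e: "0 < e"
    \<comment> \<open>The denominator 2K + 1 remains positive for K = 0.\<close>
    have "\<bar>expectation (\<lambda>\<omega>. Z \<omega> \<bullet> ?J \<omega>)\<bar> \<le> 2 * K * (e / (2 * K + 1))"
      using e K by (intro bound divide_pos_pos) auto
    also have "\<dots> \<le> e" using e K by (simp add: field_simps)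
    finally show "\<bar>expectation (\<lambda>\<omega>. Z \<omega> \<bullet> ?J \<omega>)\<bar> \<le> 0 + e" by simp
  qed
  with int show ?thesis by (simp add: has_bochner_integral_iff)
qed

end

section \<open>Dynkin's formula for solutions of SDEs\<close>

text \<open>\<open>a\<close> is the diffusion matrix \<sigma> \<sigma>^T, not its root \<sigma>; the
  formula therefore needs regularity of the matrix field alone.\<close>

definition generator :: "(real^'d::finite \<Rightarrow> real^'d) \<Rightarrow> (real^'d \<Rightarrow> real^'d^'d) \<Rightarrow> (real^'d \<Rightarrow> real) \<Rightarrow> real^'d \<Rightarrow> real" where
  "generator b a g y = (\<Sum>i\<in>UNIV. b y $ i * partial_deriv i g y)
     + (\<Sum>i\<in>UNIV. \<Sum>j\<in>UNIV. a y $ i $ j * partial_deriv j (partial_deriv i g) y) / 2"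

lemma integral_le_of_nn_integral_le:
  fixes f :: "'a \<Rightarrow> real"
  assumes "f \<in> borel_measurable N" "\<And>x. 0 \<le> f x" "(\<integral>\<^sup>+x. ennreal (f x) \<partial>N) \<le> ennreal c" "0 \<le> c"
  shows "integrable N f" "(\<integral>x. f x \<partial>N) \<le> c"
proof -
  show i: "integrable N f"
    using assms by (intro integrableI_nonneg) (auto intro: le_less_trans)
  then show "(\<integral>x. f x \<partial>N) \<le> c"
    using assms by (simp add: nn_integral_eq_integral)
qed

text \<open>Gives first moments from second moments; taking c of the expected size of y yields the
  order that Cauchy-Schwarz would give.\<close>

lemma le_add_square_div: "0 < c \<Longrightarrow> y \<le> c + y\<^sup>2 / c" for y c :: real
proof -
  assume c: "0 < c"
  have "y * c \<le> c\<^sup>2 + y\<^sup>2"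
    using sum_squares_bound[of y c] zero_le_power2[of y] zero_le_power2[of c] by linarith
  then have "y * c \<le> (c + y\<^sup>2 / c) * c" using c by (simp add: distrib_right power2_eq_square)
  then show ?thesis using c by simp
qed

lemma norm_vec_power4_le:
  fixes v :: "real^'d::finite"
  shows "norm v ^ 4 \<le> CARD('d) * (\<Sum>i\<in>UNIV. (v $ i) ^ 4)"
proof -
  have "norm v ^ 4 = ((norm v)\<^sup>2)\<^sup>2" by simp
  also have "\<dots> = (\<Sum>i\<in>UNIV. (v $ i)\<^sup>2)\<^sup>2"
    by (simp add: norm_vec_def L2_set_def sum_nonneg)
  also have "\<dots> \<le> CARD('d) * (\<Sum>i\<in>UNIV. ((v $ i)\<^sup>2)\<^sup>2)"
    using sum_squared_le_sum_of_squares[of "\<lambda>i. (v $ i)\<^sup>2" UNIV] by (simp add: mult.commute)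
  finally show ?thesis by simp
qed

text \<open>The bracket is the constant in the second moment bound of an increment of the solution;
  the summand 1 comes from Young's inequality in the passage to the first moment.\<close>

definition moment_const :: "nat \<Rightarrow> real \<Rightarrow> real" where
  "moment_const d K = 1 + (2 * (real d * K)\<^sup>2 + 8 * (real d * K))"

text \<open>The step size is hidden here: \<open>a\<close> is later \<eta> times a fixed matrix
  field, and the drift may depend on \<eta> as well. One constant \<open>K\<close> serves for all
  \<eta> \<le> 1.\<close>

locale sde = brownian M F W
  for M :: "'w measure" and F and W :: "real \<Rightarrow> 'w \<Rightarrow> real^'d::finite" +
  fixes b :: "real^'d \<Rightarrow> real^'d" and a :: "real^'d \<Rightarrow> real^'d^'d" and x :: "real^'d"
    and X :: "real \<Rightarrow> 'w \<Rightarrow> real^'d" and K :: real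
  assumes sol: "sde_solution M F W b (\<lambda>y. psd_sqrt (a y)) x X"
    and b_Clip: "\<And>i. Clip 0 K (\<lambda>y. b y $ i)"
    and a_Clip: "\<And>i j. Clip 0 K (\<lambda>y. a y $ i $ j)"
    and a_psd: "\<And>y. pos_semidef (a y)"
begin

abbreviation "\<sigma> y \<equiv> psd_sqrt (a y)"

lemma K_nonneg: "0 \<le> K" using Clip_nonneg[OF b_Clip] .

lemma norm_b_le: "norm (b y) \<le> real CARD('d) * K"
proof -
  have "norm (b y) \<le> (\<Sum>i\<in>UNIV. \<bar>b y $ i\<bar>)" by (rule norm_le_l1_cart)
  also have "\<dots> \<le> (\<Sum>i\<in>(UNIV::'d set). K)" using Clip_bound[OF b_Clip] by (intro sum_mono) auto
  finally show ?thesis by simp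
qed

lemma norm_b_diff_le: "norm (b y - b z) \<le> (real CARD('d))\<^sup>2 * K * norm (y - z)"
proof -
  have "norm (b y - b z) \<le> (\<Sum>i\<in>UNIV. \<bar>(b y - b z) $ i\<bar>)" by (rule norm_le_l1_cart)
  also have "\<dots> \<le> (\<Sum>i\<in>(UNIV::'d set). K * real CARD('d) * norm (y - z))"
    using Clip_lipschitz[OF b_Clip] by (intro sum_mono) auto
  finally show ?thesis by (simp add: power2_eq_square mult_ac)
qed

lemma norm_sigma_le: "norm (\<sigma> y) \<le> sqrt (real CARD('d) * K)"
proof -
  have "(norm (\<sigma> y))\<^sup>2 \<le> (\<Sum>i\<in>(UNIV::'d set). K)"
    unfolding norm_psd_sqrt[OF a_psd] using Clip_bound[OF a_Clip] by (intro sum_mono) (meson abs_le_D1)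
  then show ?thesis by (intro real_le_rsqrt) simp
qed

text \<open>Squaring the Hoelder estimate of the root gives 4 n^4 times the distance of the
  diffusion matrices, n being the dimension. Their n^2 entries have Lipschitz constant K n, which
  accounts for n^7.\<close>

lemma norm_sigma_diff_sq_le: "(norm (\<sigma> y - \<sigma> z))\<^sup>2 \<le> 4 * real CARD('d) ^ 7 * K * norm (y - z)"
proof -
  have "norm (a y - a z) \<le> (\<Sum>i\<in>UNIV. \<Sum>j\<in>UNIV. \<bar>(a y - a z) $ i $ j\<bar>)"
    by (rule norm_matrix_le_sum_abs)
  also have "\<dots> \<le> (\<Sum>i\<in>(UNIV::'d set). \<Sum>j\<in>(UNIV::'d set). K * real CARD('d) * norm (y - z))"
    using Clip_lipschitz[OF a_Clip] by (intro sum_mono) auto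
  finally have 1: "norm (a y - a z) \<le> real CARD('d) ^ 3 * K * norm (y - z)" by (simp add: power3_eq_cube mult_ac)
  have "(norm (\<sigma> y - \<sigma> z))\<^sup>2 \<le> (2 * CARD('d)^2 * sqrt (norm (a y - a z)))\<^sup>2"
    by (intro power_mono norm_psd_sqrt_diff_le a_psd) auto
  also have "\<dots> = 4 * real CARD('d) ^ 4 * norm (a y - a z)" by (simp add: power_mult_distrib power_mult[symmetric])
  also have "\<dots> \<le> 4 * real CARD('d) ^ 4 * (real CARD('d) ^ 3 * K * norm (y - z))"
    by (intro mult_left_mono 1) auto
  also have "\<dots> = 4 * real CARD('d) ^ 7 * K * norm (y - z)"
    by (simp add: eval_nat_numeral mult_ac)
  finally show ?thesis .
qed

lemma X_measurable_F: "0 \<le> t \<Longrightarrow> X t \<in> borel_measurable (F t)"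
  using sol by (simp add: sde_solution_def)

lemma X_measurable: "0 \<le> t \<Longrightarrow> X t \<in> borel_measurable M"
  using X_measurable_F measurable_F_imp_M by blast

lemma X_continuous: "\<omega> \<in> space M \<Longrightarrow> continuous_on {0..} (\<lambda>t. X t \<omega>)"
  using sol by (simp add: sde_solution_def)

lemma X_measurable_comp_F: "0 \<le> t \<Longrightarrow> g \<in> borel_measurable borel \<Longrightarrow> (\<lambda>\<omega>. g (X t \<omega>)) \<in> borel_measurable (F t)"
  using measurable_compose[OF X_measurable_F] .

lemma X_measurable_comp: "0 \<le> t \<Longrightarrow> g \<in> borel_measurable borel \<Longrightarrow> (\<lambda>\<omega>. g (X t \<omega>)) \<in> borel_measurable M"
  using measurable_compose[OF X_measurable] .

lemma integrable_Clip_X: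
  assumes "Clip m L g" "0 \<le> t"
  shows "integrable M (\<lambda>\<omega>. g (X t \<omega>))"
  using Clip_bound[OF assms(1)] X_measurable_comp[OF assms(2) Clip_measurable[OF assms(1)]]
  by (intro integrable_const_bound[of _ L]) auto

lemma continuous_b: "continuous_on A b"
proof -
  have "((real CARD('d))\<^sup>2 * K)-lipschitz_on A b"
    using norm_b_diff_le K_nonneg by (intro lipschitz_onI) (auto simp: dist_norm)
  then show ?thesis by (rule lipschitz_on_continuous_on)
qed

lemma continuous_sigma: "continuous_on UNIV (\<lambda>y. \<sigma> y)"
proof -
  have "((\<lambda>z. \<sigma> z) \<longlongrightarrow> \<sigma> y) (at y)" for y
  proof -
    have "((\<lambda>z. sqrt (4 * real CARD('d) ^ 7 * K * norm (z - y))) \<longlongrightarrow> sqrt (4 * real CARD('d) ^ 7 * K * norm (y - y))) (at y)"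
      by (intro tendsto_intros)
    then have l: "((\<lambda>z. sqrt (4 * real CARD('d) ^ 7 * K * norm (z - y))) \<longlongrightarrow> 0) (at y)" by simp
    have "norm (\<sigma> z - \<sigma> y) \<le> sqrt (4 * real CARD('d) ^ 7 * K * norm (z - y))" for z
      by (intro real_le_rsqrt norm_sigma_diff_sq_le)
    then show ?thesis by (intro LIM_zero_cancel[OF Lim_null_comparison[OF _ l]]) simp
  qed
  then show ?thesis by (simp add: continuous_on_def)
qed

lemma sigma_X_measurable_F: "0 \<le> s \<Longrightarrow> (\<lambda>\<omega>. \<sigma> (X s \<omega>)) \<in> borel_measurable (F s)"
  by (intro X_measurable_comp_F borel_measurable_continuous_onI continuous_sigma)

lemma b_X_integrable_on:
  assumes "\<omega> \<in> space M" "0 \<le> s"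
  shows "(\<lambda>r. b (X r \<omega>)) integrable_on {s..t}" "continuous_on {s..t} (\<lambda>r. X r \<omega>)"
proof -
  show c: "continuous_on {s..t} (\<lambda>r. X r \<omega>)"
    using continuous_on_subset[OF X_continuous[OF assms(1)]] assms(2) by auto
  have "continuous_on {s..t} (\<lambda>r. b (X r \<omega>))"
    by (rule continuous_on_compose2[OF continuous_b[of UNIV] c]) auto
  then show "(\<lambda>r. b (X r \<omega>)) integrable_on {s..t}" by (rule integrable_continuous_interval)
qed

section \<open>Increments of a solution\<close>

lemma X_increment:
  assumes st: "0 \<le> s" "s \<le> t"
  obtains It Is where "has_ito_integral M F W (\<lambda>r \<omega>. \<sigma> (X r \<omega>)) t It" "has_ito_integral M F W (\<lambda>r \<omega>. \<sigma> (X r \<omega>)) s Is"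
    "AE \<omega> in M. X t \<omega> - X s \<omega> = integral {s..t} (\<lambda>r. b (X r \<omega>)) + (It \<omega> - Is \<omega>)"
proof -
  have sol_ito: "\<forall>t\<ge>0. \<exists>I. has_ito_integral M F W (\<lambda>s \<omega>. \<sigma> (X s \<omega>)) t I \<and>
      (AE \<omega> in M. (\<lambda>s. b (X s \<omega>)) absolutely_integrable_on {0..t} \<and>
         X t \<omega> = x + integral {0..t} (\<lambda>s. b (X s \<omega>)) + I \<omega>)"
    using sol unfolding sde_solution_def by (elim conjE)
  have "\<exists>I. has_ito_integral M F W (\<lambda>r \<omega>. \<sigma> (X r \<omega>)) t I \<and> (AE \<omega> in M. X t \<omega> = x + integral {0..t} (\<lambda>r. b (X r \<omega>)) + I \<omega>)"
    if "0 \<le> t" for t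
  proof -
    from sol_ito[rule_format, OF that] obtain I where I: "has_ito_integral M F W (\<lambda>r \<omega>. \<sigma> (X r \<omega>)) t I"
      and AE: "AE \<omega> in M. (\<lambda>r. b (X r \<omega>)) absolutely_integrable_on {0..t} \<and> X t \<omega> = x + integral {0..t} (\<lambda>r. b (X r \<omega>)) + I \<omega>"
      by blast
    from AE have "AE \<omega> in M. X t \<omega> = x + integral {0..t} (\<lambda>r. b (X r \<omega>)) + I \<omega>"
      by (rule AE_mp) auto
    with I show ?thesis by blast
  qed
  from this[of t] this[of s] obtain It Is where I: "has_ito_integral M F W (\<lambda>r \<omega>. \<sigma> (X r \<omega>)) t It" "has_ito_integral M F W (\<lambda>r \<omega>. \<sigma> (X r \<omega>)) s Is"
    and AE: "AE \<omega> in M. X t \<omega> = x + integral {0..t} (\<lambda>r. b (X r \<omega>)) + It \<omega>" "AE \<omega> in M. X s \<omega> = x + integral {0..s} (\<lambda>r. b (X r \<omega>)) + Is \<omega>"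
    using st by force
  have "AE \<omega> in M. X t \<omega> - X s \<omega> = integral {s..t} (\<lambda>r. b (X r \<omega>)) + (It \<omega> - Is \<omega>)"
    using AE AE_space
  proof eventually_elim
    case (elim \<omega>)
    have "integral {0..s} (\<lambda>r. b (X r \<omega>)) + integral {s..t} (\<lambda>r. b (X r \<omega>)) = integral {0..t} (\<lambda>r. b (X r \<omega>))"
      using b_X_integrable_on(1)[OF elim(3) order_refl] st by (intro Henstock_Kurzweil_Integration.integral_combine) auto
    then show ?case using elim(1,2) by (simp add: algebra_simps)
  qed
  with I show thesis using that by blast
qed

lemma drift_increment_le:
  assumes "\<omega> \<in> space M" "0 \<le> s" "s \<le> t"
  shows "norm (integral {s..t} (\<lambda>r. b (X r \<omega>))) \<le> real CARD('d) * K * (t - s)"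
  using integral_bound[of s t "\<lambda>r. b (X r \<omega>)" "real CARD('d) * K"] assms norm_b_le
    continuous_on_compose2[OF continuous_b[of UNIV] b_X_integrable_on(2)[OF assms(1,2)]] by auto

text \<open>Tonelli reduces the error in the product space to a bound at each single time; the joint
  measurability of \<sigma>(X) is part of \<open>has_ito_integral\<close>.\<close>

lemma nn_integral_cut_X_le:
  assumes st: "0 \<le> s" "s \<le> t" and I: "has_ito_integral M F W (\<lambda>r \<omega>. \<sigma> (X r \<omega>)) t It"
    and h0: "h0 \<in> borel_measurable M"
    and bnd: "\<And>r. s < r \<Longrightarrow> r \<le> t \<Longrightarrow> (\<integral>\<^sup>+\<omega>. ennreal ((norm (\<sigma> (X r \<omega>) - h0 \<omega>))\<^sup>2) \<partial>M) \<le> ennreal c" and c: "0 \<le> c"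
  shows "(\<integral>\<^sup>+z. ennreal ((norm (cut s t (\<lambda>r \<omega>. \<sigma> (X r \<omega>) - h0 \<omega>) z))\<^sup>2) \<partial>(lborel \<Otimes>\<^sub>M M)) \<le> ennreal (c * (t - s))"
proof -
  interpret L: pair_sigma_finite "lborel :: real measure" M ..
  have t0: "0 \<le> t" using st by simp
  have m1: "cut s t (\<lambda>r \<omega>. \<sigma> (X r \<omega>)) \<in> borel_measurable (lborel \<Otimes>\<^sub>M M)"
    using I st by (intro cut_jointly_measurable[OF _ st(1) order_refl t0]) (simp add: has_ito_integral_def)
  have m2: "cut s t (\<lambda>r \<omega>. h0 \<omega>) \<in> borel_measurable (lborel \<Otimes>\<^sub>M M)"
    unfolding cut_def[abs_def] using h0 by measurable
  have "cut s t (\<lambda>r \<omega>. \<sigma> (X r \<omega>) - h0 \<omega>) = (\<lambda>z. cut s t (\<lambda>r \<omega>. \<sigma> (X r \<omega>)) z - cut s t (\<lambda>r \<omega>. h0 \<omega>) z)"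
    by (simp add: cut_def scaleR_diff_right fun_eq_iff)
  with m1 m2 have m: "cut s t (\<lambda>r \<omega>. \<sigma> (X r \<omega>) - h0 \<omega>) \<in> borel_measurable (lborel \<Otimes>\<^sub>M M)" by simp
  have "(\<integral>\<^sup>+z. ennreal ((norm (cut s t (\<lambda>r \<omega>. \<sigma> (X r \<omega>) - h0 \<omega>) z))\<^sup>2) \<partial>(lborel \<Otimes>\<^sub>M M))
      = (\<integral>\<^sup>+r. \<integral>\<^sup>+\<omega>. ennreal ((norm (cut s t (\<lambda>r \<omega>. \<sigma> (X r \<omega>) - h0 \<omega>) (r, \<omega>)))\<^sup>2) \<partial>M \<partial>lborel)"
    using m by (subst nn_integral_fst[symmetric]) auto
  also have "\<dots> \<le> (\<integral>\<^sup>+r. ennreal c * indicator {s<..t} r \<partial>lborel)"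
    using bnd by (intro nn_integral_mono) (auto simp: cut_def indicator_def)
  also have "\<dots> = ennreal c * ennreal (t - s)"
    using st by (simp add: nn_integral_cmult_indicator)
  also have "\<dots> = ennreal (c * (t - s))" using c st by (simp add: ennreal_mult)
  finally show ?thesis .
qed

lemma ito_increment_second_moment:
  assumes st: "0 \<le> s" "s \<le> t" and It: "has_ito_integral M F W (\<lambda>r \<omega>. \<sigma> (X r \<omega>)) t It" and Is: "has_ito_integral M F W (\<lambda>r \<omega>. \<sigma> (X r \<omega>)) s Is"
  shows "(\<integral>\<^sup>+\<omega>. ennreal ((norm (It \<omega> - Is \<omega>))\<^sup>2) \<partial>M) \<le> ennreal (4 * (real CARD('d) * K) * (t - s))"
proof -
  have nK: "0 \<le> real CARD('d) * K" using K_nonneg by simp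
  have "(norm (\<sigma> y))\<^sup>2 \<le> real CARD('d) * K" for y
    using power_mono[OF norm_sigma_le norm_ge_zero, of y 2] nK by simp
  then have "(\<integral>\<^sup>+\<omega>. ennreal ((norm (\<sigma> (X r \<omega>) - 0))\<^sup>2) \<partial>M) \<le> ennreal (real CARD('d) * K)" for r
    using nn_integral_mono[of M "\<lambda>\<omega>. ennreal ((norm (\<sigma> (X r \<omega>) - 0))\<^sup>2)" "\<lambda>_. ennreal (real CARD('d) * K)"]
    by (simp add: emeasure_space_1 ennreal_leI)
  then have "(\<integral>\<^sup>+z. ennreal ((norm (cut s t (\<lambda>r \<omega>. \<sigma> (X r \<omega>) - 0) z))\<^sup>2) \<partial>(lborel \<Otimes>\<^sub>M M)) \<le> ennreal (real CARD('d) * K * (t - s))"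
    using nK by (intro nn_integral_cut_X_le[OF st It]) auto
  then have "4 * (\<integral>\<^sup>+z. ennreal ((norm (cut s t (\<lambda>r \<omega>. \<sigma> (X r \<omega>) - 0) z))\<^sup>2) \<partial>(lborel \<Otimes>\<^sub>M M)) \<le> 4 * ennreal (real CARD('d) * K * (t - s))"
    by (intro mult_left_mono) auto
  also have "\<dots> = ennreal (4 * (real CARD('d) * K) * (t - s))"
  proof -
    have "0 \<le> real CARD('d) * K * (t - s)" using K_nonneg st by simp
    from ennreal_mult[OF _ this, of 4] show ?thesis by (simp add: mult.assoc)
  qed
  finally show ?thesis
    using ito_increment_frozen_error[OF It Is st, of "\<lambda>_. 0" 0] by (simp add: order_trans)
qed

text \<open>The Ito part is of order t - s by the isometry. The drift part is of order (t - s)^2,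
  which is at most t - s because the time step does not exceed 1.\<close>

lemma X_increment_second_moment:
  assumes st: "0 \<le> s" "s \<le> t" "t \<le> s + 1"
  shows "(\<integral>\<^sup>+\<omega>. ennreal ((norm (X t \<omega> - X s \<omega>))\<^sup>2) \<partial>M) \<le> ennreal ((2 * (real CARD('d) * K)\<^sup>2 + 8 * (real CARD('d) * K)) * (t - s))"
proof -
  obtain It Is where It: "has_ito_integral M F W (\<lambda>r \<omega>. \<sigma> (X r \<omega>)) t It" and Is: "has_ito_integral M F W (\<lambda>r \<omega>. \<sigma> (X r \<omega>)) s Is"
    and AE: "AE \<omega> in M. X t \<omega> - X s \<omega> = integral {s..t} (\<lambda>r. b (X r \<omega>)) + (It \<omega> - Is \<omega>)"
    using X_increment[OF st(1,2)] .
  have [measurable]: "It \<in> borel_measurable M" "Is \<in> borel_measurable M" using It Is by (auto simp: has_ito_integral_def)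
  have nK: "0 \<le> real CARD('d) * K" using K_nonneg by simp
  have sq: "(t - s)\<^sup>2 \<le> t - s" using st by (simp add: power2_eq_square mult_left_le)
  have "(\<integral>\<^sup>+\<omega>. ennreal ((norm (X t \<omega> - X s \<omega>))\<^sup>2) \<partial>M)
      \<le> (\<integral>\<^sup>+\<omega>. ennreal (2 * (real CARD('d) * K)\<^sup>2 * (t - s)) + 2 * ennreal ((norm (It \<omega> - Is \<omega>))\<^sup>2) \<partial>M)"
  proof (rule nn_integral_mono_AE)
    show "AE \<omega> in M. ennreal ((norm (X t \<omega> - X s \<omega>))\<^sup>2) \<le> ennreal (2 * (real CARD('d) * K)\<^sup>2 * (t - s)) + 2 * ennreal ((norm (It \<omega> - Is \<omega>))\<^sup>2)"
      using AE AE_space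
    proof eventually_elim
      case (elim \<omega>)
      let ?\<beta> = "integral {s..t} (\<lambda>r. b (X r \<omega>))"
      have "(norm (X t \<omega> - X s \<omega>))\<^sup>2 \<le> (norm ?\<beta> + norm (It \<omega> - Is \<omega>))\<^sup>2"
        unfolding elim(1) by (intro power_mono norm_triangle_ineq) auto
      also have "\<dots> \<le> 2 * (norm ?\<beta>)\<^sup>2 + 2 * (norm (It \<omega> - Is \<omega>))\<^sup>2"
        using sum_squares_bound[of "norm ?\<beta>" "norm (It \<omega> - Is \<omega>)"] by (simp add: power2_sum)
      also have "(norm ?\<beta>)\<^sup>2 \<le> (real CARD('d) * K * (t - s))\<^sup>2"
        using drift_increment_le[OF elim(2) st(1,2)] by (intro power_mono) auto
      also have "(real CARD('d) * K * (t - s))\<^sup>2 \<le> (real CARD('d) * K)\<^sup>2 * (t - s)"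
        using sq by (simp add: power_mult_distrib mult_left_mono)
      finally have "(norm (X t \<omega> - X s \<omega>))\<^sup>2 \<le> 2 * (real CARD('d) * K)\<^sup>2 * (t - s) + 2 * (norm (It \<omega> - Is \<omega>))\<^sup>2"
        by (simp add: mult.assoc)
      then have "ennreal ((norm (X t \<omega> - X s \<omega>))\<^sup>2) \<le> ennreal (2 * (real CARD('d) * K)\<^sup>2 * (t - s) + 2 * (norm (It \<omega> - Is \<omega>))\<^sup>2)"
        by (rule ennreal_leI)
      also have "\<dots> = ennreal (2 * (real CARD('d) * K)\<^sup>2 * (t - s)) + 2 * ennreal ((norm (It \<omega> - Is \<omega>))\<^sup>2)"
        using st by (subst ennreal_plus) (auto simp: ennreal_mult)
      finally show ?case .
    qed
  qed
  also have "\<dots> = ennreal (2 * (real CARD('d) * K)\<^sup>2 * (t - s)) + 2 * (\<integral>\<^sup>+\<omega>. ennreal ((norm (It \<omega> - Is \<omega>))\<^sup>2) \<partial>M)"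
    by (subst nn_integral_add) (auto simp: nn_integral_cmult emeasure_space_1)
  also have "\<dots> \<le> ennreal (2 * (real CARD('d) * K)\<^sup>2 * (t - s)) + 2 * ennreal (4 * (real CARD('d) * K) * (t - s))"
    by (intro add_left_mono mult_left_mono ito_increment_second_moment[OF st(1,2) It Is]) auto
  also have "\<dots> = ennreal (2 * (real CARD('d) * K)\<^sup>2 * (t - s)) + ennreal (2 * (4 * (real CARD('d) * K) * (t - s)))"
    using st nK ennreal_mult[of 2 "4 * (real CARD('d) * K) * (t - s)"] by simp
  also have "\<dots> = ennreal ((2 * (real CARD('d) * K)\<^sup>2 + 8 * (real CARD('d) * K)) * (t - s))"
  proof -
    have "0 \<le> 2 * (real CARD('d) * K)\<^sup>2 * (t - s)" "0 \<le> 2 * (4 * (real CARD('d) * K) * (t - s))"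
      using st K_nonneg by simp_all
    from ennreal_plus[OF this] show ?thesis by (simp add: algebra_simps)
  qed
  finally show ?thesis .
qed

lemma moment_const_pos: "1 \<le> moment_const CARD('d) K" using K_nonneg by (simp add: moment_const_def)

text \<open>Writing \<open>\<kappa>\<^sup>4\<close> for the length of the time step keeps all exponents integral.\<close>
lemma X_increment_first_moment:
  assumes st: "0 \<le> s" "s \<le> t" "t - s \<le> \<kappa> ^ 4" and \<kappa>: "0 < \<kappa>" "\<kappa> \<le> 1"
  shows "integrable M (\<lambda>\<omega>. norm (X t \<omega> - X s \<omega>))" "expectation (\<lambda>\<omega>. norm (X t \<omega> - X s \<omega>)) \<le> moment_const CARD('d) K * \<kappa>\<^sup>2"
proof -
  let ?c = "2 * (real CARD('d) * K)\<^sup>2 + 8 * (real CARD('d) * K)"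
  have c: "0 \<le> ?c" using K_nonneg by simp
  have [measurable]: "X t \<in> borel_measurable M" "X s \<in> borel_measurable M" using st by (auto intro: X_measurable)
  have k4: "\<kappa> ^ 4 \<le> 1" using \<kappa> by (simp add: power_le_one)
  have "ennreal (?c * (t - s)) \<le> ennreal (?c * \<kappa> ^ 4)" using c st by (intro ennreal_leI mult_left_mono)
  moreover have "t \<le> s + 1" using st k4 by simp
  ultimately have "(\<integral>\<^sup>+\<omega>. ennreal ((norm (X t \<omega> - X s \<omega>))\<^sup>2) \<partial>M) \<le> ennreal (?c * \<kappa> ^ 4)"
    by (intro order_trans[OF X_increment_second_moment[OF st(1,2)]])
  from integral_le_of_nn_integral_le[OF _ _ this] c
  have I: "integrable M (\<lambda>\<omega>. (norm (X t \<omega> - X s \<omega>))\<^sup>2)" and E: "expectation (\<lambda>\<omega>. (norm (X t \<omega> - X s \<omega>))\<^sup>2) \<le> ?c * \<kappa> ^ 4"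
    by simp_all
  \<comment> \<open>The second moment is O(\<kappa>^4), so the weight \<kappa>^2 balances the two
    terms.\<close>
  have I': "integrable M (\<lambda>\<omega>. \<kappa>\<^sup>2 + (norm (X t \<omega> - X s \<omega>))\<^sup>2 / \<kappa>\<^sup>2)" using I by simp
  have le: "norm (X t \<omega> - X s \<omega>) \<le> \<kappa>\<^sup>2 + (norm (X t \<omega> - X s \<omega>))\<^sup>2 / \<kappa>\<^sup>2" for \<omega>
    using \<kappa> by (intro le_add_square_div) simp
  show int: "integrable M (\<lambda>\<omega>. norm (X t \<omega> - X s \<omega>))"
    by (rule Bochner_Integration.integrable_bound[OF I']) (use le in \<open>auto intro: order_trans[OF _ abs_ge_self]\<close>)
  have "expectation (\<lambda>\<omega>. norm (X t \<omega> - X s \<omega>)) \<le> expectation (\<lambda>\<omega>. \<kappa>\<^sup>2 + (norm (X t \<omega> - X s \<omega>))\<^sup>2 / \<kappa>\<^sup>2)"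
    using int I' le by (intro integral_mono) auto
  also have "\<dots> = \<kappa>\<^sup>2 + expectation (\<lambda>\<omega>. (norm (X t \<omega> - X s \<omega>))\<^sup>2) / \<kappa>\<^sup>2"
    using I by (simp add: prob_space)
  also have "\<dots> \<le> \<kappa>\<^sup>2 + (?c * \<kappa> ^ 4) / \<kappa>\<^sup>2"
    using E \<kappa> by (intro add_left_mono divide_right_mono) auto
  also have "\<dots> = moment_const CARD('d) K * \<kappa>\<^sup>2"
    using \<kappa> by (simp add: moment_const_def field_simps eval_nat_numeral)
  finally show "expectation (\<lambda>\<omega>. norm (X t \<omega> - X s \<omega>)) \<le> moment_const CARD('d) K * \<kappa>\<^sup>2" .
qed

text \<open>Lipschitz continuity of b bounds the error pathwise by the time integral of the
  displacement. Its mean is the step length \<kappa>^4 times a first moment of order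
  \<kappa>^2.\<close>

lemma drift_frozen_error:
  assumes st: "0 \<le> s" "s \<le> t" "t - s \<le> \<kappa> ^ 4" and \<kappa>: "0 < \<kappa>" "\<kappa> \<le> 1"
  obtains E where "integrable M E" "expectation E \<le> (real CARD('d))\<^sup>2 * K * moment_const CARD('d) K * \<kappa> ^ 6"
    "\<And>\<omega>. \<omega> \<in> space M \<Longrightarrow> norm (integral {s..t} (\<lambda>r. b (X r \<omega>)) - (t - s) *\<^sub>R b (X s \<omega>)) \<le> E \<omega>"
proof -
  interpret L: pair_sigma_finite "lborel :: real measure" M ..
  \<comment> \<open>Paths are continuous on nonnegative times only; clamping at 0 makes them
    continuous on the whole line, as the measurability criterion requires.\<close>
  define Y where "Y r \<omega> = X (max 0 r) \<omega> - X s \<omega>" for r \<omega>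
  have Ym: "(\<lambda>z. Y (fst z) (snd z)) \<in> borel_measurable (lborel \<Otimes>\<^sub>M M)"
  proof (rule borel_measurable_Caratheodory[where g = fst and f = "\<lambda>z r. Y r (snd z)"])
    show "(\<lambda>z. Y r (snd z)) \<in> borel_measurable (lborel \<Otimes>\<^sub>M M)" for r
      unfolding Y_def using st by (intro borel_measurable_diff measurable_compose[OF measurable_snd] X_measurable) auto
    fix z :: "real \<times> 'w" assume "z \<in> space (lborel \<Otimes>\<^sub>M M)"
    then have "snd z \<in> space M" by (auto simp: space_pair_measure)
    then show "continuous_on UNIV (\<lambda>r. Y r (snd z))"
      unfolding Y_def by (intro continuous_on_diff continuous_on_const continuous_on_compose2[OF X_continuous]) (auto intro!: continuous_intros)
  qed simp
  define E where "E \<omega> = integral {s..t} (\<lambda>r. (real CARD('d))\<^sup>2 * K * norm (X r \<omega> - X s \<omega>))" for \<omega>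
  have cont: "continuous_on {s..t} (\<lambda>r. (real CARD('d))\<^sup>2 * K * norm (X r \<omega> - X s \<omega>))" if "\<omega> \<in> space M" for \<omega>
    by (intro continuous_intros b_X_integrable_on(2)[OF that st(1)])
  have E0: "0 \<le> E \<omega>" if "\<omega> \<in> space M" for \<omega>
    unfolding E_def using K_nonneg cont[OF that]
    by (intro Henstock_Kurzweil_Integration.integral_nonneg integrable_continuous_interval) auto
  have E_nn: "ennreal (E \<omega>) = (\<integral>\<^sup>+r. ennreal ((real CARD('d))\<^sup>2 * K * norm (Y r \<omega>)) * indicator {s..t} r \<partial>lborel)" if \<omega>: "\<omega> \<in> space M" for \<omega>
  proof -
    have si: "set_integrable lborel {s..t} (\<lambda>r. (real CARD('d))\<^sup>2 * K * norm (X r \<omega> - X s \<omega>))"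
      by (rule borel_integrable_atLeastAtMost'[OF cont[OF \<omega>]])
    have "E \<omega> = (\<integral>r. indicator {s..t} r *\<^sub>R ((real CARD('d))\<^sup>2 * K * norm (X r \<omega> - X s \<omega>)) \<partial>lborel)"
      unfolding E_def set_borel_integral_eq_integral(2)[OF si, symmetric] set_lebesgue_integral_def ..
    then have "ennreal (E \<omega>) = (\<integral>\<^sup>+r. ennreal (indicator {s..t} r *\<^sub>R ((real CARD('d))\<^sup>2 * K * norm (X r \<omega> - X s \<omega>))) \<partial>lborel)"
      using si K_nonneg unfolding set_integrable_def by (subst nn_integral_eq_integral) auto
    also have "\<dots> = (\<integral>\<^sup>+r. ennreal ((real CARD('d))\<^sup>2 * K * norm (Y r \<omega>)) * indicator {s..t} r \<partial>lborel)"
      using st by (intro nn_integral_cong) (auto simp: indicator_def Y_def)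
    finally show ?thesis .
  qed
  have m: "(\<lambda>z. ennreal ((real CARD('d))\<^sup>2 * K * norm (Y (fst z) (snd z))) * indicator {s..t} (fst z)) \<in> borel_measurable (lborel \<Otimes>\<^sub>M M)"
    using Ym by measurable
  have Em: "E \<in> borel_measurable M"
  proof -
    have "(\<lambda>\<omega>. \<integral>\<^sup>+r. ennreal ((real CARD('d))\<^sup>2 * K * norm (Y r \<omega>)) * indicator {s..t} r \<partial>lborel) \<in> borel_measurable M"
      using measurable_pair_swap[OF m] by (intro lborel.borel_measurable_nn_integral) (simp add: split_beta')
    then have "(\<lambda>\<omega>. enn2real (\<integral>\<^sup>+r. ennreal ((real CARD('d))\<^sup>2 * K * norm (Y r \<omega>)) * indicator {s..t} r \<partial>lborel)) \<in> borel_measurable M"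
      by measurable
    then show ?thesis
      by (rule measurable_cong[THEN iffD1, rotated]) (simp add: E_nn[symmetric] E0)
  qed
  have "(\<integral>\<^sup>+\<omega>. ennreal (E \<omega>) \<partial>M) = (\<integral>\<^sup>+\<omega>. \<integral>\<^sup>+r. ennreal ((real CARD('d))\<^sup>2 * K * norm (Y r \<omega>)) * indicator {s..t} r \<partial>lborel \<partial>M)"
    by (intro nn_integral_cong E_nn)
  also have "\<dots> = (\<integral>\<^sup>+r. \<integral>\<^sup>+\<omega>. ennreal ((real CARD('d))\<^sup>2 * K * norm (Y r \<omega>)) * indicator {s..t} r \<partial>M \<partial>lborel)"
    using L.Fubini'[of "\<lambda>r \<omega>. ennreal ((real CARD('d))\<^sup>2 * K * norm (Y r \<omega>)) * indicator {s..t} r"] m by (simp add: split_beta')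
  also have "\<dots> \<le> (\<integral>\<^sup>+r. ennreal ((real CARD('d))\<^sup>2 * K * (moment_const CARD('d) K * \<kappa>\<^sup>2)) * indicator {s..t} r \<partial>lborel)"
  proof (rule nn_integral_mono)
    fix r
    show "(\<integral>\<^sup>+\<omega>. ennreal ((real CARD('d))\<^sup>2 * K * norm (Y r \<omega>)) * indicator {s..t} r \<partial>M) \<le> ennreal ((real CARD('d))\<^sup>2 * K * (moment_const CARD('d) K * \<kappa>\<^sup>2)) * indicator {s..t} r"
    proof (cases "r \<in> {s..t}")
      case True
      then have r: "s \<le> r" "r - s \<le> \<kappa> ^ 4" "max 0 r = r" using st by auto
      note fm = X_increment_first_moment[OF st(1) r(1,2) \<kappa>]
      have "(\<integral>\<^sup>+\<omega>. ennreal ((real CARD('d))\<^sup>2 * K * norm (Y r \<omega>)) \<partial>M) = ennreal (expectation (\<lambda>\<omega>. (real CARD('d))\<^sup>2 * K * norm (X r \<omega> - X s \<omega>)))"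
        unfolding Y_def r(3) using fm(1) K_nonneg by (intro nn_integral_eq_integral) auto
      also have "\<dots> \<le> ennreal ((real CARD('d))\<^sup>2 * K * (moment_const CARD('d) K * \<kappa>\<^sup>2))"
        using fm K_nonneg by (intro ennreal_leI) (auto intro!: mult_left_mono)
      finally show ?thesis using True by simp
    qed simp
  qed
  also have "\<dots> = ennreal ((real CARD('d))\<^sup>2 * K * (moment_const CARD('d) K * \<kappa>\<^sup>2)) * ennreal (t - s)"
    using st by (simp add: nn_integral_cmult_indicator)
  also have "\<dots> = ennreal ((real CARD('d))\<^sup>2 * K * (moment_const CARD('d) K * \<kappa>\<^sup>2) * (t - s))"
    using st K_nonneg moment_const_pos by (simp add: ennreal_mult)
  also have "\<dots> \<le> ennreal ((real CARD('d))\<^sup>2 * K * (moment_const CARD('d) K * \<kappa>\<^sup>2) * \<kappa> ^ 4)"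
    using st K_nonneg moment_const_pos by (intro ennreal_leI mult_left_mono) auto
  also have "(real CARD('d))\<^sup>2 * K * (moment_const CARD('d) K * \<kappa>\<^sup>2) * \<kappa> ^ 4 = (real CARD('d))\<^sup>2 * K * moment_const CARD('d) K * \<kappa> ^ 6"
    by (simp add: eval_nat_numeral mult_ac)
  finally have bound: "(\<integral>\<^sup>+\<omega>. ennreal (E \<omega>) \<partial>M) \<le> ennreal ((real CARD('d))\<^sup>2 * K * moment_const CARD('d) K * \<kappa> ^ 6)" .
  \<comment> \<open>E is known to be nonnegative on the sample space only; the maximum with 0 makes
    this hold for every argument.\<close>
  have b2: "(\<integral>\<^sup>+\<omega>. ennreal (max 0 (E \<omega>)) \<partial>M) \<le> ennreal ((real CARD('d))\<^sup>2 * K * moment_const CARD('d) K * \<kappa> ^ 6)"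
  proof -
    have "(\<integral>\<^sup>+\<omega>. ennreal (max 0 (E \<omega>)) \<partial>M) = (\<integral>\<^sup>+\<omega>. ennreal (E \<omega>) \<partial>M)"
      using E0 by (intro nn_integral_cong) (simp add: max_absorb2)
    with bound show ?thesis by simp
  qed
  note B = integral_le_of_nn_integral_le[OF _ _ b2]
  show thesis
  proof (rule that)
    show "integrable M (\<lambda>\<omega>. max 0 (E \<omega>))" "expectation (\<lambda>\<omega>. max 0 (E \<omega>)) \<le> (real CARD('d))\<^sup>2 * K * moment_const CARD('d) K * \<kappa> ^ 6"
      using B Em K_nonneg moment_const_pos \<kappa> by simp_all
    fix \<omega> assume \<omega>: "\<omega> \<in> space M"
    have "integral {s..t} (\<lambda>r. b (X r \<omega>)) - (t - s) *\<^sub>R b (X s \<omega>) = integral {s..t} (\<lambda>r. b (X r \<omega>) - b (X s \<omega>))"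
      using st b_X_integrable_on(1)[OF \<omega> st(1)] by (subst Henstock_Kurzweil_Integration.integral_diff) auto
    also have "norm \<dots> \<le> E \<omega>"
      unfolding E_def
      by (intro integral_norm_bound_integral integrable_continuous_interval cont[OF \<omega>] norm_b_diff_le
          Henstock_Kurzweil_Integration.integrable_diff b_X_integrable_on(1)[OF \<omega> st(1)] integrable_const_ivl) auto
    finally show "norm (integral {s..t} (\<lambda>r. b (X r \<omega>)) - (t - s) *\<^sub>R b (X s \<omega>)) \<le> max 0 (E \<omega>)" by simp
  qed
qed

end

section \<open>Local expansion of expectations\<close>

text \<open>v stands for the Gaussian main part and w for a smaller remainder. The quadratic term is
  kept for v alone, because its covariance is known explicitly; what involves w is estimated by the
  last two terms.\<close>

lemma taylor_perturbed:
  fixes g :: "real^'d::finite \<Rightarrow> real"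
  assumes g: "Clip (Suc (Suc 0)) L g"
  shows "\<bar>g (y + (v + w)) - g y - (\<Sum>i\<in>UNIV. partial_deriv i g y * (v + w) $ i)
      - (\<Sum>i\<in>UNIV. \<Sum>j\<in>UNIV. partial_deriv j (partial_deriv i g) y * v $ i * v $ j) / 2\<bar>
    \<le> L * real CARD('d) ^ 3 * (norm v ^ 3 + norm w ^ 2 + norm v * norm w)"
proof -
  let ?n = "real CARD('d)"
  have L: "0 \<le> L" using Clip_nonneg[OF g] .
  have n: "?n ^ 2 \<le> ?n ^ 3" by (intro power_increasing) auto
  have 1: "\<bar>g (y + v) - g y - (\<Sum>i\<in>UNIV. partial_deriv i g y * v $ i)
      - (\<Sum>i\<in>UNIV. \<Sum>j\<in>UNIV. partial_deriv j (partial_deriv i g) y * v $ i * v $ j) / 2\<bar> \<le> L * ?n ^ 3 * norm v ^ 3"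
    using taylor_second_order[OF g, of y v] by simp
  have "\<bar>g ((y + v) + w) - g (y + v) - (\<Sum>i\<in>UNIV. partial_deriv i g (y + v) * w $ i)\<bar> \<le> L * ?n ^ 2 * norm w ^ 2"
    using taylor_first_order[OF Clip_SucD[OF g], of "y + v" w] by simp
  also have "\<dots> \<le> L * ?n ^ 3 * norm w ^ 2" using L n by (intro mult_right_mono mult_left_mono) auto
  finally have 2: "\<bar>g ((y + v) + w) - g (y + v) - (\<Sum>i\<in>UNIV. partial_deriv i g (y + v) * w $ i)\<bar> \<le> L * ?n ^ 3 * norm w ^ 2" .
  have "\<bar>\<Sum>i\<in>UNIV. (partial_deriv i g (y + v) - partial_deriv i g y) * w $ i\<bar>
      \<le> (\<Sum>i\<in>UNIV. \<bar>(partial_deriv i g (y + v) - partial_deriv i g y) * w $ i\<bar>)" by (rule sum_abs)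
  also have "\<dots> \<le> (\<Sum>i\<in>(UNIV::'d set). (L * ?n * norm v) * norm w)"
  proof (rule sum_mono)
    fix i
    show "\<bar>(partial_deriv i g (y + v) - partial_deriv i g y) * w $ i\<bar> \<le> (L * ?n * norm v) * norm w"
      unfolding abs_mult using Clip_lipschitz[OF Clip_partial[OF g], of i "y + v" y] L
      by (intro mult_mono) (auto simp: component_le_norm_cart)
  qed
  also have "\<dots> = L * ?n ^ 2 * (norm v * norm w)" by (simp add: power2_eq_square mult_ac)
  also have "\<dots> \<le> L * ?n ^ 3 * (norm v * norm w)" using L n by (intro mult_right_mono mult_left_mono) auto
  finally have 3: "\<bar>\<Sum>i\<in>UNIV. (partial_deriv i g (y + v) - partial_deriv i g y) * w $ i\<bar> \<le> L * ?n ^ 3 * (norm v * norm w)" .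
  \<comment> \<open>Second-order expansion in v at y, first-order expansion in w at y + v, and the
    cost of moving the gradient from y + v back to y.\<close>
  have eq: "g (y + (v + w)) - g y - (\<Sum>i\<in>UNIV. partial_deriv i g y * (v + w) $ i)
      - (\<Sum>i\<in>UNIV. \<Sum>j\<in>UNIV. partial_deriv j (partial_deriv i g) y * v $ i * v $ j) / 2
    = (g (y + v) - g y - (\<Sum>i\<in>UNIV. partial_deriv i g y * v $ i)
      - (\<Sum>i\<in>UNIV. \<Sum>j\<in>UNIV. partial_deriv j (partial_deriv i g) y * v $ i * v $ j) / 2)
    + (g ((y + v) + w) - g (y + v) - (\<Sum>i\<in>UNIV. partial_deriv i g (y + v) * w $ i))
    + (\<Sum>i\<in>UNIV. (partial_deriv i g (y + v) - partial_deriv i g y) * w $ i)"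
    by (simp add: sum.distrib distrib_left left_diff_distrib sum_subtractf add.assoc)
  have "\<bar>A + B + C\<bar> \<le> A' + B' + C'" if "\<bar>A\<bar> \<le> A'" "\<bar>B\<bar> \<le> B'" "\<bar>C\<bar> \<le> C'" for A B C A' B' C' :: real
    using that by linarith
  from this[OF 1 2 3] show ?thesis unfolding eq by (simp add: distrib_left)
qed

text \<open>Leaves even moments of the Gaussian part and second moments of the remainder. With p of
  size \<kappa>^2 and q of size \<kappa>^3 the terms on the right are of order \<kappa>^6 and
  \<kappa>^5, respectively.\<close>

lemma young_terms:
  fixes p q \<kappa> :: real
  assumes "0 < \<kappa>" "0 \<le> p" "0 \<le> q"
  shows "p ^ 3 \<le> \<kappa>\<^sup>2 * p\<^sup>2 + p ^ 4 / \<kappa>\<^sup>2" "p * q \<le> \<kappa> * p\<^sup>2 + q\<^sup>2 / \<kappa>"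
proof -
  have "p * p\<^sup>2 \<le> (\<kappa>\<^sup>2 + p\<^sup>2 / \<kappa>\<^sup>2) * p\<^sup>2"
    using assms by (intro mult_right_mono le_add_square_div) auto
  moreover have "(\<kappa>\<^sup>2 + p\<^sup>2 / \<kappa>\<^sup>2) * p\<^sup>2 = \<kappa>\<^sup>2 * p\<^sup>2 + p ^ 4 / \<kappa>\<^sup>2"
    by (simp add: distrib_right power_add[symmetric])
  moreover have "p * p\<^sup>2 = p ^ 3" by (simp add: eval_nat_numeral)
  ultimately show "p ^ 3 \<le> \<kappa>\<^sup>2 * p\<^sup>2 + p ^ 4 / \<kappa>\<^sup>2" by simp
  have "(\<kappa> * p) * q \<le> (\<kappa> * p)\<^sup>2 + q\<^sup>2"
    using sum_squares_bound[of "\<kappa> * p" q] zero_le_power2[of "\<kappa> * p"] zero_le_power2[of q] by linarith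
  then have "\<kappa> * (p * q) \<le> \<kappa> * (\<kappa> * p\<^sup>2 + q\<^sup>2 / \<kappa>)"
    using assms by (simp add: distrib_left power_mult_distrib power2_eq_square mult_ac)
  then show "p * q \<le> \<kappa> * p\<^sup>2 + q\<^sup>2 / \<kappa>" using assms by simp
qed

context brownian
begin

lemma
  fixes s t :: real
  assumes "0 \<le> s" "s \<le> t"
  shows integrable_increment_norm2: "integrable M (\<lambda>\<omega>. (norm (W t \<omega> - W s \<omega>))\<^sup>2)"
    and expectation_increment_norm2: "expectation (\<lambda>\<omega>. (norm (W t \<omega> - W s \<omega>))\<^sup>2) = CARD('d) * (t - s)"
    and integrable_increment_norm4: "integrable M (\<lambda>\<omega>. norm (W t \<omega> - W s \<omega>) ^ 4)"
    and expectation_increment_norm4_le: "expectation (\<lambda>\<omega>. norm (W t \<omega> - W s \<omega>) ^ 4) \<le> 3 * (real CARD('d))\<^sup>2 * (t - s)\<^sup>2"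
proof -
  let ?D = "\<lambda>\<omega>. W t \<omega> - W s \<omega>"
  have n2: "(norm v)\<^sup>2 = (\<Sum>i\<in>UNIV. v $ i * v $ i)" for v :: "real^'d"
    by (simp add: norm_vec_def L2_set_def sum_nonneg power2_eq_square)
  note I2 = integrable_increment_product[OF assms] and I4 = integrable_increment_fourth[OF assms]
  show "integrable M (\<lambda>\<omega>. (norm (?D \<omega>))\<^sup>2)"
    unfolding n2 by (intro Bochner_Integration.integrable_sum I2)
  show "expectation (\<lambda>\<omega>. (norm (?D \<omega>))\<^sup>2) = CARD('d) * (t - s)"
    unfolding n2 by (simp only: Bochner_Integration.integral_sum[OF I2] expectation_increment_product[OF assms]) simp
  have I4s: "integrable M (\<lambda>\<omega>. CARD('d) * (\<Sum>i\<in>UNIV. (?D \<omega> $ i) ^ 4))"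
    by (intro integrable_mult_right Bochner_Integration.integrable_sum I4)
  have m: "?D \<in> borel_measurable M" using assms by (intro borel_measurable_diff W_measurable) auto
  show I: "integrable M (\<lambda>\<omega>. norm (?D \<omega>) ^ 4)"
    by (rule Bochner_Integration.integrable_bound[OF I4s])
      (use m norm_vec_power4_le in \<open>auto intro!: order_trans[OF norm_vec_power4_le] abs_ge_self\<close>)
  have "expectation (\<lambda>\<omega>. norm (?D \<omega>) ^ 4) \<le> expectation (\<lambda>\<omega>. CARD('d) * (\<Sum>i\<in>UNIV. (?D \<omega> $ i) ^ 4))"
    by (intro integral_mono I I4s norm_vec_power4_le)
  also have "\<dots> = 3 * (real CARD('d))\<^sup>2 * (t - s)\<^sup>2"
    by (simp only: integral_mult_right_zero Bochner_Integration.integral_sum[OF I4] expectation_increment_fourth[OF assms])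
      (simp add: power2_eq_square)
  finally show "expectation (\<lambda>\<omega>. norm (?D \<omega>) ^ 4) \<le> 3 * (real CARD('d))\<^sup>2 * (t - s)\<^sup>2" .
qed

end

context sde
begin

text \<open>The Ito increment with the coefficient frozen at time s; given the past up to s it is
  Gaussian with covariance (t - s) a(X(s)).\<close>

definition gauss :: "real \<Rightarrow> real \<Rightarrow> 'w \<Rightarrow> real^'d" where
  "gauss s t \<omega> = \<sigma> (X s \<omega>) *v (W t \<omega> - W s \<omega>)"

lemma norm_gauss_le: "norm (gauss s t \<omega>) \<le> sqrt (real CARD('d) * K) * norm (W t \<omega> - W s \<omega>)"
  unfolding gauss_def by (intro order_trans[OF norm_matrix_vector_mult_le] mult_right_mono norm_sigma_le) auto

lemma gauss_measurable:
  assumes "0 \<le> s" "s \<le> t" shows "gauss s t \<in> borel_measurable M"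
  unfolding gauss_def[abs_def] using assms
  by (intro borel_measurable_matrix_vector_mult borel_measurable_diff W_measurable
      measurable_F_imp_M[OF sigma_X_measurable_F]) auto

lemma gauss_moments:
  assumes "0 \<le> s" "s \<le> t"
  shows "integrable M (\<lambda>\<omega>. (norm (gauss s t \<omega>))\<^sup>2)"
    "expectation (\<lambda>\<omega>. (norm (gauss s t \<omega>))\<^sup>2) \<le> (real CARD('d))\<^sup>2 * K * (t - s)"
    "integrable M (\<lambda>\<omega>. norm (gauss s t \<omega>) ^ 4)"
    "expectation (\<lambda>\<omega>. norm (gauss s t \<omega>) ^ 4) \<le> 3 * (real CARD('d)) ^ 4 * K\<^sup>2 * (t - s)\<^sup>2"
proof -
  let ?n = "real CARD('d)" and ?D = "\<lambda>\<omega>. W t \<omega> - W s \<omega>"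
  have nK: "0 \<le> ?n * K" using K_nonneg by simp
  note m = gauss_measurable[OF assms]
  have le2: "(norm (gauss s t \<omega>))\<^sup>2 \<le> ?n * K * (norm (?D \<omega>))\<^sup>2" for \<omega>
    using power_mono[OF norm_gauss_le norm_ge_zero, of s t \<omega> 2] nK by (simp add: power_mult_distrib)
  have le4: "norm (gauss s t \<omega>) ^ 4 \<le> (?n * K)\<^sup>2 * norm (?D \<omega>) ^ 4" for \<omega>
    using power_mono[OF le2 zero_le_power2, of \<omega> 2] by (simp add: power_mult_distrib power_mult[symmetric])
  have i2: "integrable M (\<lambda>\<omega>. ?n * K * (norm (?D \<omega>))\<^sup>2)" and i4: "integrable M (\<lambda>\<omega>. (?n * K)\<^sup>2 * norm (?D \<omega>) ^ 4)"
    using integrable_increment_norm2[OF assms] integrable_increment_norm4[OF assms] by simp_all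
  show I2: "integrable M (\<lambda>\<omega>. (norm (gauss s t \<omega>))\<^sup>2)"
    by (rule Bochner_Integration.integrable_bound[OF i2]) (use m le2 in \<open>auto intro!: order_trans[OF le2] abs_ge_self\<close>)
  show I4: "integrable M (\<lambda>\<omega>. norm (gauss s t \<omega>) ^ 4)"
    by (rule Bochner_Integration.integrable_bound[OF i4]) (use m le4 in \<open>auto intro!: order_trans[OF le4] abs_ge_self\<close>)
  have "expectation (\<lambda>\<omega>. (norm (gauss s t \<omega>))\<^sup>2) \<le> expectation (\<lambda>\<omega>. ?n * K * (norm (?D \<omega>))\<^sup>2)"
    by (intro integral_mono I2 i2 le2)
  also have "\<dots> = ?n * K * (?n * (t - s))"
    by (simp only: integral_mult_right_zero expectation_increment_norm2[OF assms])
  also have "\<dots> = ?n\<^sup>2 * K * (t - s)" by (simp add: power2_eq_square mult_ac)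
  finally show "expectation (\<lambda>\<omega>. (norm (gauss s t \<omega>))\<^sup>2) \<le> ?n\<^sup>2 * K * (t - s)" .
  have "expectation (\<lambda>\<omega>. norm (gauss s t \<omega>) ^ 4) \<le> expectation (\<lambda>\<omega>. (?n * K)\<^sup>2 * norm (?D \<omega>) ^ 4)"
    by (intro integral_mono I4 i4 le4)
  also have "\<dots> = (?n * K)\<^sup>2 * expectation (\<lambda>\<omega>. norm (?D \<omega>) ^ 4)" by simp
  also have "\<dots> \<le> (?n * K)\<^sup>2 * (3 * ?n\<^sup>2 * (t - s)\<^sup>2)"
    by (intro mult_left_mono expectation_increment_norm4_le assms) auto
  also have "\<dots> = 3 * ?n ^ 4 * K\<^sup>2 * (t - s)\<^sup>2" by (simp add: power_mult_distrib eval_nat_numeral mult_ac)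
  finally show "expectation (\<lambda>\<omega>. norm (gauss s t \<omega>) ^ 4) \<le> 3 * ?n ^ 4 * K\<^sup>2 * (t - s)\<^sup>2" .
qed

text \<open>The Brownian increment is independent of all factors known at time s. Only equal
  components k = l survive, and the remaining sum over k is \<sigma> \<sigma>^T = a.\<close>

lemma gauss_covariance:
  assumes st: "0 \<le> s" "s \<le> t" and D: "\<And>i j. D i j \<in> borel_measurable (F s)" "\<And>i j \<omega>. \<omega> \<in> space M \<Longrightarrow> \<bar>D i j \<omega>\<bar> \<le> B"
  shows "has_bochner_integral M (\<lambda>\<omega>. (\<Sum>i\<in>UNIV. \<Sum>j\<in>UNIV. D i j \<omega> * gauss s t \<omega> $ i * gauss s t \<omega> $ j)
     - (t - s) * (\<Sum>i\<in>UNIV. \<Sum>j\<in>UNIV. D i j \<omega> * a (X s \<omega>) $ i $ j)) 0"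
proof -
  let ?S = "\<lambda>i k \<omega>. \<sigma> (X s \<omega>) $ i $ k" and ?w = "\<lambda>k \<omega>. (W t \<omega> - W s \<omega>) $ k"
  have Sm: "?S i k \<in> borel_measurable (F s)" for i k
    using sigma_X_measurable_F[OF st(1)] by (intro borel_measurable_vec_nth)
  have Sb: "\<bar>?S i k \<omega>\<bar> \<le> sqrt (real CARD('d) * K)" for i k \<omega>
    using order_trans[OF abs_matrix_entry_le norm_sigma_le] .
  have Zm: "(\<lambda>\<omega>. D i j \<omega> * (?S i k \<omega> * ?S j l \<omega>)) \<in> borel_measurable (F s)" for i j k l
    using D(1) Sm by (intro borel_measurable_times)
  have SSint: "integrable M (\<lambda>\<omega>. ?S i k \<omega> * ?S j l \<omega>)" for i j k l
    using Sb Sm[THEN measurable_F_imp_M] by (intro integrable_bounded_product) auto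
  have Zint: "integrable M (\<lambda>\<omega>. D i j \<omega> * (?S i k \<omega> * ?S j l \<omega>))" for i j k l
    by (rule integrable_bounded_mult[OF measurable_F_imp_M[OF D(1)] D(2) SSint])
  have q: "(\<lambda>y::real^'d. y $ k * y $ l) \<in> borel_measurable borel" for k l
    by (intro borel_measurable_times borel_measurable_vec_nth) simp_all
  have hb: "has_bochner_integral M (\<lambda>\<omega>. (D i j \<omega> * (?S i k \<omega> * ?S j l \<omega>)) * (?w k \<omega> * ?w l \<omega>))
      (expectation (\<lambda>\<omega>. D i j \<omega> * (?S i k \<omega> * ?S j l \<omega>)) * (if k = l then t - s else 0))" for i j k l
    using integrable_mult_increment[OF st Zm Zint q integrable_increment_product[OF st]]
      expectation_mult_increment[OF st Zm Zint q integrable_increment_product[OF st]]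
      expectation_increment_product[OF st, of k l]
    by (simp add: has_bochner_integral_iff)
  have 1: "has_bochner_integral M (\<lambda>\<omega>. \<Sum>i\<in>UNIV. \<Sum>j\<in>UNIV. \<Sum>k\<in>UNIV. \<Sum>l\<in>UNIV. (D i j \<omega> * (?S i k \<omega> * ?S j l \<omega>)) * (?w k \<omega> * ?w l \<omega>))
      (\<Sum>i\<in>UNIV. \<Sum>j\<in>UNIV. \<Sum>k\<in>UNIV. \<Sum>l\<in>UNIV. expectation (\<lambda>\<omega>. D i j \<omega> * (?S i k \<omega> * ?S j l \<omega>)) * (if k = l then t - s else 0))"
    by (intro has_bochner_integral_sum hb)
  have e1: "(\<Sum>k\<in>UNIV. \<Sum>l\<in>UNIV. (D i j \<omega> * (?S i k \<omega> * ?S j l \<omega>)) * (?w k \<omega> * ?w l \<omega>)) = D i j \<omega> * gauss s t \<omega> $ i * gauss s t \<omega> $ j" for i j \<omega>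
  proof -
    have "gauss s t \<omega> $ i = (\<Sum>k\<in>UNIV. ?S i k \<omega> * ?w k \<omega>)" for i
      by (simp add: gauss_def matrix_vector_mult_def)
    then have p: "gauss s t \<omega> $ i * gauss s t \<omega> $ j = (\<Sum>k\<in>UNIV. \<Sum>l\<in>UNIV. (?S i k \<omega> * ?w k \<omega>) * (?S j l \<omega> * ?w l \<omega>))"
      by (simp only: sum_product)
    show ?thesis
      unfolding mult.assoc[of "D i j \<omega>" "gauss s t \<omega> $ i"] p sum_distrib_left
      by (intro sum.cong refl) (simp only: mult_ac)
  qed
  have "has_bochner_integral M (\<lambda>\<omega>. D i j \<omega> * a (X s \<omega>) $ i $ j) (\<Sum>k\<in>UNIV. expectation (\<lambda>\<omega>. D i j \<omega> * (?S i k \<omega> * ?S j k \<omega>)))" for i j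
  proof -
    have "has_bochner_integral M (\<lambda>\<omega>. \<Sum>k\<in>UNIV. D i j \<omega> * (?S i k \<omega> * ?S j k \<omega>)) (\<Sum>k\<in>UNIV. expectation (\<lambda>\<omega>. D i j \<omega> * (?S i k \<omega> * ?S j k \<omega>)))"
      by (intro has_bochner_integral_sum has_bochner_integral_integrable Zint)
    then show ?thesis
      by (simp only: sum_distrib_left[symmetric] psd_sqrt_row_sum[OF a_psd])
  qed
  then have 2: "has_bochner_integral M (\<lambda>\<omega>. (t - s) * (\<Sum>i\<in>UNIV. \<Sum>j\<in>UNIV. D i j \<omega> * a (X s \<omega>) $ i $ j))
      ((t - s) * (\<Sum>i\<in>UNIV. \<Sum>j\<in>UNIV. \<Sum>k\<in>UNIV. expectation (\<lambda>\<omega>. D i j \<omega> * (?S i k \<omega> * ?S j k \<omega>))))"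
    by (intro has_bochner_integral_mult_right has_bochner_integral_sum)
  have e2: "(\<Sum>l\<in>UNIV. E l * (if k = l then t - s else 0)) = (t - s) * E k" for E :: "'d \<Rightarrow> real" and k
    by (simp add: if_distrib[of "(*) _"] mult.commute cong: if_cong)
  show ?thesis
    using has_bochner_integral_diff[OF 1[unfolded e1 e2] 2] by (simp add: sum_distrib_left)
qed

lemma generator_Clip:
  assumes g: "Clip (Suc (Suc 0)) L g"
  shows "Clip 0 (2 * (real CARD('d))\<^sup>2 * K * L + 2 * real CARD('d) * K * L) (generator b a g)"
proof -
  have "Clip 0 ((\<Sum>i\<in>(UNIV::'d set). 2 ^ Suc 0 * K * L) + \<bar>1 / 2\<bar> * (\<Sum>i\<in>(UNIV::'d set). \<Sum>j\<in>(UNIV::'d set). 2 ^ Suc 0 * K * L))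
    (\<lambda>y. (\<Sum>i\<in>UNIV. b y $ i * partial_deriv i g y) + (1 / 2) * (\<Sum>i\<in>UNIV. \<Sum>j\<in>UNIV. a y $ i $ j * partial_deriv j (partial_deriv i g) y))"
    by (intro Clip_add Clip_cmult Clip_sum Clip_mult a_Clip b_Clip Clip_partial[OF Clip_partial[OF g]]
        Clip_SucD[OF Clip_partial[OF g]])
  moreover have "(\<lambda>y. (\<Sum>i\<in>UNIV. b y $ i * partial_deriv i g y) + (1 / 2) * (\<Sum>i\<in>UNIV. \<Sum>j\<in>UNIV. a y $ i $ j * partial_deriv j (partial_deriv i g) y)) = generator b a g"
    by (simp add: generator_def[abs_def])
  ultimately show ?thesis
    using Clip_nonneg[OF g] K_nonneg by (simp only:) (erule Clip_mono_const, simp add: power2_eq_square)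
qed

text \<open>Two mean-zero quantities are subtracted before absolute values are taken: the gradient
  against the Ito increment, \<open>?A\<close>, and the centred Gaussian quadratic form,
  \<open>?Q\<close>. What is left obeys a pointwise bound of mean O(\<kappa>^5), that is the power
  5/4 of the time step.\<close>

lemma local_expansion:
  assumes g: "Clip (Suc (Suc 0)) L g"
  obtains C where "0 \<le> C" "\<And>s t \<kappa>. 0 \<le> s \<Longrightarrow> t - s = \<kappa> ^ 4 \<Longrightarrow> 0 < \<kappa> \<Longrightarrow> \<kappa> \<le> 1 \<Longrightarrow>
    \<bar>expectation (\<lambda>\<omega>. g (X t \<omega>)) - expectation (\<lambda>\<omega>. g (X s \<omega>)) - (t - s) * expectation (\<lambda>\<omega>. generator b a g (X s \<omega>))\<bar> \<le> C * \<kappa> ^ 5"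
proof -
  let ?n = "real CARD('d)" and ?m = "moment_const CARD('d) K"
  define c2 c4 cr c3 R where "c2 = ?n\<^sup>2 * K" and "c4 = 3 * ?n ^ 4 * K\<^sup>2" and "cr = 4 * (4 * ?n ^ 7 * K * ?m)"
    and "c3 = ?n\<^sup>2 * K * ?m" and "R = 2 * (?n * K)\<^sup>2 + 2 * cr"
  have m: "0 \<le> ?m" using moment_const_pos by simp
  have L: "0 \<le> L" using Clip_nonneg[OF g] .
  have cpos: "0 \<le> c2" "0 \<le> c4" "0 \<le> cr" "0 \<le> c3" "0 \<le> R"
    using K_nonneg m by (simp_all add: c2_def c4_def cr_def c3_def R_def)
  define C where "C = L * ?n ^ 3 * (2 * c2 + c4 + 2 * R + c3)"
  have C: "0 \<le> C" using cpos L by (simp add: C_def)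
  have "\<bar>expectation (\<lambda>\<omega>. g (X t \<omega>)) - expectation (\<lambda>\<omega>. g (X s \<omega>)) - (t - s) * expectation (\<lambda>\<omega>. generator b a g (X s \<omega>))\<bar> \<le> C * \<kappa> ^ 5"
    if s: "0 \<le> s" and ts: "t - s = \<kappa> ^ 4" and \<kappa>: "0 < \<kappa>" "\<kappa> \<le> 1" for s t \<kappa>
  proof -
    have k4: "0 < \<kappa> ^ 4" using \<kappa> by simp
    have st: "s \<le> t" and t: "0 \<le> t" using s ts k4 by linarith+
    have tsle: "t - s \<le> \<kappa> ^ 4" using ts by simp
    obtain It Is where It: "has_ito_integral M F W (\<lambda>r \<omega>. \<sigma> (X r \<omega>)) t It" and Is: "has_ito_integral M F W (\<lambda>r \<omega>. \<sigma> (X r \<omega>)) s Is"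
      and AE: "AE \<omega> in M. X t \<omega> - X s \<omega> = integral {s..t} (\<lambda>r. b (X r \<omega>)) + (It \<omega> - Is \<omega>)"
      using X_increment[OF s st] .
    have Im: "It \<in> borel_measurable M" "Is \<in> borel_measurable M" using It Is by (auto simp: has_ito_integral_def)
    obtain E where E: "integrable M E" "expectation E \<le> c3 * \<kappa> ^ 6"
      "\<And>\<omega>. \<omega> \<in> space M \<Longrightarrow> norm (integral {s..t} (\<lambda>r. b (X r \<omega>)) - (t - s) *\<^sub>R b (X s \<omega>)) \<le> E \<omega>"
      using drift_frozen_error[OF s st tsle \<kappa>] unfolding c3_def by blast
    let ?J = "\<lambda>\<omega>. It \<omega> - Is \<omega>" and ?G = "gauss s t"
    let ?\<rho> = "\<lambda>\<omega>. ?J \<omega> - ?G \<omega>"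
    have Gm: "?G \<in> borel_measurable M" by (rule gauss_measurable[OF s st])
    have "(\<integral>\<^sup>+\<omega>. ennreal ((norm (\<sigma> (X r \<omega>) - \<sigma> (X s \<omega>)))\<^sup>2) \<partial>M) \<le> ennreal (4 * ?n ^ 7 * K * ?m * \<kappa>\<^sup>2)" if r: "s < r" "r \<le> t" for r
    proof -
      have rs: "s \<le> r" "r - s \<le> \<kappa> ^ 4" using r ts by auto
      note fm = X_increment_first_moment[OF s rs \<kappa>]
      have "(\<integral>\<^sup>+\<omega>. ennreal ((norm (\<sigma> (X r \<omega>) - \<sigma> (X s \<omega>)))\<^sup>2) \<partial>M) \<le> (\<integral>\<^sup>+\<omega>. ennreal (4 * ?n ^ 7 * K * norm (X r \<omega> - X s \<omega>)) \<partial>M)"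
        by (intro nn_integral_mono ennreal_leI norm_sigma_diff_sq_le)
      also have "\<dots> = ennreal (expectation (\<lambda>\<omega>. 4 * ?n ^ 7 * K * norm (X r \<omega> - X s \<omega>)))"
        using fm(1) K_nonneg by (intro nn_integral_eq_integral) auto
      also have "\<dots> \<le> ennreal (4 * ?n ^ 7 * K * (?m * \<kappa>\<^sup>2))"
        unfolding integral_mult_right_zero using fm(2) K_nonneg by (intro ennreal_leI mult_left_mono) auto
      finally show ?thesis by (simp add: mult.assoc)
    qed
    from nn_integral_cut_X_le[OF s st It measurable_F_imp_M[OF sigma_X_measurable_F[OF s]] this]
    have "(\<integral>\<^sup>+z. ennreal ((norm (cut s t (\<lambda>r \<omega>. \<sigma> (X r \<omega>) - \<sigma> (X s \<omega>)) z))\<^sup>2) \<partial>(lborel \<Otimes>\<^sub>M M)) \<le> ennreal (4 * ?n ^ 7 * K * ?m * \<kappa>\<^sup>2 * (t - s))"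
      using K_nonneg m by simp
    then have "4 * (\<integral>\<^sup>+z. ennreal ((norm (cut s t (\<lambda>r \<omega>. \<sigma> (X r \<omega>) - \<sigma> (X s \<omega>)) z))\<^sup>2) \<partial>(lborel \<Otimes>\<^sub>M M))
        \<le> 4 * ennreal (4 * ?n ^ 7 * K * ?m * \<kappa>\<^sup>2 * (t - s))"
      by (intro mult_left_mono) auto
    also have "\<dots> = ennreal (4 * (4 * ?n ^ 7 * K * ?m * \<kappa>\<^sup>2 * (t - s)))"
      using K_nonneg m st by (subst ennreal_mult) auto
    also have "4 * (4 * ?n ^ 7 * K * ?m * \<kappa>\<^sup>2 * (t - s)) = cr * \<kappa> ^ 6"
      unfolding ts cr_def by (simp add: eval_nat_numeral mult_ac)
    finally have "(\<integral>\<^sup>+\<omega>. ennreal ((norm (?\<rho> \<omega>))\<^sup>2) \<partial>M) \<le> ennreal (cr * \<kappa> ^ 6)"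
      using ito_increment_frozen_error[OF It Is s st sigma_X_measurable_F[OF s] norm_sigma_le]
      unfolding gauss_def by (rule order_trans[rotated])
    from integral_le_of_nn_integral_le[OF _ _ this] Im Gm cpos \<kappa>
    have \<rho>I: "integrable M (\<lambda>\<omega>. (norm (?\<rho> \<omega>))\<^sup>2)" and \<rho>E: "expectation (\<lambda>\<omega>. (norm (?\<rho> \<omega>))\<^sup>2) \<le> cr * \<kappa> ^ 6"
      by simp_all
    from integral_le_of_nn_integral_le(1)[OF _ _ ito_increment_second_moment[OF s st It Is]] Im K_nonneg st
    have JI: "integrable M (\<lambda>\<omega>. (norm (?J \<omega>))\<^sup>2)" by simp
    have gm: "partial_deriv i g \<in> borel_measurable borel" "partial_deriv j (partial_deriv i g) \<in> borel_measurable borel" for i j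
      using Clip_measurable[OF Clip_partial[OF g]] Clip_measurable[OF Clip_partial[OF Clip_partial[OF g]]] by blast+
    \<comment> \<open>The linear term uses the exact Ito increment, whose mean against the gradient
      vanishes. Estimating its freezing error, of L^2 size \<kappa>^3, would leave more than the
      step length \<kappa>^4.\<close>
    have "has_bochner_integral M (\<lambda>\<omega>. grad g (X s \<omega>) \<bullet> ?J \<omega>) 0"
    proof (rule has_bochner_integral_inner_ito_increment[OF It Is s st JI])
      show "(\<lambda>\<omega>. grad g (X s \<omega>)) \<in> borel_measurable (F s)"
        by (rule borel_measurable_vecI) (simp add: grad_nth X_measurable_comp_F[OF s gm(1)])
      show "norm (grad g (X s \<omega>)) \<le> L * CARD('d)" for \<omega>
        by (rule norm_grad_le[OF Clip_partial[OF g]])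
    qed
    then have A: "has_bochner_integral M (\<lambda>\<omega>. \<Sum>i\<in>UNIV. partial_deriv i g (X s \<omega>) * ?J \<omega> $ i) 0"
      by (simp add: inner_vec_def grad_nth)
    let ?Q = "\<lambda>\<omega>. ((\<Sum>i\<in>UNIV. \<Sum>j\<in>UNIV. partial_deriv j (partial_deriv i g) (X s \<omega>) * ?G \<omega> $ i * ?G \<omega> $ j)
       - (t - s) * (\<Sum>i\<in>UNIV. \<Sum>j\<in>UNIV. partial_deriv j (partial_deriv i g) (X s \<omega>) * a (X s \<omega>) $ i $ j)) / 2"
    have "has_bochner_integral M (\<lambda>\<omega>. (\<Sum>i\<in>UNIV. \<Sum>j\<in>UNIV. partial_deriv j (partial_deriv i g) (X s \<omega>) * ?G \<omega> $ i * ?G \<omega> $ j)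
       - (t - s) * (\<Sum>i\<in>UNIV. \<Sum>j\<in>UNIV. partial_deriv j (partial_deriv i g) (X s \<omega>) * a (X s \<omega>) $ i $ j)) 0"
      using Clip_bound[OF Clip_partial[OF Clip_partial[OF g]]]
      by (intro gauss_covariance[OF s st, where B = L] X_measurable_comp_F[OF s gm(2)])
    from has_bochner_integral_divide_zero[OF this, of 2]
    have Q: "has_bochner_integral M ?Q 0" by simp
    have Lg: "integrable M (\<lambda>\<omega>. generator b a g (X s \<omega>))"
      by (rule integrable_Clip_X[OF generator_Clip[OF g] s])
    have gI: "integrable M (\<lambda>\<omega>. g (X t \<omega>))" "integrable M (\<lambda>\<omega>. g (X s \<omega>))"
      using integrable_Clip_X[OF g] s t by auto
    let ?V = "\<lambda>\<omega>. g (X t \<omega>) - g (X s \<omega>) - (t - s) * generator b a g (X s \<omega>)"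
    \<comment> \<open>The majorant supplied by \<open>taylor_perturbed\<close> and
      \<open>young_terms\<close>, with the squared norm of w already split into its drift and
      freezing parts.\<close>
    let ?U = "\<lambda>\<omega>. L * ?n ^ 3 * ((\<kappa>\<^sup>2 + \<kappa>) * (norm (?G \<omega>))\<^sup>2 + norm (?G \<omega>) ^ 4 / \<kappa>\<^sup>2
        + (1 + 1 / \<kappa>) * (2 * (?n * K * \<kappa> ^ 4)\<^sup>2 + 2 * (norm (?\<rho> \<omega>))\<^sup>2) + E \<omega>)"
    have VI: "integrable M ?V" using gI Lg by simp
    have VE: "expectation ?V = expectation (\<lambda>\<omega>. g (X t \<omega>)) - expectation (\<lambda>\<omega>. g (X s \<omega>)) - (t - s) * expectation (\<lambda>\<omega>. generator b a g (X s \<omega>))"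
      using gI Lg by simp
    let ?A = "\<lambda>\<omega>. \<Sum>i\<in>UNIV. partial_deriv i g (X s \<omega>) * ?J \<omega> $ i"
    have VAQ: "has_bochner_integral M (\<lambda>\<omega>. ?V \<omega> - ?A \<omega> - ?Q \<omega>) (expectation ?V)"
      using has_bochner_integral_diff[OF has_bochner_integral_diff[OF has_bochner_integral_integrable[OF VI] A] Q] by simp
    note GM = gauss_moments[OF s st]
    have UI: "integrable M ?U" using GM \<rho>I E(1) by simp
    have UE: "expectation ?U = L * ?n ^ 3 * ((\<kappa>\<^sup>2 + \<kappa>) * expectation (\<lambda>\<omega>. (norm (?G \<omega>))\<^sup>2) + expectation (\<lambda>\<omega>. norm (?G \<omega>) ^ 4) / \<kappa>\<^sup>2
        + (1 + 1 / \<kappa>) * (2 * (?n * K * \<kappa> ^ 4)\<^sup>2 + 2 * expectation (\<lambda>\<omega>. (norm (?\<rho> \<omega>))\<^sup>2)) + expectation E)"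
      using GM \<rho>I E(1) by (simp add: prob_space)
    have bound: "AE \<omega> in M. \<bar>?V \<omega> - ?A \<omega> - ?Q \<omega>\<bar> \<le> ?U \<omega>"
      using AE AE_space
    proof eventually_elim
      case (elim \<omega>)
      define \<beta> where "\<beta> = integral {s..t} (\<lambda>r. b (X r \<omega>))"
      define e where "e = \<beta> - (t - s) *\<^sub>R b (X s \<omega>)"
      define w where "w = \<beta> + ?\<rho> \<omega>"
      define y where "y = X s \<omega>"
      define d2 where "d2 = (\<Sum>i\<in>UNIV. \<Sum>j\<in>UNIV. partial_deriv j (partial_deriv i g) y * ?G \<omega> $ i * ?G \<omega> $ j)"
      have Xt: "X t \<omega> = y + (?G \<omega> + w)" using elim(1) by (simp add: w_def y_def \<beta>_def algebra_simps)
      \<comment> \<open>The same increment regrouped for the linear term: exact Ito increment,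
        frozen drift, drift error.\<close>
      have Gw: "?G \<omega> + w = ?J \<omega> + (t - s) *\<^sub>R b y + e" by (simp add: w_def e_def y_def)
      have S1: "(\<Sum>i\<in>UNIV. partial_deriv i g y * (?G \<omega> + w) $ i) = ?A \<omega> + (t - s) * (\<Sum>i\<in>UNIV. b y $ i * partial_deriv i g y) + (\<Sum>i\<in>UNIV. partial_deriv i g y * e $ i)"
        unfolding Gw by (simp add: sum.distrib sum_subtractf sum_distrib_left algebra_simps y_def)
      have aa: "(\<Sum>i\<in>UNIV. \<Sum>j\<in>UNIV. partial_deriv j (partial_deriv i g) y * a y $ i $ j)
          = (\<Sum>i\<in>UNIV. \<Sum>j\<in>UNIV. a y $ i $ j * partial_deriv j (partial_deriv i g) y)"
        by (simp add: mult.commute)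
      have alg: "gt - gs - r * (bb + aa / 2) - A - (d2 - r * aa) / 2 = (gt - gs - (A + r * bb + ee) - d2 / 2) + ee"
        for gt gs r bb aa A d2 ee :: real by (simp add: field_simps)
      have eq: "?V \<omega> - ?A \<omega> - ?Q \<omega> = (g (y + (?G \<omega> + w)) - g y - (\<Sum>i\<in>UNIV. partial_deriv i g y * (?G \<omega> + w) $ i) - d2 / 2)
          + (\<Sum>i\<in>UNIV. partial_deriv i g y * e $ i)"
        unfolding Xt S1 unfolding y_def[symmetric] generator_def d2_def aa by (rule alg)
      have "\<bar>\<Sum>i\<in>UNIV. partial_deriv i g y * e $ i\<bar> \<le> (\<Sum>i\<in>(UNIV::'d set). L * norm e)"
        by (intro order_trans[OF sum_abs] sum_mono) (auto simp: abs_mult intro!: mult_mono Clip_bound[OF Clip_partial[OF g]] component_le_norm_cart L)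
      also have "\<dots> = L * ?n ^ 1 * norm e" by simp
      also have "\<dots> \<le> L * ?n ^ 3 * E \<omega>"
      proof (rule mult_mono)
        show "L * ?n ^ 1 \<le> L * ?n ^ 3" using L by (intro mult_left_mono power_increasing) auto
        show "norm e \<le> E \<omega>" using E(3)[OF elim(2)] by (simp add: e_def \<beta>_def)
      qed (use L in auto)
      finally have 2: "\<bar>\<Sum>i\<in>UNIV. partial_deriv i g y * e $ i\<bar> \<le> L * ?n ^ 3 * E \<omega>" .
      have "(norm w)\<^sup>2 \<le> (norm \<beta> + norm (?\<rho> \<omega>))\<^sup>2"
        unfolding w_def by (intro power_mono norm_triangle_ineq) auto
      also have "\<dots> \<le> 2 * (norm \<beta>)\<^sup>2 + 2 * (norm (?\<rho> \<omega>))\<^sup>2"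
        using sum_squares_bound[of "norm \<beta>" "norm (?\<rho> \<omega>)"] by (simp add: power2_sum)
      also have "(norm \<beta>)\<^sup>2 \<le> (?n * K * \<kappa> ^ 4)\<^sup>2"
        using drift_increment_le[OF elim(2) s st] unfolding \<beta>_def ts by (intro power_mono) auto
      finally have w2: "(norm w)\<^sup>2 \<le> 2 * (?n * K * \<kappa> ^ 4)\<^sup>2 + 2 * (norm (?\<rho> \<omega>))\<^sup>2" by simp
      let ?p = "norm (?G \<omega>)"
      have "?p ^ 3 + norm w ^ 2 + ?p * norm w \<le> (\<kappa>\<^sup>2 * ?p\<^sup>2 + ?p ^ 4 / \<kappa>\<^sup>2) + (norm w)\<^sup>2 + (\<kappa> * ?p\<^sup>2 + (norm w)\<^sup>2 / \<kappa>)"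
        using young_terms[OF \<kappa>(1), of ?p "norm w"] by simp
      also have "\<dots> = (\<kappa>\<^sup>2 + \<kappa>) * ?p\<^sup>2 + ?p ^ 4 / \<kappa>\<^sup>2 + (1 + 1 / \<kappa>) * (norm w)\<^sup>2"
        by (simp add: algebra_simps)
      also have "\<dots> \<le> (\<kappa>\<^sup>2 + \<kappa>) * ?p\<^sup>2 + ?p ^ 4 / \<kappa>\<^sup>2 + (1 + 1 / \<kappa>) * (2 * (?n * K * \<kappa> ^ 4)\<^sup>2 + 2 * (norm (?\<rho> \<omega>))\<^sup>2)"
        using w2 \<kappa> by (intro add_left_mono mult_left_mono) auto
      finally have "L * ?n ^ 3 * (?p ^ 3 + norm w ^ 2 + ?p * norm w)
          \<le> L * ?n ^ 3 * ((\<kappa>\<^sup>2 + \<kappa>) * ?p\<^sup>2 + ?p ^ 4 / \<kappa>\<^sup>2 + (1 + 1 / \<kappa>) * (2 * (?n * K * \<kappa> ^ 4)\<^sup>2 + 2 * (norm (?\<rho> \<omega>))\<^sup>2))"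
        using L by (intro mult_left_mono) auto
      with taylor_perturbed[OF g, of y "?G \<omega>" w]
      have 1: "\<bar>g (y + (?G \<omega> + w)) - g y - (\<Sum>i\<in>UNIV. partial_deriv i g y * (?G \<omega> + w) $ i) - d2 / 2\<bar>
          \<le> L * ?n ^ 3 * ((\<kappa>\<^sup>2 + \<kappa>) * ?p\<^sup>2 + ?p ^ 4 / \<kappa>\<^sup>2 + (1 + 1 / \<kappa>) * (2 * (?n * K * \<kappa> ^ 4)\<^sup>2 + 2 * (norm (?\<rho> \<omega>))\<^sup>2))"
        unfolding d2_def by (rule order_trans)
      have "\<bar>A + B\<bar> \<le> A' + B'" if "\<bar>A\<bar> \<le> A'" "\<bar>B\<bar> \<le> B'" for A B A' B' :: real
        using that by linarith
      from this[OF 1 2] show ?case unfolding eq by (simp add: distrib_left)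
    qed
    have "\<bar>expectation ?V\<bar> \<le> expectation (\<lambda>\<omega>. \<bar>?V \<omega> - ?A \<omega> - ?Q \<omega>\<bar>)"
      using VAQ integral_abs_bound[of M "\<lambda>\<omega>. ?V \<omega> - ?A \<omega> - ?Q \<omega>"] by (simp add: has_bochner_integral_iff)
    also have "\<dots> \<le> expectation ?U"
      using VAQ by (intro integral_mono_AE bound UI) (simp add: has_bochner_integral_iff)
    also have "\<dots> \<le> L * ?n ^ 3 * ((\<kappa>\<^sup>2 + \<kappa>) * (c2 * \<kappa> ^ 4) + (c4 * \<kappa> ^ 8) / \<kappa>\<^sup>2
        + (1 + 1 / \<kappa>) * (2 * (?n * K * \<kappa> ^ 4)\<^sup>2 + 2 * (cr * \<kappa> ^ 6)) + c3 * \<kappa> ^ 6)"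
      unfolding UE using GM(2,4) \<rho>E E(2) L \<kappa>
      by (intro mult_left_mono add_mono divide_right_mono) (auto simp: c2_def c4_def ts power_mult[symmetric])
    also have "\<dots> \<le> L * ?n ^ 3 * ((2 * c2 + c4 + 2 * R + c3) * \<kappa> ^ 5)"
    proof (rule mult_left_mono)
      have pw: "\<kappa> ^ 6 \<le> \<kappa> ^ 5" "\<kappa> ^ 8 \<le> \<kappa> ^ 6" using \<kappa> by (auto intro!: power_decreasing)
      have "(1 + 1 / \<kappa>) * (2 * (?n * K * \<kappa> ^ 4)\<^sup>2 + 2 * (cr * \<kappa> ^ 6)) \<le> (1 + 1 / \<kappa>) * (R * \<kappa> ^ 6)"
      proof (rule mult_left_mono)
        have "2 * (?n * K * \<kappa> ^ 4)\<^sup>2 = 2 * (?n * K)\<^sup>2 * \<kappa> ^ 8" by (simp add: power_mult_distrib power_mult[symmetric])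
        also have "\<dots> \<le> 2 * (?n * K)\<^sup>2 * \<kappa> ^ 6" using pw by (intro mult_left_mono) auto
        finally show "2 * (?n * K * \<kappa> ^ 4)\<^sup>2 + 2 * (cr * \<kappa> ^ 6) \<le> R * \<kappa> ^ 6"
          by (simp add: R_def distrib_right)
      qed (use \<kappa> in auto)
      also have "(1 + 1 / \<kappa>) * (R * \<kappa> ^ 6) = R * \<kappa> ^ 6 + R * \<kappa> ^ 5"
        using \<kappa> by (simp add: field_simps eval_nat_numeral)
      finally have a1: "(1 + 1 / \<kappa>) * (2 * (?n * K * \<kappa> ^ 4)\<^sup>2 + 2 * (cr * \<kappa> ^ 6)) \<le> R * \<kappa> ^ 6 + R * \<kappa> ^ 5" .
      have a2: "(\<kappa>\<^sup>2 + \<kappa>) * (c2 * \<kappa> ^ 4) = c2 * \<kappa> ^ 6 + c2 * \<kappa> ^ 5" by (simp add: eval_nat_numeral algebra_simps)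
      have a3: "(c4 * \<kappa> ^ 8) / \<kappa>\<^sup>2 = c4 * \<kappa> ^ 6" using \<kappa> by (simp add: eval_nat_numeral)
      have "c2 * \<kappa> ^ 6 \<le> c2 * \<kappa> ^ 5" "c4 * \<kappa> ^ 6 \<le> c4 * \<kappa> ^ 5" "R * \<kappa> ^ 6 \<le> R * \<kappa> ^ 5" "c3 * \<kappa> ^ 6 \<le> c3 * \<kappa> ^ 5"
        using pw cpos by (auto intro!: mult_left_mono)
      moreover have rhs: "(2 * c2 + c4 + 2 * R + c3) * \<kappa> ^ 5 = 2 * (c2 * \<kappa> ^ 5) + c4 * \<kappa> ^ 5 + 2 * (R * \<kappa> ^ 5) + c3 * \<kappa> ^ 5"
        by (simp add: distrib_right)
      ultimately show "(\<kappa>\<^sup>2 + \<kappa>) * (c2 * \<kappa> ^ 4) + (c4 * \<kappa> ^ 8) / \<kappa>\<^sup>2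
        + (1 + 1 / \<kappa>) * (2 * (?n * K * \<kappa> ^ 4)\<^sup>2 + 2 * (cr * \<kappa> ^ 6)) + c3 * \<kappa> ^ 6 \<le> (2 * c2 + c4 + 2 * R + c3) * \<kappa> ^ 5"
        using a1 unfolding a2 a3 rhs by linarith
    qed (use L in simp)
    also have "\<dots> = C * \<kappa> ^ 5" by (simp add: C_def mult.assoc)
    finally show ?thesis unfolding VE .
  qed
  with C show thesis using that by blast
qed

section \<open>Differentiation in time and mean value expansions\<close>

theorem dynkin_derivative:
  assumes g: "Clip (Suc (Suc 0)) L g" and t: "0 \<le> t"
  shows "((\<lambda>r. expectation (\<lambda>\<omega>. g (X r \<omega>))) has_real_derivative expectation (\<lambda>\<omega>. generator b a g (X t \<omega>))) (at t within {0..})"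
proof -
  define v l where "v r = expectation (\<lambda>\<omega>. g (X r \<omega>))" and "l r = expectation (\<lambda>\<omega>. generator b a g (X r \<omega>))" for r
  obtain C where C: "0 \<le> C" "\<And>s t \<kappa>. 0 \<le> s \<Longrightarrow> t - s = \<kappa> ^ 4 \<Longrightarrow> 0 < \<kappa> \<Longrightarrow> \<kappa> \<le> 1 \<Longrightarrow> \<bar>v t - v s - (t - s) * l s\<bar> \<le> C * \<kappa> ^ 5"
    using local_expansion[OF g] unfolding v_def l_def by blast
  define Lg where "Lg = 2 * (real CARD('d))\<^sup>2 * K * L + 2 * real CARD('d) * K * L"
  have Lg: "Clip 0 Lg (generator b a g)" unfolding Lg_def by (rule generator_Clip[OF g])
  define C' where "C' = Lg * real CARD('d) * moment_const CARD('d) K"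
  have C': "0 \<le> C'" using Clip_nonneg[OF Lg] moment_const_pos by (simp add: C'_def)
  have ldiff: "\<bar>l r - l s\<bar> \<le> C' * \<kappa>\<^sup>2" if "0 \<le> s" "r - s = \<kappa> ^ 4" "0 < \<kappa>" "\<kappa> \<le> 1" for s r \<kappa>
  proof -
    have k4: "0 < \<kappa> ^ 4" using that by simp
    have sr: "s \<le> r" "0 \<le> r" "r - s \<le> \<kappa> ^ 4" using that k4 by linarith+
    note fm = X_increment_first_moment[OF that(1) sr(1) sr(3) that(3,4)]
    have I: "integrable M (\<lambda>\<omega>. generator b a g (X r \<omega>))" "integrable M (\<lambda>\<omega>. generator b a g (X s \<omega>))"
      using integrable_Clip_X[OF Lg] that(1) sr by auto
    have "\<bar>l r - l s\<bar> = \<bar>expectation (\<lambda>\<omega>. generator b a g (X r \<omega>) - generator b a g (X s \<omega>))\<bar>"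
      unfolding l_def using I by simp
    also have "\<dots> \<le> expectation (\<lambda>\<omega>. \<bar>generator b a g (X r \<omega>) - generator b a g (X s \<omega>)\<bar>)"
      by (rule integral_abs_bound)
    also have "\<dots> \<le> expectation (\<lambda>\<omega>. Lg * real CARD('d) * norm (X r \<omega> - X s \<omega>))"
      using I fm(1) Clip_lipschitz[OF Lg] by (intro integral_mono) auto
    also have "\<dots> \<le> Lg * real CARD('d) * (moment_const CARD('d) K * \<kappa>\<^sup>2)"
      unfolding integral_mult_right_zero using fm(2) Clip_nonneg[OF Lg] by (intro mult_left_mono) auto
    finally show ?thesis by (simp add: C'_def mult_ac)
  qed
  have two_sided: "\<bar>v y - v t - (y - t) * l t\<bar> \<le> (C + C') * sqrt (sqrt \<bar>y - t\<bar>) * \<bar>y - t\<bar>"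
    if y: "0 \<le> y" "y \<noteq> t" "\<bar>y - t\<bar> < 1" for y
  proof -
    \<comment> \<open>The fourth root of the time difference, so that \<kappa>^5 is the difference
      times a factor tending to 0.\<close>
    define \<kappa> where "\<kappa> = sqrt (sqrt \<bar>y - t\<bar>)"
    have "\<kappa> ^ 4 = (\<kappa>\<^sup>2)\<^sup>2" by simp
    also have "\<dots> = \<bar>y - t\<bar>" by (simp add: \<kappa>_def)
    finally have k4: "\<kappa> ^ 4 = \<bar>y - t\<bar>" .
    have \<kappa>: "0 < \<kappa>" "\<kappa> \<le> 1" using y by (auto simp: \<kappa>_def)
    have k5: "\<kappa> ^ 5 = \<kappa> * \<bar>y - t\<bar>" by (simp add: k4[symmetric] eval_nat_numeral)
    show ?thesis
    proof (cases "t < y")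
      case True
      then have "\<bar>v y - v t - (y - t) * l t\<bar> \<le> C * \<kappa> ^ 5" using C(2)[OF t _ \<kappa>, of y] k4 by simp
      also have "\<dots> \<le> (C + C') * \<kappa> ^ 5" using C' \<kappa> by (intro mult_right_mono) auto
      finally show ?thesis unfolding k5 \<kappa>_def[symmetric] mult.assoc .
    next
      \<comment> \<open>The expansion is based at the earlier time y; replacing \<open>l y\<close>
        by \<open>l t\<close> costs \<kappa>^4 times O(\<kappa>^2).\<close>
      case False
      then have yt: "t - y = \<kappa> ^ 4" using y k4 by simp
      have "\<bar>v t - v y - (t - y) * l y\<bar> \<le> C * \<kappa> ^ 5" by (rule C(2)[OF y(1) yt \<kappa>])
      moreover have "\<bar>(t - y) * (l t - l y)\<bar> \<le> C' * \<kappa> ^ 5"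
      proof -
        have "\<bar>(t - y) * (l t - l y)\<bar> \<le> \<kappa> ^ 4 * (C' * \<kappa>\<^sup>2)"
          unfolding yt abs_mult using ldiff[OF y(1) yt \<kappa>] \<kappa> by (intro mult_mono) auto
        also have "\<dots> = C' * \<kappa> ^ 6" by (simp add: eval_nat_numeral mult_ac)
        also have "\<dots> \<le> C' * \<kappa> ^ 5" using C' \<kappa> by (intro mult_left_mono power_decreasing) auto
        finally show ?thesis .
      qed
      moreover have "v y - v t - (y - t) * l t = (t - y) * (l t - l y) - (v t - v y - (t - y) * l y)"
        by (simp add: algebra_simps)
      ultimately have "\<bar>v y - v t - (y - t) * l t\<bar> \<le> C' * \<kappa> ^ 5 + C * \<kappa> ^ 5" by linarith
      also have "C' * \<kappa> ^ 5 + C * \<kappa> ^ 5 = (C + C') * \<kappa> ^ 5" by (simp add: distrib_right)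
      finally show ?thesis unfolding k5 \<kappa>_def[symmetric] mult.assoc .
    qed
  qed
  have "((\<lambda>y. (C + C') * sqrt (sqrt \<bar>y - t\<bar>)) \<longlongrightarrow> (C + C') * sqrt (sqrt \<bar>t - t\<bar>)) (at t within {0..})"
    by (intro tendsto_intros)
  then have lim: "((\<lambda>y. (C + C') * sqrt (sqrt \<bar>y - t\<bar>)) \<longlongrightarrow> 0) (at t within {0..})" by simp
  have "((\<lambda>y. (v y - v t) / (y - t) - l t) \<longlongrightarrow> 0) (at t within {0..})"
  proof (rule Lim_null_comparison[OF _ lim])
    show "\<forall>\<^sub>F y in at t within {0..}. norm ((v y - v t) / (y - t) - l t) \<le> (C + C') * sqrt (sqrt \<bar>y - t\<bar>)"
      unfolding eventually_at
    proof (intro exI[of _ 1] conjI ballI impI)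
      fix y :: real assume y: "y \<in> {0..}" "y \<noteq> t \<and> dist y t < 1"
      then have "\<bar>v y - v t - (y - t) * l t\<bar> \<le> (C + C') * sqrt (sqrt \<bar>y - t\<bar>) * \<bar>y - t\<bar>"
        by (intro two_sided) (auto simp: dist_real_def)
      moreover have "(v y - v t) / (y - t) - l t = (v y - v t - (y - t) * l t) / (y - t)"
        using y by (simp add: field_simps)
      ultimately show "norm ((v y - v t) / (y - t) - l t) \<le> (C + C') * sqrt (sqrt \<bar>y - t\<bar>)"
        using y by (simp add: divide_le_eq)
    qed simp
  qed
  then show ?thesis
    unfolding has_field_derivative_iff v_def[symmetric] l_def[symmetric] by (rule LIM_zero_cancel)
qed

text \<open>Using the derivative through the mean value theorem avoids integrating the mean of the
  generator over time; sup bounds at an intermediate time are all that the expansions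
  require.\<close>

lemma expectation_mvt:
  assumes g: "Clip (Suc (Suc 0)) L g" and s: "0 \<le> s" "s < t"
  obtains r where "s < r" "r < t"
    "expectation (\<lambda>\<omega>. g (X t \<omega>)) - expectation (\<lambda>\<omega>. g (X s \<omega>)) = (t - s) * expectation (\<lambda>\<omega>. generator b a g (X r \<omega>))"
proof -
  have "((\<lambda>r. expectation (\<lambda>\<omega>. g (X r \<omega>))) has_derivative (*) (expectation (\<lambda>\<omega>. generator b a g (X r \<omega>)))) (at r within {s..t})"
    if "r \<in> {s..t}" for r
    using dynkin_derivative[OF g, of r] that s
    by (intro has_derivative_subset[where s = "{0..}" and t = "{s..t}"]) (auto simp: has_field_derivative_def)
  from mvt_simple[OF s(2), of "\<lambda>r. expectation (\<lambda>\<omega>. g (X r \<omega>))" "\<lambda>r. (*) (expectation (\<lambda>\<omega>. generator b a g (X r \<omega>)))"] this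
  show thesis using that by (auto simp: mult.commute)
qed

lemma expectation_increment_le:
  assumes g: "Clip (Suc (Suc 0)) L g" and s: "0 \<le> s" "s \<le> t" and B: "\<And>y. \<bar>generator b a g y\<bar> \<le> B"
  shows "\<bar>expectation (\<lambda>\<omega>. g (X t \<omega>)) - expectation (\<lambda>\<omega>. g (X s \<omega>))\<bar> \<le> (t - s) * B"
proof (cases "s = t")
  case False
  with s have lt: "s < t" by simp
  obtain r where r: "s < r" and
    eq: "expectation (\<lambda>\<omega>. g (X t \<omega>)) - expectation (\<lambda>\<omega>. g (X s \<omega>)) = (t - s) * expectation (\<lambda>\<omega>. generator b a g (X r \<omega>))"
    using expectation_mvt[OF g s(1) lt] by blast
  have "\<bar>expectation (\<lambda>\<omega>. generator b a g (X r \<omega>))\<bar> \<le> B"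
    using r s by (intro abs_expectation_le integrable_Clip_X[OF generator_Clip[OF g]] B) auto
  then show ?thesis unfolding eq using s by (simp add: abs_mult mult_left_mono)
qed simp

lemma expectation_diff_le:
  assumes "Clip m L g" "Clip m' L' h" "0 \<le> t" "\<And>y. \<bar>g y - h y\<bar> \<le> B"
  shows "\<bar>expectation (\<lambda>\<omega>. g (X t \<omega>)) - expectation (\<lambda>\<omega>. h (X t \<omega>))\<bar> \<le> B"
proof -
  note I = integrable_Clip_X[OF assms(1,3)] integrable_Clip_X[OF assms(2,3)]
  have "\<bar>expectation (\<lambda>\<omega>. g (X t \<omega>) - h (X t \<omega>))\<bar> \<le> B"
    using I by (intro abs_expectation_le assms(4)) auto
  then show ?thesis using I by simp
qed

text \<open>h is the part of the generator without the factor \<eta>. The mean value theorem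
  produces the generator at an intermediate time r; exchanging it for h costs \<eta> B, and moving h
  from r back to s costs \<eta> B'.\<close>

lemma first_order_step:
  assumes g: "Clip (Suc (Suc 0)) L g" and h: "Clip (Suc (Suc 0)) L' h" and s: "0 \<le> s" and \<eta>: "0 < \<eta>"
    and gh: "\<And>y. \<bar>generator b a g y - h y\<bar> \<le> \<eta> * B" and gen_h: "\<And>y. \<bar>generator b a h y\<bar> \<le> B'"
  shows "\<bar>expectation (\<lambda>\<omega>. g (X (s + \<eta>) \<omega>)) - expectation (\<lambda>\<omega>. g (X s \<omega>)) - \<eta> * expectation (\<lambda>\<omega>. h (X s \<omega>))\<bar> \<le> \<eta>\<^sup>2 * (B + B')"
proof -
  have lt: "s < s + \<eta>" using \<eta> by simp
  obtain r where r: "s < r" "r < s + \<eta>" and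
    eq: "expectation (\<lambda>\<omega>. g (X (s + \<eta>) \<omega>)) - expectation (\<lambda>\<omega>. g (X s \<omega>)) = (s + \<eta> - s) * expectation (\<lambda>\<omega>. generator b a g (X r \<omega>))"
    by (rule expectation_mvt[OF g s lt])
  have r0: "0 \<le> r" using r s by simp
  have B': "0 \<le> B'" using gen_h[of 0] by linarith
  have 1: "\<bar>expectation (\<lambda>\<omega>. generator b a g (X r \<omega>)) - expectation (\<lambda>\<omega>. h (X r \<omega>))\<bar> \<le> \<eta> * B"
    by (rule expectation_diff_le[OF generator_Clip[OF g] h r0 gh])
  have "\<bar>expectation (\<lambda>\<omega>. h (X r \<omega>)) - expectation (\<lambda>\<omega>. h (X s \<omega>))\<bar> \<le> (r - s) * B'"
    using r by (intro expectation_increment_le[OF h s _ gen_h]) auto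
  also have "\<dots> \<le> \<eta> * B'" using r B' by (intro mult_right_mono) auto
  finally have 2: "\<bar>expectation (\<lambda>\<omega>. h (X r \<omega>)) - expectation (\<lambda>\<omega>. h (X s \<omega>))\<bar> \<le> \<eta> * B'" .
  have "expectation (\<lambda>\<omega>. g (X (s + \<eta>) \<omega>)) - expectation (\<lambda>\<omega>. g (X s \<omega>)) - \<eta> * expectation (\<lambda>\<omega>. h (X s \<omega>))
    = \<eta> * ((expectation (\<lambda>\<omega>. generator b a g (X r \<omega>)) - expectation (\<lambda>\<omega>. h (X r \<omega>))) + (expectation (\<lambda>\<omega>. h (X r \<omega>)) - expectation (\<lambda>\<omega>. h (X s \<omega>))))"
    unfolding eq by (simp add: algebra_simps)
  also have "\<bar>\<dots>\<bar> \<le> \<eta> * (\<eta> * B + \<eta> * B')"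
    unfolding abs_mult using \<eta> 1 2 by (intro mult_mono order_trans[OF abs_triangle_ineq] add_mono) auto
  also have "\<dots> = \<eta>\<^sup>2 * (B + B')" by (simp add: power2_eq_square algebra_simps)
  finally show ?thesis .
qed

text \<open>The generator on g is h + \<eta> p, and on h it is k up to O(\<eta>). A second-order
  Taylor expansion in time follows from the mean value theorem applied to g and once more to h. Of
  the constant 3B, two parts come from h and one from p.\<close>

lemma second_order_step:
  assumes g: "Clip (Suc (Suc 0)) L g" and h: "Clip (Suc (Suc 0)) L1 h" and p: "Clip (Suc (Suc 0)) L2 p" and k: "Clip (Suc (Suc 0)) L3 k"
    and s: "0 \<le> s" and \<eta>: "0 < \<eta>"
    and gen_g: "\<And>y. generator b a g y = h y + \<eta> * p y"
    and gen_h: "\<And>y. \<bar>generator b a h y - k y\<bar> \<le> \<eta> * B"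
    and gen_p: "\<And>y. \<bar>generator b a p y\<bar> \<le> B" and gen_k: "\<And>y. \<bar>generator b a k y\<bar> \<le> B"
  shows "\<bar>expectation (\<lambda>\<omega>. g (X (s + \<eta>) \<omega>)) - expectation (\<lambda>\<omega>. g (X s \<omega>)) - \<eta> * expectation (\<lambda>\<omega>. h (X s \<omega>))
     - \<eta>\<^sup>2 * expectation (\<lambda>\<omega>. p (X s \<omega>)) - \<eta>\<^sup>2 / 2 * expectation (\<lambda>\<omega>. k (X s \<omega>))\<bar> \<le> \<eta> ^ 3 * (3 * B)"
proof -
  define v :: "(real^'d \<Rightarrow> real) \<Rightarrow> real \<Rightarrow> real" where "v q r = expectation (\<lambda>\<omega>. q (X r \<omega>))" for q r
  have B: "0 \<le> B" using gen_p[of 0] by linarith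
  \<comment> \<open>The mean of g minus its claimed expansion, as a function of the elapsed time r;
    at r = \<eta> the subtracted terms are those of the conclusion.\<close>
  define w where "w r = v g (s + r) - r * v h s - r * \<eta> * v p s - r\<^sup>2 / 2 * v k s" for r
  have gen_v: "v (generator b a g) r = v h r + \<eta> * v p r" if "0 \<le> r" for r
    unfolding v_def gen_g using integrable_Clip_X[OF h that] integrable_Clip_X[OF p that] by simp
  have dw: "(w has_derivative (*) ((v h (s + r) + \<eta> * v p (s + r)) - v h s - \<eta> * v p s - r * v k s)) (at r within {0..\<eta>})"
    if r: "r \<in> {0..\<eta>}" for r
  proof -
    have sr: "0 \<le> s + r" using r s by simp
    have "(v g has_real_derivative v (generator b a g) (s + r)) (at (s + r) within {0..})"
      unfolding v_def by (rule dynkin_derivative[OF g sr])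
    then have "(v g has_real_derivative v (generator b a g) (s + r)) (at (s + r) within (\<lambda>r. s + r) ` {0..\<eta>})"
      by (rule DERIV_subset) (use s in auto)
    moreover have "((\<lambda>r. s + r) has_real_derivative 1) (at r within {0..\<eta>})"
      by (auto intro!: derivative_eq_intros)
    ultimately have vd: "((\<lambda>r. v g (s + r)) has_real_derivative v (generator b a g) (s + r)) (at r within {0..\<eta>})"
      using DERIV_image_chain[of "v g" _ "\<lambda>r. s + r" r "{0..\<eta>}" 1] by (simp add: o_def)
    have "(w has_real_derivative (v (generator b a g) (s + r) - v h s - \<eta> * v p s - r * v k s)) (at r within {0..\<eta>})"
      unfolding w_def by (rule derivative_eq_intros vd refl | simp)+
    then show ?thesis unfolding gen_v[OF sr] by (simp add: has_field_derivative_def)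
  qed
  obtain r where r: "r \<in> {0<..<\<eta>}" and
    weq: "w \<eta> - w 0 = ((v h (s + r) + \<eta> * v p (s + r)) - v h s - \<eta> * v p s - r * v k s) * (\<eta> - 0)"
    using mvt_simple[OF \<eta> dw] by auto
  have sr: "0 \<le> s + r" "s \<le> s + r" "s < s + r" and r\<eta>: "0 < r" "r < \<eta>" using r s by auto
  have b1: "\<bar>v h (s + r) - v h s - r * v k s\<bar> \<le> 2 * (\<eta>\<^sup>2 * B)"
  proof -
    obtain q where q: "s < q" "q < s + r" and eq: "v h (s + r) - v h s = (s + r - s) * v (generator b a h) q"
      using expectation_mvt[OF h s sr(3)] unfolding v_def by blast
    have q0: "0 \<le> q" using q s by simp
    have 1: "\<bar>v (generator b a h) q - v k q\<bar> \<le> \<eta> * B"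
      unfolding v_def by (rule expectation_diff_le[OF generator_Clip[OF h] k q0 gen_h])
    have "\<bar>v k q - v k s\<bar> \<le> (q - s) * B"
      unfolding v_def using q by (intro expectation_increment_le[OF k s _ gen_k]) auto
    also have "\<dots> \<le> \<eta> * B" using q r\<eta> B by (intro mult_right_mono) auto
    finally have 2: "\<bar>v k q - v k s\<bar> \<le> \<eta> * B" .
    have "v h (s + r) - v h s - r * v k s = r * ((v (generator b a h) q - v k q) + (v k q - v k s))"
      unfolding eq by (simp add: algebra_simps)
    also have "\<bar>\<dots>\<bar> \<le> \<eta> * (\<eta> * B + \<eta> * B)"
      unfolding abs_mult using \<eta> r\<eta> 1 2 B by (intro mult_mono order_trans[OF abs_triangle_ineq] add_mono) auto
    finally show ?thesis by (simp add: power2_eq_square algebra_simps)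
  qed
  have b2: "\<bar>\<eta> * (v p (s + r) - v p s)\<bar> \<le> \<eta>\<^sup>2 * B"
  proof -
    have "\<bar>v p (s + r) - v p s\<bar> \<le> (s + r - s) * B"
      unfolding v_def by (intro expectation_increment_le[OF p s sr(2) gen_p])
    also have "\<dots> \<le> \<eta> * B" using r\<eta> B by (intro mult_right_mono) auto
    finally show ?thesis using \<eta> by (simp add: abs_mult power2_eq_square mult.assoc)
  qed
  have weq': "w \<eta> - w 0 = \<eta> * ((v h (s + r) - v h s - r * v k s) + \<eta> * (v p (s + r) - v p s))"
    unfolding weq by (simp add: algebra_simps)
  have "\<bar>w \<eta> - w 0\<bar> \<le> \<eta> * (2 * (\<eta>\<^sup>2 * B) + \<eta>\<^sup>2 * B)"
    unfolding weq' abs_mult[of \<eta> "_ + _"] using \<eta> order_trans[OF abs_triangle_ineq add_mono[OF b1 b2]]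
    by (intro mult_mono) auto
  then show ?thesis
    by (simp add: w_def v_def power2_eq_square power3_eq_cube algebra_simps)
qed

text \<open>\<open>A k\<close> runs the equation up to time k \<eta> and the chain for the remaining
  N - k steps. It joins the pure chain, k = 0, to the pure equation, k = N, and each exchange costs
  at most \<open>E\<close>.\<close>

lemma telescoping_error:
  assumes u: "u N \<in> borel_measurable borel" and step: "\<And>m k. m < N \<Longrightarrow> \<bar>expectation (\<lambda>\<omega>. u m (X (real (Suc k) * \<eta>) \<omega>)) - expectation (\<lambda>\<omega>. u (Suc m) (X (real k * \<eta>) \<omega>))\<bar> \<le> E"
  shows "\<bar>u N x - expectation (\<lambda>\<omega>. u 0 (X (real N * \<eta>) \<omega>))\<bar> \<le> real N * E"
proof -
  define A where "A k = expectation (\<lambda>\<omega>. u (N - k) (X (real k * \<eta>) \<omega>))" for k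
  have "\<bar>A k - A 0\<bar> \<le> real k * E" if "k \<le> N" for k
    using that
  proof (induction k)
    case (Suc k)
    then have "Suc (N - Suc k) = N - k" by simp
    then have "\<bar>A (Suc k) - A k\<bar> \<le> E" using step[of "N - Suc k" k] Suc.prems by (simp add: A_def)
    with Suc show ?case by (simp add: distrib_right)
  qed simp
  from this[of N] have "\<bar>A N - A 0\<bar> \<le> real N * E" by simp
  moreover have "A 0 = u N x"
  proof -
    have "AE \<omega> in M. X 0 \<omega> = x" using sol by (simp add: sde_solution_def)
    then have "AE \<omega> in M. u N (X 0 \<omega>) = u N x" by (rule AE_mp) auto
    then have "expectation (\<lambda>\<omega>. u N (X 0 \<omega>)) = expectation (\<lambda>\<omega>. u N x)"
      by (intro integral_cong_AE X_measurable_comp u) auto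
    then show ?thesis by (simp add: A_def prob_space)
  qed
  ultimately show ?thesis by (simp add: A_def abs_minus_commute)
qed

end

section \<open>Stochastic gradient descent\<close>

text \<open>The recursion defining the chain adds a step at the end; splitting off the first sample
  instead gives the backward recursion in which the starting point is the variable.\<close>

lemma sgd_chain_case_nat:
  "sgd_chain f \<eta> x (case_nat s \<omega>) (Suc n) = sgd_chain f \<eta> (x - \<eta> *\<^sub>R grad (f s) x) \<omega> n"
  by (induction n) simp_all

text \<open>Losses in C^{m+1,1} have gradients in C^{m,1}, the regularity that lets the one-step
  operator preserve C^{m,1}.\<close>

locale sgd = prob_space \<nu> for \<nu> :: "'e measure" +
  fixes f :: "'e \<Rightarrow> real^'d::finite \<Rightarrow> real" and m :: nat and L :: real
  assumes f_Clip: "\<And>\<xi>. \<xi> \<in> space \<nu> \<Longrightarrow> Clip (Suc m) L (f \<xi>)"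
    and f_measurable: "\<And>y. (\<lambda>\<xi>. f \<xi> y) \<in> borel_measurable \<nu>"
begin

definition mean_loss :: "real^'d \<Rightarrow> real" where
  "mean_loss y = expectation (\<lambda>\<xi>. f \<xi> y)"

definition sgd_op :: "real \<Rightarrow> (real^'d \<Rightarrow> real) \<Rightarrow> real^'d \<Rightarrow> real" where
  "sgd_op \<eta> g y = expectation (\<lambda>\<xi>. g (y - \<eta> *\<^sub>R grad (f \<xi>) y))"

lemma L_nonneg: "0 \<le> L"
  using not_empty f_Clip Clip_nonneg by blast

lemma partial_f_measurable: "(\<lambda>\<xi>. partial_deriv i (f \<xi>) y) \<in> borel_measurable \<nu>"
  using Clip_differentiable[OF f_Clip] by (intro measurable_partial_deriv f_measurable)

lemma partial_f_Clip: "\<xi> \<in> space \<nu> \<Longrightarrow> Clip m L (partial_deriv i (f \<xi>))"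
  by (rule Clip_partial[OF f_Clip])

lemma integrable_partial_f: "integrable \<nu> (\<lambda>\<xi>. partial_deriv i (f \<xi>) y)"
  by (rule integrable_Clip[OF partial_f_Clip partial_f_measurable])

lemma integrable_partial_f_mult: "integrable \<nu> (\<lambda>\<xi>. partial_deriv i (f \<xi>) y * partial_deriv j (f \<xi>) y)"
proof (rule integrable_const_bound[of _ "L * L"])
  show "AE \<xi> in \<nu>. norm (partial_deriv i (f \<xi>) y * partial_deriv j (f \<xi>) y) \<le> L * L"
    unfolding real_norm_def abs_mult
    by (intro AE_I2 mult_mono Clip_bound[OF partial_f_Clip] L_nonneg) auto
qed (intro borel_measurable_times partial_f_measurable)

lemma mean_loss_Clip: "Clip (Suc m) L mean_loss"
  unfolding mean_loss_def[abs_def] by (rule Clip_expectation[OF f_Clip f_measurable])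

lemma partial_mean_loss: "partial_deriv i mean_loss y = expectation (\<lambda>\<xi>. partial_deriv i (f \<xi>) y)"
proof -
  have "\<xi> \<in> space \<nu> \<Longrightarrow> Clip (Suc 0) L (f \<xi>)" for \<xi> using Clip_mono[OF f_Clip] by blast
  from partial_deriv_expectation[OF this f_measurable] show ?thesis
    unfolding mean_loss_def[abs_def] by simp
qed

lemma partial_mean_loss_Clip: "Clip m L (partial_deriv i mean_loss)"
  by (rule Clip_partial[OF mean_loss_Clip])

lemma grad_f_measurable: "(\<lambda>\<xi>. grad (f \<xi>) y) \<in> borel_measurable \<nu>"
  by (rule borel_measurable_vecI) (simp add: grad_nth partial_f_measurable)

lemma grad_step_measurable:
  assumes "g \<in> borel_measurable borel"
  shows "(\<lambda>\<xi>. g (y - \<eta> *\<^sub>R grad (f \<xi>) y) :: real) \<in> borel_measurable \<nu>"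
  by (rule measurable_compose[OF _ assms]) (use grad_f_measurable in measurable)

lemma norm_grad_f_le: "\<xi> \<in> space \<nu> \<Longrightarrow> norm (grad (f \<xi>) y) \<le> L * CARD('d)"
  by (rule norm_grad_le[OF partial_f_Clip])

lemma sgd_op_Clip:
  obtains c where "0 \<le> c" "\<And>g \<eta> K. 0 \<le> \<eta> \<Longrightarrow> \<eta> \<le> 1 \<Longrightarrow> Clip m K g \<Longrightarrow> Clip m ((1 + c * \<eta>) * K) (sgd_op \<eta> g)"
proof -
  from Clip_grad_step[of m L] obtain c where c: "0 \<le> c"
    "\<And>(f :: real^'d \<Rightarrow> real) g \<eta> K. (\<forall>j. Clip m L (partial_deriv j f)) \<Longrightarrow> 0 \<le> \<eta> \<Longrightarrow> \<eta> \<le> 1 \<Longrightarrow> Clip m K g \<Longrightarrow>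
      Clip m ((1 + c * \<eta>) * K) (\<lambda>x. g (x - \<eta> *\<^sub>R grad f x))" by blast
  have "Clip m ((1 + c * \<eta>) * K) (sgd_op \<eta> g)" if "0 \<le> \<eta>" "\<eta> \<le> 1" "Clip m K g" for g \<eta> K
    unfolding sgd_op_def[abs_def] using partial_f_Clip that
    by (intro Clip_expectation c(2) grad_step_measurable Clip_measurable[OF that(3)]) auto
  with c(1) show thesis using that by blast
qed

text \<open>(1 + c \<eta>)^k is at most exp(c k \<eta>), hence bounded by exp(c T) on the time
  horizon, with c independent of \<eta>, k and T.\<close>

lemma sgd_op_power_Clip:
  obtains c where "0 \<le> c"
    "\<And>g \<eta> K T k. 0 \<le> \<eta> \<Longrightarrow> \<eta> \<le> 1 \<Longrightarrow> Clip m K g \<Longrightarrow> real k * \<eta> \<le> T \<Longrightarrow> Clip m (exp (c * T) * K) ((sgd_op \<eta> ^^ k) g)"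
proof -
  obtain c where c: "0 \<le> c" "\<And>g \<eta> K. 0 \<le> \<eta> \<Longrightarrow> \<eta> \<le> 1 \<Longrightarrow> Clip m K g \<Longrightarrow> Clip m ((1 + c * \<eta>) * K) (sgd_op \<eta> g)"
    using sgd_op_Clip by blast
  have "Clip m (exp (c * T) * K) ((sgd_op \<eta> ^^ k) g)" if \<eta>: "0 \<le> \<eta>" "\<eta> \<le> 1" and g: "Clip m K g" and T: "real k * \<eta> \<le> T" for g \<eta> K T k
  proof -
    have "Clip m ((1 + c * \<eta>) ^ k * K) ((sgd_op \<eta> ^^ k) g)"
      by (induction k) (use g c(2)[OF \<eta>] in \<open>auto simp: mult.assoc\<close>)
    moreover have "(1 + c * \<eta>) ^ k * K \<le> exp (c * T) * K"
    proof (rule mult_right_mono)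
      have "(1 + c * \<eta>) ^ k \<le> exp (c * \<eta>) ^ k"
        using c \<eta> by (intro power_mono) auto
      also have "\<dots> = exp (c * (real k * \<eta>))" by (simp add: exp_of_nat_mult[symmetric] mult_ac)
      also have "\<dots> \<le> exp (c * T)" using c T by (simp add: mult_left_mono)
      finally show "(1 + c * \<eta>) ^ k \<le> exp (c * T)" .
    qed (rule Clip_nonneg[OF g])
    ultimately show ?thesis by (rule Clip_mono_const)
  qed
  with c(1) show thesis using that by blast
qed

text \<open>The gradient is measurable in the sample and continuous in the position, so its value at
  the random position is covered by \<open>borel_measurable_Caratheodory\<close>.\<close>

lemma sgd_chain_measurable: "(\<lambda>\<omega>. sgd_chain f \<eta> x \<omega> k) \<in> borel_measurable (\<Pi>\<^sub>M i\<in>(UNIV::nat set). \<nu>)"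
proof (induction k)
  case (Suc k)
  have comp: "(\<lambda>\<omega>. \<omega> k) \<in> measurable (\<Pi>\<^sub>M i\<in>(UNIV::nat set). \<nu>) \<nu>"
    by (rule measurable_component_singleton) simp
  have "(\<lambda>\<omega>. grad (f (\<omega> k)) (sgd_chain f \<eta> x \<omega> k)) \<in> borel_measurable (\<Pi>\<^sub>M i\<in>(UNIV::nat set). \<nu>)"
  proof (rule borel_measurable_vecI)
    fix i
    have "(\<lambda>\<omega>. partial_deriv i (f (\<omega> k)) (sgd_chain f \<eta> x \<omega> k)) \<in> borel_measurable (\<Pi>\<^sub>M i\<in>(UNIV::nat set). \<nu>)"
    proof (rule borel_measurable_Caratheodory[OF Suc.IH, where f = "\<lambda>\<omega>. partial_deriv i (f (\<omega> k))"])
      show "(\<lambda>\<omega>. partial_deriv i (f (\<omega> k)) y) \<in> borel_measurable (\<Pi>\<^sub>M i\<in>(UNIV::nat set). \<nu>)" for y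
        using measurable_compose[OF comp partial_f_measurable] .
      fix \<omega> assume "\<omega> \<in> space (\<Pi>\<^sub>M i\<in>(UNIV::nat set). \<nu>)"
      then have "\<omega> k \<in> space \<nu>" by (auto simp: space_PiM)
      then show "continuous_on UNIV (partial_deriv i (f (\<omega> k)))"
        by (intro Clip_continuous[OF partial_f_Clip])
    qed
    then show "(\<lambda>\<omega>. grad (f (\<omega> k)) (sgd_chain f \<eta> x \<omega> k) $ i) \<in> borel_measurable (\<Pi>\<^sub>M i\<in>(UNIV::nat set). \<nu>)"
      by (simp add: grad_nth)
  qed
  with Suc.IH show ?case by simp
qed simp

text \<open>A sequence of independent samples is distributed as one sample followed by an
  independent such sequence. Fubini then takes the mean over the later samples first.\<close>

lemma sgd_mean_Suc:
  assumes \<phi>: "Clip k K \<phi>"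
  shows "sgd_mean \<nu> f \<eta> \<phi> (Suc n) = sgd_op \<eta> (sgd_mean \<nu> f \<eta> \<phi> n)"
proof
  fix x
  interpret sequence_space \<nu> ..
  interpret P: pair_prob_space \<nu> S ..
  let ?G = "\<lambda>x n \<omega>. \<phi> (sgd_chain f \<eta> x \<omega> n)"
  have Gm: "?G x n \<in> borel_measurable S" for x n
    using measurable_compose[OF sgd_chain_measurable Clip_measurable[OF \<phi>]] .
  have cn: "(\<lambda>(s, \<omega>). case_nat s \<omega>) \<in> measurable (\<nu> \<Otimes>\<^sub>M S) S" by measurable
  have "sgd_mean \<nu> f \<eta> \<phi> (Suc n) x = (\<integral>\<xi>. ?G x (Suc n) \<xi> \<partial>distr (\<nu> \<Otimes>\<^sub>M S) S (\<lambda>(s, \<omega>). case_nat s \<omega>))"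
    unfolding sgd_mean_def PiM_iter ..
  also have "\<dots> = (\<integral>z. ?G x (Suc n) (case z of (s, \<omega>) \<Rightarrow> case_nat s \<omega>) \<partial>(\<nu> \<Otimes>\<^sub>M S))"
    by (rule integral_distr[OF cn Gm])
  also have "\<dots> = (\<integral>s. \<integral>\<omega>. ?G x (Suc n) (case_nat s \<omega>) \<partial>S \<partial>\<nu>)"
  proof -
    have "integrable (\<nu> \<Otimes>\<^sub>M S) (\<lambda>z. ?G x (Suc n) (case z of (s, \<omega>) \<Rightarrow> case_nat s \<omega>))"
      using Clip_bound[OF \<phi>] measurable_compose[OF cn Gm]
      by (intro P.integrable_const_bound[of _ K]) (auto simp del: sgd_chain.simps)
    from P.integral_fst'[OF this] show ?thesis by simp
  qed
  also have "\<dots> = sgd_op \<eta> (sgd_mean \<nu> f \<eta> \<phi> n) x"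
    unfolding sgd_chain_case_nat sgd_op_def sgd_mean_def ..
  finally show "sgd_mean \<nu> f \<eta> \<phi> (Suc n) x = sgd_op \<eta> (sgd_mean \<nu> f \<eta> \<phi> n) x" .
qed

lemma sgd_mean_eq_funpow:
  assumes \<phi>: "Clip k K \<phi>"
  shows "sgd_mean \<nu> f \<eta> \<phi> n = (sgd_op \<eta> ^^ n) \<phi>"
proof (induction n)
  case 0
  interpret sequence_space \<nu> ..
  show ?case by (auto simp: sgd_mean_def P.prob_space)
next
  case (Suc n)
  then show ?case by (simp add: sgd_mean_Suc[OF \<phi>])
qed

section \<open>Expansion of the one-step operator\<close>

text \<open>Taylor's formula in the direction -\<eta> grad f(y; \<xi>), averaged over \<xi>; the
  gradients are bounded by \<open>L * CARD('d)\<close>, so the remainder is uniform in y and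
  \<xi>.\<close>

lemma sgd_op_first_order:
  assumes g: "Clip (Suc 0) K g" and \<eta>: "0 \<le> \<eta>"
  shows "\<bar>sgd_op \<eta> g y - g y + \<eta> * (\<Sum>i\<in>UNIV. partial_deriv i mean_loss y * partial_deriv i g y)\<bar>
    \<le> \<eta>\<^sup>2 * (K * CARD('d) ^ 2 * (L * CARD('d))\<^sup>2)"
proof -
  let ?v = "\<lambda>\<xi>. - \<eta> *\<^sub>R grad (f \<xi>) y"
  let ?R = "\<lambda>\<xi>. g (y + ?v \<xi>) - g y - (\<Sum>i\<in>UNIV. partial_deriv i g y * ?v \<xi> $ i)"
  have K: "0 \<le> K" using Clip_nonneg[OF g] .
  have gi: "integrable \<nu> (\<lambda>\<xi>. g (y + ?v \<xi>))"
    using Clip_bound[OF g] grad_step_measurable[OF Clip_measurable[OF g], of y \<eta>] by (intro integrable_const_bound[of _ K]) auto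
  have vi: "integrable \<nu> (\<lambda>\<xi>. \<Sum>i\<in>UNIV. partial_deriv i g y * ?v \<xi> $ i)"
    using integrable_partial_f by (simp add: grad_nth)
  have "expectation ?R = expectation (\<lambda>\<xi>. g (y + ?v \<xi>)) - g y - expectation (\<lambda>\<xi>. \<Sum>i\<in>UNIV. partial_deriv i g y * ?v \<xi> $ i)"
    using gi vi by (simp add: prob_space)
  also have "expectation (\<lambda>\<xi>. g (y + ?v \<xi>)) = sgd_op \<eta> g y" by (simp add: sgd_op_def)
  also have "expectation (\<lambda>\<xi>. \<Sum>i\<in>UNIV. partial_deriv i g y * ?v \<xi> $ i) = - \<eta> * (\<Sum>i\<in>UNIV. partial_deriv i mean_loss y * partial_deriv i g y)"
    using integrable_partial_f by (simp add: grad_nth partial_mean_loss sum_distrib_left sum_negf mult_ac)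
  finally have eq: "expectation ?R = sgd_op \<eta> g y - g y + \<eta> * (\<Sum>i\<in>UNIV. partial_deriv i mean_loss y * partial_deriv i g y)"
    by simp
  have "\<bar>?R \<xi>\<bar> \<le> \<eta>\<^sup>2 * (K * CARD('d) ^ 2 * (L * CARD('d))\<^sup>2)" if "\<xi> \<in> space \<nu>" for \<xi>
  proof -
    have "\<bar>?R \<xi>\<bar> \<le> K * CARD('d) ^ 2 * norm (?v \<xi>) ^ 2" by (rule taylor_first_order[OF g])
    also have "\<dots> \<le> K * CARD('d) ^ 2 * (\<eta> * (L * CARD('d))) ^ 2"
      using norm_grad_f_le[OF that] K \<eta> by (intro mult_left_mono power_mono) (auto intro!: mult_left_mono)
    finally show ?thesis by (simp add: power_mult_distrib mult_ac)
  qed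
  then have "\<bar>expectation ?R\<bar> \<le> \<eta>\<^sup>2 * (K * CARD('d) ^ 2 * (L * CARD('d))\<^sup>2)"
    using gi vi by (intro abs_expectation_le) auto
  then show ?thesis unfolding eq .
qed

text \<open>The quadratic term contains the full second moments of the gradient, that is the
  covariance plus the products of the partial derivatives of \<open>mean_loss\<close>. The latter
  have to be matched by the square of the drift operator.\<close>

lemma sgd_op_second_order:
  assumes g: "Clip (Suc (Suc 0)) K g" and \<eta>: "0 \<le> \<eta>"
  shows "\<bar>sgd_op \<eta> g y - g y + \<eta> * (\<Sum>i\<in>UNIV. partial_deriv i mean_loss y * partial_deriv i g y)
      - \<eta>\<^sup>2 / 2 * (\<Sum>i\<in>UNIV. \<Sum>j\<in>UNIV. partial_deriv j (partial_deriv i g) y * expectation (\<lambda>\<xi>. partial_deriv i (f \<xi>) y * partial_deriv j (f \<xi>) y))\<bar>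
    \<le> \<eta> ^ 3 * (K * CARD('d) ^ 3 * (L * CARD('d)) ^ 3)"
proof -
  let ?v = "\<lambda>\<xi>. - \<eta> *\<^sub>R grad (f \<xi>) y"
  let ?D = "\<lambda>i j. partial_deriv j (partial_deriv i g) y"
  let ?R = "\<lambda>\<xi>. g (y + ?v \<xi>) - g y - (\<Sum>i\<in>UNIV. partial_deriv i g y * ?v \<xi> $ i) - (\<Sum>i\<in>UNIV. \<Sum>j\<in>UNIV. ?D i j * ?v \<xi> $ i * ?v \<xi> $ j) / 2"
  have K: "0 \<le> K" using Clip_nonneg[OF g] .
  have gi: "integrable \<nu> (\<lambda>\<xi>. g (y + ?v \<xi>))"
    using Clip_bound[OF g] grad_step_measurable[OF Clip_measurable[OF g], of y \<eta>] by (intro integrable_const_bound[of _ K]) auto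
  have vi: "integrable \<nu> (\<lambda>\<xi>. \<Sum>i\<in>UNIV. partial_deriv i g y * ?v \<xi> $ i)"
    using integrable_partial_f by (simp add: grad_nth)
  have vv: "?D i j * ?v \<xi> $ i * ?v \<xi> $ j = (\<eta>\<^sup>2 * ?D i j) * (partial_deriv i (f \<xi>) y * partial_deriv j (f \<xi>) y)" for i j \<xi>
    by (simp add: grad_nth power2_eq_square mult_ac)
  have vvi: "integrable \<nu> (\<lambda>\<xi>. \<Sum>i\<in>UNIV. \<Sum>j\<in>UNIV. ?D i j * ?v \<xi> $ i * ?v \<xi> $ j)"
    unfolding vv using integrable_partial_f_mult by simp
  have "expectation ?R = expectation (\<lambda>\<xi>. g (y + ?v \<xi>)) - g y - expectation (\<lambda>\<xi>. \<Sum>i\<in>UNIV. partial_deriv i g y * ?v \<xi> $ i)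
      - expectation (\<lambda>\<xi>. \<Sum>i\<in>UNIV. \<Sum>j\<in>UNIV. ?D i j * ?v \<xi> $ i * ?v \<xi> $ j) / 2"
    using gi vi vvi by (simp add: prob_space del: vector_scaleR_component)
  also have "expectation (\<lambda>\<xi>. g (y + ?v \<xi>)) = sgd_op \<eta> g y" by (simp add: sgd_op_def)
  also have "expectation (\<lambda>\<xi>. \<Sum>i\<in>UNIV. partial_deriv i g y * ?v \<xi> $ i) = - \<eta> * (\<Sum>i\<in>UNIV. partial_deriv i mean_loss y * partial_deriv i g y)"
    using integrable_partial_f by (simp add: grad_nth partial_mean_loss sum_distrib_left sum_negf mult_ac)
  also have "expectation (\<lambda>\<xi>. \<Sum>i\<in>UNIV. \<Sum>j\<in>UNIV. ?D i j * ?v \<xi> $ i * ?v \<xi> $ j)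
      = \<eta>\<^sup>2 * (\<Sum>i\<in>UNIV. \<Sum>j\<in>UNIV. ?D i j * expectation (\<lambda>\<xi>. partial_deriv i (f \<xi>) y * partial_deriv j (f \<xi>) y))"
    unfolding vv using integrable_partial_f_mult by (simp add: Bochner_Integration.integral_sum sum_distrib_left mult.assoc)
  finally have eq: "expectation ?R = sgd_op \<eta> g y - g y + \<eta> * (\<Sum>i\<in>UNIV. partial_deriv i mean_loss y * partial_deriv i g y)
      - \<eta>\<^sup>2 / 2 * (\<Sum>i\<in>UNIV. \<Sum>j\<in>UNIV. ?D i j * expectation (\<lambda>\<xi>. partial_deriv i (f \<xi>) y * partial_deriv j (f \<xi>) y))"
    by simp
  have "\<bar>?R \<xi>\<bar> \<le> \<eta> ^ 3 * (K * CARD('d) ^ 3 * (L * CARD('d)) ^ 3)" if "\<xi> \<in> space \<nu>" for \<xi>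
  proof -
    have "\<bar>?R \<xi>\<bar> \<le> K * CARD('d) ^ 3 * norm (?v \<xi>) ^ 3" by (rule taylor_second_order[OF g])
    also have "\<dots> \<le> K * CARD('d) ^ 3 * (\<eta> * (L * CARD('d))) ^ 3"
      using norm_grad_f_le[OF that] K \<eta> by (intro mult_left_mono power_mono) (auto intro!: mult_left_mono)
    finally show ?thesis by (simp add: power_mult_distrib mult_ac)
  qed
  then have "\<bar>expectation ?R\<bar> \<le> \<eta> ^ 3 * (K * CARD('d) ^ 3 * (L * CARD('d)) ^ 3)"
    using gi vi vvi by (intro abs_expectation_le) auto
  then show ?thesis unfolding eq .
qed

end

section \<open>Local and global errors\<close>

text \<open>Derivative and differentiability are proved together, since the induction step needs the
  differentiability of the partial sum.\<close>

lemma partial_deriv_sum: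
  fixes g :: "'i \<Rightarrow> real^'d::finite \<Rightarrow> real"
  assumes "finite I" "\<And>j. j \<in> I \<Longrightarrow> g j differentiable_on UNIV"
  shows "partial_deriv i (\<lambda>x. \<Sum>j\<in>I. g j x) = (\<lambda>x. \<Sum>j\<in>I. partial_deriv i (g j) x)
     \<and> (\<lambda>x. \<Sum>j\<in>I. g j x) differentiable_on UNIV"
  using assms
proof (induction I rule: finite_induct)
  case empty
  have "partial_deriv i (\<lambda>x::real^'d. 0) = (\<lambda>x. 0)"
    by (auto intro!: has_derivative_partialI[where c = "\<lambda>_. 0"])
  then show ?case by simp
next
  case (insert j I)
  then show ?case by (auto simp: partial_deriv_add intro!: differentiable_on_add)
qed

section \<open>The generator in powers of \<eta>\<close>

definition drift_op :: "(real^'d::finite \<Rightarrow> real) \<Rightarrow> (real^'d \<Rightarrow> real) \<Rightarrow> real^'d \<Rightarrow> real" where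
  "drift_op F g y = - (\<Sum>i\<in>UNIV. partial_deriv i F y * partial_deriv i g y)"

text \<open>The coefficient of \<eta> in the generator of the modified equation: the diffusion term
  with its factor 1/2, and the drift correction with its factor 1/4.\<close>

definition correction_op ::
  "(real^'d::finite \<Rightarrow> real) \<Rightarrow> (real^'d \<Rightarrow> real^'d^'d) \<Rightarrow> (real^'d \<Rightarrow> real) \<Rightarrow> real^'d \<Rightarrow> real" where
  "correction_op F \<Sigma> g y = (\<Sum>i\<in>UNIV. \<Sum>j\<in>UNIV. \<Sigma> y $ i $ j * partial_deriv j (partial_deriv i g) y) / 2
     - (\<Sum>i\<in>UNIV. partial_deriv i (\<lambda>z. (norm (grad F z))\<^sup>2) y * partial_deriv i g y) / 4"

lemma generator_modified:
  "generator (\<lambda>y. - grad F y - (\<eta> / 4) *\<^sub>R grad (\<lambda>z. (norm (grad F z))\<^sup>2) y) (\<lambda>y. \<eta> *\<^sub>R \<Sigma> y) g y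
    = drift_op F g y + \<eta> * correction_op F \<Sigma> g y"
  unfolding generator_def drift_op_def correction_op_def
  by (simp add: grad_nth sum_subtractf sum_negf sum_distrib_left left_diff_distrib right_diff_distrib sum_divide_distrib mult_ac)

lemma generator_gradient_flow:
  "generator (\<lambda>y. - grad F y) (\<lambda>y. \<eta> *\<^sub>R \<Sigma> y) g y
    = drift_op F g y + \<eta> * ((\<Sum>i\<in>UNIV. \<Sum>j\<in>UNIV. \<Sigma> y $ i $ j * partial_deriv j (partial_deriv i g) y) / 2)"
  unfolding generator_def drift_op_def
  by (simp add: grad_nth sum_negf sum_distrib_left sum_divide_distrib mult_ac)

lemma drift_op_Clip:
  fixes F g :: "real^'d::finite \<Rightarrow> real"
  assumes "\<And>i. Clip k L (partial_deriv i F)" "Clip (Suc k) G g"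
  shows "Clip k (real CARD('d) * 2 ^ Suc k * L * G) (drift_op F g)"
proof -
  have "Clip k (\<Sum>i\<in>(UNIV::'d set). 2 ^ Suc k * L * G) (\<lambda>y. - (\<Sum>i\<in>UNIV. partial_deriv i F y * partial_deriv i g y))"
    by (intro Clip_minus Clip_sum Clip_mult assms(1) Clip_partial[OF assms(2)])
  then show ?thesis by (simp add: drift_op_def[abs_def] mult.assoc)
qed

lemma diffusion_op_Clip:
  fixes \<Sigma> :: "real^'d::finite \<Rightarrow> real^'d^'d"
  assumes "\<And>i j. Clip k A (\<lambda>y. \<Sigma> y $ i $ j)" "Clip (Suc (Suc k)) G g"
  shows "Clip k (real CARD('d) ^ 2 * 2 ^ k * A * G) (\<lambda>y. (\<Sum>i\<in>UNIV. \<Sum>j\<in>UNIV. \<Sigma> y $ i $ j * partial_deriv j (partial_deriv i g) y) / 2)"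
proof -
  have "Clip k (\<bar>1 / 2\<bar> * (\<Sum>i\<in>(UNIV::'d set). \<Sum>j\<in>(UNIV::'d set). 2 ^ Suc k * A * G))
    (\<lambda>y. 1 / 2 * (\<Sum>i\<in>UNIV. \<Sum>j\<in>UNIV. \<Sigma> y $ i $ j * partial_deriv j (partial_deriv i g) y))"
    by (intro Clip_cmult Clip_sum Clip_mult assms(1) Clip_partial[OF Clip_partial[OF assms(2)]])
  then show ?thesis by (simp add: power2_eq_square mult_ac)
qed

lemma correction_op_Clip:
  fixes F g :: "real^'d::finite \<Rightarrow> real"
  assumes "\<And>i j. Clip k A (\<lambda>y. \<Sigma> y $ i $ j)" "\<And>i. Clip k B (partial_deriv i (\<lambda>z. (norm (grad F z))\<^sup>2))"
    and g: "Clip (Suc (Suc k)) G g"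
  shows "Clip k ((real CARD('d) ^ 2 * 2 ^ k * A + real CARD('d) * 2 ^ Suc k * B) * G) (correction_op F \<Sigma> g)"
proof -
  have B: "0 \<le> B" using Clip_nonneg[OF assms(2)] .
  have G: "0 \<le> G" using Clip_nonneg[OF g] .
  have "Clip k (real CARD('d) ^ 2 * 2 ^ k * A * G + \<bar>1 / 4\<bar> * (\<Sum>i\<in>(UNIV::'d set). 2 ^ Suc k * B * G))
    (\<lambda>y. (\<Sum>i\<in>UNIV. \<Sum>j\<in>UNIV. \<Sigma> y $ i $ j * partial_deriv j (partial_deriv i g) y) / 2
      - 1 / 4 * (\<Sum>i\<in>UNIV. partial_deriv i (\<lambda>z. (norm (grad F z))\<^sup>2) y * partial_deriv i g y))"
    by (intro Clip_diff Clip_cmult Clip_sum Clip_mult diffusion_op_Clip assms Clip_partial[OF Clip_SucD[OF g]])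
  then have "Clip k (real CARD('d) ^ 2 * 2 ^ k * A * G + \<bar>1 / 4\<bar> * (\<Sum>i\<in>(UNIV::'d set). 2 ^ Suc k * B * G)) (correction_op F \<Sigma> g)"
    by (simp add: correction_op_def[abs_def])
  then show ?thesis
  proof (rule Clip_mono_const)
    have "0 \<le> real CARD('d) * 2 ^ Suc k * B * G" using B G by simp
    then show "real CARD('d) ^ 2 * 2 ^ k * A * G + \<bar>1 / 4\<bar> * (\<Sum>i\<in>(UNIV::'d set). 2 ^ Suc k * B * G)
        \<le> (real CARD('d) ^ 2 * 2 ^ k * A + real CARD('d) * 2 ^ Suc k * B) * G"
      by (simp add: algebra_simps)
  qed
qed

lemma norm_grad_sq: "(norm (grad F z))\<^sup>2 = (\<Sum>j\<in>UNIV. partial_deriv j F z * partial_deriv j F z)"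
  by (simp add: power2_norm_eq_inner inner_vec_def grad_nth)

lemma norm_grad_sq_Clip:
  fixes F :: "real^'d::finite \<Rightarrow> real"
  assumes "\<And>i. Clip k L (partial_deriv i F)"
  shows "Clip k (real CARD('d) * 2 ^ Suc k * L * L) (\<lambda>z. (norm (grad F z))\<^sup>2)"
proof -
  have "Clip k (\<Sum>i\<in>(UNIV::'d set). 2 ^ Suc k * L * L) (\<lambda>z. \<Sum>j\<in>UNIV. partial_deriv j F z * partial_deriv j F z)"
    by (intro Clip_sum Clip_mult assms)
  then show ?thesis by (simp add: norm_grad_sq mult.assoc)
qed

text \<open>The terms of order \<open>\<eta>\<^sup>2\<close> in the expansions of the two semigroups agree: the correction
  \<open>- \<eta>/4 \<nabla>|\<nabla>F|\<^sup>2\<close> of the drift cancels the first order part of the square of the drift operator.\<close>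
lemma correction_op_drift_op_square:
  fixes F g :: "real^'d::finite \<Rightarrow> real"
  assumes F: "Clip (Suc (Suc k)) L F" and g: "Clip (Suc (Suc k')) G g"
  shows "correction_op F \<Sigma> g y + drift_op F (drift_op F g) y / 2
    = (\<Sum>i\<in>UNIV. \<Sum>j\<in>UNIV. partial_deriv j (partial_deriv i g) y * (\<Sigma> y $ i $ j + partial_deriv i F y * partial_deriv j F y)) / 2"
proof -
  let ?F = "\<lambda>i. partial_deriv i F" and ?FF = "\<lambda>i j. partial_deriv i (partial_deriv j F)"
  let ?g = "\<lambda>i. partial_deriv i g" and ?gg = "\<lambda>i j. partial_deriv i (partial_deriv j g)"
  have Fd: "?F i differentiable_on UNIV" and gd: "?g i differentiable_on UNIV" for i
    using Clip_differentiable[OF Clip_partial[OF F]] Clip_differentiable[OF Clip_partial[OF g]] by auto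
  have d1: "(\<lambda>y. ?F j y * ?g j y) differentiable_on UNIV" for j
    using Fd gd by (intro differentiable_on_mult)
  have "partial_deriv i (drift_op F g) y = - (\<Sum>j\<in>UNIV. ?FF i j y * ?g j y + ?F j y * ?gg i j y)" for i
  proof -
    have "partial_deriv i (\<lambda>y. (-1) * (\<Sum>j\<in>UNIV. ?F j y * ?g j y)) = (\<lambda>y. (-1) * partial_deriv i (\<lambda>y. \<Sum>j\<in>UNIV. ?F j y * ?g j y) y)"
      using partial_deriv_sum[of UNIV "\<lambda>j y. ?F j y * ?g j y"] d1 by (intro partial_deriv_cmult) auto
    moreover have "partial_deriv i (\<lambda>y. \<Sum>j\<in>UNIV. ?F j y * ?g j y) = (\<lambda>y. \<Sum>j\<in>UNIV. ?FF i j y * ?g j y + ?F j y * ?gg i j y)"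
      using partial_deriv_sum[of UNIV "\<lambda>j y. ?F j y * ?g j y" i] d1 by (simp add: partial_deriv_mult[OF Fd gd])
    ultimately show ?thesis by (simp add: drift_op_def[abs_def])
  qed
  then have dd: "drift_op F (drift_op F g) y = (\<Sum>i\<in>UNIV. \<Sum>j\<in>UNIV. ?F i y * ?FF i j y * ?g j y) + (\<Sum>i\<in>UNIV. \<Sum>j\<in>UNIV. ?F i y * ?F j y * ?gg i j y)"
    unfolding drift_op_def[of F "drift_op F g"]
    by (simp only: mult_minus_right sum_negf minus_minus) (simp add: sum_distrib_left sum.distrib distrib_left mult.assoc)
  have S: "partial_deriv i (\<lambda>z. (norm (grad F z))\<^sup>2) y = 2 * (\<Sum>j\<in>UNIV. ?F j y * ?FF i j y)" for i
  proof -
    have "(\<lambda>y. ?F j y * ?F j y) differentiable_on UNIV" for j using Fd by (intro differentiable_on_mult)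
    then have "partial_deriv i (\<lambda>y. \<Sum>j\<in>UNIV. ?F j y * ?F j y) = (\<lambda>y. \<Sum>j\<in>UNIV. ?FF i j y * ?F j y + ?F j y * ?FF i j y)"
      using partial_deriv_sum[of UNIV "\<lambda>j y. ?F j y * ?F j y" i] by (simp add: partial_deriv_mult[OF Fd Fd])
    then show ?thesis by (simp add: norm_grad_sq sum_distrib_left mult_ac)
  qed
  have "(\<Sum>i\<in>UNIV. partial_deriv i (\<lambda>z. (norm (grad F z))\<^sup>2) y * ?g i y) = 2 * (\<Sum>i\<in>UNIV. \<Sum>j\<in>UNIV. ?F j y * ?FF i j y * ?g i y)"
    by (simp add: S sum_distrib_left sum_distrib_right mult_ac)
  \<comment> \<open>Renaming the summation indices and the symmetry of the Hessian of F bring the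
    sum into the form occurring in the squared drift operator.\<close>
  also have "(\<Sum>i\<in>UNIV. \<Sum>j\<in>UNIV. ?F j y * ?FF i j y * ?g i y) = (\<Sum>i\<in>UNIV. \<Sum>j\<in>UNIV. ?F i y * ?FF i j y * ?g j y)"
    by (subst sum.swap) (simp add: Clip_partial_commute[OF F])
  finally have c: "(\<Sum>i\<in>UNIV. partial_deriv i (\<lambda>z. (norm (grad F z))\<^sup>2) y * ?g i y) = 2 * (\<Sum>i\<in>UNIV. \<Sum>j\<in>UNIV. ?F i y * ?FF i j y * ?g j y)" .
  have gsym: "(\<Sum>i\<in>UNIV. \<Sum>j\<in>UNIV. ?F i y * ?F j y * ?gg i j y) = (\<Sum>i\<in>UNIV. \<Sum>j\<in>UNIV. ?F i y * ?F j y * ?gg j i y)"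
    by (subst sum.swap) (simp add: mult_ac)
  have r: "(\<Sum>i\<in>UNIV. \<Sum>j\<in>UNIV. ?gg j i y * (\<Sigma> y $ i $ j + ?F i y * ?F j y))
      = (\<Sum>i\<in>UNIV. \<Sum>j\<in>UNIV. \<Sigma> y $ i $ j * ?gg j i y) + (\<Sum>i\<in>UNIV. \<Sum>j\<in>UNIV. ?F i y * ?F j y * ?gg j i y)"
    by (simp add: sum.distrib distrib_left mult_ac)
  show ?thesis unfolding correction_op_def c dd gsym r by (simp add: field_simps)
qed

section \<open>One-step and accumulated errors\<close>

context sgd
begin

lemma sgd_op_Clip_weak:
  assumes "Clip m G g" "0 \<le> \<eta>" "\<eta> \<le> 1"
  obtains G' where "Clip m G' (sgd_op \<eta> g)"
  using sgd_op_Clip assms by metis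

text \<open>Both means agree with those of g + \<eta> h at X(s), h =
  \<open>drift_op mean_loss g\<close>, up to O(\<eta>^2). The bound m \<ge> 3 makes h a C^{2,1}
  function, to which Dynkin's formula applies. The factor 8 is 2^3 from
  \<open>drift_op_Clip\<close>.\<close>

lemma first_order_one_step:
  fixes M :: "'w measure" and \<Sigma> :: "real^'d \<Rightarrow> real^'d^'d"
  assumes m: "3 \<le> m" and \<eta>: "0 < \<eta>" "\<eta> \<le> 1"
    and sde: "sde M \<F> W (\<lambda>y. - grad mean_loss y) (\<lambda>y. \<eta> *\<^sub>R \<Sigma> y) x X K"
    and \<Sigma>: "\<And>i j. Clip 0 K (\<lambda>y. \<Sigma> y $ i $ j)"
    and g: "Clip m G g" and s: "0 \<le> s"
  defines "n \<equiv> real CARD('d)"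
  shows "\<bar>(\<integral>\<omega>. g (X (s + \<eta>) \<omega>) \<partial>M) - (\<integral>\<omega>. sgd_op \<eta> g (X s \<omega>) \<partial>M)\<bar>
    \<le> \<eta>\<^sup>2 * ((n ^ 2 * K + (2 * n ^ 2 * K + 2 * n * K) * (8 * n * L) + n ^ 2 * (L * n)\<^sup>2) * G)"
proof -
  interpret S: sde M \<F> W "\<lambda>y. - grad mean_loss y" "\<lambda>y. \<eta> *\<^sub>R \<Sigma> y" x X K by fact
  let ?h = "drift_op mean_loss g"
  have FC: "Clip (Suc (Suc 0)) L (partial_deriv i mean_loss)" for i
    by (rule Clip_mono[OF partial_mean_loss_Clip]) (use m in simp)
  have g3: "Clip (Suc (Suc (Suc 0))) G g" and g2: "Clip (Suc (Suc 0)) G g" and g1: "Clip (Suc 0) G g"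
    by (rule Clip_mono[OF g], use m in simp)+
  have h: "Clip (Suc (Suc 0)) (8 * n * L * G) ?h"
    using drift_op_Clip[OF FC g3] by (simp add: n_def mult_ac)
  have gh: "\<bar>generator (\<lambda>y. - grad mean_loss y) (\<lambda>y. \<eta> *\<^sub>R \<Sigma> y) g y - ?h y\<bar> \<le> \<eta> * (n ^ 2 * K * G)" for y
    using Clip_bound[OF diffusion_op_Clip[OF \<Sigma> g2], of y] \<eta>
    by (simp add: generator_gradient_flow abs_mult n_def)
  have gen_h: "\<bar>generator (\<lambda>y. - grad mean_loss y) (\<lambda>y. \<eta> *\<^sub>R \<Sigma> y) ?h y\<bar> \<le> (2 * n ^ 2 * K + 2 * n * K) * (8 * n * L) * G" for y
    using Clip_bound[OF S.generator_Clip[OF h], of y] by (simp add: n_def algebra_simps)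
  have 1: "\<bar>S.expectation (\<lambda>\<omega>. g (X (s + \<eta>) \<omega>)) - S.expectation (\<lambda>\<omega>. g (X s \<omega>)) - \<eta> * S.expectation (\<lambda>\<omega>. ?h (X s \<omega>))\<bar>
      \<le> \<eta>\<^sup>2 * (n ^ 2 * K * G + (2 * n ^ 2 * K + 2 * n * K) * (8 * n * L) * G)"
    by (rule S.first_order_step[OF g2 h s \<eta>(1) gh gen_h])
  from sgd_op_Clip_weak[OF g less_imp_le[OF \<eta>(1)] \<eta>(2)]
  obtain G' where G': "Clip m G' (sgd_op \<eta> g)" .
  have "Clip (Suc (Suc 0)) (G + \<bar>\<eta>\<bar> * (8 * n * L * G)) (\<lambda>y. g y + \<eta> * ?h y)"
    by (intro Clip_add Clip_cmult g2 h)
  moreover have "\<bar>sgd_op \<eta> g y - (g y + \<eta> * ?h y)\<bar> \<le> \<eta>\<^sup>2 * (G * n ^ 2 * (L * n)\<^sup>2)" for y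
    using sgd_op_first_order[OF g1, of \<eta> y] \<eta> by (simp add: drift_op_def n_def algebra_simps)
  ultimately have "\<bar>S.expectation (\<lambda>\<omega>. sgd_op \<eta> g (X s \<omega>)) - S.expectation (\<lambda>\<omega>. g (X s \<omega>) + \<eta> * ?h (X s \<omega>))\<bar> \<le> \<eta>\<^sup>2 * (G * n ^ 2 * (L * n)\<^sup>2)"
    by (intro S.expectation_diff_le[OF G' _ s])
  moreover have "S.expectation (\<lambda>\<omega>. g (X s \<omega>) + \<eta> * ?h (X s \<omega>)) = S.expectation (\<lambda>\<omega>. g (X s \<omega>)) + \<eta> * S.expectation (\<lambda>\<omega>. ?h (X s \<omega>))"
    using S.integrable_Clip_X[OF g s] S.integrable_Clip_X[OF h s] by simp
  ultimately have 2: "\<bar>S.expectation (\<lambda>\<omega>. sgd_op \<eta> g (X s \<omega>)) - S.expectation (\<lambda>\<omega>. g (X s \<omega>)) - \<eta> * S.expectation (\<lambda>\<omega>. ?h (X s \<omega>))\<bar> \<le> \<eta>\<^sup>2 * (G * n ^ 2 * (L * n)\<^sup>2)"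
    by (simp add: algebra_simps)
  have "\<bar>A - D\<bar> \<le> p + q" if "\<bar>A - B - C\<bar> \<le> p" "\<bar>D - B - C\<bar> \<le> q" for A B C D p q :: real
    using that by linarith
  from this[OF 1 2] show ?thesis by (simp add: algebra_simps)
qed

text \<open>At most T/\<eta> local errors of order \<eta>^(p+1) accumulate, which costs one power of
  \<eta>. The factor exp(c T) is the growth of the iterates, to each of which the local estimate is
  applied.\<close>

lemma global_error:
  fixes M :: "'w measure" and B :: real
  assumes \<eta>: "0 < \<eta>" "\<eta> \<le> 1" and sde: "sde M \<F> W b a x X K" and \<phi>: "Clip m G \<phi>"
    and T: "real N * \<eta> \<le> T" and B: "0 \<le> B"
    and c: "\<And>g \<eta> K T k. 0 \<le> \<eta> \<Longrightarrow> \<eta> \<le> 1 \<Longrightarrow> Clip m K g \<Longrightarrow> real k * \<eta> \<le> T \<Longrightarrow> Clip m (exp (c * T) * K) ((sgd_op \<eta> ^^ k) g)"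
    and step: "\<And>g G s. Clip m G g \<Longrightarrow> 0 \<le> s \<Longrightarrow>
      \<bar>(\<integral>\<omega>. g (X (s + \<eta>) \<omega>) \<partial>M) - (\<integral>\<omega>. sgd_op \<eta> g (X s \<omega>) \<partial>M)\<bar> \<le> \<eta> ^ Suc p * (B * G)"
  shows "\<bar>sgd_mean \<nu> f \<eta> \<phi> N x - (\<integral>\<omega>. \<phi> (X (real N * \<eta>) \<omega>) \<partial>M)\<bar> \<le> B * T * exp (c * T) * G * \<eta> ^ p"
proof -
  interpret S: sde M \<F> W b a x X K by fact
  define u where "u k = (sgd_op \<eta> ^^ k) \<phi>" for k
  have G: "0 \<le> G" using Clip_nonneg[OF \<phi>] .
  have u: "Clip m (exp (c * T) * G) (u k)" if "k \<le> N" for k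
  proof -
    have "real k * \<eta> \<le> real N * \<eta>" using that \<eta> by simp
    then have "real k * \<eta> \<le> T" using T by (rule order_trans)
    then show ?thesis unfolding u_def using \<eta> by (intro c \<phi>) auto
  qed
  have "\<bar>u N x - S.expectation (\<lambda>\<omega>. u 0 (X (real N * \<eta>) \<omega>))\<bar> \<le> real N * (\<eta> ^ Suc p * (B * (exp (c * T) * G)))"
  proof (rule S.telescoping_error)
    show "u N \<in> borel_measurable borel" by (rule Clip_measurable[OF u]) simp
    fix j k assume "j < N"
    then have "\<bar>S.expectation (\<lambda>\<omega>. u j (X (real k * \<eta> + \<eta>) \<omega>)) - S.expectation (\<lambda>\<omega>. sgd_op \<eta> (u j) (X (real k * \<eta>) \<omega>))\<bar> \<le> \<eta> ^ Suc p * (B * (exp (c * T) * G))"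
      using \<eta> by (intro step u) auto
    then show "\<bar>S.expectation (\<lambda>\<omega>. u j (X (real (Suc k) * \<eta>) \<omega>)) - S.expectation (\<lambda>\<omega>. u (Suc j) (X (real k * \<eta>) \<omega>))\<bar> \<le> \<eta> ^ Suc p * (B * (exp (c * T) * G))"
      by (simp add: u_def distrib_right add.commute)
  qed
  also have "real N * (\<eta> ^ Suc p * (B * (exp (c * T) * G))) = (real N * \<eta>) * (B * exp (c * T) * G * \<eta> ^ p)"
    by simp
  also have "\<dots> \<le> T * (B * exp (c * T) * G * \<eta> ^ p)"
    using T B G \<eta> by (intro mult_right_mono) auto
  finally show ?thesis by (simp add: sgd_mean_eq_funpow[OF \<phi>] u_def mult_ac)
qed

abbreviation gradient_covariance :: "real^'d \<Rightarrow> real^'d^'d" where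
  "gradient_covariance y \<equiv> covariance_matrix \<nu> (\<lambda>\<xi>. grad (f \<xi>) y)"

text \<open>The form in which covariance and squared mean gradient recombine to the second moments
  occurring in \<open>sgd_op_second_order\<close>.\<close>

lemma gradient_covariance_nth:
  "gradient_covariance y $ i $ j = expectation (\<lambda>\<xi>. partial_deriv i (f \<xi>) y * partial_deriv j (f \<xi>) y)
     - partial_deriv i mean_loss y * partial_deriv j mean_loss y"
proof -
  let ?p = "\<lambda>i \<xi>. partial_deriv i (f \<xi>) y" and ?F = "\<lambda>i. partial_deriv i mean_loss y"
  have "gradient_covariance y $ i $ j = expectation (\<lambda>\<xi>. (?p i \<xi> - ?F i) * (?p j \<xi> - ?F j))"
    by (simp add: covariance_matrix_def grad_nth partial_mean_loss)
  also have "\<dots> = expectation (\<lambda>\<xi>. ?p i \<xi> * ?p j \<xi> - ?F j * ?p i \<xi> - ?F i * ?p j \<xi> + ?F i * ?F j)"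
    by (simp add: algebra_simps)
  also have "\<dots> = expectation (\<lambda>\<xi>. ?p i \<xi> * ?p j \<xi>) - ?F j * expectation (?p i) - ?F i * expectation (?p j) + ?F i * ?F j"
    using integrable_partial_f integrable_partial_f_mult by (simp add: prob_space)
  finally show ?thesis by (simp add: partial_mean_loss)
qed

lemma pos_semidef_gradient_covariance: "pos_semidef (gradient_covariance y)"
  by (rule pos_semidef_covariance_matrix[OF prob_space_axioms, where B = L])
    (auto simp: grad_nth partial_f_measurable intro: Clip_bound[OF partial_f_Clip])

lemma gradient_covariance_Clip:
  assumes "k \<le> m"
  shows "Clip k (2 ^ Suc k * L * L + 2 ^ Suc k * L * L) (\<lambda>y. gradient_covariance y $ i $ j)"
proof -
  have "Clip k (2 ^ Suc k * L * L) (\<lambda>y. expectation (\<lambda>\<xi>. partial_deriv i (f \<xi>) y * partial_deriv j (f \<xi>) y))"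
    by (intro Clip_expectation Clip_mult Clip_mono[OF partial_f_Clip assms] borel_measurable_times partial_f_measurable)
  then show ?thesis
    unfolding gradient_covariance_nth
    by (intro Clip_diff Clip_mult Clip_mono[OF partial_mean_loss_Clip assms])
qed

text \<open>The condition m \<ge> 4 leaves h in C^{3,1} and both k =
  \<open>drift_op mean_loss h\<close> and the correction p in C^{2,1}, so that Dynkin's formula
  applies to all of them. \<open>ch\<close>, \<open>ck\<close>, \<open>cp\<close> bound h, k, p and
  \<open>cq\<close> bounds the correction operator on h, all relative to G; \<open>A\<close> and
  \<open>B\<close> bound the covariance and the derivatives of the squared gradient norm. The powers
  of 2 come from \<open>Clip_mult\<close>.\<close>

lemma second_order_one_step:
  fixes M :: "'w measure" and K :: real
  assumes m: "4 \<le> m" and \<eta>: "0 < \<eta>" "\<eta> \<le> 1"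
    and sde: "sde M \<F> W (\<lambda>y. - grad mean_loss y - (\<eta> / 4) *\<^sub>R grad (\<lambda>z. (norm (grad mean_loss z))\<^sup>2) y)
      (\<lambda>y. \<eta> *\<^sub>R gradient_covariance y) x X K"
    and g: "Clip m G g" and s: "0 \<le> s"
  defines "n \<equiv> real CARD('d)"
  defines "A \<equiv> 16 * L * L" and "B \<equiv> n * 16 * L * L" and "c \<equiv> 2 * n ^ 2 * K + 2 * n * K"
  defines "ch \<equiv> n * 16 * L"
  defines "ck \<equiv> n * 8 * L * ch" and "cp \<equiv> n ^ 2 * 4 * A + n * 8 * B" and "cq \<equiv> (n ^ 2 * A + n * 2 * B) * ch"
  shows "\<bar>(\<integral>\<omega>. g (X (s + \<eta>) \<omega>) \<partial>M) - (\<integral>\<omega>. sgd_op \<eta> g (X s \<omega>) \<partial>M)\<bar>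
    \<le> \<eta> ^ 3 * ((3 * (cq + c * cp + c * ck) + n ^ 3 * (L * n) ^ 3) * G)"
proof -
  let ?b = "\<lambda>y. - grad mean_loss y - (\<eta> / 4) *\<^sub>R grad (\<lambda>z. (norm (grad mean_loss z))\<^sup>2) y" and ?a = "\<lambda>y. \<eta> *\<^sub>R gradient_covariance y"
  interpret S: sde M \<F> W ?b ?a x X K by fact
  let ?h = "drift_op mean_loss g" and ?p = "correction_op mean_loss gradient_covariance g"
  let ?k = "drift_op mean_loss ?h"
  have nn: "0 \<le> n" by (simp add: n_def)
  note L = L_nonneg
  have G: "0 \<le> G" using Clip_nonneg[OF g] .
  have pos: "0 \<le> A" "0 \<le> B" "0 \<le> c" "0 \<le> ch" "0 \<le> ck" "0 \<le> cp" "0 \<le> cq"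
    using nn L S.K_nonneg by (simp_all add: A_def B_def c_def ch_def ck_def cp_def cq_def)
  have FC3: "Clip (Suc (Suc (Suc 0))) L (partial_deriv i mean_loss)" for i
    by (rule Clip_mono[OF partial_mean_loss_Clip]) (use m in simp)
  have FC2: "Clip (Suc (Suc 0)) L (partial_deriv i mean_loss)" for i
    by (rule Clip_mono[OF FC3]) simp
  have F2: "Clip (Suc (Suc 0)) L mean_loss"
    by (rule Clip_mono[OF mean_loss_Clip]) (use m in simp)
  have g4: "Clip (Suc (Suc (Suc (Suc 0)))) G g" and g2: "Clip (Suc (Suc 0)) G g"
    by (rule Clip_mono[OF g], use m in simp)+
  have h3: "Clip (Suc (Suc (Suc 0))) (ch * G) ?h"
    using drift_op_Clip[OF FC3 g4] by (simp add: ch_def n_def mult_ac)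
  have h: "Clip (Suc (Suc 0)) (ch * G) ?h" by (rule Clip_SucD[OF h3])
  have k: "Clip (Suc (Suc 0)) (ck * G) ?k"
    using drift_op_Clip[OF FC2 h3] by (simp add: ck_def n_def mult_ac)
  have \<Sigma>C: "Clip j A (\<lambda>y. gradient_covariance y $ i $ i')" if "j \<le> 2" for i i' j
  proof -
    have "2 \<le> m" using m by simp
    from gradient_covariance_Clip[OF this] have "Clip 2 A (\<lambda>y. gradient_covariance y $ i $ i')"
      by (rule Clip_mono_const) (simp add: A_def)
    then show ?thesis using that by (rule Clip_mono)
  qed
  have SC: "Clip j B (partial_deriv i (\<lambda>z. (norm (grad mean_loss z))\<^sup>2))" if "j \<le> 2" for i j
  proof -
    have "Clip (Suc (Suc (Suc 0))) B (\<lambda>z. (norm (grad mean_loss z))\<^sup>2)"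
      using norm_grad_sq_Clip[OF FC3] by (simp add: B_def n_def)
    from Clip_partial[OF this, of i] show ?thesis by (rule Clip_mono) (use that in simp)
  qed
  have p: "Clip (Suc (Suc 0)) (cp * G) ?p"
    using correction_op_Clip[OF \<Sigma>C SC g4] by (simp add: cp_def n_def)
  have gen_g: "generator ?b ?a g y = ?h y + \<eta> * ?p y" for y
    by (rule generator_modified)
  have gen_h: "\<bar>generator ?b ?a ?h y - ?k y\<bar> \<le> \<eta> * ((cq + c * cp + c * ck) * G)" for y
  proof -
    have "\<bar>correction_op mean_loss gradient_covariance ?h y\<bar> \<le> cq * G"
      using Clip_bound[OF correction_op_Clip[OF \<Sigma>C SC h], of y] by (simp add: cq_def n_def mult.assoc)
    also have "\<dots> \<le> (cq + c * cp + c * ck) * G" using pos G by (intro mult_right_mono) auto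
    finally show ?thesis using \<eta> by (simp add: generator_modified abs_mult)
  qed
  have gen_p: "\<bar>generator ?b ?a ?p y\<bar> \<le> (cq + c * cp + c * ck) * G" for y
  proof -
    have "\<bar>generator ?b ?a ?p y\<bar> \<le> c * cp * G"
      using Clip_bound[OF S.generator_Clip[OF p], of y] by (simp add: c_def n_def algebra_simps)
    also have "\<dots> \<le> (cq + c * cp + c * ck) * G" using pos G by (intro mult_right_mono) auto
    finally show ?thesis .
  qed
  have gen_k: "\<bar>generator ?b ?a ?k y\<bar> \<le> (cq + c * cp + c * ck) * G" for y
  proof -
    have "\<bar>generator ?b ?a ?k y\<bar> \<le> c * ck * G"
      using Clip_bound[OF S.generator_Clip[OF k], of y] by (simp add: c_def n_def algebra_simps)
    also have "\<dots> \<le> (cq + c * cp + c * ck) * G" using pos G by (intro mult_right_mono) auto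
    finally show ?thesis .
  qed
  let ?E = "\<lambda>q. S.expectation (\<lambda>\<omega>. q (X s \<omega>))"
  have 1: "\<bar>S.expectation (\<lambda>\<omega>. g (X (s + \<eta>) \<omega>)) - ?E g - \<eta> * ?E ?h - \<eta>\<^sup>2 * ?E ?p - \<eta>\<^sup>2 / 2 * ?E ?k\<bar> \<le> \<eta> ^ 3 * (3 * ((cq + c * cp + c * ck) * G))"
    by (rule S.second_order_step[OF g2 h p k s \<eta>(1) gen_g gen_h gen_p gen_k])
  from sgd_op_Clip_weak[OF g less_imp_le[OF \<eta>(1)] \<eta>(2)]
  obtain G' where G': "Clip m G' (sgd_op \<eta> g)" .
  let ?q = "\<lambda>y. g y + \<eta> * ?h y + \<eta>\<^sup>2 * ?p y + \<eta>\<^sup>2 / 2 * ?k y"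
  have q: "Clip (Suc (Suc 0)) (G + \<bar>\<eta>\<bar> * (ch * G) + \<bar>\<eta>\<^sup>2\<bar> * (cp * G) + \<bar>\<eta>\<^sup>2 / 2\<bar> * (ck * G)) ?q"
    by (intro Clip_add Clip_cmult g2 h p k)
  have "\<bar>sgd_op \<eta> g y - ?q y\<bar> \<le> \<eta> ^ 3 * (G * n ^ 3 * (L * n) ^ 3)" for y
  proof -
    \<comment> \<open>Here the modified drift pays off: by
      \<open>correction_op_drift_op_square\<close> the quadratic Taylor term of the chain is
      \<eta>^2 (p + k/2), exactly the second-order term of the equation.\<close>
    have E: "\<eta>\<^sup>2 / 2 * (\<Sum>i\<in>UNIV. \<Sum>j\<in>UNIV. partial_deriv j (partial_deriv i g) y * expectation (\<lambda>\<xi>. partial_deriv i (f \<xi>) y * partial_deriv j (f \<xi>) y))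
       = \<eta>\<^sup>2 * (?p y + ?k y / 2)"
      unfolding correction_op_drift_op_square[OF F2 g2] by (simp add: gradient_covariance_nth)
    have S: "(\<Sum>i\<in>UNIV. partial_deriv i mean_loss y * partial_deriv i g y) = - ?h y" by (simp add: drift_op_def)
    have "sgd_op \<eta> g y - ?q y = sgd_op \<eta> g y - g y + \<eta> * (\<Sum>i\<in>UNIV. partial_deriv i mean_loss y * partial_deriv i g y)
      - \<eta>\<^sup>2 / 2 * (\<Sum>i\<in>UNIV. \<Sum>j\<in>UNIV. partial_deriv j (partial_deriv i g) y * expectation (\<lambda>\<xi>. partial_deriv i (f \<xi>) y * partial_deriv j (f \<xi>) y))"
      unfolding E S by (simp add: algebra_simps)
    then show ?thesis using sgd_op_second_order[OF g2, of \<eta> y] \<eta> by (simp add: n_def)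
  qed
  then have "\<bar>?E (sgd_op \<eta> g) - ?E ?q\<bar> \<le> \<eta> ^ 3 * (G * n ^ 3 * (L * n) ^ 3)"
    by (rule S.expectation_diff_le[OF G' q s])
  moreover have "?E ?q = ?E g + \<eta> * ?E ?h + \<eta>\<^sup>2 * ?E ?p + \<eta>\<^sup>2 / 2 * ?E ?k"
    using S.integrable_Clip_X[OF g s] S.integrable_Clip_X[OF h s] S.integrable_Clip_X[OF p s] S.integrable_Clip_X[OF k s] by simp
  ultimately have 2: "\<bar>?E (sgd_op \<eta> g) - ?E g - \<eta> * ?E ?h - \<eta>\<^sup>2 * ?E ?p - \<eta>\<^sup>2 / 2 * ?E ?k\<bar> \<le> \<eta> ^ 3 * (G * n ^ 3 * (L * n) ^ 3)"
    by (simp add: algebra_simps)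
  have "\<bar>A - D\<bar> \<le> p + q" if "\<bar>A - B - C - U - V\<bar> \<le> p" "\<bar>D - B - C - U - V\<bar> \<le> q" for A B C D U V p q :: real
    using that by linarith
  from this[OF 1 2] show ?thesis by (simp add: algebra_simps)
qed

text \<open>The constants are obtained before \<phi>, T, \<eta>, the starting point and the
  solution; this order of quantifiers gives uniformity in n, \<eta> and x.\<close>

lemma weak_error_first_order:
  fixes \<Sigma> :: "real^'d \<Rightarrow> real^'d^'d"
  assumes m: "3 \<le> m" and \<Sigma>: "\<And>i j. Clip 0 K (\<lambda>y. \<Sigma> y $ i $ j)" "\<And>y. pos_semidef (\<Sigma> y)"
  obtains B c where "0 \<le> B" "\<And>\<phi> G T \<eta> N x. \<And>(M :: 'w measure) \<F> W X. Clip m G \<phi> \<Longrightarrow> 0 < \<eta> \<Longrightarrow> \<eta> \<le> 1 \<Longrightarrow> real N * \<eta> \<le> T \<Longrightarrow>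
    sde_solution M \<F> W (\<lambda>y. - grad mean_loss y) (\<lambda>y. psd_sqrt (\<eta> *\<^sub>R \<Sigma> y)) x X \<Longrightarrow>
    \<bar>sgd_mean \<nu> f \<eta> \<phi> N x - (\<integral>\<omega>. \<phi> (X (real N * \<eta>) \<omega>) \<partial>M)\<bar> \<le> B * T * exp (c * T) * G * \<eta>"
proof -
  let ?n = "real CARD('d)"
  \<comment> \<open>One bound for the drift, controlled by \<open>L\<close>, and for the diffusion
    matrix \<eta> \<Sigma>, controlled by \<open>K\<close> since \<eta> \<le> 1.\<close>
  define K' where "K' = max L K"
  have K': "0 \<le> K'" using L_nonneg by (simp add: K'_def)
  define B where "B = ?n ^ 2 * K' + (2 * ?n ^ 2 * K' + 2 * ?n * K') * (8 * ?n * L) + ?n ^ 2 * (L * ?n)\<^sup>2"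
  have B: "0 \<le> B" using K' L_nonneg by (simp add: B_def)
  show thesis
  proof (rule sgd_op_power_Clip)
    fix c :: real
    assume "0 \<le> c" and c: "\<And>g \<eta> K T k. 0 \<le> \<eta> \<Longrightarrow> \<eta> \<le> 1 \<Longrightarrow> Clip m K g \<Longrightarrow> real k * \<eta> \<le> T \<Longrightarrow> Clip m (exp (c * T) * K) ((sgd_op \<eta> ^^ k) g)"
    have \<Sigma>K': "Clip 0 K' (\<lambda>y. \<Sigma> y $ i $ j)" for i j
      by (rule Clip_mono_const[OF \<Sigma>(1)]) (simp add: K'_def)
    have FC: "Clip 0 K' (partial_deriv i mean_loss)" for i
      by (rule Clip_mono_const[OF Clip_mono[OF partial_mean_loss_Clip]]) (simp_all add: K'_def)
    have main: "\<bar>sgd_mean \<nu> f \<eta> \<phi> N x - (\<integral>\<omega>. \<phi> (X (real N * \<eta>) \<omega>) \<partial>M)\<bar> \<le> B * T * exp (c * T) * G * \<eta>"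
      if \<phi>: "Clip m G \<phi>" and \<eta>: "0 < \<eta>" "\<eta> \<le> 1" and T: "real N * \<eta> \<le> T"
        and sol: "sde_solution M \<F> W (\<lambda>y. - grad mean_loss y) (\<lambda>y. psd_sqrt (\<eta> *\<^sub>R \<Sigma> y)) x X"
      for \<phi> G T \<eta> N x and M :: "'w measure" and \<F> W X
    proof -
      have sde: "sde M \<F> W (\<lambda>y. - grad mean_loss y) (\<lambda>y. \<eta> *\<^sub>R \<Sigma> y) x X K'"
      proof (intro sde.intro brownian.intro sde_axioms.intro sol)
        show "brownian_motion M \<F> W" using sol by (simp add: sde_solution_def)
        show "Clip 0 K' (\<lambda>y. (- grad mean_loss y) $ i)" for i
          using Clip_minus[OF FC] by (simp add: grad_nth)
        show "Clip 0 K' (\<lambda>y. (\<eta> *\<^sub>R \<Sigma> y) $ i $ j)" for i j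
          using Clip_mono_const[OF Clip_cmult[OF \<Sigma>K', of \<eta>], of K'] \<eta> K' by (simp add: mult_left_le_one_le)
        show "pos_semidef (\<eta> *\<^sub>R \<Sigma> y)" for y using \<Sigma>(2) \<eta> by (intro pos_semidef_scaleR) auto
      qed
      have "\<bar>(\<integral>\<omega>. g (X (s + \<eta>) \<omega>) \<partial>M) - (\<integral>\<omega>. sgd_op \<eta> g (X s \<omega>) \<partial>M)\<bar> \<le> \<eta> ^ Suc 1 * (B * G)"
        if "Clip m G g" "0 \<le> s" for g G s
        using first_order_one_step[OF m \<eta> sde \<Sigma>K' that] by (simp add: B_def power2_eq_square)
      from global_error[OF \<eta> sde \<phi> T B c this] show ?thesis by simp
  qed
  show thesis by (rule that[of B c]) (fact B, rule main)
  qed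
qed

lemma weak_error_second_order:
  assumes m: "4 \<le> m"
  obtains B c where "0 \<le> B" "\<And>\<phi> G T \<eta> N x. \<And>(M :: 'w measure) \<F> W X. Clip m G \<phi> \<Longrightarrow> 0 < \<eta> \<Longrightarrow> \<eta> \<le> 1 \<Longrightarrow> real N * \<eta> \<le> T \<Longrightarrow>
    sde_solution M \<F> W (\<lambda>y. - grad mean_loss y - (\<eta> / 4) *\<^sub>R grad (\<lambda>z. (norm (grad mean_loss z))\<^sup>2) y)
      (\<lambda>y. psd_sqrt (\<eta> *\<^sub>R gradient_covariance y)) x X \<Longrightarrow>
    \<bar>sgd_mean \<nu> f \<eta> \<phi> N x - (\<integral>\<omega>. \<phi> (X (real N * \<eta>) \<omega>) \<partial>M)\<bar> \<le> B * T * exp (c * T) * G * \<eta>\<^sup>2"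
proof -
  let ?n = "real CARD('d)"
  define D where "D = ?n * 16 * L * L"
  \<comment> \<open>\<open>L\<close> covers the gradient, \<open>D\<close> the correction of the
    drift with its factor \<eta>/4, and 4 L L the covariance matrix in C^{0,1}.\<close>
  define K where "K = L + D + 4 * L * L"
  have pos: "0 \<le> L" "0 \<le> D" "0 \<le> K" "0 \<le> L * L" using L_nonneg by (simp_all add: D_def K_def)
  define ch where "ch = ?n * 16 * L"
  define q where "q = 2 * ?n ^ 2 * K + 2 * ?n * K"
  define B where "B = 3 * ((?n ^ 2 * (16 * L * L) + ?n * 2 * D) * ch + q * (?n ^ 2 * 4 * (16 * L * L) + ?n * 8 * D) + q * (?n * 8 * L * ch)) + ?n ^ 3 * (L * ?n) ^ 3"
  have B: "0 \<le> B" using pos by (simp add: B_def ch_def q_def)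
  show thesis
  proof (rule sgd_op_power_Clip)
    fix c :: real
    assume "0 \<le> c" and c: "\<And>g \<eta> K T k. 0 \<le> \<eta> \<Longrightarrow> \<eta> \<le> 1 \<Longrightarrow> Clip m K g \<Longrightarrow> real k * \<eta> \<le> T \<Longrightarrow> Clip m (exp (c * T) * K) ((sgd_op \<eta> ^^ k) g)"
    have \<Sigma>C: "Clip 0 K (\<lambda>y. gradient_covariance y $ i $ j)" for i j
      by (rule Clip_mono_const[OF gradient_covariance_Clip[of 0]]) (use pos in \<open>simp_all add: K_def\<close>)
    have FC: "Clip 0 L (partial_deriv i mean_loss)" for i
      by (rule Clip_mono[OF partial_mean_loss_Clip]) simp
    have SC: "Clip 0 D (partial_deriv i (\<lambda>z. (norm (grad mean_loss z))\<^sup>2))" for i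
    proof -
      have "Clip 3 L (partial_deriv j mean_loss)" for j
        by (rule Clip_mono[OF partial_mean_loss_Clip]) (use m in simp)
      from norm_grad_sq_Clip[OF this] have "Clip (Suc (Suc (Suc 0))) D (\<lambda>z. (norm (grad mean_loss z))\<^sup>2)"
        by (simp add: D_def numeral_3_eq_3 del: Clip.simps)
      from Clip_partial[OF this] show ?thesis by (rule Clip_mono) simp
  qed
  have main: "\<bar>sgd_mean \<nu> f \<eta> \<phi> N x - (\<integral>\<omega>. \<phi> (X (real N * \<eta>) \<omega>) \<partial>M)\<bar> \<le> B * T * exp (c * T) * G * \<eta>\<^sup>2"
    if \<phi>: "Clip m G \<phi>" and \<eta>: "0 < \<eta>" "\<eta> \<le> 1" and T: "real N * \<eta> \<le> T"
      and sol: "sde_solution M \<F> W (\<lambda>y. - grad mean_loss y - (\<eta> / 4) *\<^sub>R grad (\<lambda>z. (norm (grad mean_loss z))\<^sup>2) y)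
        (\<lambda>y. psd_sqrt (\<eta> *\<^sub>R gradient_covariance y)) x X"
    for \<phi> G T \<eta> N x and M :: "'w measure" and \<F> W X
  proof -
    have sde: "sde M \<F> W (\<lambda>y. - grad mean_loss y - (\<eta> / 4) *\<^sub>R grad (\<lambda>z. (norm (grad mean_loss z))\<^sup>2) y)
      (\<lambda>y. \<eta> *\<^sub>R gradient_covariance y) x X K"
    proof (intro sde.intro brownian.intro sde_axioms.intro sol)
      show "brownian_motion M \<F> W" using sol by (simp add: sde_solution_def)
      show "Clip 0 K (\<lambda>y. (- grad mean_loss y - (\<eta> / 4) *\<^sub>R grad (\<lambda>z. (norm (grad mean_loss z))\<^sup>2) y) $ i)" for i
      proof -
        have "Clip 0 (L + \<bar>\<eta> / 4\<bar> * D) (\<lambda>y. - partial_deriv i mean_loss y - (\<eta> / 4) * partial_deriv i (\<lambda>z. (norm (grad mean_loss z))\<^sup>2) y)"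
          by (intro Clip_diff Clip_minus Clip_cmult FC SC)
        moreover have "L + \<bar>\<eta> / 4\<bar> * D \<le> K"
        proof -
          have "\<bar>\<eta> / 4\<bar> * D \<le> 1 * D" using \<eta> pos by (intro mult_right_mono) auto
          moreover have "0 \<le> 4 * L * L" using pos by simp
          ultimately show ?thesis unfolding K_def by linarith
        qed
        ultimately show ?thesis by (simp only: vector_minus_component vector_uminus_component vector_scaleR_component grad_nth real_scaleR_def) (rule Clip_mono_const)
      qed
      show "Clip 0 K (\<lambda>y. (\<eta> *\<^sub>R gradient_covariance y) $ i $ j)" for i j
        using Clip_mono_const[OF Clip_cmult[OF \<Sigma>C, of \<eta>], of K] \<eta> pos by (simp add: mult_left_le_one_le)
      show "pos_semidef (\<eta> *\<^sub>R gradient_covariance y)" for y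
        using pos_semidef_gradient_covariance \<eta> by (intro pos_semidef_scaleR) auto
    qed
    have "\<bar>(\<integral>\<omega>. g (X (s + \<eta>) \<omega>) \<partial>M) - (\<integral>\<omega>. sgd_op \<eta> g (X s \<omega>) \<partial>M)\<bar> \<le> \<eta> ^ Suc 2 * (B * G)"
      if "Clip m G g" "0 \<le> s" for g G s
      using second_order_one_step[OF m \<eta> sde that]
      by (simp only: B_def D_def ch_def q_def) (simp add: eval_nat_numeral)
    from global_error[OF \<eta> sde \<phi> T B c this] show ?thesis by simp
  qed
  show thesis by (rule that[of B c]) (fact B, rule main)
  qed
qed

end

section \<open>From the C^m hypotheses to the theorem\<close>

text \<open>One derivative is traded for the Lipschitz condition and one is taken by the gradient,
  so C^{m+2} losses have gradients in C^{m,1}.\<close>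

lemma sgdI:
  fixes f :: "'e \<Rightarrow> real^'d::finite \<Rightarrow> real"
  assumes "prob_space \<nu>" and "\<And>y. (\<lambda>\<xi>. f \<xi> y) \<in> borel_measurable \<nu>"
    and C: "\<forall>\<xi>\<in>space \<nu>. C_diff (Suc (Suc m)) (f \<xi>)" "(SUP \<xi>\<in>space \<nu>. C_norm (Suc (Suc m)) (f \<xi>)) < \<infinity>"
  shows "sgd \<nu> f m (enn2real (SUP \<xi>\<in>space \<nu>. C_norm (Suc (Suc m)) (f \<xi>)))"
proof (intro sgd.intro sgd_axioms.intro assms)
  fix \<xi> assume \<xi>: "\<xi> \<in> space \<nu>"
  show "Clip (Suc m) (enn2real (SUP \<xi>\<in>space \<nu>. C_norm (Suc (Suc m)) (f \<xi>))) (f \<xi>)"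
  proof (rule Clip_if_C_norm_le)
    show "C_norm (Suc (Suc m)) (f \<xi>) \<le> ennreal (enn2real (SUP \<xi>\<in>space \<nu>. C_norm (Suc (Suc m)) (f \<xi>)))"
      using C(2) SUP_upper[OF \<xi>, of "\<lambda>\<xi>. C_norm (Suc (Suc m)) (f \<xi>)"] by simp
  qed (use C \<xi> in auto)
qed

lemma SUP_sup_norm_le:
  assumes "\<And>n x. n \<in> I \<Longrightarrow> \<bar>e n x\<bar> \<le> D"
  shows "(SUP n\<in>I. sup_norm (e n)) \<le> ennreal D"
  unfolding sup_norm_def using assms by (intro SUP_least ennreal_leI)

text \<open>C^5 losses have gradients in C^{3,1}, and C^4 test functions lie in C^{3,1}; in the
  second part the exponents 7 and 6 lead to C^{5,1} in the same way. The one-step estimates hold for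
  all \<eta> \<le> 1, so the threshold is 1 in both parts.\<close>

theorem theorem2p2:
  fixes \<Xi> :: "(real^'m::finite) set"
    and \<nu> :: "(real^'m) measure"
    and f :: "real^'m \<Rightarrow> real^'d::finite \<Rightarrow> real"
    and F :: "real^'d \<Rightarrow> real"
  assumes "prob_space \<nu>"
    and "sets \<nu> = sets (restrict_space borel \<Xi>)"
    and "\<And>x. (\<lambda>\<xi>. f \<xi> x) \<in> borel_measurable \<nu>"
  defines "F \<equiv> (\<lambda>x. \<integral>\<xi>. f \<xi> x \<partial>\<nu>)"
  shows
    "(\<forall>\<Sigma> :: real^'d \<Rightarrow> real^'d^'d.
       (\<forall>\<xi>\<in>\<Xi>. C_diff 5 (f \<xi>)) \<and> (SUP \<xi>\<in>\<Xi>. C_norm 5 (f \<xi>)) < \<infinity> \<and>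
       (\<forall>i j. (\<lambda>x. \<Sigma> x $ i $ j) \<in> C_b 2) \<and> (\<forall>x. pos_semidef (\<Sigma> x)) \<longrightarrow>
       (\<exists>C :: real \<Rightarrow> real \<Rightarrow> real \<Rightarrow> real. \<forall>T>0. \<forall>\<phi>\<in>C_b 4. \<exists>\<eta>\<^sub>0>0.
          C T (enn2real (C_norm 4 \<phi>)) \<eta>\<^sub>0 > 0 \<and>
          (\<forall>\<eta>. 0 < \<eta> \<and> \<eta> \<le> \<eta>\<^sub>0 \<longrightarrow>
            (\<forall>(M :: real^'d \<Rightarrow> 'w measure) \<F> W X.
              (\<forall>x. sde_solution (M x) (\<F> x) (W x)
                     (\<lambda>y. - grad F y) (\<lambda>y. psd_sqrt (\<eta> *\<^sub>R \<Sigma> y)) x (X x)) \<longrightarrow>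
              (SUP n\<in>{n. real n * \<eta> \<le> T}.
                 sup_norm (\<lambda>x. sgd_mean \<nu> f \<eta> \<phi> n x - sde_mean M X \<phi> x (real n * \<eta>)))
              \<le> ennreal (C T (enn2real (C_norm 4 \<phi>)) \<eta>\<^sub>0 * \<eta>))))) \<and>
     ((\<forall>\<xi>\<in>\<Xi>. C_diff 7 (f \<xi>)) \<and> (SUP \<xi>\<in>\<Xi>. C_norm 7 (f \<xi>)) < \<infinity> \<longrightarrow>
       (\<exists>C :: real \<Rightarrow> real \<Rightarrow> real \<Rightarrow> real. \<forall>T>0. \<forall>\<phi>\<in>C_b 6. \<exists>\<eta>\<^sub>0>0.
          C T (enn2real (C_norm 6 \<phi>)) \<eta>\<^sub>0 > 0 \<and>
          (\<forall>\<eta>. 0 < \<eta> \<and> \<eta> \<le> \<eta>\<^sub>0 \<longrightarrow>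
            (\<forall>(M :: real^'d \<Rightarrow> 'w measure) \<F> W X.
              (\<forall>x. sde_solution (M x) (\<F> x) (W x)
                     (\<lambda>y. - grad F y - (\<eta> / 4) *\<^sub>R grad (\<lambda>z. (norm (grad F z))\<^sup>2) y)
                     (\<lambda>y. psd_sqrt (\<eta> *\<^sub>R covariance_matrix \<nu> (\<lambda>\<xi>. grad (f \<xi>) y))) x (X x)) \<longrightarrow>
              (SUP n\<in>{n. real n * \<eta> \<le> T}.
                 sup_norm (\<lambda>x. sgd_mean \<nu> f \<eta> \<phi> n x - sde_mean M X \<phi> x (real n * \<eta>)))
              \<le> ennreal (C T (enn2real (C_norm 6 \<phi>)) \<eta>\<^sub>0 * \<eta>\<^sup>2)))))"
proof -
  let ?\<Xi>sup = "\<lambda>k. enn2real (SUP \<xi>\<in>space \<nu>. C_norm k (f \<xi>))"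
  have space: "\<Xi> = space \<nu>"
    using sets_eq_imp_space_eq[OF assms(2)] by (simp add: space_restrict_space)
  have F: "F = sgd.mean_loss \<nu> f" if "sgd \<nu> f m L" for m L
    unfolding assms(4) sgd.mean_loss_def[OF that] ..
  have Suc3: "Suc (Suc 3) = 5" and Suc5: "Suc (Suc 5) = 7" by simp_all
  show ?thesis
  proof (intro conjI allI impI)
    fix \<Sigma> :: "real^'d \<Rightarrow> real^'d^'d"
    assume H: "(\<forall>\<xi>\<in>\<Xi>. C_diff 5 (f \<xi>)) \<and> (SUP \<xi>\<in>\<Xi>. C_norm 5 (f \<xi>)) < \<infinity> \<and>
       (\<forall>i j. (\<lambda>x. \<Sigma> x $ i $ j) \<in> C_b 2) \<and> (\<forall>x. pos_semidef (\<Sigma> x))"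
    then have "\<forall>\<xi>\<in>space \<nu>. C_diff (Suc (Suc 3)) (f \<xi>)" "(SUP \<xi>\<in>space \<nu>. C_norm (Suc (Suc 3)) (f \<xi>)) < \<infinity>"
      unfolding space Suc3 by blast+
    from sgdI[where f = f and m = 3, OF assms(1,3) this] have sgd: "sgd \<nu> f 3 (?\<Xi>sup 5)"
      unfolding Suc3 .
    interpret sgd \<nu> f 3 "?\<Xi>sup 5" by fact
    \<comment> \<open>The sum over all entries bounds each of them, so that one constant serves for
      the whole matrix field.\<close>
    define K where "K = (\<Sum>i\<in>UNIV. \<Sum>j\<in>UNIV. enn2real (C_norm 2 (\<lambda>x. \<Sigma> x $ i $ j)))"
    have \<Sigma>: "Clip 0 K (\<lambda>y. \<Sigma> y $ i $ j)" for i j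
    proof (rule Clip_mono_const)
      have Suc1: "Suc 1 = 2" by simp
      have "(\<lambda>x. \<Sigma> x $ i $ j) \<in> C_b (Suc 1)" using H unfolding Suc1 by blast
      from Clip_mono[OF Clip_if_C_b[OF this] le0]
      show "Clip 0 (enn2real (C_norm 2 (\<lambda>x. \<Sigma> x $ i $ j))) (\<lambda>y. \<Sigma> y $ i $ j)"
        unfolding Suc1 .
      have "enn2real (C_norm 2 (\<lambda>x. \<Sigma> x $ i $ j)) \<le> (\<Sum>j\<in>UNIV. enn2real (C_norm 2 (\<lambda>x. \<Sigma> x $ i $ j)))"
        by (rule member_le_sum) auto
      also have "\<dots> \<le> K"
        unfolding K_def by (rule member_le_sum[where f = "\<lambda>i. \<Sum>j\<in>UNIV. enn2real (C_norm 2 (\<lambda>x. \<Sigma> x $ i $ j))"]) (auto intro: sum_nonneg)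
      finally show "enn2real (C_norm 2 (\<lambda>x. \<Sigma> x $ i $ j)) \<le> K" .
    qed
    show "\<exists>C :: real \<Rightarrow> real \<Rightarrow> real \<Rightarrow> real. \<forall>T>0. \<forall>\<phi>\<in>C_b 4. \<exists>\<eta>\<^sub>0>0.
          C T (enn2real (C_norm 4 \<phi>)) \<eta>\<^sub>0 > 0 \<and>
          (\<forall>\<eta>. 0 < \<eta> \<and> \<eta> \<le> \<eta>\<^sub>0 \<longrightarrow>
            (\<forall>(M :: real^'d \<Rightarrow> 'w measure) \<F> W X.
              (\<forall>x. sde_solution (M x) (\<F> x) (W x)
                     (\<lambda>y. - grad F y) (\<lambda>y. psd_sqrt (\<eta> *\<^sub>R \<Sigma> y)) x (X x)) \<longrightarrow>
              (SUP n\<in>{n. real n * \<eta> \<le> T}.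
                 sup_norm (\<lambda>x. sgd_mean \<nu> f \<eta> \<phi> n x - sde_mean M X \<phi> x (real n * \<eta>)))
              \<le> ennreal (C T (enn2real (C_norm 4 \<phi>)) \<eta>\<^sub>0 * \<eta>)))"
    proof (rule weak_error_first_order[of K \<Sigma>])
      fix B c
      assume B: "0 \<le> B" and err: "\<And>\<phi> G T \<eta> N x. \<And>(M :: 'w measure) \<F> W X. Clip 3 G \<phi> \<Longrightarrow> 0 < \<eta> \<Longrightarrow> \<eta> \<le> 1 \<Longrightarrow> real N * \<eta> \<le> T \<Longrightarrow>
        sde_solution M \<F> W (\<lambda>y. - grad mean_loss y) (\<lambda>y. psd_sqrt (\<eta> *\<^sub>R \<Sigma> y)) x X \<Longrightarrow>
        \<bar>sgd_mean \<nu> f \<eta> \<phi> N x - (\<integral>\<omega>. \<phi> (X (real N * \<eta>) \<omega>) \<partial>M)\<bar> \<le> B * T * exp (c * T) * G * \<eta>"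
      show ?thesis
      \<comment> \<open>The summand 1 keeps the constant strictly positive when B or the norm of
        \<phi> is zero.\<close>
      proof (intro exI[of _ "\<lambda>T G \<eta>\<^sub>0. B * T * exp (c * T) * G + 1"] allI impI ballI exI[of _ "1::real"] conjI)
        fix T :: real and \<phi> :: "real^'d \<Rightarrow> real" assume T: "0 < T" and \<phi>: "\<phi> \<in> C_b 4"
        let ?G = "enn2real (C_norm 4 \<phi>)"
        show "0 < B * T * exp (c * T) * ?G + 1" using B T by (intro add_nonneg_pos mult_nonneg_nonneg) auto
        have G: "Clip 3 ?G \<phi>" using Clip_if_C_b[of \<phi> 3] \<phi> by simp
        fix \<eta> and M :: "real^'d \<Rightarrow> 'w measure" and \<F> W X
        assume \<eta>: "0 < \<eta> \<and> \<eta> \<le> 1" and sol: "\<forall>x. sde_solution (M x) (\<F> x) (W x)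
                     (\<lambda>y. - grad F y) (\<lambda>y. psd_sqrt (\<eta> *\<^sub>R \<Sigma> y)) x (X x)"
        show "(SUP n\<in>{n. real n * \<eta> \<le> T}.
                 sup_norm (\<lambda>x. sgd_mean \<nu> f \<eta> \<phi> n x - sde_mean M X \<phi> x (real n * \<eta>)))
              \<le> ennreal ((B * T * exp (c * T) * ?G + 1) * \<eta>)"
        proof (rule SUP_sup_norm_le)
          fix n x assume n: "n \<in> {n. real n * \<eta> \<le> T}"
          then have "\<bar>sgd_mean \<nu> f \<eta> \<phi> n x - sde_mean M X \<phi> x (real n * \<eta>)\<bar> \<le> B * T * exp (c * T) * ?G * \<eta>"
            using \<eta> sol unfolding sde_mean_def F[OF sgd] by (intro err[OF G]) auto
          then show "\<bar>sgd_mean \<nu> f \<eta> \<phi> n x - sde_mean M X \<phi> x (real n * \<eta>)\<bar> \<le> (B * T * exp (c * T) * ?G + 1) * \<eta>"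
            using \<eta> by (simp add: distrib_right)
        qed
      qed simp
    qed (use H \<Sigma> in auto)
  next
    assume H: "(\<forall>\<xi>\<in>\<Xi>. C_diff 7 (f \<xi>)) \<and> (SUP \<xi>\<in>\<Xi>. C_norm 7 (f \<xi>)) < \<infinity>"
    then have "\<forall>\<xi>\<in>space \<nu>. C_diff (Suc (Suc 5)) (f \<xi>)" "(SUP \<xi>\<in>space \<nu>. C_norm (Suc (Suc 5)) (f \<xi>)) < \<infinity>"
      unfolding space Suc5 by blast+
    from sgdI[where f = f and m = 5, OF assms(1,3) this] have sgd: "sgd \<nu> f 5 (?\<Xi>sup 7)"
      unfolding Suc5 .
    interpret sgd \<nu> f 5 "?\<Xi>sup 7" by fact
    show "\<exists>C :: real \<Rightarrow> real \<Rightarrow> real \<Rightarrow> real. \<forall>T>0. \<forall>\<phi>\<in>C_b 6. \<exists>\<eta>\<^sub>0>0.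
          C T (enn2real (C_norm 6 \<phi>)) \<eta>\<^sub>0 > 0 \<and>
          (\<forall>\<eta>. 0 < \<eta> \<and> \<eta> \<le> \<eta>\<^sub>0 \<longrightarrow>
            (\<forall>(M :: real^'d \<Rightarrow> 'w measure) \<F> W X.
              (\<forall>x. sde_solution (M x) (\<F> x) (W x)
                     (\<lambda>y. - grad F y - (\<eta> / 4) *\<^sub>R grad (\<lambda>z. (norm (grad F z))\<^sup>2) y)
                     (\<lambda>y. psd_sqrt (\<eta> *\<^sub>R covariance_matrix \<nu> (\<lambda>\<xi>. grad (f \<xi>) y))) x (X x)) \<longrightarrow>
              (SUP n\<in>{n. real n * \<eta> \<le> T}.
                 sup_norm (\<lambda>x. sgd_mean \<nu> f \<eta> \<phi> n x - sde_mean M X \<phi> x (real n * \<eta>)))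
              \<le> ennreal (C T (enn2real (C_norm 6 \<phi>)) \<eta>\<^sub>0 * \<eta>\<^sup>2)))"
    proof (rule weak_error_second_order)
      fix B c
      assume B: "0 \<le> B" and err: "\<And>\<phi> G T \<eta> N x. \<And>(M :: 'w measure) \<F> W X. Clip 5 G \<phi> \<Longrightarrow> 0 < \<eta> \<Longrightarrow> \<eta> \<le> 1 \<Longrightarrow> real N * \<eta> \<le> T \<Longrightarrow>
        sde_solution M \<F> W (\<lambda>y. - grad mean_loss y - (\<eta> / 4) *\<^sub>R grad (\<lambda>z. (norm (grad mean_loss z))\<^sup>2) y)
          (\<lambda>y. psd_sqrt (\<eta> *\<^sub>R gradient_covariance y)) x X \<Longrightarrow>
        \<bar>sgd_mean \<nu> f \<eta> \<phi> N x - (\<integral>\<omega>. \<phi> (X (real N * \<eta>) \<omega>) \<partial>M)\<bar> \<le> B * T * exp (c * T) * G * \<eta>\<^sup>2"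
      show ?thesis
      proof (intro exI[of _ "\<lambda>T G \<eta>\<^sub>0. B * T * exp (c * T) * G + 1"] allI impI ballI exI[of _ "1::real"] conjI)
        fix T :: real and \<phi> :: "real^'d \<Rightarrow> real" assume T: "0 < T" and \<phi>: "\<phi> \<in> C_b 6"
        let ?G = "enn2real (C_norm 6 \<phi>)"
        show "0 < B * T * exp (c * T) * ?G + 1" using B T by (intro add_nonneg_pos mult_nonneg_nonneg) auto
        have G: "Clip 5 ?G \<phi>" using Clip_if_C_b[of \<phi> 5] \<phi> by simp
        fix \<eta> and M :: "real^'d \<Rightarrow> 'w measure" and \<F> W X
        assume \<eta>: "0 < \<eta> \<and> \<eta> \<le> 1" and sol: "\<forall>x. sde_solution (M x) (\<F> x) (W x)
                     (\<lambda>y. - grad F y - (\<eta> / 4) *\<^sub>R grad (\<lambda>z. (norm (grad F z))\<^sup>2) y)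
                     (\<lambda>y. psd_sqrt (\<eta> *\<^sub>R covariance_matrix \<nu> (\<lambda>\<xi>. grad (f \<xi>) y))) x (X x)"
        show "(SUP n\<in>{n. real n * \<eta> \<le> T}.
                 sup_norm (\<lambda>x. sgd_mean \<nu> f \<eta> \<phi> n x - sde_mean M X \<phi> x (real n * \<eta>)))
              \<le> ennreal ((B * T * exp (c * T) * ?G + 1) * \<eta>\<^sup>2)"
        proof (rule SUP_sup_norm_le)
          fix n x assume n: "n \<in> {n. real n * \<eta> \<le> T}"
          then have "\<bar>sgd_mean \<nu> f \<eta> \<phi> n x - sde_mean M X \<phi> x (real n * \<eta>)\<bar> \<le> B * T * exp (c * T) * ?G * \<eta>\<^sup>2"
            using \<eta> sol unfolding sde_mean_def F[OF sgd] by (intro err[OF G]) auto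
          then show "\<bar>sgd_mean \<nu> f \<eta> \<phi> n x - sde_mean M X \<phi> x (real n * \<eta>)\<bar> \<le> (B * T * exp (c * T) * ?G + 1) * \<eta>\<^sup>2"
            by (simp add: distrib_right add_increasing2)
        qed
      qed simp
    qed simp
  qed
qed

end
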